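(* Let $K\in\{K_0,K_1\}$, let $\sigma$ be a weight of $K$, let $\lambda\in\overline{\mathbf F}_p$, and let $\pi=\mathrm{ind}_K^G\sigma/(T-\lambda)$, where $(T-\lambda)$ denotes the image of the operator $T-\lambda$ on $\mathrm{ind}_K^G\sigma$. Let $I^+(\sigma,\pi)$ and $I^-(\sigma,\pi)$ be the images of $I^+(\sigma)$ and $I^-(\sigma)$ under the quotient map $\mathrm{ind}_K^G\sigma\to\pi$. Then the $I_K$-subrepresentation $I^+(\sigma,\pi)\cap I^-(\sigma,\pi)$ of $\pi$ is two dimensional over $\overline{\mathbf F}_p$, with basis $\{\overline{f_0},\overline{f_1}\}$, where $\overline{f_n}$ is the image of $f_n$ in $\pi$.
   Context: Group. $F$ is a non-archimedean local field of odd residue characteristic $p$, $E/F$ the unramified quadratic extension with ring of integers $\mathfrak o_E$, maximal ideal $\mathfrak p_E$, and $x\mapsto\bar x$ the non-trivial Galois conjugation; $k_F,k_E$ are the residue fields; $\varpi_E\in F$ is a uniformizer of $E$. Let $\beta=\begin{pmatrix} 0 & 0 & 1 \\ 0 & 1 & 0 \\ 1 & 0 & 0 \end{pmatrix}$ and $G=\{g\in GL_3(E): g^{T}\beta\bar g=\beta\}$ (the unramified $U(2,1)(E/F)$). For $(x,y)\in E^2$ with $x\bar x+y+\bar y=0$ put $n(x,y)=\begin{pmatrix} 1 & x & y \\ 0 & 1 & -\bar x \\ 0 & 0 & 1 \end{pmatrix}$, $n'(x,y)=\begin{pmatrix} 1 & 0 & 0 \\ x & 1 & 0 \\ y & -\bar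 x & 1 \end{pmatrix}$; $N$ (resp. $N'$) is the group of all $n(x,y)$ (resp. $n'(x,y)$). Put $\alpha=\mathrm{diag}(\varpi_E^{-1},1,\varpi_E)\in G$. Let $K_0=G\cap GL_3(\mathfrak o_E)$ and $K_1=G\cap\begin{pmatrix} \mathfrak o_E & \mathfrak o_E & \mathfrak p_E^{-1} \\ \mathfrak p_E & \mathfrak o_E & \mathfrak o_E \\ \mathfrak p_E & \mathfrak p_E & \mathfrak o_E \end{pmatrix}$; up to conjugacy these are the maximal compact open subgroups of $G$. For $K\in\{K_0,K_1\}$ let $K^1$ be its maximal normal pro-$p$ subgroup, $\Gamma_K=K/K^1$ (which is $U(2,1)(k_E/k_F)$ for $K_0$ and $(U(1,1)\times U(1))(k_E/k_F)$ for $K_1$), and $\beta_K=\beta$ if $K=K_0$, $\beta_K=\beta\alpha^{-1}$ if $K=K_1$. The Iwahori subgroup $I_K$ (resp. $I'_K$) is the inverse image in $K$ of the upper (resp. lower) triangular subgroup of $\Gamma_K$, and the pro-$p$ Iwahori subgroup $I_{1,K}$ (resp. $I'_{1,K}$) is the inverse image of its unipotent radical. Weights and Hecke operator. All representations are smooth over $\overline{\mathbf F}_p$. A weight of $K$ is an irreducible smooth representation $\sigma$ of $K$; it factors through $\Gamma_K$. The space $\sigma^{I_{1,K}}$ and the coinvariants $\sigma_{I'_{1,K}}$ are one-dimensional and the composition $\sigma^{I_{1,K}}\hookrightarrow\sigma\twoheadrightarrow\sigma_{I'_{1,K}}$ is an isomorphism; let $j_\sigma:\sigma\to\sigma^{I_{1,K}}$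 be the projection $\sigma\to\sigma_{I'_{1,K}}$ followed by the inverse of this isomorphism. $\mathrm{ind}_K^G\sigma$ is the compact induction: locally constant compactly supported $f:G\to\sigma$ with $f(kg)=\sigma(k)f(g)$ for $k\in K$, $G$ acting by right translation. Let $\varphi:G\to\mathrm{End}(\sigma)$ be the function supported on $K\alpha K$ with $\varphi(kgk')=\sigma(k)\varphi(g)\sigma(k')$ ($k,k'\in K$) and $\varphi(\alpha)=j_\sigma$; $T\in\mathrm{End}_G(\mathrm{ind}_K^G\sigma)$ is given by $(Tf)(g)=\sum_{Ky\in K\backslash G}\varphi(gy^{-1})f(y)$. Functions and subspaces. Fix a non-zero $v_0\in\sigma^{I_{1,K}}$. For $n\in\mathbb Z$, $f_n\in(\mathrm{ind}_K^G\sigma)^{I_{1,K}}$ is the function supported on $K\alpha^{-n}I_{1,K}$ with $f_n(\alpha^{-n})=\beta_Kv_0$ if $n>0$ and $f_n(\alpha^{-n})=v_0$ if $n\le 0$. For $n\ge 0$, $R_n^+(\sigma)$ (resp. $R_n^-(\sigma)$) is the space of functions in $\mathrm{ind}_K^G\sigma$ supported in $K\alpha^nI_K$ (resp. $K\alpha^{-(n+1)}I_K$). Put $I^+(\sigma)=\bigoplus_{n\ge0}R_n^+(\sigma)$, $I^-(\sigma)=\bigoplus_{n\ge0}R_n^-(\sigma)$, so that $\mathrm{ind}_K^G\sigma=I^+(\sigma)\oplus I^-(\sigma)$ as $I_K$-representations. *)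

theory Defs
  imports
    "HOL-Analysis.Analysis"
    "HOL-Algebra.Algebraic_Closure_Type"
    "HOL-Library.Groups_Big_Fun"
    "Berlekamp_Zassenhaus.Finite_Field"
    "Jordan_Normal_Form.Missing_VectorSpace"
begin

no_notation fps_nth (infixl "$" 75)

section \<open>Local fields and unramified quadratic extensions\<close>

text \<open>
  A valuation is an integer-valued function; its value at \<open>0\<close> (which should be infinite) is
  irrelevant and is never used. \<open>frac_ideal v n\<close> is the fractional ideal \<open>\<pp>\<^sup>n\<close>, so that
  \<open>frac_ideal v 0\<close> is the ring of integers and \<open>frac_ideal v 1\<close> its maximal ideal.
\<close>

definition frac_ideal :: "('a::field \<Rightarrow> int) \<Rightarrow> int \<Rightarrow> 'a set" where
  "frac_ideal v n = {x. x = 0 \<or> v x \<ge> n}"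

definition normalized_valuation :: "('a::field \<Rightarrow> int) \<Rightarrow> bool" where
  "normalized_valuation v \<longleftrightarrow>
     (\<forall>x y. x \<noteq> 0 \<longrightarrow> y \<noteq> 0 \<longrightarrow> v (x * y) = v x + v y) \<and>
     (\<forall>x y. x \<noteq> 0 \<longrightarrow> y \<noteq> 0 \<longrightarrow> x + y \<noteq> 0 \<longrightarrow> v (x + y) \<ge> min (v x) (v y)) \<and>
     (\<exists>x. x \<noteq> 0 \<and> v x = 1)"

definition valuation_complete :: "('a::field \<Rightarrow> int) \<Rightarrow> bool" where
  "valuation_complete v \<longleftrightarrow>
     (\<forall>s :: nat \<Rightarrow> 'a.
        (\<forall>k. \<exists>M. \<forall>m\<ge>M. \<forall>n\<ge>M. s m - s n \<in> frac_ideal v k) \<longrightarrow>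
        (\<exists>l. \<forall>k. \<exists>M. \<forall>n\<ge>M. s n - l \<in> frac_ideal v k))"

definition residue_field :: "('a::field \<Rightarrow> int) \<Rightarrow> 'a set ring" where
  "residue_field v = ring_of_type_algebra\<lparr>carrier := frac_ideal v 0\<rparr> Quot frac_ideal v 1"

definition nonarch_local_field :: "('a::field \<Rightarrow> int) \<Rightarrow> bool" where
  "nonarch_local_field v \<longleftrightarrow>
     normalized_valuation v \<and> valuation_complete v \<and> finite (carrier (residue_field v))"

text \<open>
  \<open>E/F\<close> is given by an embedding \<open>\<iota> : F \<rightarrow> E\<close>. As residue fields are finite (hence perfect),
  unramified means ramification index one, i.e. the normalized valuation of \<open>E\<close> restricts to
  the normalized valuation of \<open>F\<close>.
\<close>

definition unramified_quadratic ::
  "('f::field \<Rightarrow> int) \<Rightarrow> ('e::field \<Rightarrow> int) \<Rightarrow> ('f \<Rightarrow> 'e) \<Rightarrow> ('e \<Rightarrow> 'e) \<Rightarrow> bool" where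
  "unramified_quadratic vF vE \<iota> bar \<longleftrightarrow>
     nonarch_local_field vF \<and> nonarch_local_field vE \<and>
     field_hom \<iota> \<and> vector_space.dim (\<lambda>a x. \<iota> a * x) (UNIV :: 'e set) = 2 \<and>
     (\<forall>a. a \<noteq> 0 \<longrightarrow> vE (\<iota> a) = vF a) \<and>
     field_hom bar \<and> bij bar \<and> (\<forall>a. bar (\<iota> a) = \<iota> a) \<and> bar \<noteq> id"

section \<open>The unitary group and its maximal compact subgroups\<close>

datatype vertex = V0 | V1 \<comment> \<open>\<open>Kset V0\<close>, \<open>Kset V1\<close> below are \<open>K\<^sub>0\<close>, \<open>K\<^sub>1\<close>\<close>

definition mat3 :: "'a \<Rightarrow> 'a \<Rightarrow> 'a \<Rightarrow> 'a \<Rightarrow> 'a \<Rightarrow> 'a \<Rightarrow> 'a \<Rightarrow> 'a \<Rightarrow> 'a \<Rightarrow> 'a::zero^3^3" where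
  "mat3 a b c d e f g h i = vector [vector [a, b, c], vector [d, e, f], vector [g, h, i]]"

definition antidiag :: "'e::field^3^3" where
  "antidiag = mat3 0 0 1  0 1 0  1 0 0"

context
  fixes v :: "'e::field \<Rightarrow> int"   \<comment> \<open>valuation of \<open>E\<close>\<close>
    and bar :: "'e \<Rightarrow> 'e"           \<comment> \<open>Galois conjugation\<close>
    and \<pi> :: 'e                    \<comment> \<open>uniformizer \<open>\<varpi>\<^sub>E\<close>\<close>
    and p :: nat                   \<comment> \<open>residue characteristic\<close>
begin

definition Ugrp :: "('e^3^3) monoid" where
  "Ugrp = \<lparr>carrier = {g. invertible g \<and>
             transpose g ** antidiag ** (\<chi> i j. bar (g $ i $ j)) = antidiag},
           mult = (**), one = mat 1\<rparr>"

definition Utop :: "('e^3^3) topology" where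
  "Utop = topology (\<lambda>U. U \<subseteq> carrier Ugrp \<and>
     (\<forall>g\<in>U. \<exists>m. \<forall>h\<in>carrier Ugrp. (\<forall>i j. h $ i $ j - g $ i $ j \<in> frac_ideal v m) \<longrightarrow> h \<in> U))"

definition alpha :: "'e^3^3" where
  "alpha = mat3 (inverse \<pi>) 0 0  0 1 0  0 0 \<pi>"

definition Kset :: "vertex \<Rightarrow> ('e^3^3) set" where
  "Kset t = (case t of
     V0 \<Rightarrow> {g\<in>carrier Ugrp. \<forall>i j. g $ i $ j \<in> frac_ideal v 0 \<and> matrix_inv g $ i $ j \<in> frac_ideal v 0}
   | V1 \<Rightarrow> {g\<in>carrier Ugrp.
             g$1$1 \<in> frac_ideal v 0 \<and> g$1$2 \<in> frac_ideal v 0 \<and> g$1$3 \<in> frac_ideal v (-1) \<and>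
             g$2$1 \<in> frac_ideal v 1 \<and> g$2$2 \<in> frac_ideal v 0 \<and> g$2$3 \<in> frac_ideal v 0 \<and>
             g$3$1 \<in> frac_ideal v 1 \<and> g$3$2 \<in> frac_ideal v 1 \<and> g$3$3 \<in> frac_ideal v 0})"

definition Kgrp :: "vertex \<Rightarrow> ('e^3^3) monoid" where
  "Kgrp t = Ugrp\<lparr>carrier := Kset t\<rparr>"

text \<open>
  A pro-\<open>p\<close> group is a profinite group all of whose open normal subgroups have \<open>p\<close>-power index.
  Subgroups of \<open>G\<close> are Hausdorff and totally disconnected, so profinite means compact.
\<close>

definition pro_p_subgroup :: "('e^3^3) set \<Rightarrow> bool" where
  "pro_p_subgroup P \<longleftrightarrow> subgroup P Ugrp \<and> compactin Utop P \<and>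
     (\<forall>U. U \<lhd> Ugrp\<lparr>carrier := P\<rparr> \<and> openin (subtopology Utop P) U \<longrightarrow>
          (\<exists>n. card (rcosets\<^bsub>Ugrp\<lparr>carrier := P\<rparr>\<^esub> U) = p ^ n))"

definition K_pro_p_radical :: "vertex \<Rightarrow> ('e^3^3) set" where  \<comment> \<open>\<open>K\<^sup>1\<close>\<close>
  "K_pro_p_radical t = (GREATEST P. P \<lhd> Kgrp t \<and> pro_p_subgroup P)"

definition Gamma :: "vertex \<Rightarrow> ('e^3^3) set monoid" where
  "Gamma t = Kgrp t Mod K_pro_p_radical t"

text \<open>
  The identification of \<open>\<Gamma>\<^sub>K\<close> with a group of matrices over the residue field \<open>k\<^sub>E\<close> sends the class
  of \<open>g\<close> to the entrywise reduction modulo \<open>\<pp>\<^sub>E\<close> of \<open>gamma_lift t g\<close>. For \<open>K\<^sub>1\<close>, the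
  corner entries form the \<open>U(1,1)\<close>-factor (rescaled by \<open>\<varpi>\<^sub>E\<close> so as to be integral) and the
  middle entry is the \<open>U(1)\<close>-factor.
\<close>

definition gamma_lift :: "vertex \<Rightarrow> 'e^3^3 \<Rightarrow> 'e^3^3" where
  "gamma_lift t g = (case t of
     V0 \<Rightarrow> g
   | V1 \<Rightarrow> mat3 (g$1$1) 0 (\<pi> * g$1$3)  0 (g$2$2) 0  (inverse \<pi> * g$3$1) 0 (g$3$3))"

text \<open>The index type \<open>3\<close> has \<open>3 = 0\<close>, so its order is not the order of rows and columns.\<close>

definition red_upper :: "'e^3^3 \<Rightarrow> bool" where
  "red_upper h \<longleftrightarrow> h$2$1 \<in> frac_ideal v 1 \<and> h$3$1 \<in> frac_ideal v 1 \<and> h$3$2 \<in> frac_ideal v 1"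

definition red_lower :: "'e^3^3 \<Rightarrow> bool" where
  "red_lower h \<longleftrightarrow> h$1$2 \<in> frac_ideal v 1 \<and> h$1$3 \<in> frac_ideal v 1 \<and> h$2$3 \<in> frac_ideal v 1"

definition red_unit_diag :: "'e^3^3 \<Rightarrow> bool" where
  "red_unit_diag h \<longleftrightarrow> (\<forall>i. h$i$i - 1 \<in> frac_ideal v 1)"

definition Gamma_part :: "vertex \<Rightarrow> ('e^3^3 \<Rightarrow> bool) \<Rightarrow> ('e^3^3) set set" where
  "Gamma_part t Q = {C\<in>carrier (Gamma t). \<exists>g\<in>C. Q (gamma_lift t g)}"

definition K_preimage :: "vertex \<Rightarrow> ('e^3^3) set set \<Rightarrow> ('e^3^3) set" where
  "K_preimage t S = {g\<in>Kset t. K_pro_p_radical t #>\<^bsub>Kgrp t\<^esub> g \<in> S}"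

definition Iwahori :: "vertex \<Rightarrow> ('e^3^3) set" where                  \<comment> \<open>\<open>I\<^sub>K\<close>\<close>
  "Iwahori t = K_preimage t (Gamma_part t red_upper)"

definition pro_p_Iwahori :: "vertex \<Rightarrow> ('e^3^3) set" where            \<comment> \<open>\<open>I\<^sub>1\<^sub>,\<^sub>K\<close>\<close>
  "pro_p_Iwahori t = K_preimage t (Gamma_part t (\<lambda>h. red_upper h \<and> red_unit_diag h))"

definition pro_p_Iwahori_opp :: "vertex \<Rightarrow> ('e^3^3) set" where        \<comment> \<open>\<open>I'\<^sub>1\<^sub>,\<^sub>K\<close>\<close>
  "pro_p_Iwahori_opp t = K_preimage t (Gamma_part t (\<lambda>h. red_lower h \<and> red_unit_diag h))"

definition beta :: "vertex \<Rightarrow> 'e^3^3" where                           \<comment> \<open>\<open>\<beta>\<^sub>K\<close>\<close>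
  "beta t = (case t of V0 \<Rightarrow> antidiag | V1 \<Rightarrow> antidiag ** inv\<^bsub>Ugrp\<^esub> alpha)"

section \<open>Weights, compact induction and the Hecke operator\<close>

context
  fixes t :: vertex
    and scale :: "'c::field \<Rightarrow> 'v::ab_group_add \<Rightarrow> 'v"
    and \<sigma> :: "'e^3^3 \<Rightarrow> 'v \<Rightarrow> 'v"
begin

definition weight :: bool where
  "weight \<longleftrightarrow>
     vector_space scale \<and>
     (\<forall>k\<in>Kset t. Vector_Spaces.linear scale scale (\<sigma> k)) \<and>
     \<sigma> (mat 1) = id \<and> (\<forall>k\<in>Kset t. \<forall>l\<in>Kset t. \<sigma> (k ** l) = \<sigma> k \<circ> \<sigma> l) \<and>
     (\<forall>x. openin Utop {k\<in>Kset t. \<sigma> k x = x}) \<and>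
     (\<exists>x::'v. x \<noteq> 0) \<and>
     (\<forall>W. Modules.module.subspace scale W \<and> (\<forall>k\<in>Kset t. \<forall>x\<in>W. \<sigma> k x \<in> W) \<longrightarrow> W = {0} \<or> W = UNIV)"

definition invariants :: "'v set" where                  \<comment> \<open>vectors of \<open>\<sigma>\<close> fixed by \<open>I\<^sub>1\<^sub>,\<^sub>K\<close>\<close>
  "invariants = {x. \<forall>k\<in>pro_p_Iwahori t. \<sigma> k x = x}"

definition coinv_proj :: "'v \<Rightarrow> 'v set" where            \<comment> \<open>\<open>\<sigma>\<close> onto its coinvariants for \<open>I'\<^sub>1\<^sub>,\<^sub>K\<close>\<close>
  "coinv_proj x = {y. y - x \<in> Modules.module.span scale {\<sigma> k z - z | k z. k \<in> pro_p_Iwahori_opp t}}"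

text \<open>
  The projection onto the coinvariants restricts to a bijection from \<open>invariants\<close> onto the
  coinvariants; \<open>jmap\<close> is the projection followed by the inverse of that bijection.
\<close>

definition jmap :: "'v \<Rightarrow> 'v" where                      \<comment> \<open>\<open>j\<^sub>\<sigma>\<close>\<close>
  "jmap x = inv_into invariants coinv_proj (coinv_proj x)"

text \<open>
  Functions on \<open>G\<close> are represented by functions on all matrices that vanish outside \<open>G\<close>.
  The support of a locally constant function is closed, so no closure is taken.
\<close>

definition ind :: "('e^3^3 \<Rightarrow> 'v) set" where
  "ind = {f. (\<forall>g. g \<notin> carrier Ugrp \<longrightarrow> f g = 0) \<and>
             (\<forall>g\<in>carrier Ugrp. \<exists>U. openin Utop U \<and> g \<in> U \<and> (\<forall>h\<in>U. f h = f g)) \<and>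
             compactin Utop {g. f g \<noteq> 0} \<and>
             (\<forall>k\<in>Kset t. \<forall>g\<in>carrier Ugrp. f (k ** g) = \<sigma> k (f g))}"

definition ind_module :: "('c, 'e^3^3 \<Rightarrow> 'v) module" where
  "ind_module = \<lparr>carrier = ind, mult = undefined, one = undefined,
                 zero = (\<lambda>g. 0), add = (\<lambda>f f' g. f g + f' g),
                 smult = (\<lambda>c f g. scale c (f g))\<rparr>"

definition dcoset :: "'e^3^3 \<Rightarrow> ('e^3^3) set \<Rightarrow> ('e^3^3) set" where
  "dcoset g H = (Kset t #>\<^bsub>Ugrp\<^esub> g) <#>\<^bsub>Ugrp\<^esub> H"

definition hecke_fun :: "'e^3^3 \<Rightarrow> 'v \<Rightarrow> 'v" where       \<comment> \<open>\<open>\<phi>\<close>\<close>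
  "hecke_fun = (THE \<phi>.
     (\<forall>g. g \<notin> dcoset alpha (Kset t) \<longrightarrow> \<phi> g = (\<lambda>x. 0)) \<and>
     (\<forall>k\<in>Kset t. \<forall>l\<in>Kset t. \<forall>g\<in>carrier Ugrp. \<phi> (k ** g ** l) = \<sigma> k \<circ> \<phi> g \<circ> \<sigma> l) \<and>
     \<phi> alpha = jmap)"

text \<open>
  The summand does not depend on the representative of the coset \<open>Ky\<close>, and only finitely many
  summands are nonzero. \<open>Sum_any\<close> sums over the nonzero summands.
\<close>

definition hecke_T :: "('e^3^3 \<Rightarrow> 'v) \<Rightarrow> ('e^3^3 \<Rightarrow> 'v)" where
  "hecke_T f = (\<lambda>g. Sum_any (\<lambda>C.
     if C \<in> rcosets\<^bsub>Ugrp\<^esub> Kset t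
     then (let y = (SOME y. y \<in> C) in hecke_fun (g ** inv\<^bsub>Ugrp\<^esub> y) (f y))
     else 0))"

definition R_plus :: "nat \<Rightarrow> ('e^3^3 \<Rightarrow> 'v) set" where
  "R_plus n = {f\<in>ind. {g. f g \<noteq> 0} \<subseteq> dcoset (alpha [^]\<^bsub>Ugrp\<^esub> int n) (Iwahori t)}"

definition R_minus :: "nat \<Rightarrow> ('e^3^3 \<Rightarrow> 'v) set" where
  "R_minus n = {f\<in>ind. {g. f g \<noteq> 0} \<subseteq> dcoset (alpha [^]\<^bsub>Ugrp\<^esub> (- int (n + 1))) (Iwahori t)}"

definition I_plus :: "('e^3^3 \<Rightarrow> 'v) set" where
  "I_plus = {\<lambda>g. \<Sum>n\<le>N. h n g | (N::nat) h. \<forall>n\<le>N. h n \<in> R_plus n}"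

definition I_minus :: "('e^3^3 \<Rightarrow> 'v) set" where
  "I_minus = {\<lambda>g. \<Sum>n\<le>N. h n g | (N::nat) h. \<forall>n\<le>N. h n \<in> R_minus n}"

definition f_fun :: "'v \<Rightarrow> int \<Rightarrow> 'e^3^3 \<Rightarrow> 'v" where     \<comment> \<open>\<open>f\<^sub>n\<close>, depending on \<open>v\<^sub>0\<close>\<close>
  "f_fun v0 n = (THE f. f \<in> ind \<and>
     (\<forall>g\<in>carrier Ugrp. \<forall>i\<in>pro_p_Iwahori t. f (g ** i) = f g) \<and>
     {g. f g \<noteq> 0} \<subseteq> dcoset (alpha [^]\<^bsub>Ugrp\<^esub> (- n)) (pro_p_Iwahori t) \<and>
     f (alpha [^]\<^bsub>Ugrp\<^esub> (- n)) = (if n > 0 then \<sigma> (beta t) v0 else v0))"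

definition T_minus_image :: "'c \<Rightarrow> ('e^3^3 \<Rightarrow> 'v) set" where
  "T_minus_image lam = (\<lambda>f g. hecke_T f g - scale lam (f g)) ` ind"

end

end

section \<open>Quotient modules\<close>

text \<open>The quotient \<open>M/W\<close> with carrier the additive cosets of \<open>W\<close>, compare \<open>A_Mod\<close> and \<open>Quot\<close>.\<close>

definition quot_module :: "('c, 'm) module \<Rightarrow> 'm set \<Rightarrow> ('c, 'm set) module" where
  "quot_module M W = \<lparr>carrier = a_rcosets\<^bsub>M\<^esub> W, mult = undefined, one = undefined,
     zero = W, add = set_add M, smult = (\<lambda>c A. \<Union>x\<in>A. W +>\<^bsub>M\<^esub> (c \<odot>\<^bsub>M\<^esub> x))\<rparr>"

definition right_translate :: "'e::field^3^3 \<Rightarrow> ('e^3^3 \<Rightarrow> 'v) \<Rightarrow> ('e^3^3 \<Rightarrow> 'v)" where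
  "right_translate h f = (\<lambda>g. f (g ** h))"

end

theory Submission
  imports Defs "HOL-Library.Function_Algebras" "HOL-Algebra.Sylow" "HOL-Algebra.Group_Action" "HOL-Number_Theory.Cong"
begin

text \<open>The cosets K g are the vertices of one type in the tree of G. By \<open>GG_cells\<close>
  and \<open>cell_unique\<close>, G is the disjoint union of the double cosets K alpha^m I; the
  integer m is the level \<open>lev g\<close>, and |4 m + 1| is, in a suitable scale, the distance
  of the vertex from the midpoint of the base edge, the edge fixed by I. The space I^+ consists of
  the functions supported on levels m >= 0 and I^- of those supported on levels m < 0
  (\<open>I_plus_eq\<close>, \<open>I_minus_eq\<close>). The function f_0 lives at level 0 and f_1
  at level -1.

  The Hecke operator T connects vertices of the same type that are as close as possible. Two such
  neighbours with levels of different sign must have levels 0 and -1 (\<open>crossing\<close>).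
  Hence for P in I^+ the part of T P on negative levels is a multiple of f_1
  (\<open>T_plus\<close>), and for Q in I^- the part of T Q on nonnegative levels is a multiple of
  f_0 (\<open>T_minus\<close>). Suppose that F1 in I^+ and F2 in I^- have the same image in the
  quotient, so F1 - F2 = (T - lambda) F, and split F = P + Q along the sign of the level. Comparing
  levels, F1 differs from (T - lambda) P by a combination of f_0 and f_1, so the common image lies
  in the span of their images. Conversely, subtracting T - lambda of a function at level 0 moves f_1
  into I^+, and subtracting T - lambda of a function at level -1 moves f_0 into I^-
  (\<open>f1_plus\<close>, \<open>f0_minus\<close>). Together this is
  \<open>intersection_eq\<close>.

  Linear independence is \<open>comb_W\<close>. If a f_0 + b f_1 = (T - lambda) F, then T F = lambda
  F away from the levels 0 and -1. At a vertex just outside the support of F only one neighbour y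
  can contribute to T F, because the way back to the base edge is unique
  (\<open>outward_unique\<close>). Up to a reflection, the contributions of y to its outer
  neighbours are the vectors j_sigma(sigma(u) F(y)) with u in the unipotent radical, and these
  determine F(y) (\<open>lc_eq_0\<close>). So the support shrinks shell by shell until F = 0
  (\<open>outer_vanish\<close>, \<open>eigen_vanish\<close>), and then a = b = 0.

  The facts about weights come from the abstract setting \<open>rank_one_rep\<close>. In
  characteristic p a p-group has nonzero fixed vectors and fixed functionals; the Hecke operator of
  the reflection satisfies a quadratic relation and therefore has eigenvectors; such an eigenvector
  generates the representation. This gives one-dimensional invariants and coinvariants, the
  isomorphism between them, and the nondegeneracy used above (\<open>fixed_unique\<close>,
  \<open>coinvariants\<close>). To apply it, the groups of the statement, which are defined through
  the greatest normal pro-p subgroup, are identified with explicit congruence groups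
  (\<open>K_pro_p_radical_eq\<close>, \<open>pro_p_Iwahori_eq\<close>), the Hecke function is shown
  to exist (\<open>phi_well_defined\<close>), and the arithmetic of E/F is condensed into a
  valuation, a conjugation and a unit of trace zero
  (\<open>unramified_local_unitary\<close>).\<close>

section \<open>Valuation bounds, the standard apartment and its stabilizers\<close>

locale valued_involution =
  fixes v :: "'e::field \<Rightarrow> int" and bar :: "'e \<Rightarrow> 'e" and \<pi> :: 'e
  assumes v_mult: "x \<noteq> 0 \<Longrightarrow> y \<noteq> 0 \<Longrightarrow> v (x * y) = v x + v y"
    and v_add: "x \<noteq> 0 \<Longrightarrow> y \<noteq> 0 \<Longrightarrow> x + y \<noteq> 0 \<Longrightarrow> min (v x) (v y) \<le> v (x + y)"
    and pi_nonzero [simp]: "\<pi> \<noteq> 0" and v_pi [simp]: "v \<pi> = 1"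
    and bar_add: "bar (x + y) = bar x + bar y" and bar_mult: "bar (x * y) = bar x * bar y"
    and bar_1 [simp]: "bar 1 = 1" and bar_bar [simp]: "bar (bar x) = x"
    and v_bar: "x \<noteq> 0 \<Longrightarrow> v (bar x) = v x" and bar_pi [simp]: "bar \<pi> = \<pi>"
begin

lemma bar_0 [simp]: "bar 0 = 0"
  using bar_add[of 0 0] by (metis add.right_neutral add_left_cancel)

lemma bar_eq_0_iff [simp]: "bar x = 0 \<longleftrightarrow> x = 0"
  by (metis bar_0 bar_bar)

lemma bar_minus: "bar (- x) = - bar x"
  using bar_add[of x "- x"] by (simp add: eq_neg_iff_add_eq_0 add.commute)

lemma bar_diff: "bar (x - y) = bar x - bar y"
  using bar_add[of x "- y"] by (simp add: bar_minus)

lemma bar_inverse: "bar (inverse x) = inverse (bar x)"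
proof (cases "x = 0")
  case False
  have "bar x * bar (inverse x) = 1"
    using False by (simp flip: bar_mult)
  then show ?thesis by (simp add: inverse_unique)
qed simp

lemma bar_divide: "bar (x / y) = bar x / bar y"
  by (simp add: divide_inverse bar_mult bar_inverse)

lemma bar_sum: "bar (\<Sum>i\<in>A. f i) = (\<Sum>i\<in>A. bar (f i))"
  by (induction A rule: infinite_finite_induct) (auto simp: bar_add)

lemma bar_power: "bar (x ^ n) = bar x ^ n"
  by (induction n) (auto simp: bar_mult)

lemma bar_power_int: "bar (x powi n) = bar x powi n"
  by (simp add: power_int_def bar_power bar_inverse)

lemma bar_eq_iff: "bar x = y \<longleftrightarrow> x = bar y"
  by auto

lemma v_1 [simp]: "v 1 = 0"
  using v_mult[of 1 1] by simp

lemma v_minus [simp]: "v (- x) = v x"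
proof (cases "x = 0")
  case False
  have "v (-1) + v (-1) = v 1" using v_mult[of "-1" "-1"] by simp
  then have "v (-1) = 0" by simp
  then show ?thesis using v_mult[of "-1" x] False by simp
qed simp

lemma v_inverse: "x \<noteq> 0 \<Longrightarrow> v (inverse x) = - v x"
  using v_mult[of x "inverse x"] by simp

lemma v_divide: "x \<noteq> 0 \<Longrightarrow> y \<noteq> 0 \<Longrightarrow> v (x / y) = v x - v y"
  by (simp add: divide_inverse v_mult v_inverse)

lemma v_power: "x \<noteq> 0 \<Longrightarrow> v (x ^ n) = int n * v x"
  by (induction n) (auto simp: v_mult algebra_simps)

lemma v_pi_power_int [simp]: "v (\<pi> powi n) = n"
  by (auto simp: power_int_def v_power v_inverse)

text \<open>
  Valuations are scaled by \<open>4\<close>, so that bounds at the vertices and edges of an apartment, whose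
  coordinates are quarter-integers, become integral.
\<close>

definition vge :: "int \<Rightarrow> 'e \<Rightarrow> bool" where
  "vge n x \<longleftrightarrow> x = 0 \<or> n \<le> 4 * v x"

lemma vge_0 [simp]: "vge n 0" by (simp add: vge_def)

lemma vge_1: "vge n 1 \<longleftrightarrow> n \<le> 0" by (simp add: vge_def)

lemma vge_mono: "vge n x \<Longrightarrow> m \<le> n \<Longrightarrow> vge m x"
  by (auto simp: vge_def)

lemma vge_add: "vge n x \<Longrightarrow> vge n y \<Longrightarrow> vge n (x + y)"
  using v_add[of x y] by (cases "x + y = 0"; cases "x = 0"; cases "y = 0") (auto simp: vge_def min_def split: if_splits)

lemma vge_minus [simp]: "vge n (- x) \<longleftrightarrow> vge n x"
  by (simp add: vge_def)

lemma vge_diff: "vge n x \<Longrightarrow> vge n y \<Longrightarrow> vge n (x - y)"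
  using vge_add[of n x "- y"] by simp

lemma vge_mult: "vge n x \<Longrightarrow> vge m y \<Longrightarrow> vge (n + m) (x * y)"
  by (cases "x = 0"; cases "y = 0") (auto simp: vge_def v_mult)

lemma vge_bar [simp]: "vge n (bar x) \<longleftrightarrow> vge n x"
  by (simp add: vge_def) (metis v_bar)

lemma vge_sum: "(\<And>i. i \<in> A \<Longrightarrow> vge n (f i)) \<Longrightarrow> vge n (\<Sum>i\<in>A. f i)"
  by (induction A rule: infinite_finite_induct) (auto simp: vge_add)

lemma vge_of_nat: "vge 0 (of_nat n)"
  by (induction n) (auto intro!: vge_add simp: vge_1)

lemma vge_frac_ideal: "x \<in> frac_ideal v n \<longleftrightarrow> vge (4 * n) x"
  by (auto simp: frac_ideal_def vge_def)

text \<open>Isotropy of a row or column bounds a norm \<open>x * bar x\<close>. As conjugation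
  preserves the valuation, the norm has twice the valuation of x and the bound can be
  halved.\<close>

lemma vge_square: "vge (2 * n) (x * bar x) \<Longrightarrow> vge n x"
  by (cases "x = 0") (auto simp: vge_def v_mult v_bar)

lemma vge_pi_power_int: "vge n (\<pi> powi m) \<longleftrightarrow> n \<le> 4 * m"
  by (simp add: vge_def)

lemma vge_divide: "vge n x \<Longrightarrow> y \<noteq> 0 \<Longrightarrow> m \<le> n - 4 * v y \<Longrightarrow> vge m (x / y)"
  by (cases "x = 0") (auto simp: vge_def v_divide)

lemma v_1_plus:
  assumes "vge 1 x" shows "1 + x \<noteq> 0" "v (1 + x) = 0"
proof -
  show nz: "1 + x \<noteq> 0"
  proof
    assume "1 + x = 0"
    then have "x = - 1" by (simp add: add_eq_0_iff)
    then show False using assms by (auto simp: vge_1)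
  qed
  have "vge 0 (1 + x)" using assms by (intro vge_add) (auto simp: vge_1 intro: vge_mono)
  moreover have "\<not> vge 1 (1 + x)"
    using vge_diff[of 1 "1 + x" x] assms by (auto simp: vge_1)
  ultimately show "v (1 + x) = 0" using nz by (auto simp: vge_def)
qed

text \<open>The exponents with which alpha scales the three basis vectors; \<open>flip\<close> is
  the duality of basis vectors under the antidiagonal form.\<close>

definition ht :: "3 \<Rightarrow> int" where "ht i = (if i = 1 then -1 else if i = 2 then 0 else 1)"
definition flip :: "3 \<Rightarrow> 3" where "flip i = (if i = 1 then 3 else if i = 3 then 1 else 2)"

lemma ht_simps [simp]: "ht 1 = -1" "ht 2 = 0" "ht 3 = 1"
  by (simp_all add: ht_def)
lemma flip_simps [simp]: "flip 1 = 3" "flip 2 = 2" "flip 3 = 1"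
  by (simp_all add: flip_def)
lemma flip_flip [simp]: "flip (flip i) = i"
  using exhaust_3[of i] by auto
lemma ht_flip [simp]: "ht (flip i) = - ht i"
  using exhaust_3[of i] by auto
lemma flip_eq_iff [simp]: "flip i = flip j \<longleftrightarrow> i = j"
  by (metis flip_flip)

lemma mat3_nth [simp]:
  "mat3 a b c d e f g h i $ 1 $ 1 = a" "mat3 a b c d e f g h i $ 1 $ 2 = b" "mat3 a b c d e f g h i $ 1 $ 3 = c"
  "mat3 a b c d e f g h i $ 2 $ 1 = d" "mat3 a b c d e f g h i $ 2 $ 2 = e" "mat3 a b c d e f g h i $ 2 $ 3 = f"
  "mat3 a b c d e f g h i $ 3 $ 1 = g" "mat3 a b c d e f g h i $ 3 $ 2 = h" "mat3 a b c d e f g h i $ 3 $ 3 = i"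
  by (simp_all add: mat3_def)

lemma mat3_eqI:
  fixes Z Y :: "'x^3^3"
  assumes "Z$1$1 = Y$1$1" "Z$1$2 = Y$1$2" "Z$1$3 = Y$1$3" "Z$2$1 = Y$2$1" "Z$2$2 = Y$2$2" "Z$2$3 = Y$2$3"
    "Z$3$1 = Y$3$1" "Z$3$2 = Y$3$2" "Z$3$3 = Y$3$3"
  shows "Z = Y"
  using assms by (simp add: vec_eq_iff forall_3)

lemma mult_nth: "((A::'e^3^3) ** B) $ i $ j = A$i$1 * B$1$j + A$i$2 * B$2$j + A$i$3 * B$3$j"
  by (simp add: matrix_matrix_mult_def sum_3)

lemma mat_1_nth [simp]: "(mat 1 :: 'e^3^3) $ i $ j = (if i = j then 1 else 0)"
  by (simp add: mat_def)

lemma distinct_3 [simp]: "(1::3) \<noteq> 2" "(1::3) \<noteq> 3" "(2::3) \<noteq> 3" "(2::3) \<noteq> 1" "(3::3) \<noteq> 1" "(3::3) \<noteq> 2"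
  by simp_all

text \<open>A point R of the apartment is the norm on E^3 that weights the basis vectors by R times
  \<open>ht\<close>; \<open>MM R S c\<close> consists of the matrices that map the norm at S to the
  norm at R and gain at least c. In the scale by 4 the even points are the vertices of the tree and
  the odd points are the midpoints of edges.\<close>

definition MM :: "int \<Rightarrow> int \<Rightarrow> int \<Rightarrow> ('e^3^3) set" where
  "MM R S c = {Z. \<forall>i j. vge (R * ht i - S * ht j + c) (Z$i$j)}"

lemma MM_mult: "Z \<in> MM R S c \<Longrightarrow> Y \<in> MM S Q d \<Longrightarrow> Z ** Y \<in> MM R Q (c + d)"
  unfolding MM_def mem_Collect_eq matrix_matrix_mult_def
proof (intro allI)
  fix i j assume a: "\<forall>i j. vge (R * ht i - S * ht j + c) (Z$i$j)" "\<forall>i j. vge (S * ht i - Q * ht j + d) (Y$i$j)"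
  have "vge (R * ht i - Q * ht j + (c + d)) (Z $ i $ k * Y $ k $ j)" for k
    using vge_mult[of "R * ht i - S * ht k + c" "Z$i$k" "S * ht k - Q * ht j + d" "Y$k$j"] a
    by (simp add: algebra_simps)
  then show "vge (R * ht i - Q * ht j + (c + d)) ((\<chi> i j. \<Sum>k\<in>UNIV. Z $ i $ k * Y $ k $ j) $ i $ j)"
    by (auto intro!: vge_sum)
qed

lemma MM_mono: "Z \<in> MM R S c \<Longrightarrow> d \<le> c \<Longrightarrow> Z \<in> MM R S d"
  unfolding MM_def mem_Collect_eq by (meson add_left_mono vge_mono)

lemma MM_add: "Z \<in> MM R S c \<Longrightarrow> Y \<in> MM R S c \<Longrightarrow> Z + Y \<in> MM R S c"
  by (auto simp: MM_def intro: vge_add)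

lemma MM_diff: "Z \<in> MM R S c \<Longrightarrow> Y \<in> MM R S c \<Longrightarrow> Z - Y \<in> MM R S c"
  by (auto simp: MM_def intro: vge_diff)

lemma MM_minus: "Z \<in> MM R S c \<Longrightarrow> - Z \<in> MM R S c"
  by (auto simp: MM_def)

lemma MM_0 [simp]: "0 \<in> MM R S c"
  by (auto simp: MM_def)

lemma MM_1 [simp]: "mat 1 \<in> MM R R 0"
  by (auto simp: MM_def vge_1)

lemma MM_nth: "Z \<in> MM R S c \<Longrightarrow> vge (R * ht i - S * ht j + c) (Z$i$j)"
  by (simp add: MM_def)

lemma MM_iff: "Z \<in> MM R S c \<longleftrightarrow>
    vge (S - R + c) (Z$1$1) \<and> vge (c - R) (Z$1$2) \<and> vge (c - R - S) (Z$1$3) \<and>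
    vge (S + c) (Z$2$1) \<and> vge c (Z$2$2) \<and> vge (c - S) (Z$2$3) \<and>
    vge (R + S + c) (Z$3$1) \<and> vge (R + c) (Z$3$2) \<and> vge (R - S + c) (Z$3$3)"
  by (simp add: MM_def forall_3 algebra_simps)

text \<open>The adjoint for the hermitian form. On G it is the inverse, which turns inversion into a
  formula in the entries that visibly respects the bounds \<open>MM\<close>.\<close>

definition star :: "'e^3^3 \<Rightarrow> 'e^3^3" where
  "star g = (\<chi> i j. bar (g $ flip j $ flip i))"

lemma star_nth [simp]: "star g $ i $ j = bar (g $ flip j $ flip i)"
  by (simp add: star_def)

lemma star_mult: "star (A ** B) = star B ** star A"
  by (rule mat3_eqI) (simp_all add: mult_nth bar_add bar_mult algebra_simps)

lemma star_star [simp]: "star (star A) = A"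
  by (simp add: star_def vec_eq_iff)

lemma star_1 [simp]: "star (mat 1) = mat 1"
  by (rule mat3_eqI) simp_all

lemma star_diff: "star (A - B) = star A - star B"
  by (rule mat3_eqI) (simp_all add: bar_diff)

lemma MM_star: "Z \<in> MM R S c \<Longrightarrow> star Z \<in> MM S R c"
  by (auto simp: MM_iff algebra_simps)

abbreviation "GG \<equiv> carrier (Ugrp bar)"

lemma antidiag_nth [simp]: "(antidiag :: 'e^3^3) $ i $ j = (if j = flip i then 1 else 0)"
  using exhaust_3[of i] exhaust_3[of j] by (elim disjE; simp add: antidiag_def)

lemma mem_GG_iff: "g \<in> GG \<longleftrightarrow> star g ** g = mat 1"
proof -
  have "transpose g ** antidiag ** (\<chi> i j. bar (g $ i $ j)) = antidiag \<longleftrightarrow> star g ** g = mat 1"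
  proof -
    have 1: "bar ((transpose g ** antidiag ** (\<chi> i j. bar (g $ i $ j))) $ i $ j) = (star g ** g) $ flip i $ j" for i j
      using exhaust_3[of i] exhaust_3[of j]
      by (elim disjE; simp add: mult_nth transpose_def bar_add bar_mult algebra_simps)
    have 2: "bar ((antidiag::'e^3^3) $ i $ j) = mat 1 $ flip i $ j" for i j
      using exhaust_3[of i] exhaust_3[of j] by (elim disjE; simp)
    show ?thesis
      unfolding vec_eq_iff
      using 1 2 by (metis bar_bar flip_flip)
  qed
  moreover have "star g ** g = mat 1 \<Longrightarrow> invertible g"
    using invertible_left_inverse by blast
  ultimately show ?thesis by (auto simp: Ugrp_def)
qed

lemma GG_star_right: "g \<in> GG \<Longrightarrow> g ** star g = mat 1"
  by (simp add: mem_GG_iff matrix_left_right_inverse)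

lemma star_GG: "g \<in> GG \<Longrightarrow> star g \<in> GG"
  by (simp add: mem_GG_iff GG_star_right)

lemma one_GG [simp]: "mat 1 \<in> GG"
  by (simp add: mem_GG_iff)

lemma mult_GG: "g \<in> GG \<Longrightarrow> h \<in> GG \<Longrightarrow> g ** h \<in> GG"
  unfolding mem_GG_iff star_mult by (metis matrix_mul_assoc matrix_mul_lid)

lemma Ugrp_simps [simp]: "mult (Ugrp bar) = (**)" "one (Ugrp bar) = mat 1"
  by (auto simp: Ugrp_def)

lemma group_Ugrp: "group (Ugrp bar)"
proof (rule groupI)
  fix x assume "x \<in> GG"
  then show "\<exists>y\<in>GG. y \<otimes>\<^bsub>Ugrp bar\<^esub> x = \<one>\<^bsub>Ugrp bar\<^esub>"
    by (intro bexI[of _ "star x"]) (auto simp: star_GG mem_GG_iff[of x])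
qed (auto simp: mult_GG matrix_mul_assoc)

sublocale G: group "Ugrp bar"
  by (rule group_Ugrp)

lemma inv_GG: "g \<in> GG \<Longrightarrow> inv\<^bsub>Ugrp bar\<^esub> g = star g"
  using G.inv_equality[of "star g" g] star_GG by (simp add: mem_GG_iff)

lemma matrix_inv_GG: assumes "g \<in> GG" shows "matrix_inv g = star g"
proof -
  have "g ** star g = mat 1 \<and> star g ** g = mat 1"
    using assms GG_star_right by (auto simp: mem_GG_iff)
  moreover from this have "g ** matrix_inv g = mat 1 \<and> matrix_inv g ** g = mat 1"
    unfolding matrix_inv_def by (rule someI)
  ultimately show ?thesis by (metis matrix_mul_assoc matrix_mul_rid matrix_mul_lid)
qed

lemma star_cancel: "g \<in> GG \<Longrightarrow> star g ** (g ** x) = x" "g \<in> GG \<Longrightarrow> g ** (star g ** x) = x"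
  using GG_star_right[of g] by (auto simp: matrix_mul_assoc mem_GG_iff)

lemma star_cancel': "g \<in> GG \<Longrightarrow> x ** star g ** g = x" "g \<in> GG \<Longrightarrow> x ** g ** star g = x"
  using GG_star_right[of g] by (auto simp: mem_GG_iff simp flip: matrix_mul_assoc)

text \<open>The stabilizer of the point R. \<open>PP 0\<close> and \<open>PP 2\<close> are the two
  maximal compact subgroups, \<open>PP 1\<close> and \<open>PP 3\<close> are the Iwahori subgroups
  chosen in them; \<open>KP R c\<close> is the congruence filtration at the same point.\<close>

definition PP :: "int \<Rightarrow> ('e^3^3) set" where
  "PP R = GG \<inter> MM R R 0"

definition KP :: "int \<Rightarrow> int \<Rightarrow> ('e^3^3) set" where
  "KP R c = {g\<in>GG. g - mat 1 \<in> MM R R c}"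

lemma PP_GG: "g \<in> PP R \<Longrightarrow> g \<in> GG" by (simp add: PP_def)
lemma PP_MM: "g \<in> PP R \<Longrightarrow> g \<in> MM R R 0" by (simp add: PP_def)
lemma KP_GG: "g \<in> KP R c \<Longrightarrow> g \<in> GG" by (simp add: KP_def)

lemma PP_1 [simp]: "mat 1 \<in> PP R" by (simp add: PP_def)
lemma PP_mult: "g \<in> PP R \<Longrightarrow> h \<in> PP R \<Longrightarrow> g ** h \<in> PP R"
  using MM_mult[of g R R 0 h R 0] by (simp add: PP_def mult_GG)
lemma PP_star: "g \<in> PP R \<Longrightarrow> star g \<in> PP R"
  by (simp add: PP_def MM_star star_GG)

lemma KP_subset_PP: "0 \<le> c \<Longrightarrow> KP R c \<subseteq> PP R"
proof
  fix g assume "0 \<le> c" and g: "g \<in> KP R c"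
  then have "(g - mat 1) + mat 1 \<in> MM R R 0"
    by (intro MM_add) (auto simp: KP_def intro: MM_mono)
  then show "g \<in> PP R" using g by (simp add: PP_def KP_GG)
qed

lemma KP_1 [simp]: "mat 1 \<in> KP R c" by (simp add: KP_def)

lemma KP_star: assumes "g \<in> KP R c" shows "star g \<in> KP R c"
proof -
  have "star (g - mat 1) \<in> MM R R c" using assms by (intro MM_star) (simp add: KP_def)
  then show ?thesis using assms by (simp add: star_diff KP_def star_GG)
qed

lemma KP_mono: "g \<in> KP R c \<Longrightarrow> d \<le> c \<Longrightarrow> g \<in> KP R d"
  by (auto simp: KP_def intro: MM_mono)

lemma matrix_sub_ldistrib: "(A::'e^3^3) ** (B - C) = A ** B - A ** C"
  by (simp add: vec_eq_iff matrix_matrix_mult_def algebra_simps sum_subtractf)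

lemma matrix_sub_rdistrib: "(B - C) ** (A::'e^3^3) = B ** A - C ** A"
  by (simp add: vec_eq_iff matrix_matrix_mult_def algebra_simps sum_subtractf)

lemma KP_mult: assumes "0 \<le> c" "g \<in> KP R c" "h \<in> KP R c" shows "g ** h \<in> KP R c"
proof -
  have "(g - mat 1) ** (h - mat 1) \<in> MM R R (c + c)" using assms by (intro MM_mult) (auto simp: KP_def)
  then have "(g - mat 1) ** (h - mat 1) \<in> MM R R c" using assms by (auto intro: MM_mono)
  then have "(g - mat 1) ** (h - mat 1) + (g - mat 1) + (h - mat 1) \<in> MM R R c"
    using assms by (intro MM_add) (auto simp: KP_def)
  moreover have "(g - mat 1) ** (h - mat 1) + (g - mat 1) + (h - mat 1) = g ** h - mat 1"
    by (simp add: matrix_sub_ldistrib matrix_sub_rdistrib)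
  ultimately show ?thesis using assms by (simp add: KP_def mult_GG)
qed

lemma KP_conj: assumes "k \<in> PP R" "g \<in> KP R c" shows "k ** g ** star k \<in> KP R c"
proof -
  have "k ** (g - mat 1) ** star k \<in> MM R R (0 + c + 0)"
    using assms by (intro MM_mult MM_star) (auto simp: KP_def PP_def)
  moreover have "k ** (g - mat 1) ** star k = k ** g ** star k - mat 1"
    using assms by (simp add: matrix_sub_ldistrib matrix_sub_rdistrib GG_star_right PP_GG)
  ultimately show ?thesis using assms by (simp add: KP_def mult_GG star_GG PP_GG)
qed

lemma PP_subgroup: "subgroup (PP R) (Ugrp bar)"
  by (rule G.subgroupI) (auto simp: PP_mult PP_star inv_GG PP_GG intro: PP_1)

lemma KP_subgroup: "0 \<le> c \<Longrightarrow> subgroup (KP R c) (Ugrp bar)"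
  by (rule G.subgroupI) (auto simp: KP_mult KP_star inv_GG KP_GG intro: KP_1)

definition nu :: "'e \<Rightarrow> 'e \<Rightarrow> 'e^3^3" where "nu x y = mat3 1 x y 0 1 (- bar x) 0 0 1"
definition nl :: "'e \<Rightarrow> 'e \<Rightarrow> 'e^3^3" where "nl x y = mat3 1 0 0 x 1 0 y (- bar x) 1"
definition dg :: "'e \<Rightarrow> 'e \<Rightarrow> 'e^3^3" where "dg c b = mat3 c 0 0 0 b 0 0 0 (inverse (bar c))"
text \<open>\<open>alph m\<close> is the m-th power of alpha and translates the apartment by 4 m.
  \<open>sw a\<close> reflects the apartment at the vertex 2 a, hence lies in the stabilizer of that
  vertex and represents its nontrivial Weyl element.\<close>

definition alph :: "int \<Rightarrow> 'e^3^3" where "alph m = mat3 (\<pi> powi (- m)) 0 0 0 1 0 0 0 (\<pi> powi m)"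
definition sw :: "int \<Rightarrow> 'e^3^3" where "sw a = mat3 0 0 (\<pi> powi (- a)) 0 1 0 (\<pi> powi a) 0 0"

lemma nu_GG: "x * bar x + y + bar y = 0 \<Longrightarrow> nu x y \<in> GG"
  unfolding mem_GG_iff by (rule mat3_eqI) (auto simp: mult_nth nu_def bar_minus algebra_simps)
lemma nl_GG: "x * bar x + y + bar y = 0 \<Longrightarrow> nl x y \<in> GG"
  unfolding mem_GG_iff by (rule mat3_eqI) (auto simp: mult_nth nl_def bar_minus algebra_simps)
lemma dg_GG: "c \<noteq> 0 \<Longrightarrow> b * bar b = 1 \<Longrightarrow> dg c b \<in> GG"
  unfolding mem_GG_iff by (rule mat3_eqI) (auto simp: mult_nth dg_def bar_inverse mult.commute)
lemma alph_GG [simp]: "alph m \<in> GG"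
  unfolding mem_GG_iff by (rule mat3_eqI) (auto simp: mult_nth alph_def bar_power_int bar_inverse power_int_minus)
lemma sw_GG [simp]: "sw a \<in> GG"
  unfolding mem_GG_iff by (rule mat3_eqI) (auto simp: mult_nth sw_def bar_power_int bar_inverse power_int_minus)

lemma alph_add: "alph m ** alph n = alph (m + n)"
  by (rule mat3_eqI) (auto simp: mult_nth alph_def simp flip: power_int_add)
lemma alph_0 [simp]: "alph 0 = mat 1"
  by (rule mat3_eqI) (auto simp: alph_def)
lemma star_alph [simp]: "star (alph m) = alph (- m)"
  by (rule mat3_eqI) (auto simp: alph_def bar_power_int)
lemma sw_sw: "sw a ** sw a = mat 1"
  by (rule mat3_eqI) (auto simp: mult_nth sw_def power_int_minus)
lemma star_sw [simp]: "star (sw a) = sw a"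
  by (rule mat3_eqI) (auto simp: sw_def bar_power_int)
lemma sw_alph: "sw a ** alph m = alph (- m) ** sw a"
  by (rule mat3_eqI) (auto simp: mult_nth sw_def alph_def)
lemma sw_shift: "sw 0 = sw a ** alph a"
  by (rule mat3_eqI) (auto simp: mult_nth sw_def alph_def power_int_minus)
lemma sw_PP: "sw a \<in> PP (2 * a)"
  unfolding PP_def by (auto simp: MM_iff sw_def vge_pi_power_int vge_1 simp del: sw_GG intro: sw_GG[unfolded sw_def])

text \<open>The loss of a translation between two points is their distance after translating. With
  the converse below, which reads the two signs off the corner entries, this makes the level of a
  double coset measurable.\<close>

lemma alph_MM: "\<bar>4 * m + S - R\<bar> \<le> c \<Longrightarrow> alph m \<in> MM R S (- c)"
  by (auto simp: MM_iff alph_def vge_pi_power_int vge_1)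

lemma alph_MM_D: "alph m \<in> MM R S (- c) \<Longrightarrow> \<bar>4 * m + S - R\<bar> \<le> c"
  by (auto simp: MM_iff alph_def vge_pi_power_int vge_1)

end

section \<open>Elimination, the Bruhat decomposition of K and the decomposition of G into K alpha^m
  I\<close>

context valued_involution begin

lemma GG_rows: assumes "g \<in> GG"
  shows "g$i$1 * bar (g$flip j$3) + g$i$2 * bar (g$flip j$2) + g$i$3 * bar (g$flip j$1) = (if i = j then 1 else 0)"
proof -
  have "(g ** star g) $ i $ j = mat 1 $ i $ j" using GG_star_right[OF assms] by simp
  then show ?thesis by (simp add: mult_nth)
qed

lemma GG_cols: assumes "g \<in> GG"
  shows "bar (g$3$flip i) * g$1$j + bar (g$2$flip i) * g$2$j + bar (g$1$flip i) * g$3$j = (if i = j then 1 else 0)"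
proof -
  have "(star g ** g) $ i $ j = mat 1 $ i $ j" using assms by (simp add: mem_GG_iff)
  then show ?thesis by (simp add: mult_nth)
qed

lemma nl_nth [simp]:
  "nl x y $ 1 $ 1 = 1" "nl x y $ 1 $ 2 = 0" "nl x y $ 1 $ 3 = 0"
  "nl x y $ 2 $ 1 = x" "nl x y $ 2 $ 2 = 1" "nl x y $ 2 $ 3 = 0"
  "nl x y $ 3 $ 1 = y" "nl x y $ 3 $ 2 = - bar x" "nl x y $ 3 $ 3 = 1"
  by (simp_all add: nl_def)

lemma nu_nth [simp]:
  "nu x y $ 1 $ 1 = 1" "nu x y $ 1 $ 2 = x" "nu x y $ 1 $ 3 = y"
  "nu x y $ 2 $ 1 = 0" "nu x y $ 2 $ 2 = 1" "nu x y $ 2 $ 3 = - bar x"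
  "nu x y $ 3 $ 1 = 0" "nu x y $ 3 $ 2 = 0" "nu x y $ 3 $ 3 = 1"
  by (simp_all add: nu_def)

lemma dg_nth [simp]:
  "dg c b $ 1 $ 1 = c" "dg c b $ 1 $ 2 = 0" "dg c b $ 1 $ 3 = 0"
  "dg c b $ 2 $ 1 = 0" "dg c b $ 2 $ 2 = b" "dg c b $ 2 $ 3 = 0"
  "dg c b $ 3 $ 1 = 0" "dg c b $ 3 $ 2 = 0" "dg c b $ 3 $ 3 = inverse (bar c)"
  by (simp_all add: dg_def)

lemma alph_nth [simp]:
  "alph m $ 1 $ 1 = \<pi> powi (- m)" "alph m $ 1 $ 2 = 0" "alph m $ 1 $ 3 = 0"
  "alph m $ 2 $ 1 = 0" "alph m $ 2 $ 2 = 1" "alph m $ 2 $ 3 = 0"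
  "alph m $ 3 $ 1 = 0" "alph m $ 3 $ 2 = 0" "alph m $ 3 $ 3 = \<pi> powi m"
  by (simp_all add: alph_def)

lemma sw_nth [simp]:
  "sw a $ 1 $ 1 = 0" "sw a $ 1 $ 2 = 0" "sw a $ 1 $ 3 = \<pi> powi (- a)"
  "sw a $ 2 $ 1 = 0" "sw a $ 2 $ 2 = 1" "sw a $ 2 $ 3 = 0"
  "sw a $ 3 $ 1 = \<pi> powi a" "sw a $ 3 $ 2 = 0" "sw a $ 3 $ 3 = 0"
  by (simp_all add: sw_def)

lemma sum3_eq_0: "(p::'e) + q + r = 0 \<Longrightarrow> - p - r = q"
  using eq_neg_iff_add_eq_0[of q "p + r"] by (simp add: ac_simps)

lemma nl_PP: "x * bar x + y + bar y = 0 \<Longrightarrow> vge R x \<Longrightarrow> vge (2 * R) y \<Longrightarrow> nl x y \<in> PP R"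
  by (auto simp: PP_def nl_GG MM_iff vge_1)

lemma nu_PP: "x * bar x + y + bar y = 0 \<Longrightarrow> vge (- R) x \<Longrightarrow> vge (- 2 * R) y \<Longrightarrow> nu x y \<in> PP R"
  by (auto simp: PP_def nu_GG MM_iff vge_1)

lemma nl_KP: "x * bar x + y + bar y = 0 \<Longrightarrow> vge (R + c) x \<Longrightarrow> vge (2 * R + c) y \<Longrightarrow> nl x y \<in> KP R c"
  by (auto simp: KP_def nl_GG MM_iff vge_1)

lemma nu_KP: "x * bar x + y + bar y = 0 \<Longrightarrow> vge (c - R) x \<Longrightarrow> vge (c - 2 * R) y \<Longrightarrow> nu x y \<in> KP R c"
  by (auto simp: KP_def nu_GG MM_iff vge_1)

lemma nl_PP_D: "nl x y \<in> PP R \<Longrightarrow> vge R x \<and> vge (2 * R) y"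
  by (auto simp: PP_def MM_iff)
lemma nu_PP_D: "nu x y \<in> PP R \<Longrightarrow> vge (- R) x \<and> vge (- 2 * R) y"
  by (auto simp: PP_def MM_iff)
lemma nl_KP_D: "nl x y \<in> KP R c \<Longrightarrow> vge (R + c) x \<and> vge (2 * R + c) y"
  by (auto simp: KP_def MM_iff)
lemma nu_KP_D: "nu x y \<in> KP R c \<Longrightarrow> vge (c - R) x \<and> vge (c - 2 * R) y"
  by (auto simp: KP_def MM_iff)

lemma norm_1_v: assumes "b * bar b = 1" shows "b \<noteq> 0" "v b = 0"
proof -
  show b: "b \<noteq> 0" using assms by auto
  have "v (b * bar b) = v b + v b" using b by (simp add: v_mult v_bar)
  then show "v b = 0" using assms by simp
qed

lemma dg_PP: "c \<noteq> 0 \<Longrightarrow> v c = 0 \<Longrightarrow> b * bar b = 1 \<Longrightarrow> dg c b \<in> PP R"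
  using norm_1_v[of b] by (auto simp: PP_def dg_GG MM_iff vge_def v_inverse v_bar)

lemma star_nl: "star (nl x y) = nl (- x) (bar y)"
  by (rule mat3_eqI) (auto simp: bar_minus)
lemma star_nu: "star (nu x y) = nu (- x) (bar y)"
  by (rule mat3_eqI) (auto simp: bar_minus)
lemma star_dg: "c \<noteq> 0 \<Longrightarrow> star (dg c b) = dg (inverse c) (bar b)"
  by (rule mat3_eqI) (auto simp: bar_inverse)
lemma nl_0 [simp]: "nl 0 0 = mat 1"
  by (rule mat3_eqI) auto

lemma lower_unipotent:
  assumes "g \<in> GG" "g$1$1 = 1" "g$2$2 = 1" "g$3$3 = 1" "g$1$2 = 0" "g$1$3 = 0" "g$2$3 = 0"
  defines "x \<equiv> g$2$1" and "y \<equiv> g$3$1"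
  shows "g = nl x y" "x * bar x + y + bar y = 0"
proof -
  have 1: "g$3$2 = - bar x" using GG_rows[OF assms(1), of 3 2] assms(2-7)
    by (simp add: x_def add_eq_0_iff2)
  show "g = nl x y" using assms 1 by (intro mat3_eqI) auto
  show "x * bar x + y + bar y = 0"
    using GG_rows[OF assms(1), of 3 1] assms(2-7) 1 by (simp add: y_def bar_minus algebra_simps)
qed

text \<open>When the first row is (c, 0, 0), the unitary relations force the matrix to be lower
  triangular with diagonal c, b, 1 / bar c. Dividing by this torus element leaves an element of
  N'.\<close>

lemma lower_decomp:
  assumes g: "g \<in> GG" and 12: "g$1$2 = 0" and 13: "g$1$3 = 0"
  obtains b x y where "b * bar b = 1" "x * bar x + y + bar y = 0" "g = dg (g$1$1) b ** nl x y"
    "g$1$1 \<noteq> 0" "g$2$1 = b * x" "y = g$3$1 * bar (g$1$1)" "g$2$2 = b"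
proof -
  define c b where "c = g$1$1" and "b = g$2$2"
  have c: "c * bar (g$3$3) = 1" using GG_rows[OF g, of 1 1] 12 13 by (simp add: c_def)
  then have c0: "c \<noteq> 0" and "g$3$3 \<noteq> 0" by auto
  have 33: "g$3$3 = inverse (bar c)"
    by (metis c bar_mult bar_1 bar_bar inverse_unique mult.commute)
  have 23: "g$2$3 = 0" using GG_rows[OF g, of 1 2] 12 13 c0 by (simp add: c_def)
  have b: "b * bar b = 1" using GG_rows[OF g, of 2 2] 12 13 23 by (simp add: b_def)
  define l where "l = star (dg c b) ** g"
  have l: "l \<in> GG" unfolding l_def by (intro mult_GG star_GG dg_GG g c0 b)
  have lg: "g = dg c b ** l" unfolding l_def by (simp add: star_cancel(2) dg_GG c0 b)
  have 21: "l$2$1 = bar b * g$2$1" "l$3$1 = g$3$1 * bar c"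
    using 12 13 23 33 c0 b by (simp_all add: l_def mult_nth star_dg bar_inverse)
  have "l$1$1 = 1" "l$2$2 = 1" "l$3$3 = 1" "l$1$2 = 0" "l$1$3 = 0" "l$2$3 = 0"
    using 12 13 23 33 c0 b
    by (simp_all add: l_def mult_nth star_dg bar_inverse mult.commute flip: c_def b_def)
  from lower_unipotent[OF l this] have 1: "l = nl (l$2$1) (l$3$1)" "l$2$1 * bar (l$2$1) + l$3$1 + bar (l$3$1) = 0"
    by auto
  show ?thesis
  proof (rule that[OF b 1(2)])
    show "g = dg (g$1$1) b ** nl (l$2$1) (l$3$1)" using lg 1(1) by (simp add: c_def)
    show "g$1$1 \<noteq> 0" using c0 by (simp add: c_def)
    show "g$2$1 = b * l$2$1" using 21 b by simp
  qed (use 21 in \<open>auto simp: c_def b_def\<close>)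
qed

lemma row_rel:
  assumes "a1 * bar a3 + a2 * bar a2 + a3 * bar a1 = 0" "a1 \<noteq> 0"
  shows "(a2 / a1) * bar (a2 / a1) + a3 / a1 + bar (a3 / a1) = 0"
  using assms by (simp add: bar_divide field_simps)

text \<open>Gaussian elimination with pivot in the upper left corner: the first row is isotropic, so
  divided by the pivot it is the first row of an element of N, and removing that element clears the
  row.\<close>

lemma LDU:
  assumes g: "g \<in> GG" and nz: "g$1$1 \<noteq> 0"
  defines "x' \<equiv> g$1$2 / g$1$1" and "y' \<equiv> g$1$3 / g$1$1"
  obtains b x y where "b * bar b = 1" "x * bar x + y + bar y = 0" "x' * bar x' + y' + bar y' = 0"
    "g = dg (g$1$1) b ** nl x y ** nu x' y'" "g$2$1 = b * x" "y = g$3$1 * bar (g$1$1)"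
proof -
  have rel: "x' * bar x' + y' + bar y' = 0"
    unfolding x'_def y'_def using GG_rows[OF g, of 1 3] nz by (intro row_rel) auto
  define l where "l = g ** star (nu x' y')"
  have l: "l \<in> GG" unfolding l_def by (intro mult_GG star_GG nu_GG g rel)
  have g12: "g$1$2 = x' * g$1$1" "g$1$3 = y' * g$1$1" using nz by (auto simp: x'_def y'_def)
  have l12: "l$1$2 = 0" by (simp add: l_def mult_nth star_nu g12)
  have "l$1$3 = g$1$1 * (x' * bar x' + y' + bar y')"
    by (simp add: l_def mult_nth star_nu g12 bar_minus algebra_simps)
  then have l13: "l$1$3 = 0" using rel by simp
  from l l12 l13 obtain b x y where h: "b * bar b = 1" "x * bar x + y + bar y = 0" "l = dg (l$1$1) b ** nl x y"
    "l$2$1 = b * x" "y = l$3$1 * bar (l$1$1)"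
    by (rule lower_decomp)
  have col: "l$i$1 = g$i$1" for i by (simp add: l_def mult_nth star_nu)
  have "g = l ** nu x' y'"
    unfolding l_def by (simp add: star_cancel'(1) nu_GG rel)
  then show ?thesis using h(3-5) by (intro that[OF h(1,2) rel]) (simp_all only: col)
qed

lemma alph_nu: "alph m ** nu x y ** alph (- m) = nu (x * \<pi> powi (- m)) (y * \<pi> powi (- 2 * m))"
proof -
  have "\<pi> powi (m * 2) = \<pi> powi m * \<pi> powi m" 
    using power_int_add[of \<pi> m m] by (simp add: mult_2_right)
  then show ?thesis
    by (intro mat3_eqI) (auto simp: mult_nth bar_mult bar_power_int bar_inverse power_int_minus field_simps bar_divide)
qed

lemma alph_nl: "alph m ** nl x y ** alph (- m) = nl (x * \<pi> powi m) (y * \<pi> powi (2 * m))"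
proof -
  have "\<pi> powi (m * 2) = \<pi> powi m * \<pi> powi m" 
    using power_int_add[of \<pi> m m] by (simp add: mult_2_right)
  then show ?thesis
    by (intro mat3_eqI) (auto simp: mult_nth bar_mult bar_power_int power_int_minus field_simps)
qed

lemma alph_dg: "alph m ** dg c b = dg c b ** alph m"
  by (rule mat3_eqI) (auto simp: mult_nth)

lemma sw_nu: "sw a ** nu x y ** sw a = nl (- bar x * \<pi> powi a) (y * \<pi> powi (2 * a))"
proof -
  have "\<pi> powi (a * 2) = \<pi> powi a * \<pi> powi a" 
    using power_int_add[of \<pi> a a] by (simp add: mult_2_right)
  then show ?thesis
    by (intro mat3_eqI) (auto simp: mult_nth bar_mult bar_minus bar_power_int power_int_minus field_simps)
qed

lemma rel_sw:
  assumes "x * bar x + y + bar y = 0"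
  shows "(- bar x * \<pi> powi a) * bar (- bar x * \<pi> powi a) + y * \<pi> powi (2 * a) + bar (y * \<pi> powi (2 * a)) = 0"
proof -
  have "\<pi> powi (2 * a) = \<pi> powi a * \<pi> powi a" 
    by (metis mult_2 power_int_add pi_nonzero)
  then have "(- bar x * \<pi> powi a) * bar (- bar x * \<pi> powi a) + y * \<pi> powi (2 * a) + bar (y * \<pi> powi (2 * a))
      = \<pi> powi a * \<pi> powi a * (x * bar x + y + bar y)"
    by (simp add: bar_mult bar_minus bar_power_int algebra_simps)
  then show ?thesis using assms by simp
qed

lemma sw_dg: "c \<noteq> 0 \<Longrightarrow> sw a ** dg c b ** sw a = dg (inverse (bar c)) b"
  by (intro mat3_eqI) (auto simp: mult_nth power_int_minus bar_inverse)

lemma sw_conj_eq: "sw a ** g ** sw a = h \<Longrightarrow> g = sw a ** h ** sw a"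
  by (metis matrix_mul_assoc matrix_mul_lid matrix_mul_rid sw_sw)

text \<open>Valuations are integers, so bounds on 4 v round up to the next multiple of 4. Such
  rounding is what makes the groups at nearby points of the apartment comparable.\<close>

lemma vge_even: "vge (4 * n - 3) x \<Longrightarrow> vge (4 * n) x"
  by (auto simp: vge_def)

definition LO :: "int \<Rightarrow> ('e^3^3) set" where
  "LO R = {dg c b ** nl x y | c b x y. c \<noteq> 0 \<and> v c = 0 \<and> b * bar b = 1 \<and> x * bar x + y + bar y = 0
     \<and> vge R x \<and> vge (2 * R) y}"
definition NU :: "int \<Rightarrow> ('e^3^3) set" where
  "NU R = {nu x y | x y. x * bar x + y + bar y = 0 \<and> vge (- R) x \<and> vge (- 2 * R) y}"
definition NL :: "int \<Rightarrow> ('e^3^3) set" where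
  "NL R = {nl x y | x y. x * bar x + y + bar y = 0 \<and> vge R x \<and> vge (2 * R) y}"
definition DG :: "('e^3^3) set" where
  "DG = {dg c b | c b. c \<noteq> 0 \<and> v c = 0 \<and> b * bar b = 1}"

lemma LO_I: "c \<noteq> 0 \<Longrightarrow> v c = 0 \<Longrightarrow> b * bar b = 1 \<Longrightarrow> x * bar x + y + bar y = 0 \<Longrightarrow> vge R x \<Longrightarrow> vge (2 * R) y
    \<Longrightarrow> dg c b ** nl x y \<in> LO R"
  unfolding LO_def by blast
lemma NU_I: "x * bar x + y + bar y = 0 \<Longrightarrow> vge (- R) x \<Longrightarrow> vge (- 2 * R) y \<Longrightarrow> nu x y \<in> NU R"
  unfolding NU_def by blast
lemma NL_I: "x * bar x + y + bar y = 0 \<Longrightarrow> vge R x \<Longrightarrow> vge (2 * R) y \<Longrightarrow> nl x y \<in> NL R"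
  unfolding NL_def by blast
lemma DG_I: "c \<noteq> 0 \<Longrightarrow> v c = 0 \<Longrightarrow> b * bar b = 1 \<Longrightarrow> dg c b \<in> DG"
  unfolding DG_def by blast

lemma NU_PP: "n \<in> NU R \<Longrightarrow> n \<in> PP R" by (auto simp: NU_def intro!: nu_PP)
lemma NL_PP: "n \<in> NL R \<Longrightarrow> n \<in> PP R" by (auto simp: NL_def intro!: nl_PP)
lemma DG_PP: "h \<in> DG \<Longrightarrow> h \<in> PP R" by (auto simp: DG_def intro!: dg_PP)

lemma LO_iff: "l \<in> LO R \<longleftrightarrow> (\<exists>h\<in>DG. \<exists>n\<in>NL R. l = h ** n)"
  unfolding LO_def DG_def NL_def by blast

lemma LO_PP: "l \<in> LO R \<Longrightarrow> l \<in> PP R"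
  unfolding LO_iff by (metis PP_mult DG_PP NL_PP)

text \<open>Bruhat decomposition of the finite reductive quotient, in the form \<open>B' U \<union> B' s\<close>.\<close>

lemma K_cells:
  assumes k: "k \<in> PP (2 * a)"
  shows "(\<exists>l\<in>LO (2 * a). \<exists>n\<in>NU (2 * a). k = l ** n) \<or>
         (\<exists>l\<in>LO (2 * a). \<exists>n\<in>NL (2 * a) \<inter> KP (2 * a) 1. k = l ** sw a ** n)"
proof (cases "vge 1 (k$1$1)")
  case False
  have g: "k \<in> GG" and M: "vge 0 (k$1$1)" "vge (-2*a) (k$1$2)" "vge (-4*a) (k$1$3)" "vge (2*a) (k$2$1)" "vge (4*a) (k$3$1)"
    using k by (auto simp: PP_def MM_iff)
  have nz: "k$1$1 \<noteq> 0" and v0: "v (k$1$1) = 0" using False M(1) by (auto simp: vge_def)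
  from g nz obtain b x y where *: "b * bar b = 1" "x * bar x + y + bar y = 0"
    "k$1$2 / k$1$1 * bar (k$1$2 / k$1$1) + k$1$3 / k$1$1 + bar (k$1$3 / k$1$1) = 0"
    "k = dg (k$1$1) b ** nl x y ** nu (k$1$2 / k$1$1) (k$1$3 / k$1$1)" "k$2$1 = b * x" "y = k$3$1 * bar (k$1$1)"
    by (rule LDU)
  have "x = k$2$1 * bar b" using *(1,5) by (simp add: algebra_simps)
  then have "vge (2*a + 0) x" using M(4) norm_1_v[OF *(1)] by (metis vge_mult vge_bar vge_def order_refl mult_zero_right)
  moreover have "vge (4*a + 0) y" unfolding *(6) using M(5) v0 by (intro vge_mult) (auto simp: vge_def v_bar[OF nz])
  moreover have "vge (-2*a) (k$1$2 / k$1$1)" "vge (-4*a) (k$1$3 / k$1$1)"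
    by (rule vge_divide[OF M(2) nz], simp add: v0, rule vge_divide[OF M(3) nz], simp add: v0)
  ultimately have "dg (k$1$1) b ** nl x y \<in> LO (2*a)" "nu (k$1$2 / k$1$1) (k$1$3 / k$1$1) \<in> NU (2*a)"
    using * nz v0 by (auto intro!: LO_I NU_I)
  then show ?thesis using *(4) by metis
next
  case True
  have g: "k \<in> GG" and M: "vge 4 (k$1$1)" "vge (-2*a) (k$1$2)" "vge (-4*a) (k$1$3)" "vge (2*a) (k$2$1)" "vge (4*a) (k$3$1)"
      "vge (2*a) (k$3$2)" "vge 0 (k$3$3)"
    using k vge_even[of 1 "k$1$1"] True by (auto simp: PP_def MM_iff)
  \<comment> \<open>Isotropy of the first row: since the (1,1) entry is not a unit, the norm of the
    (1,2) entry gains 4 over the bound given by K, and half of the gain remains for the entry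
    itself.\<close>
  have iso: "k$1$1 * bar (k$1$3) + k$1$2 * bar (k$1$2) + k$1$3 * bar (k$1$1) = 0"
    using GG_rows[OF g, of 1 3] by simp
  have "vge (4 + (-4*a)) (- (k$1$1 * bar (k$1$3)) - k$1$3 * bar (k$1$1))"
    using vge_mult[of 4 "k$1$1" "-4*a" "bar (k$1$3)"] vge_mult[of "-4*a" "k$1$3" 4 "bar (k$1$1)"] M
    by (intro vge_diff) (auto simp: add.commute)
  moreover have "- (k$1$1 * bar (k$1$3)) - k$1$3 * bar (k$1$1) = k$1$2 * bar (k$1$2)"
    using sum3_eq_0[OF iso] by simp
  ultimately have "vge (2 * (2 + (-2*a))) (k$1$2 * bar (k$1$2))" by (simp add: algebra_simps)
  then have 12: "vge (2 + (-2*a)) (k$1$2)" by (rule vge_square)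
  \<comment> \<open>If the (1,3) entry were small as well, the product of row 1 with row 3, which is
    1, would lie in the maximal ideal.\<close>
  have "\<not> vge (1 + (-4*a)) (k$1$3)"
  proof
    assume 13: "vge (1 + (-4*a)) (k$1$3)"
    have "k$1$1 * bar (k$3$3) + k$1$2 * bar (k$3$2) + k$1$3 * bar (k$3$1) = 1"
      using GG_rows[OF g, of 1 1] by simp
    moreover have "vge 1 (k$1$1 * bar (k$3$3) + k$1$2 * bar (k$3$2) + k$1$3 * bar (k$3$1))"
      using vge_mult[OF M(1), of 0 "bar (k$3$3)"] vge_mult[OF 12, of "2*a" "bar (k$3$2)"]
         vge_mult[OF 13, of "4*a" "bar (k$3$1)"] M
      by (intro vge_add) (auto elim: vge_mono)
    ultimately show False by (simp add: vge_1)
  qed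
  then have nz: "k$1$3 \<noteq> 0" and v13: "v (k$1$3) = -a" using M(3) by (auto simp: vge_def)
  \<comment> \<open>The reflection moves the large (1,3) entry into the pivot position, so the
    elimination of the other case applies to h.\<close>
  define h where "h = k ** sw a"
  have h: "h \<in> PP (2 * a)" unfolding h_def by (intro PP_mult k sw_PP)
  have h1: "h$1$1 = k$1$3 * \<pi> powi a" "h$1$2 = k$1$2" "h$1$3 = k$1$1 * \<pi> powi (- a)"
    by (simp_all add: h_def mult_nth)
  have hnz: "h$1$1 \<noteq> 0" and hv: "v (h$1$1) = 0" using nz by (auto simp: h1 v_mult v13)
  have hg: "h \<in> GG" and hM: "vge (2*a) (h$2$1)" "vge (4*a) (h$3$1)" using h by (auto simp: PP_def MM_iff)
  from hg hnz obtain b x y where *: "b * bar b = 1" "x * bar x + y + bar y = 0"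
    "h$1$2 / h$1$1 * bar (h$1$2 / h$1$1) + h$1$3 / h$1$1 + bar (h$1$3 / h$1$1) = 0"
    "h = dg (h$1$1) b ** nl x y ** nu (h$1$2 / h$1$1) (h$1$3 / h$1$1)" "h$2$1 = b * x" "y = h$3$1 * bar (h$1$1)"
    by (rule LDU)
  let ?x = "h$1$2 / h$1$1" and ?y = "h$1$3 / h$1$1"
  have "x = h$2$1 * bar b" using *(1,5) by (simp add: algebra_simps)
  then have "vge (2*a + 0) x" using hM norm_1_v[OF *(1)] by (metis vge_mult vge_bar vge_def order_refl mult_zero_right)
  moreover have "vge (4*a + 0) y" unfolding *(6) using hM hv by (intro vge_mult) (auto simp: vge_def v_bar[OF hnz])
  ultimately have L: "dg (h$1$1) b ** nl x y \<in> LO (2*a)" by (intro LO_I hnz hv *(1,2)) auto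
  have "vge (2 - 2*a) ?x" by (rule vge_divide[of "2 + (-2*a)", OF _ hnz]) (use 12 hv in \<open>auto simp: h1(2)\<close>)
  moreover have "vge (4 + 4 * (-a)) (h$1$3)" unfolding h1 by (intro vge_mult M) (simp add: vge_pi_power_int)
  then have "vge (4 - 4*a) ?y" by (rule vge_divide[OF _ hnz]) (auto simp: hv)
  ultimately have xy: "vge (2 - 2*a) ?x" "vge (4 - 4*a) ?y" by auto
  define n where "n = sw a ** nu ?x ?y ** sw a"
  have n: "n = nl (- bar ?x * \<pi> powi a) (?y * \<pi> powi (2 * a))" unfolding n_def by (rule sw_nu)
  have "vge ((2 - 2*a) + 4 * a) (- bar ?x * \<pi> powi a)" "vge ((4 - 4*a) + 4 * (2 * a)) (?y * \<pi> powi (2 * a))"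
    using xy by (intro vge_mult; simp add: vge_pi_power_int)+
  then have xy': "vge (2 + 2*a) (- bar ?x * \<pi> powi a)" "vge (4 + 4*a) (?y * \<pi> powi (2 * a))"
    by (auto elim: vge_mono)
  have rel: "(- bar ?x * \<pi> powi a) * bar (- bar ?x * \<pi> powi a) + ?y * \<pi> powi (2 * a) + bar (?y * \<pi> powi (2 * a)) = 0"
    by (rule rel_sw[OF *(3)])
  have "n \<in> NL (2 * a) \<inter> KP (2 * a) 1"
    unfolding n using rel xy' by (intro IntI NL_I nl_KP) (auto elim: vge_mono)
  moreover have "k = dg (h$1$1) b ** nl x y ** sw a ** n"
  proof -
    have "k = h ** sw a" by (simp add: h_def sw_sw flip: matrix_mul_assoc)
    also have "\<dots> = dg (h$1$1) b ** nl x y ** (sw a ** sw a) ** nu ?x ?y ** sw a"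
      using *(4) by (simp add: sw_sw)
    finally show ?thesis by (simp add: n_def matrix_mul_assoc)
  qed
  ultimately show ?thesis using L by blast
qed


lemma DG_NL_NU_finite_part:
  assumes "c \<noteq> 0" "b * bar b = 1"
  obtains c' where "c' \<noteq> 0" "v c' = 0" "dg c b = dg c' b ** alph (- v c)"
proof (rule that[of "c * \<pi> powi (- v c)"])
  show "dg c b = dg (c * \<pi> powi (- v c)) b ** alph (- v c)"
    using assms(1) by (intro mat3_eqI)
      (auto simp: mult_nth power_int_minus bar_mult bar_inverse bar_divide bar_power_int field_simps)
qed (use assms in \<open>auto simp: v_mult\<close>)

text \<open>Elimination at the corner entry of least weight. Minimality bounds only the four corner
  entries; isotropy of row 1 and of column j bounds the middle ones. The column is then cleared by a
  unipotent element that lies in K, and the row by one that lies in the Iwahori subgroup.\<close>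

lemma GG_cells_pivot:
  assumes g: "g \<in> GG" and j: "j = 1 \<or> j = 3" and nz: "g$1$j \<noteq> 0"
    and min: "\<And>i' j'. i' \<in> {1,3} \<Longrightarrow> j' \<in> {1,3} \<Longrightarrow>
       vge (4 * v (g$1$j) + 2 * a + (2 * a + 1) * ht j + 2 * a * ht i' - (2 * a + 1) * ht j') (g$i'$j')"
  shows "\<exists>k\<in>PP (2 * a). \<exists>m. \<exists>i\<in>PP (2 * a + 1). g = k ** alph m ** i"
proof -
  define R S c where "R = 2 * a" and "S = 2 * a + 1" and "c = 4 * v (g$1$j) + R + S * ht j"
  have corner: "vge (c - R + S) (g$1$1)" "vge (c - R - S) (g$1$3)" "vge (c + R + S) (g$3$1)" "vge (c + R - S) (g$3$3)"
    using min[of 1 1] min[of 1 3] min[of 3 1] min[of 3 3] by (simp_all add: R_def S_def c_def algebra_simps)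
  then have col: "vge (c - R - S * ht j) (g$1$j)" "vge (c + R - S * ht j) (g$3$j)" using j by auto
  have iso: "g$1$1 * bar (g$1$3) + g$1$2 * bar (g$1$2) + g$1$3 * bar (g$1$1) = 0"
    using GG_rows[OF g, of 1 3] by simp
  have isoc: "bar (g$3$j) * g$1$j + bar (g$2$j) * g$2$j + bar (g$1$j) * g$3$j = 0"
    using GG_cols[OF g, of "flip j" j] j by auto
  have "vge ((c - R + S) + (c - R - S)) (- (g$1$1 * bar (g$1$3)) - bar (g$1$1) * g$1$3)"
    using corner by (intro vge_diff vge_mult; simp only: vge_minus vge_bar; intro vge_mult; simp)
  moreover have "- (g$1$1 * bar (g$1$3)) - bar (g$1$1) * g$1$3 = g$1$2 * bar (g$1$2)"
    using sum3_eq_0[OF iso] by (simp add: mult.commute)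
  ultimately have "vge (2 * (c - R)) (g$1$2 * bar (g$1$2))" by (simp add: algebra_simps)
  then have 12: "vge (c - R) (g$1$2)" by (rule vge_square)
  have "vge ((c - R - S * ht j) + (c + R - S * ht j)) (- (g$1$j * bar (g$3$j)) - bar (g$1$j) * g$3$j)"
    using col by (intro vge_diff vge_mult; simp only: vge_minus vge_bar; intro vge_mult; simp)
  moreover have "- (g$1$j * bar (g$3$j)) - bar (g$1$j) * g$3$j = g$2$j * bar (g$2$j)"
    using sum3_eq_0[OF isoc] by (simp add: mult.commute)
  ultimately have "vge (2 * (c - S * ht j)) (g$2$j * bar (g$2$j))" by (simp add: algebra_simps)
  then have 2: "vge (c - S * ht j) (g$2$j)" by (rule vge_square)
  have vc: "4 * v (g$1$j) = c - R - S * ht j" by (simp add: c_def)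
  define x y where "x = g$2$j / g$1$j" and "y = g$3$j / g$1$j"
  have rel: "x * bar x + y + bar y = 0"
    unfolding x_def y_def using isoc nz by (intro row_rel) (auto simp: algebra_simps)
  have xR: "vge R x" "vge (2 * R) y"
    unfolding x_def y_def by (rule vge_divide[OF 2 nz], simp add: vc, rule vge_divide[OF col(2) nz], simp add: vc)
  have n1: "nl x y \<in> PP R" by (rule nl_PP[OF rel xR])
  define h where "h = star (nl x y) ** g"
  have h: "h \<in> GG" unfolding h_def by (intro mult_GG star_GG g nl_GG rel)
  have gh: "g = nl x y ** h" unfolding h_def by (simp add: star_cancel nl_GG rel)
  have row: "h$1$i = g$1$i" for i by (simp add: h_def mult_nth star_nl)
  have g2: "g$2$j = x * g$1$j" "g$3$j = y * g$1$j" using nz by (auto simp: x_def y_def)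
  have hc2: "h$2$j = 0" by (simp add: h_def mult_nth star_nl g2)
  have "h$3$j = g$1$j * (x * bar x + y + bar y)"
    by (simp add: h_def mult_nth star_nl g2 bar_minus algebra_simps)
  then have hc3: "h$3$j = 0" using rel by simp
  have step: "\<exists>k\<in>PP (2 * a). \<exists>m. \<exists>i\<in>PP (2 * a + 1). g = k ** alph m ** i"
    if "h = k ** alph m ** i" "k \<in> PP R" "i \<in> PP S" for k m i
    using that n1 gh unfolding R_def S_def by (metis PP_mult matrix_mul_assoc)
  from j show ?thesis
  proof
    assume j1: "j = 1"
    define x' y' where "x' = g$1$2 / g$1$1" and "y' = g$1$3 / g$1$1"
    have nz: "g$1$1 \<noteq> 0" using nz j1 by simp
    have rel': "x' * bar x' + y' + bar y' = 0"
      unfolding x'_def y'_def using iso nz by (intro row_rel) auto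
    have "vge (- S) x'" "vge (- 2 * S) y'"
      unfolding x'_def y'_def using vc j1
      by (intro vge_divide[OF 12 nz], simp, intro vge_divide[OF corner(2) nz], simp)
    then have n2: "nu x' y' \<in> PP S" by (rule nu_PP[OF rel'])
    define l where "l = h ** star (nu x' y')"
    have l: "l \<in> GG" unfolding l_def by (intro mult_GG star_GG h nu_GG rel')
    have hl: "h = l ** nu x' y'" unfolding l_def by (simp add: star_cancel' nu_GG rel')
    have g12: "g$1$2 = x' * g$1$1" "g$1$3 = y' * g$1$1" using nz by (auto simp: x'_def y'_def)
    have l12: "l$1$2 = 0" by (simp add: l_def mult_nth star_nu g12 row)
    have "l$1$3 = g$1$1 * (x' * bar x' + y' + bar y')"
      by (simp add: l_def mult_nth star_nu g12 row bar_minus algebra_simps)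
    then have l13: "l$1$3 = 0" using rel' by simp
    have lc: "l$2$1 = 0" "l$3$1 = 0" using hc2 hc3 j1 by (simp_all add: l_def mult_nth star_nu)
    from l l12 l13 obtain b x y where b: "b * bar b = 1" "l = dg (l$1$1) b ** nl x y" "l$1$1 \<noteq> 0"
       "l$2$1 = b * x" "y = l$3$1 * bar (l$1$1)"
      by (rule lower_decomp)
    have "x = 0" "y = 0" using b norm_1_v[OF b(1)] lc by auto
    then have "l = dg (l$1$1) b" using b(2) by simp
    moreover from b(3,1) obtain c' where "c' \<noteq> 0" "v c' = 0" "dg (l$1$1) b = dg c' b ** alph (- v (l$1$1))"
      by (rule DG_NL_NU_finite_part)
    ultimately show ?thesis
      using hl n2 dg_PP[of c' b R] b(1) by (intro step[of "dg c' b" "- v (l$1$1)" "nu x' y'"]) auto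
  next
    assume j3: "j = 3"
    define x' y' where "x' = - bar (g$1$2 / g$1$3)" and "y' = g$1$1 / g$1$3"
    have nz: "g$1$3 \<noteq> 0" using nz j3 by simp
    have "(g$1$2 / g$1$3) * bar (g$1$2 / g$1$3) + g$1$1 / g$1$3 + bar (g$1$1 / g$1$3) = 0"
      using iso nz by (intro row_rel) (auto simp: algebra_simps)
    then have rel': "x' * bar x' + y' + bar y' = 0"
      unfolding x'_def y'_def by (simp add: bar_minus mult.commute del: bar_divide)
    have "vge S (g$1$2 / g$1$3)" "vge (2 * S) y'"
      unfolding x'_def y'_def using vc j3
      by (intro vge_divide[OF 12 nz], simp, intro vge_divide[OF corner(1) nz], simp)
    then have n2: "nl x' y' \<in> PP S" by (intro nl_PP[OF rel']) (auto simp: x'_def)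
    define l where "l = h ** star (nl x' y')"
    have l: "l \<in> GG" unfolding l_def by (intro mult_GG star_GG h nl_GG rel')
    have hl: "h = l ** nl x' y'" unfolding l_def by (simp add: star_cancel' nl_GG rel')
    have g12: "g$1$2 = - bar x' * g$1$3" "g$1$1 = y' * g$1$3" using nz by (auto simp: x'_def y'_def bar_minus)
    have l12: "l$1$2 = 0" by (simp add: l_def mult_nth star_nl g12 row bar_minus)
    have "l$1$1 = g$1$3 * (x' * bar x' + y' + bar y')"
      by (simp add: l_def mult_nth star_nl g12 row bar_minus algebra_simps)
    then have l11: "l$1$1 = 0" using rel' by simp
    have lc: "l$2$3 = 0" "l$3$3 = 0" using hc2 hc3 j3 by (simp_all add: l_def mult_nth star_nl)
    \<comment> \<open>With the pivot in position (1,3) the remaining matrix is antidiagonal; the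
      reflection makes it diagonal.\<close>
    define q where "q = l ** sw a"
    have q: "q \<in> GG" unfolding q_def by (intro mult_GG l sw_GG)
    have q0: "q$1$2 = 0" "q$1$3 = 0" "q$2$1 = 0" "q$3$1 = 0" using l12 l11 lc by (simp_all add: q_def mult_nth)
    from q q0(1,2) obtain b x y where b: "b * bar b = 1" "q = dg (q$1$1) b ** nl x y" "q$1$1 \<noteq> 0"
       "q$2$1 = b * x" "y = q$3$1 * bar (q$1$1)"
      by (rule lower_decomp)
    have "x = 0" "y = 0" using b norm_1_v[OF b(1)] q0 by auto
    then have qd: "q = dg (q$1$1) b" using b(2) by simp
    from b(3,1) obtain c' where c': "c' \<noteq> 0" "v c' = 0" "dg (q$1$1) b = dg c' b ** alph (- v (q$1$1))"
      by (rule DG_NL_NU_finite_part)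
    have "l = q ** sw a" unfolding q_def by (simp add: sw_sw flip: matrix_mul_assoc)
    also have "\<dots> = dg c' b ** alph (- v (q$1$1)) ** sw a" using qd c'(3) by simp
    also have "\<dots> = dg c' b ** sw a ** alph (v (q$1$1))"
      using sw_alph[of a "v (q$1$1)"] by (simp flip: matrix_mul_assoc)
    finally show ?thesis
      using hl n2 dg_PP[of c' b R] b(1) c' sw_PP[of a]
      by (intro step[of "dg c' b ** sw a" "v (q$1$1)" "nl x' y'"] PP_mult) (auto simp: R_def)
  qed
qed

text \<open>Some corner entry is nonzero, for otherwise isotropy would make the whole first row
  vanish. A pivot in the third row is brought into the first one by the reflection, which lies in
  K.\<close>

lemma GG_cells:
  assumes g: "g \<in> GG"
  shows "\<exists>k\<in>PP (2 * a). \<exists>m. \<exists>i\<in>PP (2 * a + 1). g = k ** alph m ** i"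
proof -
  \<comment> \<open>The weight of an entry is the largest c that this entry allows in
    \<open>MM (2 * a) (2 * a + 1) c\<close>.\<close>
  define w where "w = (\<lambda>p::3\<times>3. 4 * v (g $ fst p $ snd p) - 2 * a * ht (fst p) + (2 * a + 1) * ht (snd p))"
  define C where "C = {p \<in> {1,3} \<times> {1,3}. g $ fst p $ snd p \<noteq> 0}"
  have fin: "finite C" unfolding C_def by simp
  have ne: "C \<noteq> {}"
  proof
    assume "C = {}"
    then have 0: "g$1$1 = 0" "g$1$3 = 0" "g$3$1 = 0" "g$3$3 = 0" by (auto simp: C_def)
    then show False using GG_rows[OF g, of 1 3] GG_rows[OF g, of 1 1] by simp
  qed
  obtain p where p: "p \<in> C" and pm: "\<And>q. q \<in> C \<Longrightarrow> w p \<le> w q"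
    using ex_min_if_finite[of "w ` C"] fin ne by (metis (no_types, lifting) arg_min_if_finite not_le)
  obtain i j where ij: "p = (i, j)" by (cases p)
  have ij': "i = 1 \<or> i = 3" "j = 1 \<or> j = 3" "g$i$j \<noteq> 0" using p by (auto simp: C_def ij)
  have min: "vge (4 * v (g$i$j) - 2 * a * ht i + (2 * a + 1) * ht j + 2 * a * ht i' - (2 * a + 1) * ht j') (g$i'$j')"
    if "i' \<in> {1,3}" "j' \<in> {1,3}" for i' j'
  proof (cases "g$i'$j' = 0")
    case False
    then have "w p \<le> w (i', j')" using that False by (intro pm) (auto simp: C_def)
    then show ?thesis by (simp add: w_def ij vge_def)
  qed simp
  show ?thesis
  proof (cases "i = 1")
    case True
    then show ?thesis using ij' min by (intro GG_cells_pivot[OF g, of j]) auto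
  next
    case False
    then have i: "i = 3" using ij' by auto
    have "\<exists>k\<in>PP (2 * a). \<exists>m. \<exists>i\<in>PP (2 * a + 1). sw a ** g = k ** alph m ** i"
    proof (rule GG_cells_pivot[OF _ ij'(2)])
      show "sw a ** g \<in> GG" by (intro mult_GG sw_GG g)
      show "(sw a ** g) $ 1 $ j \<noteq> 0" using ij' i by (simp add: mult_nth)
      fix i' j' :: 3 assume i': "i' \<in> {1,3}" and j': "j' \<in> {1,3}"
      have "vge (4 * v (g$i$j) - 2 * a * ht i + (2 * a + 1) * ht j + 2 * a * ht (flip i') - (2 * a + 1) * ht j' + 4 * (a * ht i'))
         (g$flip i'$j' * \<pi> powi (a * ht i'))"
        using i' j' by (intro vge_mult min) (auto simp: vge_pi_power_int)
      moreover have "(sw a ** g) $ i' $ j' = g$flip i'$j' * \<pi> powi (a * ht i')"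
        using i' by (auto simp: mult_nth)
      ultimately show "vge (4 * v ((sw a ** g)$1$j) + 2 * a + (2 * a + 1) * ht j + 2 * a * ht i' - (2 * a + 1) * ht j') ((sw a ** g)$i'$j')"
        using ij' i by (simp add: mult_nth v_mult algebra_simps)
    qed
    then obtain k m i where "k \<in> PP (2 * a)" "i \<in> PP (2 * a + 1)" "sw a ** g = k ** alph m ** i" by blast
    moreover have "g = sw a ** (sw a ** g)" by (simp add: sw_sw matrix_mul_assoc)
    ultimately show ?thesis using PP_mult[OF sw_PP[of a], of k] by (metis matrix_mul_assoc)
  qed
qed

text \<open>Membership in \<open>MM R S (- c)\<close> does not change under multiplication by the
  stabilizers of R and S, so it can be tested on the translation, where it measures a
  distance.\<close>

lemma level_iff:
  assumes "k \<in> PP R" "i \<in> PP S"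
  shows "k ** alph m ** i \<in> MM R S (- c) \<longleftrightarrow> \<bar>4 * m + S - R\<bar> \<le> c"
proof
  note M = PP_MM[OF assms(1)] PP_MM[OF assms(2)]
  assume "k ** alph m ** i \<in> MM R S (- c)"
  then have "star k ** (k ** alph m ** i) ** star i \<in> MM R S (0 + - c + 0)"
    using MM_mult[OF MM_mult[OF MM_star[OF M(1)]] MM_star[OF M(2)]] by blast
  moreover have "star k ** (k ** alph m ** i) ** star i = alph m"
    using assms by (simp add: star_cancel star_cancel' PP_GG matrix_mul_assoc mem_GG_iff[THEN iffD1])
  ultimately show "\<bar>4 * m + S - R\<bar> \<le> c" by (simp add: alph_MM_D)
next
  assume "\<bar>4 * m + S - R\<bar> \<le> c"
  then have "k ** alph m ** i \<in> MM R S (0 + - c + 0)"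
    using assms by (intro MM_mult alph_MM) (auto dest: PP_MM)
  then show "k ** alph m ** i \<in> MM R S (- c)" by simp
qed

text \<open>\<open>level_iff\<close> recovers |4 m + 1|, and 4 m + 1 is congruent to 1 modulo 4, so
  the sign of m is not lost. This is the effect of an edge midpoint on the right: with a vertex
  there, m and -m would give the same double coset.\<close>

lemma cell_unique:
  assumes "k \<in> PP (2 * a)" "i \<in> PP (2 * a + 1)" "k' \<in> PP (2 * a)" "i' \<in> PP (2 * a + 1)"
    "k ** alph m ** i = k' ** alph m' ** i'"
  shows "m = m'"
proof -
  have "\<bar>4 * m + 1\<bar> \<le> c \<longleftrightarrow> \<bar>4 * m' + 1\<bar> \<le> c" for c
    using level_iff[OF assms(1,2), of m c] level_iff[OF assms(3,4), of m' c] assms(5) by simp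
  then have "\<bar>4 * m + 1\<bar> = \<bar>4 * m' + 1\<bar>" by (metis antisym order_refl)
  then show ?thesis by presburger
qed

end

section \<open>Neighbouring vertices and their levels\<close>

context valued_involution begin

text \<open>Conjugation by positive powers of alpha fixes the torus and contracts the lower
  unipotent part.\<close>

lemma alph_LO_PP: 
  assumes "l \<in> LO R" "0 \<le> m" shows "alph m ** l ** alph (- m) \<in> PP R"
proof -
  from assms(1) obtain c b x y where l: "l = dg c b ** nl x y" "c \<noteq> 0" "v c = 0" "b * bar b = 1"
    "x * bar x + y + bar y = 0" "vge R x" "vge (2 * R) y" unfolding LO_def by blast
  have "alph m ** l ** alph (- m) = dg c b ** (alph m ** nl x y ** alph (- m))"
    using alph_dg[of m c b] by (simp add: l(1) matrix_mul_assoc)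
  moreover have "alph m ** nl x y ** alph (- m) \<in> PP R"
  proof -
    have "alph m ** nl x y ** alph (- m) \<in> GG" using l by (intro mult_GG nl_GG alph_GG)
    moreover have "vge (R + 4 * m) (x * \<pi> powi m)" "vge (2 * R + 4 * (2 * m)) (y * \<pi> powi (2 * m))"
      using l by (intro vge_mult; simp add: vge_pi_power_int)+
    then have "vge R (x * \<pi> powi m)" "vge (2 * R) (y * \<pi> powi (2 * m))"
      using assms(2) by (auto elim!: vge_mono)
    ultimately show ?thesis
      unfolding alph_nl by (auto simp: PP_def MM_iff vge_1)
  qed
  ultimately show ?thesis using l dg_PP by (metis PP_mult)
qed

lemma alph_mult_cancel [simp]: "alph (- m) ** (alph m ** g) = g" "alph m ** (alph (- m) ** g) = g"
  by (simp_all add: matrix_mul_assoc alph_add)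

lemma conj_alph_mult: "g ** alph m ** h = g ** (alph m ** h ** alph (- m)) ** alph m"
  by (simp add: matrix_mul_assoc[symmetric] alph_add)

text \<open>The vertices K x and K y are neighbours if x y^-1 lies in K alpha K, the support of the
  Hecke function.\<close>

definition neighbours :: "int \<Rightarrow> 'e^3^3 \<Rightarrow> 'e^3^3 \<Rightarrow> bool" where
  "neighbours a x y \<longleftrightarrow> (\<exists>k\<in>PP (2 * a). \<exists>k'\<in>PP (2 * a). x = k ** alph 1 ** k' ** y)"

text \<open>The reflection in K conjugates alpha to its inverse, so K alpha K is closed under
  inversion.\<close>

lemma neighbours_sym: assumes "neighbours a x y" "y \<in> GG" shows "neighbours a y x"
proof -
  from assms(1) obtain k k' where k: "k \<in> PP (2 * a)" "k' \<in> PP (2 * a)" "x = k ** alph 1 ** k' ** y"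
    unfolding neighbours_def by blast
  have "star k' ** alph (-1) ** star k ** x = star k' ** (alph (-1) ** (star k ** (k ** (alph 1 ** (k' ** y)))))"
    by (simp add: k(3) matrix_mul_assoc)
  also have "\<dots> = y" using k(1,2) alph_mult_cancel(1)[of 1] by (simp add: star_cancel PP_GG)
  finally have y: "y = star k' ** alph (-1) ** star k ** x" by simp
  have "alph (-1) = sw a ** alph 1 ** sw a"
    using sw_alph[of a 1] sw_sw[of a] by (simp flip: matrix_mul_assoc)
  then have "y = (star k' ** sw a) ** alph 1 ** (sw a ** star k) ** x"
    using y by (simp add: matrix_mul_assoc)
  then show ?thesis unfolding neighbours_def using k PP_mult PP_star sw_PP by blast
qed

text \<open>The distance from the midpoint of the base edge is |4 m + 1|, so going outwards the
  cells occur in the order 0, -1, 1, -2, 2 and so on.\<close>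

definition cell :: "int \<Rightarrow> int \<Rightarrow> ('e^3^3) set" where
  "cell a m = {k ** alph m ** i | k i. k \<in> PP (2 * a) \<and> i \<in> PP (2 * a + 1)}"

lemma GG_cell: "g \<in> GG \<Longrightarrow> \<exists>m. g \<in> cell a m"
  using GG_cells[of g a] unfolding cell_def by blast

lemma cell_disjoint: "g \<in> cell a m \<Longrightarrow> g \<in> cell a m' \<Longrightarrow> m = m'"
  unfolding cell_def using cell_unique by blast

lemma cell_GG: "g \<in> cell a m \<Longrightarrow> g \<in> GG"
  by (auto simp: cell_def mult_GG PP_GG)

lemma cell_level: "g \<in> cell a m \<Longrightarrow> g \<in> MM (2 * a) (2 * a + 1) (- c) \<Longrightarrow> \<bar>4 * m + 1\<bar> \<le> c"
  using level_iff[of _ "2 * a" _ "2 * a + 1" m c] by (auto simp: cell_def)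

lemma cell_K: assumes "k \<in> PP (2 * a)" "g \<in> cell a m" shows "k ** g \<in> cell a m"
proof -
  from assms(2) obtain k' i where g: "g = k' ** alph m ** i" "k' \<in> PP (2 * a)" "i \<in> PP (2 * a + 1)" unfolding cell_def by blast
  have "k ** g = (k ** k') ** alph m ** i" by (simp add: g(1) matrix_mul_assoc)
  then show ?thesis unfolding cell_def using assms(1) g PP_mult by blast
qed

lemma cell_I: assumes "i \<in> PP (2 * a + 1)" "g \<in> cell a m" shows "g ** i \<in> cell a m"
proof -
  from assms(2) obtain k' i' where g: "g = k' ** alph m ** i'" "k' \<in> PP (2 * a)" "i' \<in> PP (2 * a + 1)" unfolding cell_def by blast
  have "g ** i = k' ** alph m ** (i' ** i)" by (simp add: g(1) matrix_mul_assoc)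
  then show ?thesis unfolding cell_def using assms(1) g PP_mult by blast
qed

lemma alph_cell: "alph m \<in> cell a m"
  unfolding cell_def by (rule CollectI, intro exI[of _ "mat 1"]) auto

text \<open>
  The part of the neighbours of a vertex at distance \<open>n\<close> that lies further out; both vertices are
  then described by the same element \<open>i\<close>.
\<close>

definition outward :: "int \<Rightarrow> int \<Rightarrow> int \<Rightarrow> 'e^3^3 \<Rightarrow> 'e^3^3 \<Rightarrow> bool" where
  "outward a m n x y \<longleftrightarrow> (\<exists>i\<in>PP (2 * a + 1). (\<exists>k\<in>PP (2 * a). x = k ** alph m ** i) \<and> (\<exists>k\<in>PP (2 * a). y = k ** alph n ** i))"

lemma alph_NU_PP: assumes "n0 \<in> NU (2 * a)" "0 \<le> n" shows "alph (- n) ** n0 ** alph n \<in> PP (2 * a + 1)"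
proof -
  from assms(1) obtain x y where n0: "n0 = nu x y" "x * bar x + y + bar y = 0" "vge (- (2*a)) x" "vge (- 2 * (2*a)) y"
    unfolding NU_def by auto
  have G: "alph (- n) ** nu x y ** alph n \<in> GG" using n0 by (intro mult_GG nu_GG alph_GG)
  have e: "alph (- n) ** nu x y ** alph n = nu (x * \<pi> powi n) (y * \<pi> powi (2 * n))"
    using alph_nu[of "- n" x y] by simp
  have "vge (- (2*a) + 4 * n) (x * \<pi> powi n)" "vge (- 2 * (2*a) + 4 * (2 * n)) (y * \<pi> powi (2 * n))"
    using n0 by (intro vge_mult; simp add: vge_pi_power_int)+
  then have "vge (- (2 * a + 1)) (x * \<pi> powi n)" "vge (- 2 * (2 * a + 1)) (y * \<pi> powi (2 * n))"
    using assms(2) by (auto elim!: vge_mono)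
  then show ?thesis using G unfolding n0(1) e by (auto simp: PP_def MM_iff vge_1)
qed

text \<open>The estimate for neighbours that do not lie further out: starting from distance 4 n + 1
  the new distance is at most c. The value 3 is needed for n = 0, where the neighbour may be at
  level -1.\<close>

lemma nl_inner_bound:
  assumes n: "0 \<le> n" and c: "c = max (4 * n + 1) 3" and x: "vge (2 * a + 1) x" and y: "vge (4 * a + 1) y"
  shows "alph (- 1) ** nl x y ** alph n \<in> MM (2 * a) (2 * a + 1) (- c)"
proof -
  have y4: "vge (4 * a + 4) y" using vge_even[of "a + 1" y] y by (simp add: algebra_simps)
  have xn: "vge (2 * a + 1 + 4 * (- n)) (x * \<pi> powi (- n))" by (intro vge_mult x) (simp add: vge_pi_power_int)
  have yn: "vge (4 * a + 4 + 4 * (- 1 - n)) (y * \<pi> powi (- 1 - n))" by (intro vge_mult y4) (simp add: vge_pi_power_int)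
  have x1: "vge (2 * a + 1 + 4 * (- 1)) (bar x * \<pi> powi (- 1))" using x by (intro vge_mult) (simp_all only: vge_pi_power_int vge_bar)
  have p: "\<pi> powi (1 - n) = \<pi> * \<pi> powi (- n)" "\<pi> powi (n - 1) = inverse \<pi> * \<pi> powi n" 
      "\<pi> powi (- 1 - n) = inverse \<pi> * \<pi> powi (- n)" "\<pi> powi (-1) = inverse \<pi>"
    by (simp_all add: power_int_diff power_int_minus field_simps)
  have e: "alph (- 1) ** nl x y ** alph n = mat3 (\<pi> powi (1 - n)) 0 0 (x * \<pi> powi (- n)) 1 0
     (y * \<pi> powi (- 1 - n)) (- (bar x * \<pi> powi (- 1))) (\<pi> powi (n - 1))"
    unfolding p by (rule mat3_eqI) (simp_all add: mult_nth)
  show ?thesis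
    unfolding e MM_iff mat3_nth
    using xn yn x1 n by (intro conjI) (auto simp only: vge_0 vge_minus vge_pi_power_int vge_1 c elim!: vge_mono, auto)
qed

lemma nu_inner_bound:
  assumes n: "n \<le> - 1" and c: "c = - 4 * n - 1" and x: "vge (1 - 2 * a) x" and y: "vge (1 - 4 * a) y"
  shows "alph 1 ** nu x y ** alph n \<in> MM (2 * a) (2 * a + 1) (- c)"
proof -
  have y4: "vge (4 - 4 * a) y" using vge_even[of "1 - a" y] y by (simp add: algebra_simps)
  have xn: "vge (1 - 2 * a + 4 * n) (bar x * \<pi> powi n)" by (intro vge_mult) (auto simp: vge_pi_power_int x)
  have yn: "vge (4 - 4 * a + 4 * (n - 1)) (y * \<pi> powi (n - 1))" by (intro vge_mult y4) (simp add: vge_pi_power_int)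
  have x1: "vge (1 - 2 * a + 4 * (- 1)) (x * \<pi> powi (- 1))" using x by (intro vge_mult) (simp_all only: vge_pi_power_int)
  have p: "\<pi> powi (1 + n) = \<pi> * \<pi> powi n" "\<pi> powi (- 1 - n) = inverse \<pi> * \<pi> powi (- n)" 
      "\<pi> powi (n - 1) = inverse \<pi> * \<pi> powi n" "\<pi> powi (-1) = inverse \<pi>"
    by (simp_all add: power_int_diff power_int_add power_int_minus field_simps)
  have e: "alph 1 ** nu x y ** alph n = mat3 (\<pi> powi (- 1 - n)) (x * \<pi> powi (- 1)) (y * \<pi> powi (n - 1)) 0 1 (- (bar x * \<pi> powi n))
     0 0 (\<pi> powi (1 + n))"
    unfolding p by (rule mat3_eqI) (simp_all add: mult_nth)
  show ?thesis
    unfolding e MM_iff mat3_nth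
    using xn yn x1 n by (intro conjI) (auto simp only: vge_0 vge_minus vge_pi_power_int vge_1 c elim!: vge_mono, auto)
qed

text \<open>The element of K between alpha and \<open>alph n\<close> is decomposed by
  \<open>K_cells\<close>. In the cell with an upper unipotent factor, that factor moves to the right
  into the Iwahori subgroup and the powers of alpha add up to n + 1. In the cell with the
  reflection, alpha becomes its inverse and \<open>nl_inner_bound\<close> limits the
  distance.\<close>

lemma neighbours_plus:
  assumes n: "0 \<le> n" and y: "y \<in> cell a n" and xy: "neighbours a x y" and x: "x \<in> cell a m"
  shows "(m = n + 1 \<and> outward a m n x y) \<or> \<bar>4 * m + 1\<bar> \<le> max (4 * n + 1) 3"
proof -
  from y obtain k1 i1 where y': "y = k1 ** alph n ** i1" "k1 \<in> PP (2 * a)" "i1 \<in> PP (2 * a + 1)" unfolding cell_def by blast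
  from xy obtain k k' where k: "k \<in> PP (2 * a)" "k' \<in> PP (2 * a)" "x = k ** alph 1 ** k' ** y" unfolding neighbours_def by blast
  have x1: "x = k ** alph 1 ** (k' ** k1) ** alph n ** i1" by (simp add: k(3) y'(1) matrix_mul_assoc)
  have "k' ** k1 \<in> PP (2 * a)" using k y' PP_mult by blast
  from K_cells[OF this] show ?thesis
  proof
    assume "\<exists>l\<in>LO (2 * a). \<exists>n\<in>NU (2 * a). k' ** k1 = l ** n"
    then obtain l n0 where l: "l \<in> LO (2 * a)" "n0 \<in> NU (2 * a)" "k' ** k1 = l ** n0" by blast
    \<comment> \<open>Absorbing the unipotent factor into i describes x and y with the same Iwahori
      element, as \<open>outward\<close> demands.\<close>
    define i where "i = alph (- n) ** n0 ** alph n ** i1"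
    have i: "i \<in> PP (2 * a + 1)" unfolding i_def using alph_NU_PP[OF l(2) n] y'(3) by (rule PP_mult)
    have i1: "alph n ** i = n0 ** (alph n ** i1)" by (simp add: i_def flip: matrix_mul_assoc)
    define q where "q = k ** (alph 1 ** l ** alph (- 1))"
    have q: "q \<in> PP (2 * a)" unfolding q_def by (intro PP_mult k alph_LO_PP l) simp
    have a1: "alph (n + 1) = alph 1 ** alph n" by (simp add: alph_add add.commute)
    have "x = q ** (alph 1 ** (n0 ** (alph n ** i1)))"
      unfolding x1 l(3) q_def by (simp flip: matrix_mul_assoc)
    also have "\<dots> = q ** alph (n + 1) ** i" unfolding i1[symmetric] a1 by (simp add: matrix_mul_assoc)
    finally have xq: "x = q ** alph (n + 1) ** i" .
    have "y = k1 ** star n0 ** (n0 ** (alph n ** i1))"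
      using NU_PP[OF l(2)] by (simp add: y'(1) matrix_mul_assoc star_cancel' PP_GG)
    then have yq: "y = k1 ** star n0 ** alph n ** i" unfolding i1[symmetric] by (simp add: matrix_mul_assoc)
    have "m = n + 1" using x xq q i by (intro cell_disjoint[OF x]) (auto simp: cell_def)
    moreover have "k1 ** star n0 \<in> PP (2 * a)" using y' l NU_PP PP_star PP_mult by blast
    ultimately show ?thesis unfolding outward_def using xq yq q i by blast
  next
    assume "\<exists>l\<in>LO (2 * a). \<exists>n\<in>NL (2 * a) \<inter> KP (2 * a) 1. k' ** k1 = l ** sw a ** n"
    then obtain l n1 where l: "l \<in> LO (2 * a)" "n1 \<in> NL (2 * a)" "n1 \<in> KP (2 * a) 1" "k' ** k1 = l ** sw a ** n1" by blast
    from l(2) obtain x' y' where n1: "n1 = nl x' y'" unfolding NL_def by blast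
    define q where "q = k ** (alph 1 ** l ** alph (- 1)) ** sw a"
    have q: "q \<in> PP (2 * a)" unfolding q_def by (intro PP_mult k alph_LO_PP l sw_PP) simp
    have s: "alph 1 ** sw a = sw a ** alph (-1)" by (simp add: sw_alph)
    have "x = k ** (alph 1 ** l ** alph (- 1)) ** (alph 1 ** sw a) ** n1 ** alph n ** i1"
      unfolding x1 l(4) by (simp flip: matrix_mul_assoc)
    also have "\<dots> = q ** (alph (-1) ** n1 ** alph n) ** i1" unfolding q_def s by (simp add: matrix_mul_assoc)
    finally have xq: "x = q ** (alph (-1) ** n1 ** alph n) ** i1" .
    define c where "c = max (4 * n + 1) 3"
    have "alph (-1) ** n1 ** alph n \<in> MM (2 * a) (2 * a + 1) (- c)"
      unfolding n1 using nl_KP_D[of x' y' "2 * a" 1] l(3) n1 by (intro nl_inner_bound n c_def) auto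
    then have "x \<in> MM (2 * a) (2 * a + 1) (0 + - c + 0)"
      unfolding xq using PP_MM[OF q] PP_MM[OF y'(3)] MM_mult by blast
    then show ?thesis using cell_level[OF x, of c] by (simp add: c_def)
  qed
qed

lemma sw_LO_sw: assumes "l \<in> LO (2 * a)" shows "alph (- 1) ** (sw a ** l ** sw a) ** alph 1 \<in> PP (2 * a)"
proof -
  have "alph (- 1) ** (sw a ** l ** sw a) ** alph 1 = (alph (-1) ** sw a) ** l ** (sw a ** alph 1)"
    by (simp add: matrix_mul_assoc)
  also have "\<dots> = sw a ** (alph 1 ** l ** alph (- 1)) ** sw a"
    using sw_alph[of a 1] by (simp add: matrix_mul_assoc)
  finally show ?thesis using alph_LO_PP[OF assms, of 1] by (simp add: PP_mult sw_PP)
qed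

lemma sw_NU: assumes "n \<in> NU (2 * a)" shows "sw a ** n ** sw a \<in> NL (2 * a)"
proof -
  from assms obtain x y where n: "n = nu x y" "x * bar x + y + bar y = 0" "vge (- (2*a)) x" "vge (- 2 * (2*a)) y"
    unfolding NU_def by auto
  have "vge (- (2*a) + 4 * a) (- bar x * \<pi> powi a)" "vge (- 2 * (2*a) + 4 * (2 * a)) (y * \<pi> powi (2 * a))"
    using n by (intro vge_mult; simp add: vge_pi_power_int)+
  then show ?thesis unfolding n(1) sw_nu by (intro NL_I rel_sw n) auto
qed

lemma sw_NL: assumes "n \<in> NL (2 * a)" 
  obtains x y where "sw a ** n ** sw a = nu x y" "nu x y \<in> NU (2 * a)" 
proof -
  from assms obtain x y where n: "n = nl x y" "x * bar x + y + bar y = 0" "vge (2*a) x" "vge (2 * (2*a)) y"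
    unfolding NL_def by auto
  let ?x = "- bar x * \<pi> powi (- a)" and ?y = "y * \<pi> powi (2 * (- a))"
  have rel: "?x * bar ?x + ?y + bar ?y = 0" by (rule rel_sw[OF n(2)])
  have 1: "sw a ** nu ?x ?y ** sw a = nl x y"
    unfolding sw_nu by (simp add: bar_mult bar_minus bar_power_int power_int_minus bar_inverse mult.assoc)
  have "vge (2*a + 4 * (- a)) ?x" "vge (2 * (2*a) + 4 * (2 * (- a))) ?y"
    using n by (intro vge_mult; simp add: vge_pi_power_int)+
  then have "nu ?x ?y \<in> NU (2 * a)" by (intro NU_I rel) (auto simp: algebra_simps)
  moreover have "sw a ** n ** sw a = nu ?x ?y" using sw_conj_eq[OF 1] n(1) by simp
  ultimately show ?thesis using that by blast
qed

lemma KP_sw: "g \<in> KP (2 * a) c \<Longrightarrow> sw a ** g ** sw a \<in> KP (2 * a) c"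
  using KP_conj[OF sw_PP, of g a c] by simp

text \<open>The mirror image of \<open>neighbours_plus\<close> under the reflection. The asymmetry
  of the constants comes from the midpoint at +1: level n < 0 has distance -(4 n + 1).\<close>

lemma neighbours_minus:
  assumes n: "n \<le> - 1" and y: "y \<in> cell a n" and xy: "neighbours a x y" and x: "x \<in> cell a m"
  shows "(m = n - 1 \<and> outward a m n x y) \<or> \<bar>4 * m + 1\<bar> \<le> - (4 * n + 1)"
proof -
  from y obtain k1 i1 where y': "y = k1 ** alph n ** i1" "k1 \<in> PP (2 * a)" "i1 \<in> PP (2 * a + 1)" unfolding cell_def by blast
  from xy obtain k k' where k: "k \<in> PP (2 * a)" "k' \<in> PP (2 * a)" "x = k ** alph 1 ** k' ** y" unfolding neighbours_def by blast
  \<comment> \<open>Conjugating by the reflection exchanges the two Borel subgroups, because for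
    negative n it is the lower unipotent part that conjugation by \<open>alph (- n)\<close> moves
    into the Iwahori subgroup.\<close>
  define p where "p = k' ** k1 ** sw a"
  have x1: "x = k ** alph 1 ** (k' ** k1) ** alph n ** i1" by (simp add: k(3) y'(1) matrix_mul_assoc)
  have "sw a ** p ** sw a = sw a ** (k' ** k1) ** (sw a ** sw a)"
    unfolding p_def by (simp only: matrix_mul_assoc)
  then have pe: "sw a ** (sw a ** p ** sw a) = k' ** k1" by (simp add: sw_sw matrix_mul_assoc)
  have s: "alph 1 ** sw a = sw a ** alph (-1)" by (simp add: sw_alph)
  have "x = k ** (alph 1 ** sw a) ** (sw a ** p ** sw a) ** alph n ** i1"
    unfolding x1 pe[symmetric] by (simp add: matrix_mul_assoc)
  then have x2: "x = k ** sw a ** alph (- 1) ** (sw a ** p ** sw a) ** alph n ** i1"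
    unfolding s by (simp add: matrix_mul_assoc)
  have "p \<in> PP (2 * a)" unfolding p_def by (intro PP_mult sw_PP k y')
  from K_cells[OF this] show ?thesis
  proof
    assume "\<exists>l\<in>LO (2 * a). \<exists>n\<in>NU (2 * a). p = l ** n"
    then obtain l n' where l: "l \<in> LO (2 * a)" "n' \<in> NU (2 * a)" "p = l ** n'" by blast
    define n0 where "n0 = sw a ** n' ** sw a"
    have n0: "n0 \<in> NL (2 * a)" unfolding n0_def by (rule sw_NU[OF l(2)])
    have pl: "sw a ** p ** sw a = (sw a ** l ** sw a) ** n0"
    proof -
      have "(sw a ** l ** sw a) ** n0 = sw a ** l ** (sw a ** sw a) ** n' ** sw a"
        unfolding n0_def by (simp add: matrix_mul_assoc)
      then show ?thesis by (simp add: l(3) sw_sw matrix_mul_assoc)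
    qed
    define i where "i = alph (- n) ** n0 ** alph n ** i1"
    have "alph (- n) ** n0 ** alph n \<in> PP (2 * a + 1)"
    proof -
      from n0 obtain x y where n0': "n0 = nl x y" "x * bar x + y + bar y = 0" "vge (2*a) x" "vge (2 * (2*a)) y"
        unfolding NL_def by auto
      have G: "alph (- n) ** nl x y ** alph n \<in> GG" using n0' by (intro mult_GG nl_GG alph_GG)
      have e: "alph (- n) ** nl x y ** alph n = nl (x * \<pi> powi (- n)) (y * \<pi> powi (2 * (- n)))"
        using alph_nl[of "- n" x y] by simp
      have "vge (2*a + 4 * (- n)) (x * \<pi> powi (- n))" "vge (2 * (2*a) + 4 * (2 * (- n))) (y * \<pi> powi (2 * (- n)))"
        using n0' by (intro vge_mult; simp add: vge_pi_power_int)+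
      then have "vge (2 * a + 1) (x * \<pi> powi (- n))" "vge (2 * (2 * a + 1)) (y * \<pi> powi (2 * (- n)))"
        using n by (auto elim!: vge_mono)
      then show ?thesis using G unfolding n0'(1) e by (auto simp: PP_def MM_iff vge_1)
    qed
    then have i: "i \<in> PP (2 * a + 1)" unfolding i_def using y'(3) by (rule PP_mult)
    have i1: "alph n ** i = n0 ** (alph n ** i1)" by (simp add: i_def flip: matrix_mul_assoc)
    define q where "q = k ** sw a ** (alph (- 1) ** (sw a ** l ** sw a) ** alph 1)"
    have q: "q \<in> PP (2 * a)" unfolding q_def by (intro PP_mult k sw_PP sw_LO_sw l)
    have a1: "alph (n - 1) = alph (- 1) ** alph n" by (simp add: alph_add)
    have "x = q ** (alph (- 1) ** (n0 ** (alph n ** i1)))"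
      unfolding x2 pl q_def by (simp flip: matrix_mul_assoc)
    also have "\<dots> = q ** alph (n - 1) ** i" unfolding i1[symmetric] a1 by (simp add: matrix_mul_assoc)
    finally have xq: "x = q ** alph (n - 1) ** i" .
    have "y = k1 ** star n0 ** (n0 ** (alph n ** i1))"
      using NL_PP[OF n0] by (simp add: y'(1) matrix_mul_assoc star_cancel' PP_GG)
    then have yq: "y = k1 ** star n0 ** alph n ** i" unfolding i1[symmetric] by (simp add: matrix_mul_assoc)
    have "m = n - 1" using x xq q i by (intro cell_disjoint[OF x]) (auto simp: cell_def)
    moreover have "k1 ** star n0 \<in> PP (2 * a)" using y' n0 NL_PP PP_star PP_mult by blast
    ultimately show ?thesis unfolding outward_def using xq yq q i by blast
  next
    assume "\<exists>l\<in>LO (2 * a). \<exists>n\<in>NL (2 * a) \<inter> KP (2 * a) 1. p = l ** sw a ** n"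
    then obtain l n' where l: "l \<in> LO (2 * a)" "n' \<in> NL (2 * a)" "n' \<in> KP (2 * a) 1" "p = l ** sw a ** n'" by blast
    from l(2) obtain x' y' where n1: "sw a ** n' ** sw a = nu x' y'" by (rule sw_NL)
    define n1 where "n1 = sw a ** n' ** sw a"
    have n1K: "nu x' y' \<in> KP (2 * a) 1" using KP_sw[OF l(3)] n1 by simp
    define q where "q = k ** sw a ** (alph (- 1) ** (sw a ** l ** sw a) ** alph 1) ** sw a"
    have q: "q \<in> PP (2 * a)" unfolding q_def by (intro PP_mult k sw_PP sw_LO_sw l)
    have "sw a ** p ** sw a = (sw a ** l ** sw a) ** (sw a ** sw a) ** n' ** sw a"
      unfolding l(4) by (simp add: matrix_mul_assoc sw_sw)
    then have pl: "sw a ** p ** sw a = (sw a ** l ** sw a) ** sw a ** n1"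
      unfolding n1_def by (simp add: matrix_mul_assoc)
    have s': "alph (- 1) ** sw a = sw a ** alph 1" by (simp add: sw_alph)
    have "x = k ** sw a ** (alph (- 1) ** (sw a ** l ** sw a) ** alph 1) ** (alph (- 1) ** sw a) ** n1 ** alph n ** i1"
      unfolding x2 pl by (simp flip: matrix_mul_assoc)
    also have "\<dots> = q ** (alph 1 ** n1 ** alph n) ** i1" unfolding q_def s' by (simp add: matrix_mul_assoc)
    finally have xq: "x = q ** (alph 1 ** n1 ** alph n) ** i1" .
    define c where "c = - 4 * n - 1"
    have "alph 1 ** n1 ** alph n \<in> MM (2 * a) (2 * a + 1) (- c)"
      unfolding n1_def n1 using nu_KP_D[OF n1K] by (intro nu_inner_bound n c_def) auto
    then have "x \<in> MM (2 * a) (2 * a + 1) (0 + - c + 0)"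
      unfolding xq using PP_MM[OF q] PP_MM[OF y'(3)] MM_mult by blast
    then show ?thesis using cell_level[OF x, of c] by (simp add: c_def)
  qed
qed


lemma vge_parity: "vge (2 * n - 1) x \<Longrightarrow> vge (2 * n) x" "vge (4 * n - 2) x \<Longrightarrow> vge (4 * n) x"
  by (auto simp: vge_def)

lemma PP_odd_subset: "PP (2 * a + 1) \<subseteq> PP (2 * a)"
proof
  fix g assume g: "g \<in> PP (2 * a + 1)"
  then show "g \<in> PP (2 * a)"
    using vge_parity(1)[of "- a" "g$1$2"] vge_parity(1)[of "- a" "g$2$3"] vge_parity(2)[of "- a" "g$1$3"]
    by (auto simp: PP_def MM_iff elim: vge_mono)
qed

lemma KP_even_subset: "KP (2 * a) 1 \<subseteq> KP (2 * a + 1) 1"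
proof
  fix g assume g: "g \<in> KP (2 * a) 1"
  then have *: "vge (2 * a + 1) (g$2$1)" "vge (2 * a + 1) (g$3$2)" "vge (4 * a + 1) (g$3$1)"
    by (auto simp: KP_def MM_iff)
  then have "vge (2 * a + 2) (g$2$1)" "vge (2 * a + 2) (g$3$2)" "vge (4 * a + 4) (g$3$1)"
    using vge_parity(1)[of "a + 1" "g$2$1"] vge_parity(1)[of "a + 1" "g$3$2"] vge_even[of "a + 1" "g$3$1"]
    by (auto simp: algebra_simps)
  then show "g \<in> KP (2 * a + 1) 1"
    using g by (auto simp: KP_def MM_iff elim: vge_mono)
qed

lemma NU_KP: "n \<in> NU (2 * a) \<Longrightarrow> n \<in> KP (2 * a + 1) 1"
  unfolding NU_def by (auto intro!: nu_KP elim: vge_mono)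

text \<open>The pro-p Iwahori subgroup is K^1 times the integral points of N. Dividing by the
  element of N with the same first row leaves a lower triangular matrix, for which the bound at the
  midpoint is the stronger one.\<close>

lemma KP_odd_decomp:
  assumes g: "g \<in> KP (2 * a + 1) 1"
  obtains k n where "k \<in> KP (2 * a) 1" "n \<in> NU (2 * a)" "g = k ** n"
proof -
  have gG: "g \<in> GG" and e: "vge 1 (g$1$1 - 1)" "vge (- (2 * a)) (g$1$2)" "vge (- 4 * a - 1) (g$1$3)"
    using g by (auto simp: KP_def MM_iff)
  have nz: "g$1$1 \<noteq> 0" and v0: "v (g$1$1) = 0" using v_1_plus[OF e(1)] by auto
  define x y where "x = g$1$2 / g$1$1" and "y = g$1$3 / g$1$1"
  have "vge (2 * (- (2 * a))) (g$1$3)" using e(3) vge_parity(1)[of "- 2 * a" "g$1$3"] by (auto simp: algebra_simps)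
  then have xy: "vge (- (2 * a)) x" "vge (- 2 * (2 * a)) y"
    unfolding x_def y_def using v0 by (auto intro: vge_divide[OF _ nz] vge_divide[OF e(2) nz])
  have rel: "x * bar x + y + bar y = 0"
    unfolding x_def y_def using GG_rows[OF gG, of 1 3] nz by (intro row_rel) auto
  have n: "nu x y \<in> NU (2 * a)" by (rule NU_I[OF rel xy])
  define l where "l = g ** star (nu x y)"
  have l: "l \<in> KP (2 * a + 1) 1" unfolding l_def by (intro KP_mult KP_star g NU_KP n) simp
  have g12: "g$1$2 = x * g$1$1" "g$1$3 = y * g$1$1" using nz by (auto simp: x_def y_def)
  have l12: "l$1$2 = 0" by (simp add: l_def mult_nth star_nu g12)
  have "l$1$3 = g$1$1 * (x * bar x + y + bar y)"
    by (simp add: l_def mult_nth star_nu g12 bar_minus algebra_simps)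
  then have l13: "l$1$3 = 0" using rel by simp
  have l11: "l$1$1 = g$1$1" by (simp add: l_def mult_nth star_nu)
  have l23: "l$2$3 = 0" using GG_rows[OF KP_GG[OF l], of 1 2] l12 l13 l11 nz by simp
  have "l \<in> KP (2 * a) 1" using l l12 l13 l23 by (auto simp: KP_def MM_iff elim: vge_mono)
  moreover have "g = l ** nu x y" unfolding l_def by (simp add: star_cancel' nu_GG rel)
  ultimately show ?thesis using that n by blast
qed

lemma sw_MM: "S + S' = 4 * a \<Longrightarrow> sw a \<in> MM S S' 0"
  by (auto simp: MM_iff vge_pi_power_int vge_1)

lemma sw_PP_conj: "g \<in> PP (2 * a + b) \<Longrightarrow> sw a ** g ** sw a \<in> PP (2 * a - b)"
  using MM_mult[OF MM_mult[OF sw_MM[of "2 * a - b" "2 * a + b" a], of g "2 * a + b" 0] sw_MM[of "2 * a + b" "2 * a - b" a]]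
  by (auto simp: PP_def mult_GG)

lemma sw_KP_conj: assumes "g \<in> KP (2 * a + b) c" shows "sw a ** g ** sw a \<in> KP (2 * a - b) c"
proof -
  have "sw a ** (g - mat 1) ** sw a \<in> MM (2 * a - b) (2 * a - b) (0 + c + 0)"
    using assms by (intro MM_mult[of _ _ "2 * a + b"] sw_MM) (auto simp: KP_def)
  then show ?thesis using assms by (simp add: KP_def mult_GG matrix_sub_ldistrib matrix_sub_rdistrib sw_sw)
qed

lemma sw_conj_conj [simp]: "sw a ** (sw a ** g ** sw a) ** sw a = g" "sw a ** (sw a ** g) = g" "g ** sw a ** sw a = g"
proof -
  show 1: "sw a ** (sw a ** g) = g" for g by (simp add: matrix_mul_assoc sw_sw)
  show 2: "g ** sw a ** sw a = g" for g by (simp add: sw_sw flip: matrix_mul_assoc)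
  show "sw a ** (sw a ** g ** sw a) ** sw a = g" using 1[of "g ** sw a"] 2[of g] by (simp add: matrix_mul_assoc)
qed

lemma KP_opp_decomp:
  assumes g: "g \<in> KP (2 * a - 1) 1"
  obtains k n where "k \<in> KP (2 * a) 1" "n \<in> NU (2 * a)" "g = k ** (sw a ** n ** sw a)"
proof -
  have "sw a ** g ** sw a \<in> KP (2 * a + 1) 1" using sw_KP_conj[of g a "-1" 1] g by simp
  then obtain k n where k: "k \<in> KP (2 * a) 1" "n \<in> NU (2 * a)" "sw a ** g ** sw a = k ** n" by (rule KP_odd_decomp)
  have "g = sw a ** (k ** n) ** sw a" using k(3) by (metis sw_conj_conj(1))
  also have "\<dots> = sw a ** k ** (sw a ** sw a) ** n ** sw a" by (simp add: matrix_mul_assoc sw_sw)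
  finally have "g = (sw a ** k ** sw a) ** (sw a ** n ** sw a)" by (simp only: matrix_mul_assoc)
  then show ?thesis using that k(2) KP_sw[OF k(1)] by blast
qed

lemma sw_DG: assumes "h \<in> DG" shows "sw a ** h ** sw a \<in> DG"
proof -
  from assms obtain c b where "h = dg c b" "c \<noteq> 0" "v c = 0" "b * bar b = 1" unfolding DG_def by blast
  then show ?thesis using DG_I[of "inverse (bar c)" b] by (simp add: sw_dg v_inverse v_bar)
qed

lemma star_NU: assumes "n \<in> NU R" shows "star n \<in> NU R"
proof -
  from assms obtain x y where "n = nu x y" "x * bar x + y + bar y = 0" "vge (- R) x" "vge (- 2 * R) y" unfolding NU_def by blast
  then show ?thesis using NU_I[of "- x" "bar y" R] by (simp add: star_nu bar_minus algebra_simps)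
qed

text \<open>After rounding, the off-diagonal products in the pairing of rows 1 and 3 lie in the
  maximal ideal, so the (1,1) entry is a unit and \<open>LDU\<close> applies with integral
  factors.\<close>

lemma Iwahori_decomp:
  assumes g: "g \<in> PP (2 * a + 1)"
  obtains h i where "h \<in> DG" "i \<in> KP (2 * a + 1) 1" "g = h ** i"
proof -
  have gG: "g \<in> GG" and e: "vge 0 (g$1$1)" "vge (-2 * a - 1) (g$1$2)" "vge (- 4 * a - 2) (g$1$3)" 
    "vge (2 * a + 1) (g$2$1)" "vge (4 * a + 2) (g$3$1)" "vge (2 * a + 1) (g$3$2)" "vge 0 (g$3$3)"
    using g by (auto simp: PP_def MM_iff)
  have e': "vge (-2 * a) (g$1$2)" "vge (- 4 * a) (g$1$3)" "vge (2 * a + 2) (g$2$1)" "vge (4 * a + 4) (g$3$1)"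
    using e vge_parity(1)[of "- a" "g$1$2"] vge_parity(2)[of "- a" "g$1$3"] vge_parity(1)[of "a + 1" "g$2$1"]
      vge_parity(2)[of "a + 1" "g$3$1"] by (auto simp: algebra_simps)
  have "\<not> vge 1 (g$1$1)"
  proof
    assume 1: "vge 1 (g$1$1)"
    have "g$1$1 * bar (g$3$3) + g$1$2 * bar (g$3$2) + g$1$3 * bar (g$3$1) = 1"
      using GG_rows[OF gG, of 1 1] by simp
    moreover have "vge 1 (g$1$1 * bar (g$3$3) + g$1$2 * bar (g$3$2) + g$1$3 * bar (g$3$1))"
      using vge_mult[OF 1, of 0 "bar (g$3$3)"] vge_mult[OF e'(1), of "2*a+1" "bar (g$3$2)"]
         vge_mult[OF e'(2), of "4*a+4" "bar (g$3$1)"] e e'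
      by (intro vge_add) (auto elim: vge_mono)
    ultimately show False by (simp add: vge_1)
  qed
  then have nz: "g$1$1 \<noteq> 0" and v0: "v (g$1$1) = 0" using e(1) by (auto simp: vge_def)
  from gG nz obtain b x y where *: "b * bar b = 1" "x * bar x + y + bar y = 0"
    "g$1$2 / g$1$1 * bar (g$1$2 / g$1$1) + g$1$3 / g$1$1 + bar (g$1$3 / g$1$1) = 0"
    "g = dg (g$1$1) b ** nl x y ** nu (g$1$2 / g$1$1) (g$1$3 / g$1$1)" "g$2$1 = b * x" "y = g$3$1 * bar (g$1$1)"
    by (rule LDU)
  have "x = g$2$1 * bar b" using *(1,5) by (simp add: algebra_simps)
  moreover have "vge (2 * a + 2 + 0) (g$2$1 * bar b)"
    using norm_1_v[OF *(1)] by (intro vge_mult e') (simp only: vge_bar, simp add: vge_def)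
  ultimately have x: "vge (2 * a + 2) x" by simp
  have "vge (4*a + 4 + 0) y" unfolding *(6) using e' v0 by (intro vge_mult) (auto simp: vge_def v_bar[OF nz])
  then have "nl x y \<in> KP (2 * a + 1) 1" using x by (intro nl_KP *(2)) (auto elim: vge_mono)
  moreover have "nu (g$1$2 / g$1$1) (g$1$3 / g$1$1) \<in> NU (2 * a)"
    by (intro NU_I *(3), rule vge_divide[OF e'(1) nz], simp add: v0, rule vge_divide[OF e'(2) nz], simp add: v0)
  ultimately have "nl x y ** nu (g$1$2 / g$1$1) (g$1$3 / g$1$1) \<in> KP (2 * a + 1) 1"
    using KP_mult[OF zero_le_one] NU_KP by blast
  moreover have "dg (g$1$1) b \<in> DG" by (rule DG_I[OF nz v0 *(1)])
  moreover have "g = dg (g$1$1) b ** (nl x y ** nu (g$1$2 / g$1$1) (g$1$3 / g$1$1))"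
    using *(4) by (simp only: matrix_mul_assoc)
  ultimately show ?thesis using that by blast
qed

lemma sw_LO_PP_odd: assumes "l \<in> LO (2 * a)" shows "sw a ** l ** sw a \<in> PP (2 * a + 1)"
proof -
  from assms obtain h n where l: "h \<in> DG" "n \<in> NL (2 * a)" "l = h ** n" unfolding LO_iff by blast
  from l(2) obtain x y where n: "sw a ** n ** sw a = nu x y" "nu x y \<in> NU (2 * a)" by (rule sw_NL)
  have "sw a ** l ** sw a = sw a ** h ** (sw a ** sw a) ** n ** sw a"
    unfolding l(3) by (simp add: matrix_mul_assoc sw_sw)
  then have "sw a ** l ** sw a = (sw a ** h ** sw a) ** (sw a ** n ** sw a)"
    by (simp only: matrix_mul_assoc)
  moreover have "nu x y \<in> PP (2 * a + 1)" using NU_KP[OF n(2)] KP_subset_PP[of 1] by auto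
  ultimately show ?thesis using sw_DG[OF l(1)] DG_PP n(1) PP_mult by metis
qed

text \<open>\<open>K_cells\<close> is applied to the reflected inverse of k and then inverted; this
  turns lower factors on the left into Iwahori factors on the right.\<close>

lemma K_big_cell:
  assumes k: "k \<in> PP (2 * a)"
  shows "k \<in> PP (2 * a + 1) \<or> (\<exists>n\<in>NU (2 * a). \<exists>i\<in>PP (2 * a + 1). k = n ** sw a ** i)"
proof -
  have "sw a ** star k \<in> PP (2 * a)" by (intro PP_mult sw_PP PP_star k)
  from K_cells[OF this] show ?thesis
  proof
    assume "\<exists>l\<in>LO (2 * a). \<exists>n\<in>NU (2 * a). sw a ** star k = l ** n"
    then obtain l n where l: "l \<in> LO (2 * a)" "n \<in> NU (2 * a)" "sw a ** star k = l ** n" by blast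
    then have "star (sw a ** star k) = star n ** star l" by (simp add: star_mult)
    then have "k ** sw a = star n ** star l" by (simp add: star_mult)
    then have "k = star n ** star l ** sw a" by (metis sw_conj_conj(3))
    also have "\<dots> = star n ** sw a ** star (sw a ** l ** sw a)"
      by (simp add: star_mult matrix_mul_assoc)
    finally have "k = star n ** sw a ** star (sw a ** l ** sw a)" .
    moreover have "star n \<in> NU (2 * a)" by (rule star_NU[OF l(2)])
    ultimately show ?thesis using sw_LO_PP_odd[OF l(1)] PP_star by blast
  next
    assume "\<exists>l\<in>LO (2 * a). \<exists>n\<in>NL (2 * a) \<inter> KP (2 * a) 1. sw a ** star k = l ** sw a ** n"
    then obtain l n where l: "l \<in> LO (2 * a)" "n \<in> KP (2 * a) 1" "sw a ** star k = l ** sw a ** n" by blast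
    then have "star (sw a ** star k) = star n ** (sw a ** star l)" by (simp add: star_mult)
    then have "k ** sw a = star n ** (sw a ** star l)" by (simp add: star_mult)
    then have "k = star n ** (sw a ** star l) ** sw a" by (metis sw_conj_conj(3))
    also have "\<dots> = star n ** star (sw a ** l ** sw a)"
      by (simp add: star_mult matrix_mul_assoc)
    finally have "k = star n ** star (sw a ** l ** sw a)" .
    moreover have "star n \<in> PP (2 * a + 1)"
      using KP_star[OF l(2)] KP_even_subset KP_subset_PP[of 1] by auto
    ultimately show ?thesis using sw_LO_PP_odd[OF l(1)] PP_star PP_mult by metis
  qed
qed

text \<open>The rank one relation s u s = u1 h s u2 for a unipotent u that is nontrivial in the
  finite reductive quotient, lifted to K at the cost of a factor in K^1.\<close>

lemma NL_sw_NU_decomp: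
  assumes n: "n \<in> NU (2 * a)" and nK: "n \<notin> KP (2 * a) 1"
  obtains n1 h n2 k where "n1 \<in> NU (2 * a)" "h \<in> DG" "n2 \<in> NU (2 * a)" "k \<in> KP (2 * a) 1"
    "sw a ** n ** sw a = n1 ** h ** sw a ** k ** n2"
proof -
  have "sw a ** n ** sw a \<in> PP (2 * a)" by (intro PP_mult sw_PP NU_PP n)
  moreover have "sw a ** n ** sw a \<notin> PP (2 * a + 1)"
  proof
    assume P: "sw a ** n ** sw a \<in> PP (2 * a + 1)"
    from sw_NU[OF n] obtain x y where xy: "sw a ** n ** sw a = nl x y" "x * bar x + y + bar y = 0" unfolding NL_def by blast
    then have "nl x y \<in> KP (2 * a) 1" using nl_PP_D[of x y "2 * a + 1"] P by (intro nl_KP) (auto elim: vge_mono)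
    then have "sw a ** (sw a ** n ** sw a) ** sw a \<in> KP (2 * a) 1" unfolding xy(1) by (rule KP_sw)
    then show False using nK by simp
  qed
  ultimately obtain n1 i where n1: "n1 \<in> NU (2 * a)" "i \<in> PP (2 * a + 1)" "sw a ** n ** sw a = n1 ** sw a ** i"
    using K_big_cell by blast
  from n1(2) obtain h i1 where h: "h \<in> DG" "i1 \<in> KP (2 * a + 1) 1" "i = h ** i1" by (rule Iwahori_decomp)
  from h(2) obtain k n2 where k: "k \<in> KP (2 * a) 1" "n2 \<in> NU (2 * a)" "i1 = k ** n2" by (rule KP_odd_decomp)
  have "sw a ** n ** sw a = n1 ** (sw a ** h ** sw a) ** sw a ** k ** n2"
    by (simp add: n1(3) h(3) k(3) matrix_mul_assoc)
  then show ?thesis using that n1(1) sw_DG[OF h(1)] k by blast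
qed

text \<open>Describes the intersection of K with its conjugate by alpha^-1: a torus part commuting
  with alpha, a lower unipotent part that alpha contracts into K^1, and an upper unipotent part in
  K^1 that alpha expands into K. \<open>phi_well_defined\<close> compares the actions of both
  sides.\<close>

lemma hecke_stabilizer:
  assumes b: "b \<in> PP (2 * a)" and ab: "alph 1 ** b ** alph (- 1) \<in> PP (2 * a)"
  obtains h m n where "h \<in> DG" "m \<in> NL (2 * a)" "n \<in> NU (2 * a)" "n \<in> KP (2 * a) 1" "b = h ** m ** n"
    "alph 1 ** m ** alph (- 1) \<in> KP (2 * a) 1" "alph 1 ** n ** alph (- 1) \<in> NU (2 * a)"
proof -
  from K_cells[OF b] show ?thesis
  proof
    assume "\<exists>l\<in>LO (2 * a). \<exists>n\<in>NU (2 * a). b = l ** n"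
    then obtain l n where l: "l \<in> LO (2 * a)" "n \<in> NU (2 * a)" "b = l ** n" by blast
    from l(1) obtain h m where h: "h \<in> DG" "m \<in> NL (2 * a)" "l = h ** m" unfolding LO_iff by blast
    define q where "q = alph 1 ** l ** alph (- 1)"
    have q: "q \<in> PP (2 * a)" unfolding q_def by (intro alph_LO_PP l) simp
    have "alph 1 ** b ** alph (- 1) = q ** (alph 1 ** n ** alph (- 1))"
      unfolding l(3) q_def by (simp flip: matrix_mul_assoc)
    then have "star q ** (alph 1 ** b ** alph (- 1)) = alph 1 ** n ** alph (- 1)"
      using q by (simp add: star_cancel PP_GG)
    then have nP: "alph 1 ** n ** alph (- 1) \<in> PP (2 * a)" using PP_mult[OF PP_star[OF q] ab] by simp
    from l(2) obtain x y where n: "n = nu x y" "x * bar x + y + bar y = 0" unfolding NU_def by blast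
    let ?x = "x * \<pi> powi (- 1)" and ?y = "y * \<pi> powi (- 2)"
    have e: "alph 1 ** n ** alph (- 1) = nu ?x ?y" unfolding n(1) using alph_nu[of 1 x y] by simp
    have v: "vge (- (2 * a)) ?x" "vge (- 2 * (2 * a)) ?y" using nu_PP_D[of ?x ?y "2 * a"] nP unfolding e by auto
    have "\<pi> powi (- 2) * \<pi> powi 2 = 1" using power_int_add[of \<pi> "- 2" 2] by simp
    then have eqs: "?x * \<pi> powi 1 = x" "?y * \<pi> powi 2 = y" by (simp_all only: mult.assoc) simp_all
    have "vge (- (2 * a) + 4 * 1) (?x * \<pi> powi 1)" "vge (- 2 * (2 * a) + 4 * 2) (?y * \<pi> powi 2)"
      by (intro vge_mult v; simp only: vge_pi_power_int)+
    then have "vge (- (2 * a) + 4 * 1) x" "vge (- 2 * (2 * a) + 4 * 2) y" unfolding eqs .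
    then have nK: "n \<in> KP (2 * a) 1" unfolding n(1) by (intro nu_KP n) (auto elim: vge_mono)
    have "alph 1 ** n ** alph (- 1) \<in> GG" using nP PP_GG by blast
    then have "?x * bar ?x + ?y + bar ?y = 0"
      unfolding e using GG_rows[of "nu ?x ?y" 1 3] by (simp add: algebra_simps)
    then have nN: "alph 1 ** n ** alph (- 1) \<in> NU (2 * a)" unfolding e using v by (rule NU_I)
    from h(2) obtain x' y' where m: "m = nl x' y'" "x' * bar x' + y' + bar y' = 0" "vge (2 * a) x'" "vge (2 * (2 * a)) y'"
      unfolding NL_def by blast
    have "alph 1 ** m ** alph (- 1) \<in> GG" unfolding m(1) by (intro mult_GG nl_GG m alph_GG)
    moreover have e': "alph 1 ** m ** alph (- 1) = nl (x' * \<pi> powi 1) (y' * \<pi> powi 2)" unfolding m(1) using alph_nl[of 1 x' y'] by simp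
    moreover have "vge (2 * a + 4 * 1) (x' * \<pi> powi 1)" "vge (2 * (2 * a) + 4 * 2) (y' * \<pi> powi 2)"
      by (intro vge_mult m; simp only: vge_pi_power_int)+
    ultimately have "alph 1 ** m ** alph (- 1) \<in> KP (2 * a) 1"
      unfolding KP_def by (auto simp: MM_iff elim: vge_mono)
    then show ?thesis using that h l nK nN by blast
  next
    assume "\<exists>l\<in>LO (2 * a). \<exists>n\<in>NL (2 * a) \<inter> KP (2 * a) 1. b = l ** sw a ** n"
    then obtain l n where l: "l \<in> LO (2 * a)" "n \<in> NL (2 * a)" "b = l ** sw a ** n" by blast
    define q where "q = alph 1 ** l ** alph (- 1) ** sw a"
    have q: "q \<in> PP (2 * a)" unfolding q_def by (intro PP_mult alph_LO_PP l sw_PP) simp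
    have s: "alph 1 ** sw a = sw a ** alph (-1)" by (simp add: sw_alph)
    have "alph 1 ** b ** alph (- 1) = alph 1 ** l ** alph (- 1) ** (alph 1 ** sw a) ** n ** alph (- 1)"
      unfolding l(3) by (simp flip: matrix_mul_assoc)
    also have "\<dots> = q ** (alph (- 1) ** n ** alph (- 1))"
      unfolding q_def s by (simp add: matrix_mul_assoc)
    finally have "star q ** (alph 1 ** b ** alph (- 1)) = alph (- 1) ** n ** alph (- 1)"
      using q by (simp add: star_cancel PP_GG)
    then have nP: "alph (- 1) ** n ** alph (- 1) \<in> PP (2 * a)" using PP_mult[OF PP_star[OF q] ab] by simp
    from l(2) obtain x y where n: "n = nl x y" unfolding NL_def by blast
    \<comment> \<open>In this cell the (3,3) entry would have valuation -2, which an element of K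
      does not allow.\<close>
    have "(alph (- 1) ** n ** alph (- 1)) $ 3 $ 3 = \<pi> powi (- 2)"
      unfolding n using power_int_add[of \<pi> "-1" "-1"] by (simp add: mult_nth)
    moreover have "vge 0 ((alph (- 1) ** n ** alph (- 1)) $ 3 $ 3)" using nP by (simp add: PP_def MM_iff)
    ultimately show ?thesis by (simp add: vge_pi_power_int)
  qed
qed

text \<open>The bounds are affine in the point, so a matrix that respects the norms at two points
  respects those on the segment between them.\<close>

lemma MM_convex:
  assumes "g \<in> MM S S 0" "g \<in> MM Q Q 0" "min S Q \<le> T" "T \<le> max S Q"
  shows "g \<in> MM T T 0"
  using assms unfolding MM_iff by (auto simp: min_def max_def elim: vge_mono split: if_splits)

text \<open>Two descriptions of x differ by an element q that fixes the base edge and the vertex of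
  x. By convexity q fixes the vertex of level n in between, so y and y' are the same vertex: in a
  tree there is only one way back.\<close>

lemma outward_unique:
  assumes "outward a m n x y" "outward a m n x y'" "(m = n + 1 \<and> 0 \<le> n) \<or> (m = n - 1 \<and> n \<le> - 1)"
  shows "\<exists>k\<in>PP (2 * a). y' = k ** y"
proof -
  from assms(1) obtain i k1 k2 where 1: "i \<in> PP (2 * a + 1)" "k1 \<in> PP (2 * a)" "k2 \<in> PP (2 * a)"
    "x = k1 ** alph m ** i" "y = k2 ** alph n ** i" unfolding outward_def by blast
  from assms(2) obtain i' k1' k2' where 2: "i' \<in> PP (2 * a + 1)" "k1' \<in> PP (2 * a)" "k2' \<in> PP (2 * a)"
    "x = k1' ** alph m ** i'" "y' = k2' ** alph n ** i'" unfolding outward_def by blast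
  define q where "q = i' ** star i"
  have q: "q \<in> PP (2 * a + 1)" unfolding q_def by (intro PP_mult PP_star 1 2)
  have "star k1' ** (k1 ** alph m ** i) ** star i = alph m ** q"
  proof -
    have E: "k1 ** alph m ** i = k1' ** (alph m ** i')" using 1(4) 2(4) by (simp add: matrix_mul_assoc)
    show ?thesis unfolding E q_def using PP_GG[OF 2(2)] by (simp only: star_cancel matrix_mul_assoc[symmetric])
  qed
  then have 3: "star k1' ** (k1 ** alph m ** (i ** star i)) = alph m ** q" by (simp only: matrix_mul_assoc)
  have "alph (- m) ** (star k1' ** k1) ** alph m = alph (- m) ** (star k1' ** (k1 ** alph m))"
    by (simp only: matrix_mul_assoc)
  also have "\<dots> = alph (- m) ** (alph m ** q)"
    using 3 GG_star_right[OF PP_GG[OF 1(1)]] by (simp only: matrix_mul_rid)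
  finally have qe: "q = alph (- m) ** (star k1' ** k1) ** alph m" by (simp only: alph_mult_cancel)
  have "alph (- m) ** (star k1' ** k1) ** alph m \<in> MM (2 * a - 4 * m) (2 * a - 4 * m) (0 + 0 + 0)"
    using alph_MM[of "- m" "2 * a" "2 * a - 4 * m" 0] alph_MM[of m "2 * a - 4 * m" "2 * a" 0] PP_MM[OF PP_mult[OF PP_star[OF 2(2)] 1(2)]]
    by (intro MM_mult) auto
  then have "q \<in> MM (2 * a - 4 * m) (2 * a - 4 * m) 0" by (simp add: qe)
  then have qn: "q \<in> MM (2 * a - 4 * n) (2 * a - 4 * n) 0"
    using MM_convex[OF PP_MM[OF q], of "2 * a - 4 * m" "2 * a - 4 * n"] assms(3) by auto
  have "alph n ** q ** alph (- n) \<in> MM (2 * a) (2 * a) (0 + 0 + 0)"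
    using alph_MM[of n "2 * a - 4 * n" "2 * a" 0] alph_MM[of "- n" "2 * a" "2 * a - 4 * n" 0] qn
    by (intro MM_mult[of _ _ "2 * a - 4 * n"]) auto
  then have r: "alph n ** q ** alph (- n) \<in> PP (2 * a)"
    using q by (auto simp: PP_def mult_GG)
  have "i' = q ** i" unfolding q_def using PP_GG[OF 1(1)] by (simp add: star_cancel')
  then have "y' = k2' ** (alph n ** q ** alph (- n)) ** star k2 ** y"
    using PP_GG[OF 1(3)] by (simp add: 1(5) 2(5) star_cancel flip: matrix_mul_assoc)
  moreover have "k2' ** (alph n ** q ** alph (- n)) ** star k2 \<in> PP (2 * a)"
    by (intro PP_mult PP_star 1 2 r)
  ultimately show ?thesis by blast
qed

end

section \<open>Finite p-groups acting on sets and on vector spaces of characteristic p\<close>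

hide_const (open) Divisibility.prime Group_Action.invariants up_ring.coeff up_ring.monom Polynomials.degree Polynomials.lead_coeff

text \<open>If another prime q divided the order, Sylow's theorem would give a subgroup of order q,
  and a nontrivial element of it would have an order dividing both q and a power of p.\<close>

lemma group_p_power_order:
  fixes G (structure)
  assumes "group G" and fin: "finite (carrier G)" and p: "prime (p::nat)"
    and tors: "\<And>x. x \<in> carrier G \<Longrightarrow> \<exists>j. x [^]\<^bsub>G\<^esub> (p ^ j) = \<one>\<^bsub>G\<^esub>"
  shows "\<exists>n. order G = p ^ n"
proof -
  interpret group G by fact
  have "order G > 0" using fin by (simp add: order_gt_0_iff_finite)
  define k where "k = multiplicity p (order G)"
  obtain m where m: "order G = p ^ k * m" "\<not> p dvd m"
    using \<open>order G > 0\<close> p unfolding k_def by (metis multiplicity_decompose' not_prime_unit less_irrefl)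
  have "m = 1"
  proof (rule ccontr)
    assume "m \<noteq> 1"
    then obtain q where q: "prime q" "q dvd m" by (metis prime_factor_nat)
    then obtain r where "order G = q ^ 1 * r" using m(1) by (metis dvd_def dvd_mult power_one_right)
    then obtain H where H: "subgroup H G" "card H = q ^ 1"
      using sylow_thm[OF q(1) \<open>group G\<close> _ fin] by blast
    have "card H > 1" using H(2) prime_gt_1_nat[OF q(1)] by simp
    then have "\<exists>x\<in>H. x \<noteq> \<one>" by (metis card_le_Suc0_iff_eq card_eq_0_iff not_le One_nat_def less_nat_zero_code)
    then obtain x where x: "x \<in> H" "x \<noteq> \<one>" by blast
    then have xG: "x \<in> carrier G" using subgroup.subset[OF H(1)] by blast
    interpret H: group "G\<lparr>carrier := H\<rparr>" using subgroup.subgroup_is_group[OF H(1)] is_group by blast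
    have "x [^]\<^bsub>G\<lparr>carrier := H\<rparr>\<^esub> order (G\<lparr>carrier := H\<rparr>) = \<one>\<^bsub>G\<lparr>carrier := H\<rparr>\<^esub>"
      using x by (intro H.pow_order_eq_1) auto
    then have "x [^] q = \<one>" using H(2) by (simp add: order_def nat_pow_consistent[symmetric])
    then have 1: "ord x dvd q" using pow_eq_id[OF xG] by simp
    obtain j where "x [^] (p ^ j) = \<one>" using tors[OF xG] by blast
    then have 2: "ord x dvd p ^ j" using pow_eq_id[OF xG] by simp
    have "q \<noteq> p" using m(2) q(2) by blast
    then have "coprime q (p ^ j)" using p q(1) by (simp add: primes_coprime)
    then have "ord x = 1" using 1 2 by (metis coprime_common_divisor nat_dvd_1_iff_1)
    then show False using x(2) xG ord_eq_1 by blast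
  qed
  then show ?thesis using m by auto
qed

text \<open>The class equation for a group acting through a finite \<open>p\<close>-group.\<close>

lemma p_group_action_card:
  fixes G (structure)
  assumes G: "group G" and p: "prime (p::nat)" and fin: "finite E"
    and closed: "\<And>g x. g \<in> carrier G \<Longrightarrow> x \<in> E \<Longrightarrow> act g x \<in> E"
    and one: "\<And>x. x \<in> E \<Longrightarrow> act \<one>\<^bsub>G\<^esub> x = x"
    and mult: "\<And>g h x. g \<in> carrier G \<Longrightarrow> h \<in> carrier G \<Longrightarrow> x \<in> E \<Longrightarrow> act (g \<otimes>\<^bsub>G\<^esub> h) x = act g (act h x)"
    and tors: "\<And>g. g \<in> carrier G \<Longrightarrow> \<exists>j. \<forall>x\<in>E. act (g [^]\<^bsub>G\<^esub> (p ^ j)) x = x"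
  shows "[card E = card {x\<in>E. \<forall>g\<in>carrier G. act g x = x}] (mod p)"
proof -
  interpret group G by fact
  define \<phi> where "\<phi> = (\<lambda>g. restrict (act g) E)"
  have bij: "bij_betw (act g) E E" if g: "g \<in> carrier G" for g
  proof (rule bij_betw_byWitness[where f' = "act (inv g)"])
    show "\<forall>a\<in>E. act (inv g) (act g a) = a" using g mult[of "inv g" g] one by auto
    show "\<forall>a'\<in>E. act g (act (inv g) a') = a'" using g mult[of g "inv g"] one by auto
  qed (use closed g in auto)
  have hom: "\<phi> \<in> hom G (BijGroup E)"
  proof (rule homI)
    fix g assume g: "g \<in> carrier G"
    show "\<phi> g \<in> carrier (BijGroup E)"
      using bij[OF g] by (auto simp: BijGroup_def Bij_def \<phi>_def bij_betw_def inj_on_def image_def)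
    fix h assume h: "h \<in> carrier G"
    have "\<phi> g \<in> Bij E" "\<phi> h \<in> Bij E" using bij[OF g] bij[OF h]
      by (auto simp: Bij_def \<phi>_def bij_betw_def inj_on_def image_def)
    then show "\<phi> (g \<otimes> h) = \<phi> g \<otimes>\<^bsub>BijGroup E\<^esub> \<phi> h"
      using mult[OF g h] closed[OF h] by (auto simp: BijGroup_def \<phi>_def compose_def restrict_def)
  qed
  interpret \<phi>: group_hom G "BijGroup E" \<phi>
    by (simp add: group_hom_def group_hom_axioms_def G group_BijGroup hom)
  \<comment> \<open>The image in the permutation group of E is a finite p-group even when G is
    infinite; its orbits are those of G.\<close>
  define Im where "Im = (BijGroup E)\<lparr>carrier := \<phi> ` carrier G\<rparr>"
  have sub: "subgroup (\<phi> ` carrier G) (BijGroup E)" by (rule \<phi>.img_is_subgroup)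
  interpret Im: group Im unfolding Im_def using sub group_BijGroup by (rule subgroup.subgroup_is_group)
  have carr: "carrier Im = \<phi> ` carrier G" by (simp add: Im_def)
  have "\<phi> ` carrier G \<subseteq> E \<rightarrow>\<^sub>E E" using closed by (auto simp: \<phi>_def)
  then have finIm: "finite (carrier Im)" unfolding carr using fin by (meson finite_PiE finite_subset)
  have "\<exists>n. order Im = p ^ n"
  proof (rule group_p_power_order[OF Im.is_group finIm p])
    fix x assume "x \<in> carrier Im"
    then obtain g where g: "g \<in> carrier G" "x = \<phi> g" unfolding carr by blast
    obtain j where j: "\<forall>x\<in>E. act (g [^] (p ^ j)) x = x" using tors[OF g(1)] by blast
    have "x [^]\<^bsub>Im\<^esub> (p ^ j) = x [^]\<^bsub>BijGroup E\<^esub> (p ^ j)"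
      unfolding Im_def by (simp add: nat_pow_def)
    also have "\<dots> = \<phi> (g [^] (p ^ j))" using g by (simp add: \<phi>.hom_nat_pow)
    also have "\<dots> = \<one>\<^bsub>Im\<^esub>" using j by (auto simp: Im_def BijGroup_def \<phi>_def)
    finally show "\<exists>j. x [^]\<^bsub>Im\<^esub> (p ^ j) = \<one>\<^bsub>Im\<^esub>" by blast
  qed
  then obtain n where n: "order Im = p ^ n" by blast
  interpret act: group_action Im E id
  proof
    show "id \<in> hom Im (BijGroup E)"
      using subgroup.subset[OF sub] by (auto simp: hom_def Im_def)
  qed
  define F where "F = {x\<in>E. \<forall>g\<in>carrier G. act g x = x}"
  have orb: "orbit Im id x = (\<lambda>g. act g x) ` carrier G" if "x \<in> E" for x
  proof -
    have "orbit Im id x = {\<psi> x | \<psi>. \<psi> \<in> \<phi> ` carrier G}" by (simp add: orbit_def carr)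
    also have "\<dots> = (\<lambda>g. \<phi> g x) ` carrier G" by blast
    finally show ?thesis using that by (simp add: \<phi>_def)
  qed
  have dv: "card (orbit Im id x) dvd p ^ n" if "x \<in> E" for x
    using act.orbit_stabilizer_theorem[OF that] n by (metis dvd_triv_left)
  have self: "x \<in> orbit Im id x" if "x \<in> E" for x
    using orb[OF that] one[OF that] by (metis image_eqI one_closed)
  have orbE: "orbit Im id x \<subseteq> E" if "x \<in> E" for x using orb[OF that] closed that by auto
  have single: "p dvd card (orbit Im id x)" if x: "x \<in> E" "x \<notin> F" for x
  proof -
    obtain g where "g \<in> carrier G" "act g x \<noteq> x" using x by (auto simp: F_def)
    then have "card (orbit Im id x) \<noteq> 1"
      using self[OF x(1)] orb[OF x(1)] by (metis card_1_singletonE image_eqI singletonD)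
    moreover obtain i where "card (orbit Im id x) = p ^ i"
      using dv[OF x(1)] p by (metis divides_primepow_nat)
    ultimately show ?thesis by (cases i) auto
  qed
  have Fsing: "orbit Im id x = {x}" if "x \<in> F" for x
    using that orb[of x] by (auto simp: F_def image_def)
  define Os where "Os = orbits Im E id"
  define O1 where "O1 = (\<lambda>x. {x}) ` F"
  have O1: "O1 \<subseteq> Os" unfolding O1_def Os_def orbits_def using Fsing by (auto simp: F_def)
  have finO: "finite Os" unfolding Os_def orbits_def using fin by simp
  have "card E = (\<Sum>orb\<in>Os. \<Sum>x\<in>orb. 1)"
    using act.disjoint_sum[OF fin, of "\<lambda>_. 1::nat"] by (simp add: Os_def)
  also have "\<dots> = (\<Sum>orb\<in>Os. card orb)" by simp
  also have "\<dots> = (\<Sum>orb\<in>Os - O1. card orb) + (\<Sum>orb\<in>O1. card orb)"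
    by (rule sum.subset_diff[OF O1 finO])
  also have "(\<Sum>orb\<in>O1. card orb) = card F"
    unfolding O1_def by (subst sum.reindex) auto
  finally have eq: "card E = (\<Sum>orb\<in>Os - O1. card orb) + card F" .
  have "p dvd (\<Sum>orb\<in>Os - O1. card orb)"
  proof (rule dvd_sum)
    fix orb assume "orb \<in> Os - O1"
    then obtain x where x: "x \<in> E" "orb = orbit Im id x" "orb \<notin> O1" by (auto simp: Os_def orbits_def)
    then have "x \<notin> F" using Fsing by (auto simp: O1_def)
    then show "p dvd card orb" using single x by simp
  qed
  then show ?thesis unfolding F_def[symmetric] eq by (auto simp: cong_def elim!: dvdE)
qed

text \<open>The integral combinations of the orbit of z form a finite additive p-group E that is
  stable under the action. The number of its fixed points is congruent to the order of E, hence
  divisible by p, and since 0 is one of them there is another.\<close>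

lemma p_group_fixed_vector:
  fixes G (structure) and scale :: "'c::field \<Rightarrow> 'v::ab_group_add \<Rightarrow> 'v"
  assumes G: "group G" and p: "prime (p::nat)" and vs: "vector_space scale" and char: "of_nat p = (0::'c)"
    and add: "\<And>g x y. g \<in> carrier G \<Longrightarrow> act g (x + y) = act g x + act g y"
    and sc: "\<And>g c x. g \<in> carrier G \<Longrightarrow> act g (scale c x) = scale c (act g x)"
    and one: "\<And>x. act \<one>\<^bsub>G\<^esub> x = x"
    and mult: "\<And>g h x. g \<in> carrier G \<Longrightarrow> h \<in> carrier G \<Longrightarrow> act (g \<otimes>\<^bsub>G\<^esub> h) x = act g (act h x)"
    and tors: "\<And>g. g \<in> carrier G \<Longrightarrow> \<exists>j. \<forall>x. act (g [^]\<^bsub>G\<^esub> (p ^ j)) x = x"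
    and Z: "Modules.module.subspace scale Z" "\<And>g x. g \<in> carrier G \<Longrightarrow> x \<in> Z \<Longrightarrow> act g x \<in> Z"
    and z: "z \<in> Z" "z \<noteq> 0" and orb: "finite ((\<lambda>g. act g z) ` carrier G)"
  shows "\<exists>x\<in>Z. x \<noteq> 0 \<and> (\<forall>g\<in>carrier G. act g x = x)"
proof -
  interpret group G by fact
  interpret vs: vector_space scale by fact
  define B where "B = (\<lambda>g. act g z) ` carrier G"
  define f where "f = (\<lambda>n::'v \<Rightarrow> nat. \<Sum>y\<in>B. scale (of_nat (n y)) y)"
  define E where "E = range f"
  have finB: "finite B" using orb by (simp add: B_def)
  have actB: "act g ` B = B" if g: "g \<in> carrier G" for g
  proof (rule antisym)
    show "act g ` B \<subseteq> B" using g by (auto simp: B_def mult[symmetric])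
    show "B \<subseteq> act g ` B"
    proof
      fix y assume "y \<in> B"
      then obtain h where h: "h \<in> carrier G" "y = act h z" by (auto simp: B_def)
      have "act g (act (inv g \<otimes> h) z) = act (g \<otimes> (inv g \<otimes> h)) z" using g h by (simp add: mult)
      also have "\<dots> = y" using g h by (simp add: m_assoc[symmetric])
      finally show "y \<in> act g ` B" using g h by (auto simp: B_def intro!: image_eqI[of _ _ "act (inv g \<otimes> h) z"])
    qed
  qed
  have inj: "inj_on (act g) B" if "g \<in> carrier G" for g
  proof (rule inj_onI)
    fix x y assume "act g x = act g y"
    then have "act (inv g \<otimes> g) x = act (inv g \<otimes> g) y" using that by (simp only: mult inv_closed)
    then show "x = y" using that by (simp add: one)
  qed
  have 0: "act g 0 = 0" if "g \<in> carrier G" for g using add[OF that, of 0 0] by simp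
  have actsum: "act g (sum h C) = (\<Sum>y\<in>C. act g (h y))" if "g \<in> carrier G" for g h and C :: "'v set"
    by (induction C rule: infinite_finite_induct) (auto simp: add 0 that)
  have fE: "f n \<in> E" for n by (simp add: E_def)
  have actE: "act g x \<in> E" if g: "g \<in> carrier G" and x: "x \<in> E" for g x
  proof -
    obtain n where n: "x = f n" using x by (auto simp: E_def)
    define r where "r = the_inv_into B (act g)"
    have "act g x = (\<Sum>y\<in>B. scale (of_nat (n y)) (act g y))" using g by (simp add: n f_def actsum sc)
    also have "\<dots> = (\<Sum>y\<in>B. scale (of_nat (n (r (act g y)))) (act g y))"
      using inj[OF g] by (intro sum.cong refl) (simp add: r_def the_inv_into_f_f)
    also have "\<dots> = (\<Sum>y\<in>act g ` B. scale (of_nat (n (r y))) y)" by (simp add: sum.reindex[OF inj[OF g]])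
    also have "\<dots> = f (n \<circ> r)" by (simp add: actB[OF g] f_def)
    finally show ?thesis by (simp add: fE)
  qed
  \<comment> \<open>In characteristic p the coefficients only matter modulo p, so finitely many
    combinations remain.\<close>
  have "f n = f (\<lambda>y\<in>B. n y mod p)" for n
  proof -
    have "of_nat (n y) = (of_nat (n y mod p) :: 'c)" for y
      using char by (metis mod_div_mult_eq of_nat_add of_nat_mult mult_zero_right add.right_neutral)
    then show ?thesis by (auto simp: f_def intro!: sum.cong)
  qed
  then have "E \<subseteq> f ` (B \<rightarrow>\<^sub>E {..<p})" unfolding E_def using prime_gt_0_nat[OF p] by fastforce
  then have finE: "finite E" using finB by (meson finite_PiE finite_imageI finite_lessThan finite_subset)
  have addE: "x + y \<in> E" if "x \<in> E" "y \<in> E" for x y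
  proof -
    obtain n m where "x = f n" "y = f m" using \<open>x \<in> E\<close> \<open>y \<in> E\<close> by (auto simp: E_def)
    then have "x + y = f (\<lambda>y. n y + m y)" by (simp add: f_def sum.distrib vs.scale_left_distrib)
    then show ?thesis by (simp add: fE)
  qed
  have zE: "z \<in> E"
  proof -
    have "z \<in> B" using one by (metis B_def image_eqI one_closed)
    then have "f (\<lambda>y. if y = z then 1 else 0) = z"
      using finB by (simp add: f_def if_distrib[of of_nat] if_distrib[of "\<lambda>c. scale c _"] sum.delta cong: if_cong)
    then show ?thesis by (metis fE)
  qed
  have E0: "0 \<in> E" using fE[of "\<lambda>_. 0"] by (simp add: f_def)
  define A where "A = \<lparr>carrier = E, mult = (+), one = (0::'v)\<rparr>"
  have uE: "\<exists>y\<in>E. y + x = 0" if x: "x \<in> E" for x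
  proof -
    have "scale (of_nat n) x \<in> E" for n
      by (induction n) (auto simp: E0 vs.scale_left_distrib intro: addE x)
    moreover have "scale (of_nat (p - 1)) x + x = scale (of_nat (p - 1) + 1) x" by (simp add: vs.scale_left_distrib)
    moreover have "of_nat (p - 1) + 1 = (0 :: 'c)"
      using char prime_gt_0_nat[OF p] by (metis Suc_diff_1 of_nat_Suc add.commute)
    ultimately show ?thesis by (metis vs.scale_zero_left)
  qed
  have gA: "group A" by (rule groupI) (auto simp: A_def addE E0 add.assoc intro: uE)
  have powA: "x [^]\<^bsub>A\<^esub> n = scale (of_nat n) x" for x and n :: nat
    by (induction n) (auto simp: A_def nat_pow_def vs.scale_left_distrib add.commute)
  have "\<exists>n. order A = p ^ n"
  proof (rule group_p_power_order[OF gA _ p])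
    show "finite (carrier A)" using finE by (simp add: A_def)
    show "\<exists>j. x [^]\<^bsub>A\<^esub> (p ^ j) = \<one>\<^bsub>A\<^esub>" for x
      unfolding powA using char by (intro exI[of _ 1]) (simp add: A_def)
  qed
  then obtain n where n: "card E = p ^ n" by (auto simp: A_def order_def)
  have "card {0, z} \<le> card E" by (rule card_mono[OF finE]) (use E0 zE in auto)
  then have "n \<noteq> 0" using z(2) n by (cases n) auto
  then have "p dvd card E" using n by simp
  moreover have "[card E = card {x\<in>E. \<forall>g\<in>carrier G. act g x = x}] (mod p)"
  proof (rule p_group_action_card[OF G p finE])
    show "\<exists>j. \<forall>x\<in>E. act (g [^] (p ^ j)) x = x" if "g \<in> carrier G" for g
      using tors[OF that] by blast
  qed (simp_all add: actE one mult)
  ultimately have pd: "p dvd card {x\<in>E. \<forall>g\<in>carrier G. act g x = x}" (is "_ dvd card ?F")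
    by (simp add: cong_def dvd_eq_mod_eq_0)
  have 0: "0 \<in> ?F" using E0 0 by auto
  have "?F \<noteq> {0}"
  proof
    assume "?F = {0}"
    then have "card ?F = card {0::'v}" by (rule arg_cong)
    then show False using pd prime_gt_1_nat[OF p] by simp
  qed
  then obtain x where x: "x \<in> ?F" "x \<noteq> 0" using 0 by blast
  have BZ: "B \<subseteq> Z" using Z(2) z(1) by (auto simp: B_def)
  have "f n \<in> Z" for n
    unfolding f_def using BZ by (intro vs.subspace_sum[OF Z(1)] vs.subspace_scale[OF Z(1)]) blast
  then have "x \<in> Z" using x by (auto simp: E_def)
  then show ?thesis using x by blast
qed

section \<open>Irreducible representations of rank one groups in characteristic p\<close>

text \<open>Models a finite group with a split BN-pair of rank one by the operators of its unipotent
  radical (\<open>UU\<close>), its torus (\<open>HH\<close>) and its reflection. Working with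
  operators and not with group elements allows a kernel; when the unipotent radical acts trivially,
  the rank one relation degenerates and \<open>trivial_UU\<close> takes its place.
  \<open>UU_fixed_vector\<close> and \<open>UU_coinv\<close> are the fixed point principle for
  p-groups on the space and on its dual.\<close>

locale rank_one_rep = vector_space scale
  for scale :: "'c::alg_closed_field \<Rightarrow> 'v::ab_group_add \<Rightarrow> 'v" +
  fixes UU HH :: "('v \<Rightarrow> 'v) set" and s :: "'v \<Rightarrow> 'v"
  assumes op_add: "A \<in> UU \<union> HH \<union> {s} \<Longrightarrow> A (x + y) = A x + A y"
    and op_scale: "A \<in> UU \<union> HH \<union> {s} \<Longrightarrow> A (scale c x) = scale c (A x)"
    and finite_UU: "finite UU" and finite_HH: "finite HH"
    and UU_id: "id \<in> UU" and UU_comp: "A \<in> UU \<Longrightarrow> B \<in> UU \<Longrightarrow> A \<circ> B \<in> UU"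
    and UU_inv: "A \<in> UU \<Longrightarrow> \<exists>B\<in>UU. A \<circ> B = id \<and> B \<circ> A = id"
    and HH_comp: "h \<in> HH \<Longrightarrow> k \<in> HH \<Longrightarrow> h \<circ> k \<in> HH"
    and HH_inv: "h \<in> HH \<Longrightarrow> \<exists>k\<in>HH. h \<circ> k = id \<and> k \<circ> h = id"
    and HH_comm: "h \<in> HH \<Longrightarrow> k \<in> HH \<Longrightarrow> h \<circ> k = k \<circ> h"
    and s_s: "s (s x) = x"
    and s_HH: "h \<in> HH \<Longrightarrow> \<exists>k\<in>HH. \<forall>x. h (s x) = s (k x)"
    and HH_UU: "h \<in> HH \<Longrightarrow> A \<in> UU \<Longrightarrow> \<exists>B\<in>UU. h \<circ> A = B \<circ> h"
    and UU_HH: "h \<in> HH \<Longrightarrow> A \<in> UU \<Longrightarrow> \<exists>B\<in>UU. A \<circ> h = h \<circ> B"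
    and big_cell: "A \<in> UU \<Longrightarrow> A \<noteq> id \<Longrightarrow> \<exists>B\<in>UU. \<exists>h\<in>HH. \<exists>C\<in>UU. \<forall>x. s (A (s x)) = B (h (s (C x)))"
    and trivial_UU: "UU = {id} \<Longrightarrow> s \<in> HH"
    and irred: "subspace W \<Longrightarrow> (\<And>A x. A \<in> UU \<union> HH \<union> {s} \<Longrightarrow> x \<in> W \<Longrightarrow> A x \<in> W) \<Longrightarrow> W = {0} \<or> W = UNIV"
    and UU_fixed_vector: "subspace Z \<Longrightarrow> (\<And>A z. A \<in> UU \<Longrightarrow> z \<in> Z \<Longrightarrow> A z \<in> Z) \<Longrightarrow> z \<in> Z \<Longrightarrow> z \<noteq> 0
        \<Longrightarrow> \<exists>x\<in>Z. x \<noteq> 0 \<and> (\<forall>A\<in>UU. A x = x)"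
    and UU_coinv: "span {A x - x | A x. A \<in> UU} \<noteq> UNIV"
    and card_UU: "UU \<noteq> {id} \<Longrightarrow> of_nat (card UU) = (0::'c)"
begin

abbreviation "ops \<equiv> UU \<union> HH \<union> {s}"

lemma op_0: "A \<in> ops \<Longrightarrow> A 0 = 0"
  using op_scale[of A 0 0] by simp

lemma op_sum: "A \<in> ops \<Longrightarrow> A (sum f I) = (\<Sum>i\<in>I. A (f i))"
  by (induction I rule: infinite_finite_induct) (auto simp: op_0 op_add)

lemma op_diff: "A \<in> ops \<Longrightarrow> A (x - y) = A x - A y"
  using op_add[of A "x - y" y] by (simp add: algebra_simps)

lemma op_span: assumes A: "A \<in> ops" and Y: "\<And>y. y \<in> Y \<Longrightarrow> A y \<in> span Z" and x: "x \<in> span Y"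
  shows "A x \<in> span Z"
  using x by (induction rule: span_induct_alt)
    (auto simp: op_0[OF A] op_add[OF A] op_scale[OF A] span_zero intro!: span_add span_scale Y)

lemma op_funpow: "h \<in> HH \<Longrightarrow> (h ^^ Suc n) \<in> HH"
  by (induction n) (auto intro: HH_comp)

text \<open>
  Eigenvectors come from finite order: if \<open>h\<^sup>n = 1\<close> then \<open>X\<^sup>n - 1\<close> splits and annihilates everything.
\<close>

definition peval :: "('v \<Rightarrow> 'v) \<Rightarrow> 'c poly \<Rightarrow> 'v \<Rightarrow> 'v" where
  "peval h q w = (\<Sum>i\<le>degree q. scale (coeff q i) ((h ^^ i) w))"

lemma peval_bound: assumes "degree q \<le> n" shows "peval h q w = (\<Sum>i\<le>n. scale (coeff q i) ((h ^^ i) w))"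
  unfolding peval_def using assms by (intro sum.mono_neutral_left) (auto simp: coeff_eq_0 not_le)

lemma peval_add: "peval h (q + r) w = peval h q w + peval h r w"
  by (simp add: peval_bound[of _ "max (degree q) (degree r)"] degree_add_le_max scale_left_distrib sum.distrib)

lemma peval_smult: "peval h (Polynomial.smult c q) w = scale c (peval h q w)"
  by (simp add: peval_bound[of _ "degree q"] degree_smult_le scale_sum_right)

lemma peval_pCons: assumes h: "h \<in> HH" shows "peval h (pCons 0 q) w = h (peval h q w)"
proof -
  have "peval h (pCons 0 q) w = (\<Sum>i\<le>Suc (degree q). scale (coeff (pCons 0 q) i) ((h ^^ i) w))"
    by (rule peval_bound) (simp add: degree_pCons_le)
  also have "\<dots> = (\<Sum>i\<le>degree q. scale (coeff q i) (h ((h ^^ i) w)))"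
    by (subst sum.atMost_Suc_shift) simp
  also have "\<dots> = h (peval h q w)"
    using h by (simp add: peval_def op_sum op_scale)
  finally show ?thesis .
qed

lemma peval_linear: assumes "h \<in> HH" shows "peval h ([:- a, 1:] * q) w = h (peval h q w) - scale a (peval h q w)"
proof -
  have "[:- a, 1:] * q = pCons 0 q + Polynomial.smult (- a) q" by simp
  then show ?thesis by (simp only: peval_add peval_smult peval_pCons[OF assms]) simp
qed

lemma eigenvector_from_roots:
  assumes h: "h \<in> HH" and W: "subspace W" "\<And>x. x \<in> W \<Longrightarrow> h x \<in> W"
    and w: "w \<in> W" "w \<noteq> 0"
  shows "peval h (prod_list (map (\<lambda>a. [:- a, 1:]) as)) w = 0 \<Longrightarrow> \<exists>x\<in>W. x \<noteq> 0 \<and> (\<exists>c. h x = scale c x)"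
proof (induction as)
  case Nil
  then show ?case using w by (simp add: peval_def)
next
  case (Cons a as)
  define x where "x = peval h (prod_list (map (\<lambda>a. [:- a, 1:]) as)) w"
  show ?case
  proof (cases "x = 0")
    case True
    then show ?thesis using Cons.IH by (simp add: x_def)
  next
    case False
    have pw: "(h ^^ i) w \<in> W" for i by (induction i) (auto simp: w W)
    have "x \<in> W" unfolding x_def peval_def by (intro subspace_sum W subspace_scale pw)
    moreover have "h x = scale a x"
      using Cons.prems peval_linear[OF h] by (simp add: x_def)
    ultimately show ?thesis using False by blast
  qed
qed

lemma finite_order: assumes h: "h \<in> HH" shows "\<exists>n>0. h ^^ n = id"
proof -
  have "\<not> inj (\<lambda>n. h ^^ Suc n)"
  proof
    assume "inj (\<lambda>n. h ^^ Suc n)"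
    moreover have "range (\<lambda>n. h ^^ Suc n) \<subseteq> HH" using op_funpow[OF h] by blast
    ultimately show False using finite_HH by (meson finite_imageD finite_subset infinite_UNIV_nat)
  qed
  then obtain i j where ij: "i < j" "h ^^ Suc i = h ^^ Suc j" unfolding inj_on_def by (metis linorder_neqE_nat)
  obtain k where k: "k \<circ> h = id" using HH_inv[OF h] by blast
  have kh: "k (h x) = x" for x using k by (simp add: fun_eq_iff)
  have "(k ^^ n) ((h ^^ n) x) = x" for n x
    by (induction n) (simp_all add: funpow_swap1[of k] kh)
  then have kl: "k ^^ n \<circ> h ^^ n = id" for n by (simp add: fun_eq_iff)
  have "h ^^ Suc j = h ^^ Suc i \<circ> h ^^ (j - i)" using ij(1) by (metis Suc_leI add_Suc funpow_add le_add_diff_inverse less_imp_le)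
  then have "k ^^ Suc i \<circ> h ^^ Suc i = k ^^ Suc i \<circ> (h ^^ Suc i \<circ> h ^^ (j - i))" using ij(2) by simp
  then have "id = h ^^ (j - i)" using kl[of "Suc i"] by (metis comp_assoc id_comp)
  then show ?thesis using ij(1) by (intro exI[of _ "j - i"]) auto
qed

lemma eigenvector:
  assumes h: "h \<in> HH" and W: "subspace W" "\<And>x. x \<in> W \<Longrightarrow> h x \<in> W" and w: "w \<in> W" "w \<noteq> 0"
  shows "\<exists>x\<in>W. x \<noteq> 0 \<and> (\<exists>c. h x = scale c x)"
proof -
  obtain n where n: "n > 0" "h ^^ n = id" using finite_order[OF h] by blast
  define q where "q = (monom 1 n - 1 :: 'c poly)"
  have dq: "degree q = n" unfolding q_def using n(1)
    by (subst diff_conv_add_uminus, subst degree_add_eq_left) (auto simp: degree_monom_eq)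
  have q0: "q \<noteq> 0" using dq n(1) by auto
  have lq: "lead_coeff q = 1" unfolding dq unfolding q_def using n(1) by simp
  obtain A where A: "q = Polynomial.smult (lead_coeff q) (\<Prod>x\<in>#A. [:- x, 1:])"
    using alg_closed_imp_factorization[OF q0] by blast
  obtain as where as: "A = mset as" by (metis ex_mset)
  have qe: "q = prod_list (map (\<lambda>a. [:- a, 1:]) as)"
    using A by (simp add: lq as prod_mset_prod_list flip: mset_map)
  have "peval h q w = (\<Sum>i\<le>n. scale (coeff q i) ((h ^^ i) w))" by (simp add: peval_def dq)
  also have "\<dots> = (\<Sum>i\<in>{0,n}. scale (coeff q i) ((h ^^ i) w))"
    using n(1) by (intro sum.mono_neutral_right) (auto simp: q_def )
  also have "\<dots> = 0" using n by (simp add: q_def )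
  finally show ?thesis using eigenvector_from_roots[OF h W w] qe by simp
qed

text \<open>Commuting operators are treated one at a time: the next one preserves the joint
  eigenspace of the earlier ones and has an eigenvector in it.\<close>

lemma common_eigenvector:
  assumes W: "subspace W" "\<And>h x. h \<in> HH \<Longrightarrow> x \<in> W \<Longrightarrow> h x \<in> W" and w: "w \<in> W" "w \<noteq> 0"
  shows "\<exists>x\<in>W. x \<noteq> 0 \<and> (\<forall>h\<in>HH. \<exists>c. h x = scale c x)"
proof -
  have "F \<subseteq> HH \<Longrightarrow> \<exists>x\<in>W. x \<noteq> 0 \<and> (\<forall>h\<in>F. \<exists>c. h x = scale c x)" if "finite F" for F
    using that
  proof (induction F)
    case empty
    show ?case by (intro bexI[of _ w] conjI w) simp
  next
    case (insert k F)
    have k: "k \<in> HH" and F: "F \<subseteq> HH" using insert.prems by auto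
    obtain x where x: "x \<in> W" "x \<noteq> 0" "\<forall>h\<in>F. \<exists>c. h x = scale c x" using insert.IH[OF F] by (elim bexE conjE)
    from bchoice[OF x(3)] obtain ev where ev: "\<And>h. h \<in> F \<Longrightarrow> h x = scale (ev h) x" by auto
    define W' where "W' = {y\<in>W. \<forall>h\<in>F. h y = scale (ev h) y}"
    have "subspace W'"
      unfolding W'_def using F W(1)
      by (intro subspaceI) (auto simp: subspace_0 subspace_add subspace_scale op_0 op_add op_scale scale_right_distrib scale_left_commute subset_iff)
    moreover have "k y \<in> W'" if y: "y \<in> W'" for y
    proof -
      have "h (k y) = scale (ev h) (k y)" if h: "h \<in> F" for h
      proof -
        have "h (k y) = k (h y)" using HH_comm[of h k] h F k by (metis comp_apply subsetD)
        moreover have "h y = scale (ev h) y" using y h by (simp add: W'_def)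
        ultimately have "h (k y) = k (scale (ev h) y)" by simp
        then show ?thesis using k by (simp add: op_scale)
      qed
      then show ?thesis using y W(2)[OF k] by (simp add: W'_def)
    qed
    moreover have "x \<in> W'" using x ev by (simp add: W'_def)
    ultimately obtain y where "y \<in> W'" "y \<noteq> 0" "\<exists>c. k y = scale c y" using eigenvector[OF k, of W' x] x(2) by auto
    then show ?case by (auto simp: W'_def)
  qed
  from this[OF finite_HH order_refl] show ?thesis .
qed

definition fixed :: "'v \<Rightarrow> bool" where "fixed x \<longleftrightarrow> (\<forall>A\<in>UU. A x = x)"
text \<open>On vectors fixed by the unipotent radical, \<open>Nm (s x)\<close> is the Hecke operator
  of the double coset of the reflection.\<close>

definition Nm :: "'v \<Rightarrow> 'v" where "Nm x = (\<Sum>A\<in>UU. A x)"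
text \<open>The kernel of the projection onto the coinvariants of the opposite unipotent radical,
  which is the conjugate of \<open>UU\<close> by s.\<close>

definition IU :: "'v set" where "IU = span {s (A (s x)) - x | A x. A \<in> UU}"
definition eigen :: "'v \<Rightarrow> bool" where "eigen x \<longleftrightarrow> (\<forall>h\<in>HH. \<exists>c. h x = scale c x)"

lemma UU_bij: assumes "B \<in> UU" shows "bij_betw (\<lambda>A. B \<circ> A) UU UU" "bij_betw (\<lambda>A. A \<circ> B) UU UU"
proof -
  obtain C where C: "C \<in> UU" "B \<circ> C = id" "C \<circ> B = id" using UU_inv[OF assms] by blast
  have 1: "C \<circ> (B \<circ> A) = A" "B \<circ> (C \<circ> A) = A" "A \<circ> B \<circ> C = A" "A \<circ> C \<circ> B = A" for A
    by (simp_all add: C comp_assoc) (simp_all add: C flip: comp_assoc)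
  show "bij_betw (\<lambda>A. B \<circ> A) UU UU"
    by (rule bij_betw_byWitness[where f' = "\<lambda>A. C \<circ> A"]) (auto simp: 1 UU_comp C assms)
  show "bij_betw (\<lambda>A. A \<circ> B) UU UU"
    by (rule bij_betw_byWitness[where f' = "\<lambda>A. A \<circ> C"]) (auto simp: 1 UU_comp C assms)
qed

lemma Nm_fixed: "fixed (Nm x)"
  unfolding fixed_def
proof
  fix B assume B: "B \<in> UU"
  have "B (Nm x) = (\<Sum>A\<in>UU. (B \<circ> A) x)" using B by (simp add: Nm_def op_sum)
  also have "\<dots> = Nm x" unfolding Nm_def by (rule sum.reindex_bij_betw[OF UU_bij(1)[OF B]])
  finally show "B (Nm x) = Nm x" .
qed

lemma Nm_UU: assumes B: "B \<in> UU" shows "Nm (B x) = Nm x"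
proof -
  have "Nm (B x) = (\<Sum>A\<in>UU. (A \<circ> B) x)" by (simp add: Nm_def)
  also have "\<dots> = Nm x" unfolding Nm_def by (rule sum.reindex_bij_betw[OF UU_bij(2)[OF B]])
  finally show ?thesis .
qed

lemma Nm_add: "Nm (x + y) = Nm x + Nm y"
  by (simp add: Nm_def op_add sum.distrib)
lemma Nm_scale: "Nm (scale c x) = scale c (Nm x)"
  by (simp add: Nm_def op_scale scale_sum_right)
lemma Nm_0: "Nm 0 = 0" using Nm_scale[of 0 0] by simp
lemma Nm_sum: "Nm (sum f I) = (\<Sum>i\<in>I. Nm (f i))"
  by (induction I rule: infinite_finite_induct) (auto simp: Nm_0 Nm_add)

lemma HH_Nm: assumes h: "h \<in> HH" shows "h (Nm x) = Nm (h x)"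
proof -
  obtain k where k: "k \<in> HH" "h \<circ> k = id" "k \<circ> h = id" using HH_inv[OF h] by blast
  have *: "\<exists>B\<in>UU. h \<circ> A \<circ> k = B" if A: "A \<in> UU" for A
    using HH_UU[OF h A] k(2) by (metis comp_assoc comp_id)
  have **: "\<exists>B\<in>UU. k \<circ> A \<circ> h = B" if A: "A \<in> UU" for A
    using UU_HH[OF h A] k(3) by (metis comp_assoc id_comp)
  have 1: "k \<circ> (h \<circ> A \<circ> k) \<circ> h = A" "h \<circ> (k \<circ> A \<circ> h) \<circ> k = A" for A
    using k(2,3) by (simp_all add: fun_eq_iff)
  have b: "bij_betw (\<lambda>A. h \<circ> A \<circ> k) UU UU"
    by (rule bij_betw_byWitness[where f' = "\<lambda>A. k \<circ> A \<circ> h"]) (use * ** 1 in auto)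
  have kh: "k (h x) = x" using k(3) by (simp add: fun_eq_iff)
  have "h (Nm x) = (\<Sum>A\<in>UU. (h \<circ> A \<circ> k) (h x))" using h by (simp add: Nm_def op_sum kh)
  also have "\<dots> = Nm (h x)" unfolding Nm_def by (rule sum.reindex_bij_betw[OF b])
  finally show ?thesis .
qed

lemma eigen_s: assumes "eigen x" shows "eigen (s x)"
  unfolding eigen_def
proof
  fix h assume "h \<in> HH"
  then obtain k where k: "k \<in> HH" "h (s x) = s (k x)" using s_HH by blast
  obtain c where "k x = scale c x" using assms k(1) by (auto simp: eigen_def)
  then have "h (s x) = scale c (s x)" using k by (simp add: op_scale)
  then show "\<exists>c. h (s x) = scale c (s x)" ..
qed

lemma eigen_Nm: "eigen x \<Longrightarrow> eigen (Nm x)"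
  unfolding eigen_def by (metis HH_Nm Nm_scale)

text \<open>In the rank one relation the right unipotent factor fixes x and the torus factor scales
  s x.\<close>

lemma s_UU_s_span:
  assumes x: "fixed x" "eigen x" and A: "A \<in> UU" "A \<noteq> id"
  shows "\<exists>B\<in>UU. \<exists>c. s (A (s x)) = scale c (B (s x))"
proof -
  obtain B h C where *: "B \<in> UU" "h \<in> HH" "C \<in> UU" "\<forall>x. s (A (s x)) = B (h (s (C x)))" using big_cell[OF A] by blast
  obtain c where c: "h (s x) = scale c (s x)" using eigen_s[OF x(2)] *(2) by (auto simp: eigen_def)
  have "C x = x" using *(3) x(1) by (simp add: fixed_def)
  then have "s (A (s x)) = B (h (s x))" using *(4) by simp
  then have "s (A (s x)) = scale c (B (s x))" using c *(1) by (simp add: op_scale)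
  then show ?thesis using *(1) by blast
qed

definition orbit_span :: "'v \<Rightarrow> 'v set" where "orbit_span x = span ((\<lambda>A. A (s x)) ` UU)"

text \<open>The span of the vectors A (s x) is stable under unipotent and torus operators. By the
  rank one relation, s preserves it except for the generator with A = id, which it sends to x. That
  x lies in the span is read off from the eigenvalue equation, so the span is a nonzero
  subrepresentation.\<close>

lemma cyclic:
  assumes x: "fixed x" "eigen x" "x \<noteq> 0" and T: "Nm (s x) = scale c x"
  shows "orbit_span x = UNIV"
proof -
  let ?Y = "(\<lambda>A. A (s x)) ` UU"
  have ys: "A (s x) \<in> span ?Y" if "A \<in> UU" for A using that by (auto intro: span_base)
  have sA: "s (A (s x)) \<in> span ?Y" if A: "A \<in> UU" "A \<noteq> id" for A
    using s_UU_s_span[OF x(1,2) A] ys by (metis span_scale)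
  have xs: "x \<in> span ?Y"
  proof (cases "c = 0")
    case False
    have "x = scale (inverse c) (Nm (s x))" using False by (simp add: T)
    moreover have "Nm (s x) \<in> span ?Y" unfolding Nm_def by (intro span_sum ys)
    ultimately show ?thesis by (metis span_scale)
  next
    case True
    \<comment> \<open>For eigenvalue 0, applying s to the vanishing sum isolates x as the term of
      the identity; the other terms are again multiples of generators.\<close>
    have "0 = s (Nm (s x))" using T True op_0[of s] by simp
    also have "\<dots> = (\<Sum>A\<in>UU. s (A (s x)))" by (simp add: Nm_def op_sum)
    also have "\<dots> = s (id (s x)) + (\<Sum>A\<in>UU - {id}. s (A (s x)))"
      by (rule sum.remove[OF finite_UU UU_id])
    finally have "x = - (\<Sum>A\<in>UU - {id}. s (A (s x)))" by (simp add: s_s add_eq_0_iff2)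
    moreover have "(\<Sum>A\<in>UU - {id}. s (A (s x))) \<in> span ?Y" by (intro span_sum sA) auto
    ultimately show ?thesis by (metis span_neg)
  qed
  have "span ?Y = {0} \<or> span ?Y = UNIV"
  proof (rule irred[OF subspace_span])
    fix A y assume A: "A \<in> ops" and y: "y \<in> span ?Y"
    show "A y \<in> span ?Y"
    proof (rule op_span[OF A _ y])
      fix z assume "z \<in> ?Y"
      then obtain B where B: "B \<in> UU" "z = B (s x)" by blast
      consider "A \<in> UU" | "A \<in> HH" | "A = s" using A by blast
      then show "A z \<in> span ?Y"
      proof cases
        case 1
        then have "(A \<circ> B) (s x) \<in> span ?Y" using B UU_comp by (intro ys)
        then show ?thesis by (simp add: B(2))
      next
        case 2
        obtain C where C: "C \<in> UU" "A \<circ> B = C \<circ> A" using HH_UU[OF 2 B(1)] by blast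
        obtain c where "A (s x) = scale c (s x)" using eigen_s[OF x(2)] 2 by (auto simp: eigen_def)
        then have "A z = scale c (C (s x))" using C B(2) by (simp add: fun_eq_iff op_scale)
        then show ?thesis using ys[OF C(1)] by (simp add: span_scale)
      next
        case 3
        then show ?thesis using sA[OF B(1)] xs by (cases "B = id") (auto simp: B(2) s_s)
      qed
    qed
  qed
  then show ?thesis using xs x(3) by (auto simp: orbit_span_def)
qed

lemma subspace_fixed: "subspace {x. fixed x}"
  by (rule subspaceI) (auto simp: fixed_def op_0 op_add op_scale)

lemma HH_fixed: assumes "h \<in> HH" "fixed x" shows "fixed (h x)"
  unfolding fixed_def
proof
  fix A assume "A \<in> UU"
  then obtain B where "B \<in> UU" "A \<circ> h = h \<circ> B" using UU_HH[OF assms(1)] by blast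
  then show "A (h x) = h x" using assms(2) by (metis comp_apply fixed_def)
qed

text \<open>
  The idea is that \<open>x \<mapsto> Nm (s x)\<close> satisfies a quadratic relation on eigenvectors of the torus.
\<close>

lemma Hecke_eigenvector:
  assumes W: "subspace W" "\<And>x. x \<in> W \<Longrightarrow> fixed x" "\<And>h x. h \<in> HH \<Longrightarrow> x \<in> W \<Longrightarrow> h x \<in> W"
      "\<And>x. x \<in> W \<Longrightarrow> Nm (s x) \<in> W" and w: "w \<in> W" "w \<noteq> 0"
  shows "\<exists>x\<in>W. x \<noteq> 0 \<and> eigen x \<and> (\<exists>c. Nm (s x) = scale c x)"
proof -
  obtain x where x: "x \<in> W" "x \<noteq> 0" "eigen x"
  proof -
    have "\<exists>x\<in>W. x \<noteq> 0 \<and> (\<forall>h\<in>HH. \<exists>c. h x = scale c x)"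
      by (rule common_eigenvector[OF W(1) _ w]) (rule W(3))
    then show ?thesis using that by (auto simp: eigen_def)
  qed
  have fx: "fixed x" by (rule W(2)[OF x(1)])
  show ?thesis
  proof (cases "UU = {id}")
    case True
    then have "s \<in> HH" by (rule trivial_UU)
    then obtain c where "s x = scale c x" using x(3) by (auto simp: eigen_def)
    moreover have "Nm (s x) = (\<Sum>A\<in>{id}. A (s x))" unfolding Nm_def by (simp only: True)
    ultimately have "Nm (s x) = scale c x" by simp
    then show ?thesis using x by blast
  next
    case False
    define y where "y = Nm (s x)"
    show ?thesis
    proof (cases "y = 0")
      case True
      then have "Nm (s x) = scale 0 x" by (simp add: y_def)
      then show ?thesis using x by blast
    next
      case y0: False
      \<comment> \<open>The quadratic relation, term by term: the identity contributes the order of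
        the unipotent group times x, which is zero in characteristic p, and every other term is a
        multiple of y. Thus a nonzero y is an eigenvector.\<close>
      have "\<exists>c. Nm (s (A (s x))) = scale c y" if A: "A \<in> UU" for A
      proof (cases "A = id")
        case True
        have "Nm x = (\<Sum>A\<in>UU. x)" unfolding Nm_def using fx by (intro sum.cong) (auto simp: fixed_def)
        also have "\<dots> = scale (of_nat (card UU)) x" by (rule sum_constant_scale)
        finally have "Nm x = scale (of_nat (card UU)) x" .
        then have "Nm x = 0" using card_UU[OF False] by simp
        then show ?thesis using True by (intro exI[of _ 0]) (simp add: s_s)
      next
        case False
        then show ?thesis using s_UU_s_span[OF fx x(3) A False] by (metis Nm_UU Nm_scale y_def)
      qed
      then obtain c where c: "\<And>A. A \<in> UU \<Longrightarrow> Nm (s (A (s x))) = scale (c A) y" by metis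
      have "Nm (s y) = (\<Sum>A\<in>UU. Nm (s (A (s x))))" by (simp add: y_def Nm_def[of "s x"] op_sum Nm_sum)
      also have "\<dots> = scale (\<Sum>A\<in>UU. c A) y" by (simp add: c scale_sum_left)
      finally have "Nm (s y) = scale (\<Sum>A\<in>UU. c A) y" .
      moreover have "eigen y" unfolding y_def by (intro eigen_Nm eigen_s x)
      moreover have "y \<in> W" unfolding y_def by (rule W(4)[OF x(1)])
      ultimately show ?thesis using y0 by blast
    qed
  qed
qed

lemma subspace_IU: "subspace IU" unfolding IU_def by (rule subspace_span)

lemma IU_not_UNIV: "IU \<noteq> UNIV"
proof
  assume a: "IU = UNIV"
  have "y \<in> span {A x - x | A x. A \<in> UU}" for y
  proof -
    have "s (s y) \<in> span {A x - x | A x. A \<in> UU}"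
    proof (rule op_span[of s "{s (A (s x)) - x | A x. A \<in> UU}"])
      fix z assume "z \<in> {s (A (s x)) - x | A x. A \<in> UU}"
      then obtain A x where "A \<in> UU" "z = s (A (s x)) - x" by blast
      then show "s z \<in> span {A x - x | A x. A \<in> UU}" by (auto simp: op_diff s_s intro!: span_base)
    qed (use a in \<open>auto simp: IU_def\<close>)
    then show ?thesis by (simp add: s_s)
  qed
  then show False using UU_coinv by blast
qed

lemma HH_IU: assumes h: "h \<in> HH" and x: "x \<in> IU" shows "h x \<in> IU"
  unfolding IU_def
proof (rule op_span[of h "{s (A (s x)) - x | A x. A \<in> UU}"])
  fix z assume "z \<in> {s (A (s x)) - x | A x. A \<in> UU}"
  then obtain A y where z: "A \<in> UU" "z = s (A (s y)) - y" by blast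
  obtain k where k: "k \<in> HH" "\<forall>x. h (s x) = s (k x)" using s_HH[OF h] by blast
  obtain B where B: "B \<in> UU" "k \<circ> A = B \<circ> k" using HH_UU[OF k(1) z(1)] by blast
  have ks: "k (s y) = s (h y)" using k(2) by (metis s_s)
  have "h z = s (B (s (h y))) - h y" using B(2) k h ks by (simp add: z(2) op_diff fun_eq_iff)
  then show "h z \<in> span {s (A (s x)) - x | A x. A \<in> UU}" using B(1) by (auto intro!: span_base)
qed (use h x in \<open>auto simp: IU_def\<close>)

text \<open>By \<open>cyclic\<close>, s y is a combination of vectors A (s x). Applying s to each of
  them gives x modulo \<open>IU\<close>.\<close>

lemma eigen_generates:
  assumes x: "fixed x" "eigen x" "x \<noteq> 0" and T: "Nm (s x) = scale c x"
  shows "\<exists>a. y - scale a x \<in> IU"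
proof -
  have "s y \<in> orbit_span x" using cyclic[OF assms] by simp
  then have "\<exists>a. s (s y) - scale a x \<in> IU" unfolding orbit_span_def
  proof (induction rule: span_induct_alt)
    case base
    show ?case using subspace_0[OF subspace_IU] op_0[of s] by (intro exI[of _ 0]) simp
  next
    case (step c z y)
    then obtain A a where A: "A \<in> UU" "z = A (s x)" and a: "s y - scale a x \<in> IU" by blast
    have "s (A (s x)) - x \<in> IU" unfolding IU_def using A by (auto intro!: span_base)
    then have "scale c (s z - x) + (s y - scale a x) \<in> IU"
      using a A subspace_IU by (intro subspace_add subspace_scale) auto
    moreover have "scale c (s z - x) + (s y - scale a x) = s (scale c z + y) - scale (c + a) x"
      by (simp add: op_add op_scale algebra_simps)
    ultimately show ?case by metis
  qed
  then show ?thesis by (simp add: s_s)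
qed

lemma eigen_not_IU:
  assumes x: "fixed x" "eigen x" "x \<noteq> 0" and T: "Nm (s x) = scale c x"
  shows "x \<notin> IU"
proof
  assume xI: "x \<in> IU"
  have "y \<in> IU" for y
  proof -
    obtain a where "y - scale a x \<in> IU" using eigen_generates[OF assms] by blast
    then have "(y - scale a x) + scale a x \<in> IU" using xI subspace_IU by (intro subspace_add subspace_scale)
    then show ?thesis by simp
  qed
  then show False using IU_not_UNIV by blast
qed

text \<open>\<open>Nm\<close> does not distinguish the generators A (s x) of the space, and on s x
  its value is c x.\<close>

lemma Nm_multiple:
  assumes x: "fixed x" "eigen x" "x \<noteq> 0" and T: "Nm (s x) = scale c x"
  shows "\<exists>a. Nm y = scale (a * c) x"
proof -
  have "y \<in> orbit_span x" using cyclic[OF assms] by simp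
  then show ?thesis unfolding orbit_span_def
  proof (induction rule: span_induct_alt)
    case base
    then show ?case by (intro exI[of _ 0]) (simp add: Nm_0)
  next
    case (step d z y)
    then obtain A a where "A \<in> UU" "z = A (s x)" "Nm y = scale (a * c) x" by blast
    then have "Nm (scale d z + y) = scale ((d + a) * c) x"
      by (simp add: Nm_add Nm_scale Nm_UU T algebra_simps)
    then show ?case ..
  qed
qed

text \<open>Let x be a Hecke eigenvector with eigenvalue c. If c = 0, then \<open>Nm\<close>
  vanishes identically, so the fixed vectors inside \<open>IU\<close> are stable under torus and
  Hecke operator; a nonzero one would yield a Hecke eigenvector in \<open>IU\<close>, against
  \<open>eigen_not_IU\<close>. If c is nonzero, a nonzero fixed vector killed by the Hecke operator
  would yield an eigenvector of eigenvalue 0, and then \<open>Nm\<close> would vanish although it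
  does not vanish on s x. Either way every fixed vector is a multiple of x up to an element of a
  zero space W.\<close>

theorem fixed_unique:
  assumes v0: "fixed v0" "v0 \<noteq> 0" 
  shows "eigen v0" "\<exists>c. Nm (s v0) = scale c v0" "fixed y \<Longrightarrow> \<exists>a. y = scale a v0"
proof -
  have "\<exists>x\<in>{x. fixed x}. x \<noteq> 0 \<and> eigen x \<and> (\<exists>c. Nm (s x) = scale c x)"
    by (rule Hecke_eigenvector[OF subspace_fixed _ _ _ _ v0(2)]) (auto simp: HH_fixed Nm_fixed v0)
  then obtain x c where x: "fixed x" "x \<noteq> 0" "eigen x" "Nm (s x) = scale c x" by blast
  note xx = x(1,3,2,4)
  have one: "\<exists>a. y = scale a x" if y: "fixed y" for y
  proof (cases "c = 0")
    case True
    define W where "W = {x. fixed x} \<inter> IU"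
    have N0: "Nm y = 0" for y using Nm_multiple[OF xx, of y] True by auto
    have W0: "W = {0}"
    proof (rule ccontr)
      assume "W \<noteq> {0}"
      moreover have W: "subspace W" unfolding W_def by (intro subspace_inter subspace_fixed subspace_IU)
      ultimately obtain w where w: "w \<in> W" "w \<noteq> 0" using subspace_0 by blast
      have "\<exists>x\<in>W. x \<noteq> 0 \<and> eigen x \<and> (\<exists>c. Nm (s x) = scale c x)"
        by (rule Hecke_eigenvector[OF W _ _ _ w]) (use subspace_0[OF W] in \<open>auto simp: W_def HH_fixed HH_IU N0\<close>)
      then obtain z c where "z \<in> W" "z \<noteq> 0" "eigen z" "Nm (s z) = scale c z" by blast
      then show False using eigen_not_IU[of z c] by (auto simp: W_def)
    qed
    obtain a where "y - scale a x \<in> IU" using eigen_generates[OF xx] by blast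
    moreover have "fixed (y - scale a x)"
      using subspace_diff[OF subspace_fixed] subspace_scale[OF subspace_fixed] y x(1) by auto
    ultimately have "y - scale a x \<in> W" by (simp add: W_def)
    then show ?thesis using W0 by auto
  next
    case False
    define W where "W = {z. fixed z \<and> Nm (s z) = 0}"
    have W: "subspace W"
      using subspace_fixed unfolding W_def
      by (intro subspaceI) (auto simp: op_0 op_add op_scale Nm_0 Nm_add Nm_scale dest: subspace_0 subspace_add subspace_scale)
    have W0: "W = {0}"
    proof (rule ccontr)
      assume "W \<noteq> {0}"
      then obtain w where w: "w \<in> W" "w \<noteq> 0" using subspace_0[OF W] by blast
      have HW: "h z \<in> W" if h: "h \<in> HH" and z: "z \<in> W" for h z
      proof -
        obtain k where k: "k \<in> HH" "\<forall>x. k (s x) = s (h x)"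
        proof -
          obtain k where k: "k \<in> HH" "\<forall>x. h (s x) = s (k x)" using s_HH[OF h] by blast
          then have "\<forall>x. k (s x) = s (h x)" by (metis s_s)
          then show ?thesis using that k(1) by blast
        qed
        then have "Nm (s (h z)) = k (Nm (s z))" by (simp add: HH_Nm)
        then show ?thesis using z h k by (simp add: W_def HH_fixed op_0)
      qed
      have "\<exists>x\<in>W. x \<noteq> 0 \<and> eigen x \<and> (\<exists>c. Nm (s x) = scale c x)"
        by (rule Hecke_eigenvector[OF W _ _ _ w]) (use subspace_0[OF W] HW in \<open>auto simp: W_def\<close>)
      then obtain z c where z: "z \<in> W" "z \<noteq> 0" "eigen z" "Nm (s z) = scale c z" by blast
      then have "Nm (s x) = 0"
        using Nm_multiple[of z 0 "s x"] by (auto simp: W_def)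
      then show False using x False by simp
    qed
    obtain a where a: "Nm (s y) = scale (a * c) x" using Nm_multiple[OF xx] by blast
    have "y - scale a x \<in> W" unfolding W_def
      using subspace_diff[OF subspace_fixed] subspace_scale[OF subspace_fixed] y x(1) a
        Nm_add[of "s (y - scale a x)" "s (scale a x)"]
      by (auto simp: op_diff op_scale Nm_scale x(4))
    then show ?thesis using W0 by auto
  qed
  obtain a where a: "v0 = scale a x" using one[OF v0(1)] by blast
  have a0: "a \<noteq> 0" using a v0(2) by auto
  then have xa: "x = scale (inverse a) v0" by (simp add: a)
  show "eigen v0" unfolding eigen_def a
  proof
    fix h assume h: "h \<in> HH"
    then obtain c where "h x = scale c x" using x(3) by (auto simp: eigen_def)
    then have "h (scale a x) = scale c (scale a x)" using h by (simp add: op_scale mult.commute)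
    then show "\<exists>c. h (scale a x) = scale c (scale a x)" ..
  qed
  show "\<exists>c. Nm (s v0) = scale c v0"
    by (intro exI[of _ c]) (simp add: a op_scale Nm_scale x(4) mult.commute)
  show "\<exists>a. y = scale a v0" if "fixed y"
    using one[OF that] xa by (metis scale_scale)
qed

text \<open>The last part is the nondegeneracy behind the injectivity of the Hecke operator. The
  vectors whose unipotent orbit stays in \<open>IU\<close> form a stable subspace; if it were
  nonzero it would contain a fixed vector, that is a multiple of v0, and v0 is not in
  \<open>IU\<close>.\<close>

theorem coinvariants:
  assumes v0: "fixed v0" "v0 \<noteq> 0"
  shows "v0 \<notin> IU" "\<exists>a. y - scale a v0 \<in> IU" "(\<And>A. A \<in> UU \<Longrightarrow> A y \<in> IU) \<Longrightarrow> y = 0"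
proof -
  obtain c where c: "Nm (s v0) = scale c v0" using fixed_unique(2)[OF v0] by blast
  show v0I: "v0 \<notin> IU" by (rule eigen_not_IU[OF v0(1) fixed_unique(1)[OF v0] v0(2) c])
  show "\<exists>a. y - scale a v0 \<in> IU" by (rule eigen_generates[OF v0(1) fixed_unique(1)[OF v0] v0(2) c])
  assume y: "\<And>A. A \<in> UU \<Longrightarrow> A y \<in> IU"
  define Z where "Z = {z. \<forall>A\<in>UU. A z \<in> IU}"
  show "y = 0"
  proof (rule ccontr)
    assume y0: "y \<noteq> 0"
    have "subspace Z" using subspace_IU unfolding Z_def
      by (intro subspaceI) (auto simp: op_0 op_add op_scale dest: subspace_0 subspace_add subspace_scale)
    moreover have "A z \<in> Z" if A: "A \<in> UU" and z: "z \<in> Z" for A z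
      unfolding Z_def
    proof (rule CollectI, rule ballI)
      fix B assume "B \<in> UU"
      then have "(B \<circ> A) z \<in> IU" using UU_comp[OF _ A] z unfolding Z_def by blast
      then show "B (A z) \<in> IU" by simp
    qed
    moreover have "y \<in> Z" using y by (simp add: Z_def)
    ultimately obtain x where x: "x \<in> Z" "x \<noteq> 0" "\<forall>A\<in>UU. A x = x" using UU_fixed_vector[of Z y] y0 by blast
    then obtain a where a: "x = scale a v0" using fixed_unique(3)[OF v0, of x] by (auto simp: fixed_def)
    have "x \<in> IU" using x UU_id by (force simp: Z_def)
    moreover have "a \<noteq> 0" using a x(2) by auto
    ultimately have "scale (inverse a) x \<in> IU" using subspace_scale[OF subspace_IU] by blast
    then show False using v0I \<open>a \<noteq> 0\<close> by (simp add: a)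
  qed
qed

end

section \<open>The topology of the unitary group and compactness\<close>

text \<open>Adds the arithmetic of the local field: residue characteristic, completeness and, as
  \<open>digits\<close>, finiteness of the residue field. The unit \<delta> of trace zero supplies
  an element of N that is nontrivial modulo the maximal ideal.\<close>

locale local_unitary = valued_involution v bar \<pi>
  for v :: "'e::field \<Rightarrow> int" and bar :: "'e \<Rightarrow> 'e" and \<pi> :: 'e +
  fixes \<delta> :: 'e and p :: nat
  assumes prime_p: "prime p" and vge_p: "vge 4 (of_nat p)" and complete: "valuation_complete v"
    and digits: "\<exists>D. finite D \<and> (\<forall>x. vge 0 x \<longrightarrow> (\<exists>d\<in>D. vge 4 (x - d)))"
    and bar_delta: "bar \<delta> = - \<delta>" and delta_nonzero: "\<delta> \<noteq> 0" and v_delta: "v \<delta> = 0"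
begin

text \<open>Changing the point R changes each bound by at most 2 |R|, so every point of the
  apartment induces the same topology.\<close>

lemma MM_0_I: "g \<in> MM 0 0 (c + 2 * \<bar>R\<bar>) \<Longrightarrow> g \<in> MM R R c"
  unfolding MM_iff by (auto elim!: vge_mono)

lemma MM_0_D: "g \<in> MM R R c \<Longrightarrow> g \<in> MM 0 0 (c - 2 * \<bar>R\<bar>)"
  unfolding MM_iff by (auto elim!: vge_mono)

lemma vge_ex: "\<exists>n. vge n x"
  by (auto simp: vge_def intro!: exI[of _ "4 * v x"])

lemma MM_ex: "\<exists>b. g \<in> MM 0 0 b"
proof -
  have "\<forall>i j. \<exists>n. vge n (g$i$j)" using vge_ex by blast
  then obtain n where n: "\<And>i j. vge (n i j) (g$i$j)" by metis
  define b where "b = Min (range (\<lambda>(i,j). n i j))"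
  have bn: "b \<le> n i j" for i j
    unfolding b_def by (rule Min_le) auto
  then have "g \<in> MM 0 0 b" by (simp add: MM_def vge_mono[OF n bn])
  then show ?thesis ..
qed

lemma frac_MM: "(\<forall>i j. h $ i $ j - g $ i $ j \<in> frac_ideal v m) \<longleftrightarrow> h - g \<in> MM 0 0 (4 * m)"
  by (simp add: MM_def vge_frac_ideal)

lemma istopology_Utop: "istopology (\<lambda>U. U \<subseteq> GG \<and>
     (\<forall>g\<in>U. \<exists>m. \<forall>h\<in>GG. (\<forall>i j. h $ i $ j - g $ i $ j \<in> frac_ideal v m) \<longrightarrow> h \<in> U))"
  unfolding istopology_def frac_MM
proof (intro conjI allI impI)
  fix S T assume S: "S \<subseteq> GG \<and> (\<forall>g\<in>S. \<exists>m. \<forall>h\<in>GG. h - g \<in> MM 0 0 (4 * m) \<longrightarrow> h \<in> S)"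
    and T: "T \<subseteq> GG \<and> (\<forall>g\<in>T. \<exists>m. \<forall>h\<in>GG. h - g \<in> MM 0 0 (4 * m) \<longrightarrow> h \<in> T)"
  show "S \<inter> T \<subseteq> GG" using S by blast
  show "\<forall>g\<in>S \<inter> T. \<exists>m. \<forall>h\<in>GG. h - g \<in> MM 0 0 (4 * m) \<longrightarrow> h \<in> S \<inter> T"
  proof
    fix g assume g: "g \<in> S \<inter> T"
    obtain m where m: "\<forall>h\<in>GG. h - g \<in> MM 0 0 (4 * m) \<longrightarrow> h \<in> S" using S g by blast
    obtain n where n: "\<forall>h\<in>GG. h - g \<in> MM 0 0 (4 * n) \<longrightarrow> h \<in> T" using T g by blast
    have "h - g \<in> MM 0 0 (4 * m) \<and> h - g \<in> MM 0 0 (4 * n)" if "h - g \<in> MM 0 0 (4 * max m n)" for h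
      using that by (auto elim: MM_mono)
    then show "\<exists>m. \<forall>h\<in>GG. h - g \<in> MM 0 0 (4 * m) \<longrightarrow> h \<in> S \<inter> T"
      using m n by (intro exI[of _ "max m n"]) blast
  qed
next
  fix K assume K: "\<forall>S\<in>K. S \<subseteq> GG \<and> (\<forall>g\<in>S. \<exists>m. \<forall>h\<in>GG. h - g \<in> MM 0 0 (4 * m) \<longrightarrow> h \<in> S)"
  then show "\<Union> K \<subseteq> GG" by blast
  show "\<forall>g\<in>\<Union> K. \<exists>m. \<forall>h\<in>GG. h - g \<in> MM 0 0 (4 * m) \<longrightarrow> h \<in> \<Union> K"
  proof
    fix g assume "g \<in> \<Union> K"
    then obtain S where S: "S \<in> K" "g \<in> S" by blast
    then obtain m where "\<forall>h\<in>GG. h - g \<in> MM 0 0 (4 * m) \<longrightarrow> h \<in> S" using K by blast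
    then show "\<exists>m. \<forall>h\<in>GG. h - g \<in> MM 0 0 (4 * m) \<longrightarrow> h \<in> \<Union> K" using S(1) by (intro exI[of _ m]) blast
  qed
qed

lemma openin_Utop: "openin (Utop v bar) U \<longleftrightarrow>
    U \<subseteq> GG \<and> (\<forall>g\<in>U. \<exists>c. \<forall>h\<in>GG. h - g \<in> MM 0 0 c \<longrightarrow> h \<in> U)"
proof -
  have "openin (Utop v bar) U \<longleftrightarrow> U \<subseteq> GG \<and> (\<forall>g\<in>U. \<exists>m. \<forall>h\<in>GG. h - g \<in> MM 0 0 (4 * m) \<longrightarrow> h \<in> U)"
    using fun_cong[OF topology_inverse'[OF istopology_Utop], of U] by (simp only: Utop_def frac_MM)
  moreover have "(\<exists>m. \<forall>h\<in>GG. h - g \<in> MM 0 0 (4 * m) \<longrightarrow> h \<in> U) \<longleftrightarrow> (\<exists>c. \<forall>h\<in>GG. h - g \<in> MM 0 0 c \<longrightarrow> h \<in> U)" for g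
  proof
    assume "\<exists>c. \<forall>h\<in>GG. h - g \<in> MM 0 0 c \<longrightarrow> h \<in> U"
    then obtain c where c: "\<forall>h\<in>GG. h - g \<in> MM 0 0 c \<longrightarrow> h \<in> U" ..
    have "h - g \<in> MM 0 0 c" if "h - g \<in> MM 0 0 (4 * \<bar>c\<bar>)" for h using that by (rule MM_mono) simp
    then show "\<exists>m. \<forall>h\<in>GG. h - g \<in> MM 0 0 (4 * m) \<longrightarrow> h \<in> U" using c by blast
  qed blast
  ultimately show ?thesis by simp
qed

lemma topspace_Utop: "topspace (Utop v bar) = GG"
proof
  show "topspace (Utop v bar) \<subseteq> GG" using openin_Utop openin_topspace by metis
  have "openin (Utop v bar) GG" by (auto simp: openin_Utop)
  then show "GG \<subseteq> topspace (Utop v bar)" by (rule openin_subset)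
qed

lemma near_MM: assumes "\<And>g. g \<in> S \<Longrightarrow> g \<in> GG" "\<And>g h. g \<in> S \<Longrightarrow> h \<in> GG \<Longrightarrow> h - g \<in> MM R R c \<Longrightarrow> h \<in> S"
  shows "openin (Utop v bar) S"
  unfolding openin_Utop using assms MM_0_I by blast

lemma KP_near: "g \<in> KP R c \<Longrightarrow> h \<in> GG \<Longrightarrow> h - g \<in> MM R R c \<Longrightarrow> h \<in> KP R c"
  using MM_add[of "h - g" R R c "g - mat 1"] by (simp add: KP_def)

lemma PP_near: "g \<in> PP R \<Longrightarrow> h \<in> GG \<Longrightarrow> h - g \<in> MM R R 0 \<Longrightarrow> h \<in> PP R"
  using MM_add[of "h - g" R R 0 g] by (simp add: PP_def)

lemma openin_KP: "openin (Utop v bar) (KP R c)"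
  by (rule near_MM[of "KP R c" R c]) (erule KP_GG, erule KP_near)

lemma openin_PP: "openin (Utop v bar) (PP R)"
  by (rule near_MM[of "PP R" R 0]) (erule PP_GG, erule PP_near)

lemma openin_right_translate:
  assumes U: "openin (Utop v bar) U" and x: "x \<in> GG"
  shows "openin (Utop v bar) ((\<lambda>u. u ** x) ` U)"
  unfolding openin_Utop
proof (intro conjI ballI)
  show "(\<lambda>u. u ** x) ` U \<subseteq> GG" using U x by (auto simp: openin_Utop intro!: mult_GG)
  fix g assume "g \<in> (\<lambda>u. u ** x) ` U"
  then obtain u where u: "u \<in> U" "g = u ** x" by blast
  obtain c where c: "\<forall>h\<in>GG. h - u \<in> MM 0 0 c \<longrightarrow> h \<in> U" using U u(1) by (auto simp: openin_Utop)
  obtain b where b: "star x \<in> MM 0 0 b" using MM_ex by blast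
  show "\<exists>c. \<forall>h\<in>GG. h - g \<in> MM 0 0 c \<longrightarrow> h \<in> (\<lambda>u. u ** x) ` U"
  proof (intro exI[of _ "c - b"] ballI impI)
    fix h assume h: "h \<in> GG" "h - g \<in> MM 0 0 (c - b)"
    have "(h - g) ** star x \<in> MM 0 0 (c - b + b)" by (rule MM_mult[OF h(2) b])
    moreover have "(h - g) ** star x = h ** star x - u"
      using x by (simp add: matrix_sub_rdistrib u(2) star_cancel')
    ultimately have "h ** star x \<in> U" using c h x by (simp add: mult_GG star_GG)
    moreover have "h = (h ** star x) ** x" using x by (simp add: star_cancel')
    ultimately show "h \<in> (\<lambda>u. u ** x) ` U" by blast
  qed
qed

lemma nbhd_KP: assumes U: "openin (Utop v bar) U" "mat 1 \<in> U" shows "\<exists>c\<ge>1. KP R c \<subseteq> U"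
proof -
  obtain c where c: "\<forall>h\<in>GG. h - mat 1 \<in> MM 0 0 c \<longrightarrow> h \<in> U" using U by (auto simp: openin_Utop)
  have "KP R (\<bar>c\<bar> + 2 * \<bar>R\<bar> + 1) \<subseteq> U"
  proof
    fix h assume h: "h \<in> KP R (\<bar>c\<bar> + 2 * \<bar>R\<bar> + 1)"
    then have "h - mat 1 \<in> MM 0 0 (\<bar>c\<bar> + 2 * \<bar>R\<bar> + 1 - 2 * \<bar>R\<bar>)" by (intro MM_0_D) (simp add: KP_def)
    then have "h - mat 1 \<in> MM 0 0 c" by (rule MM_mono) simp
    then show "h \<in> U" using c h KP_GG by blast
  qed
  then show ?thesis by (intro exI[of _ "\<bar>c\<bar> + 2 * \<bar>R\<bar> + 1"]) auto
qed

text \<open>Digit expansions: each further digit refines the net by one power of the uniformizer and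
  keeps it finite.\<close>

lemma scalar_net: "\<exists>F. finite F \<and> (\<forall>x. vge (4 * k) x \<longrightarrow> (\<exists>y\<in>F. vge (4 * (k + int n)) (x - y)))"
proof (induction n)
  case 0
  show ?case by (intro exI[of _ "{0}"]) auto
next
  case (Suc n)
  then obtain F where F: "finite F" "\<And>x. vge (4 * k) x \<Longrightarrow> \<exists>y\<in>F. vge (4 * (k + int n)) (x - y)" by blast
  obtain D where D: "finite D" "\<And>x. vge 0 x \<Longrightarrow> \<exists>d\<in>D. vge 4 (x - d)" using digits by blast
  define q where "q = \<pi> powi (k + int n)"
  have q: "q * \<pi> powi (- (k + int n)) = 1" unfolding q_def by (subst power_int_add[symmetric]) auto
  show ?case
  proof (intro exI conjI allI impI)
    show "finite ((\<lambda>(y, d). y + q * d) ` (F \<times> D))" using F(1) D(1) by simp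
    fix x assume "vge (4 * k) x"
    then obtain y where y: "y \<in> F" "vge (4 * (k + int n)) (x - y)" using F(2) by blast
    have "vge (4 * (k + int n) + 4 * (- (k + int n))) ((x - y) * \<pi> powi (- (k + int n)))"
      using y(2) by (intro vge_mult; simp only: vge_pi_power_int order_refl)
    then have "vge 0 ((x - y) * \<pi> powi (- (k + int n)))" by (rule vge_mono) simp
    then obtain d where d: "d \<in> D" "vge 4 ((x - y) * \<pi> powi (- (k + int n)) - d)" using D(2) by blast
    have "vge (4 * (k + int n) + 4) (q * ((x - y) * \<pi> powi (- (k + int n)) - d))"
      using d(2) by (intro vge_mult; simp add: vge_pi_power_int q_def)
    moreover have "q * ((x - y) * r - d) = x - (y + q * d)" if "q * r = 1" for r
    proof -
      have "q * ((x - y) * r - d) = (q * r) * (x - y) - q * d" by (simp add: algebra_simps)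
      then show ?thesis using that by simp
    qed
    note this[OF q]
    ultimately have "vge (4 * (k + int n) + 4) (x - (y + q * d))" by (simp only:)
    then have "vge (4 * (k + int (Suc n))) (x - (y + q * d))" by (rule vge_mono) simp
    then show "\<exists>y\<in>(\<lambda>(y, d). y + q * d) ` (F \<times> D). vge (4 * (k + int (Suc n))) (x - y)"
      using y(1) d(1) by force
  qed
qed

lemma finite_matrices: assumes "finite F" shows "finite {M :: 'e^3^3. \<forall>i j. M$i$j \<in> F}"
proof -
  have "{M :: 'e^3^3. \<forall>i j. M$i$j \<in> F} \<subseteq> (\<lambda>f. \<chi> i j. f (i, j)) ` (UNIV \<rightarrow>\<^sub>E F)"
  proof
    fix M assume "M \<in> {M :: 'e^3^3. \<forall>i j. M$i$j \<in> F}"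
    then have "M = (\<chi> i j. (\<lambda>(i, j). M$i$j) (i, j))" "(\<lambda>(i, j). M$i$j) \<in> UNIV \<rightarrow>\<^sub>E F" by (auto simp: vec_eq_iff)
    then show "M \<in> (\<lambda>f. \<chi> i j. f (i, j)) ` (UNIV \<rightarrow>\<^sub>E F)" by blast
  qed
  then show ?thesis using assms by (meson finite_PiE finite_UNIV finite_imageI finite_subset finite_code)
qed

lemma matrix_net: "\<exists>F. finite F \<and> (\<forall>Z\<in>MM 0 0 b. \<exists>Y\<in>F. Z - Y \<in> MM 0 0 c)"
proof -
  define k where "k = - \<bar>b\<bar>"
  obtain F where F: "finite F" "\<And>x. vge (4 * k) x \<Longrightarrow> \<exists>y\<in>F. vge (4 * (k + int (nat (\<bar>c\<bar> - k)))) (x - y)"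
    using scalar_net[of k "nat (\<bar>c\<bar> - k)"] by blast
  show ?thesis
  proof (intro exI conjI ballI)
    show "finite {M :: 'e^3^3. \<forall>i j. M$i$j \<in> F}" by (rule finite_matrices[OF F(1)])
    fix Z assume "Z \<in> MM 0 0 b"
    then have "vge b (Z$i$j)" for i j by (simp add: MM_def)
    then have "vge (4 * k) (Z$i$j)" for i j by (rule vge_mono) (simp add: k_def)
    then have "\<exists>y\<in>F. vge (4 * (k + int (nat (\<bar>c\<bar> - k)))) (Z$i$j - y)" for i j using F(2) by blast
    then obtain y where y: "\<And>i j. y i j \<in> F" "\<And>i j. vge (4 * (k + int (nat (\<bar>c\<bar> - k)))) (Z$i$j - y i j)" by metis
    have "vge c (Z$i$j - y i j)" for i j using y(2)[of i j] by (rule vge_mono) (auto simp: k_def)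
    then have "Z - (\<chi> i j. y i j) \<in> MM 0 0 c" by (simp add: MM_def)
    then show "\<exists>Y\<in>{M :: 'e^3^3. \<forall>i j. M$i$j \<in> F}. Z - Y \<in> MM 0 0 c" using y(1) by (intro bexI) auto
  qed
qed

lemma matrix_Cauchy_limit:
  fixes g :: "nat \<Rightarrow> 'e^3^3"
  assumes "\<And>n m. n \<le> m \<Longrightarrow> g m - g n \<in> MM 0 0 (int n)"
  shows "\<exists>l. \<forall>c. \<exists>M. \<forall>n\<ge>M. g n - l \<in> MM 0 0 c"
proof -
  have ex: "\<exists>l. \<forall>k. \<exists>M. \<forall>n\<ge>M. g n $ i $ j - l \<in> frac_ideal v k" for i j
  proof -
    define s where "s = (\<lambda>n. g n $ i $ j)"
    have "\<forall>k. \<exists>M. \<forall>m\<ge>M. \<forall>n\<ge>M. s m - s n \<in> frac_ideal v k"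
    proof (rule allI)
      fix k :: int
      show "\<exists>M. \<forall>m\<ge>M. \<forall>n\<ge>M. s m - s n \<in> frac_ideal v k"
      proof (intro exI allI impI)
        fix m n :: nat assume mn: "nat (4 * \<bar>k\<bar>) \<le> m" "nat (4 * \<bar>k\<bar>) \<le> n"
        have "(g m - g (nat (4 * \<bar>k\<bar>))) - (g n - g (nat (4 * \<bar>k\<bar>))) \<in> MM 0 0 (int (nat (4 * \<bar>k\<bar>)))"
          by (intro MM_diff assms mn)
        then have "(g m - g (nat (4 * \<bar>k\<bar>))) - (g n - g (nat (4 * \<bar>k\<bar>))) \<in> MM 0 0 (4 * k)" by (rule MM_mono) simp
        then have "g m - g n \<in> MM 0 0 (4 * k)" by simp
        then show "s m - s n \<in> frac_ideal v k" by (simp add: MM_def vge_frac_ideal s_def)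
      qed
    qed
    from mp[OF spec[OF complete[unfolded valuation_complete_def], of s] this]
    show ?thesis unfolding s_def .
  qed
  define l where "l i j = (SOME l. \<forall>k. \<exists>M. \<forall>n\<ge>M. g n $ i $ j - l \<in> frac_ideal v k)" for i j
  have lA: "\<forall>k. \<exists>M. \<forall>n\<ge>M. g n $ i $ j - l i j \<in> frac_ideal v k" for i j
    unfolding l_def by (rule someI_ex[OF ex])
  note l = spec[OF lA]
  have "\<exists>M. \<forall>n\<ge>M. g n - (\<chi> i j. l i j) \<in> MM 0 0 c" for c
  proof -
    define M where "M i j = (SOME M. \<forall>n\<ge>M. g n $ i $ j - l i j \<in> frac_ideal v \<bar>c\<bar>)" for i j
    have M: "\<forall>n\<ge>M i j. g n $ i $ j - l i j \<in> frac_ideal v \<bar>c\<bar>" for i j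
      unfolding M_def by (rule someI_ex[OF l])
    have "M i j \<le> Max (range (\<lambda>(i,j). M i j))" for i j by (rule Max_ge) auto
    then have "\<forall>n\<ge>Max (range (\<lambda>(i,j). M i j)). \<forall>i j. vge (4 * \<bar>c\<bar>) (g n $ i $ j - l i j)"
      using M unfolding vge_frac_ideal by (meson order_trans)
    then have "\<forall>n\<ge>Max (range (\<lambda>(i,j). M i j)). g n - (\<chi> i j. l i j) \<in> MM 0 0 c"
      by (auto simp: MM_def intro: vge_mono[of "4 * \<bar>c\<bar>"])
    then show ?thesis ..
  qed
  then show ?thesis by blast
qed

text \<open>Bounded closed sets are totally bounded by \<open>matrix_net\<close>, and the matrices
  are complete. A set without finite subcover contains arbitrarily small pieces without one; a
  nested sequence of such pieces has centres converging to a point of S, and the member of the cover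
  containing this point swallows a whole piece.\<close>

lemma compactin_Utop:
  assumes S: "S \<subseteq> GG" and bd: "S \<subseteq> MM 0 0 b"
    and cl: "\<And>g. (\<And>c. \<exists>h\<in>S. h - g \<in> MM 0 0 c) \<Longrightarrow> g \<in> S"
  shows "compactin (Utop v bar) S"
  unfolding compactin_def topspace_Utop
proof (intro conjI S allI impI)
  fix \<U> assume U: "(\<forall>U\<in>\<U>. openin (Utop v bar) U) \<and> S \<subseteq> \<Union> \<U>"
  define good where "good T \<longleftrightarrow> (\<exists>\<F>. finite \<F> \<and> \<F> \<subseteq> \<U> \<and> T \<subseteq> \<Union> \<F>)" for T
  have good_2: "good (A \<union> B)" if "good A" "good B" for A B
  proof -
    from that(1) obtain \<F> where 1: "finite \<F>" "\<F> \<subseteq> \<U>" "A \<subseteq> \<Union> \<F>" unfolding good_def by blast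
    from that(2) obtain \<F>' where 2: "finite \<F>'" "\<F>' \<subseteq> \<U>" "B \<subseteq> \<Union> \<F>'" unfolding good_def by blast
    show ?thesis unfolding good_def
      by (intro exI[of _ "\<F> \<union> \<F>'"] conjI finite_UnI 1(1) 2(1)) (use 1(2,3) 2(2,3) in auto)
  qed
  have good_Un: "good (\<Union>Y\<in>F. T Y)" if F: "finite F" "\<forall>Y\<in>F. good (T Y)" for F :: "('e^3^3) set" and T
    using F
  proof (induction F)
    case empty
    show ?case unfolding good_def by (intro exI[of _ "{}"]) auto
  next
    case (insert Y F)
    then have "good (T Y \<union> (\<Union>Y\<in>F. T Y))" by (intro good_2) auto
    then show ?case by simp
  qed
  have good_sub: "good T" if "good T'" "T \<subseteq> T'" for T T' using that unfolding good_def by blast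
  have step: "\<exists>g\<in>T. \<not> good {h\<in>T. h - g \<in> MM 0 0 c}" if T: "T \<subseteq> S" "\<not> good T" for T c
  proof -
    obtain F where F: "finite F" "\<forall>Z\<in>MM 0 0 b. \<exists>Y\<in>F. Z - Y \<in> MM 0 0 c" using matrix_net by blast
    have "T \<subseteq> (\<Union>Y\<in>F. {h\<in>T. h - Y \<in> MM 0 0 c})" using F(2) T bd by blast
    then have "\<not> good (\<Union>Y\<in>F. {h\<in>T. h - Y \<in> MM 0 0 c})" using T(2) good_sub by blast
    then have "\<not> (\<forall>Y\<in>F. good {h\<in>T. h - Y \<in> MM 0 0 c})" using good_Un[OF F(1), of "\<lambda>Y. {h\<in>T. h - Y \<in> MM 0 0 c}"] by argo
    then obtain Y where Y: "Y \<in> F" "\<not> good {h\<in>T. h - Y \<in> MM 0 0 c}" by blast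
    then obtain g where g: "g \<in> T" "g - Y \<in> MM 0 0 c" by (auto simp: good_def)
    have "{h\<in>T. h - Y \<in> MM 0 0 c} \<subseteq> {h\<in>T. h - g \<in> MM 0 0 c}"
    proof clarify
      fix h assume "h - Y \<in> MM 0 0 c"
      then have "(h - Y) - (g - Y) \<in> MM 0 0 c" using g(2) by (rule MM_diff)
      then show "h - g \<in> MM 0 0 c" by simp
    qed
    then show ?thesis using Y(2) g(1) good_sub by blast
  qed
  have "good S"
  proof (rule ccontr)
    assume nS: "\<not> good S"
    \<comment> \<open>A stage is a pair of a piece without finite subcover and a point near all of
      it; Q makes the stages nested, with the next point inside the current piece, so that the
      points form a Cauchy sequence.\<close>
    define P where "P = (\<lambda>(n::nat) (Tg::('e^3^3) set \<times> ('e^3^3)). fst Tg \<subseteq> S \<and> \<not> good (fst Tg) \<and> snd Tg \<in> S \<and> (\<forall>h\<in>fst Tg. h - snd Tg \<in> MM 0 0 (int n)))"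
    define Q where "Q = (\<lambda>(n::nat) (Tg::('e^3^3) set \<times> ('e^3^3)) (Tg'::('e^3^3) set \<times> ('e^3^3)). fst Tg' \<subseteq> fst Tg \<and> snd Tg' \<in> fst Tg)"
    have nxt: "\<exists>Tg. P n Tg \<and> fst Tg \<subseteq> T \<and> snd Tg \<in> T" if T: "T \<subseteq> S" "\<not> good T" for T n
    proof -
      obtain g where "g \<in> T" "\<not> good {h\<in>T. h - g \<in> MM 0 0 (int n)}" using step[OF T] by blast
      then show ?thesis using T by (intro exI[of _ "({h\<in>T. h - g \<in> MM 0 0 (int n)}, g)"]) (auto simp: P_def)
    qed
    have "\<exists>f. \<forall>n. P n (f n) \<and> Q n (f n) (f (Suc n))"
    proof (rule dependent_nat_choice)
      show "\<exists>x. P 0 x" using nxt[OF order_refl nS] by blast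
      fix x n assume "P n x"
      then show "\<exists>y. P (Suc n) y \<and> Q n x y" using nxt[of "fst x" "Suc n"] by (auto simp: P_def Q_def)
    qed
    then obtain f where P: "\<And>n. P n (f n)" and Q: "\<And>n. Q n (f n) (f (Suc n))" by blast
    define g where "g = (\<lambda>n. snd (f n))"
    have dec: "fst (f (n + k)) \<subseteq> fst (f n)" for n k
      by (induction k) (use Q in \<open>auto simp: Q_def\<close>)
    have gin: "g m \<in> fst (f n)" if "n < m" for n m
    proof -
      from less_imp_Suc_add[OF that] obtain k where "m = Suc (n + k)" by blast
      then show ?thesis using Q[of "n + k"] dec[of n k] by (auto simp: Q_def g_def)
    qed
    have cauchy: "g m - g n \<in> MM 0 0 (int n)" if "n \<le> m" for m n
      using that gin[of n m] P[of n] by (cases "n = m") (auto simp: P_def g_def)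
    have "\<exists>l. \<forall>c. \<exists>M. \<forall>n\<ge>M. g n - l \<in> MM 0 0 c"
      by (rule matrix_Cauchy_limit) (rule cauchy)
    then obtain l where l': "\<forall>c. \<exists>M. \<forall>n\<ge>M. g n - l \<in> MM 0 0 c" by (elim exE)
    note l = spec[OF l']
    have gS: "g n \<in> S" for n using P[of n] by (simp add: P_def g_def)
    have "l \<in> S"
    proof (rule cl)
      fix c
      obtain M where "\<forall>n\<ge>M. g n - l \<in> MM 0 0 c" using l[of c] by (elim exE)
      then have "g M - l \<in> MM 0 0 c" by simp
      then show "\<exists>h\<in>S. h - l \<in> MM 0 0 c" using gS[of M] by (rule rev_bexI[rotated])
    qed
    then obtain O' where O': "O' \<in> \<U>" "l \<in> O'" using U by blast
    then obtain c where c: "\<forall>h\<in>GG. h - l \<in> MM 0 0 c \<longrightarrow> h \<in> O'" using U unfolding openin_Utop by blast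
    obtain M where M: "\<forall>n\<ge>M. g n - l \<in> MM 0 0 c" using l[of c] by (elim exE)
    define n where "n = max M (nat \<bar>c\<bar>)"
    have "h \<in> O'" if h: "h \<in> fst (f n)" for h
    proof -
      have "h - g n \<in> MM 0 0 (int n)" using P[of n] h by (auto simp: P_def g_def)
      then have "h - g n \<in> MM 0 0 c" by (rule MM_mono) (simp add: n_def)
      moreover have "g n - l \<in> MM 0 0 c" using M by (simp add: n_def)
      ultimately have "(h - g n) + (g n - l) \<in> MM 0 0 c" by (rule MM_add)
      then have "h - l \<in> MM 0 0 c" by simp
      moreover have "h \<in> GG" using P[of n] h S by (auto simp: P_def)
      ultimately show ?thesis using c by blast
    qed
    then have "good (fst (f n))" unfolding good_def using O' by (intro exI[of _ "{O'}"]) auto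
    then show False using P[of n] by (simp add: P_def)
  qed
  then show "\<exists>\<F>. finite \<F> \<and> \<F> \<subseteq> \<U> \<and> S \<subseteq> \<Union> \<F>" by (simp add: good_def)
qed

lemma MM_all_eq_0: assumes "\<And>c. g \<in> MM 0 0 c" shows "g = 0"
proof -
  have "g $ i $ j = 0" for i j
  proof (rule ccontr)
    assume "g $ i $ j \<noteq> 0"
    then show False using MM_nth[OF assms[of "4 * v (g$i$j) + 1"], of i j] by (auto simp: vge_def)
  qed
  then show ?thesis by (simp add: vec_eq_iff)
qed

lemma GG_closed:
  assumes "\<And>c. \<exists>h\<in>GG. h - g \<in> MM 0 0 c" shows "g \<in> GG"
proof -
  obtain b where b: "g \<in> MM 0 0 b" using MM_ex by blast
  have "star g ** g - mat 1 \<in> MM 0 0 c" for c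
  proof -
    define d where "d = \<bar>c\<bar> + \<bar>b\<bar>"
    obtain h where h: "h \<in> GG" "h - g \<in> MM 0 0 d" using assms by blast
    have "h - g + g \<in> MM 0 0 (- \<bar>b\<bar>)" by (intro MM_add MM_mono[OF h(2)] MM_mono[OF b]) (auto simp: d_def)
    then have hb: "h \<in> MM 0 0 (- \<bar>b\<bar>)" by simp
    have 1: "star (h - g) ** g \<in> MM 0 0 (d + b)" by (rule MM_mult[OF MM_star[OF h(2)] b])
    have 2: "star h ** (h - g) \<in> MM 0 0 (- \<bar>b\<bar> + d)" by (rule MM_mult[OF MM_star[OF hb] h(2)])
    have "star (h - g) ** g + star h ** (h - g) \<in> MM 0 0 c"
      by (intro MM_add MM_mono[OF 1] MM_mono[OF 2]) (simp_all add: d_def)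
    moreover have "star (h - g) ** g + star h ** (h - g) = star h ** h - star g ** g"
      by (simp add: star_diff matrix_sub_rdistrib matrix_sub_ldistrib)
    moreover have "star h ** h = mat 1" using h(1) by (simp add: mem_GG_iff)
    ultimately have "- (mat 1 - star g ** g) \<in> MM 0 0 c" by (intro MM_minus) simp
    then show ?thesis by simp
  qed
  then have "star g ** g - mat 1 = 0" by (rule MM_all_eq_0)
  then show ?thesis by (simp add: mem_GG_iff)
qed

lemma compactin_KP: assumes "0 \<le> c" shows "compactin (Utop v bar) (KP R c)"
proof (rule compactin_Utop)
  show "KP R c \<subseteq> GG" using KP_GG by blast
  show "KP R c \<subseteq> MM 0 0 (0 - 2 * \<bar>R\<bar>)"
    using KP_subset_PP[OF assms] PP_MM MM_0_D by blast
  fix g assume g: "\<And>d. \<exists>h\<in>KP R c. h - g \<in> MM 0 0 d"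
  have gG: "g \<in> GG" using g KP_GG by (intro GG_closed) blast
  obtain h where h: "h \<in> KP R c" "h - g \<in> MM 0 0 (c + 2 * \<bar>R\<bar>)" using g by blast
  have "- (h - g) \<in> MM R R c" by (rule MM_minus[OF MM_0_I[OF h(2)]])
  then show "g \<in> KP R c" using KP_near[OF h(1) gG] by simp
qed

lemma compactin_PP: "compactin (Utop v bar) (PP R)"
proof (rule compactin_Utop)
  show "PP R \<subseteq> GG" using PP_GG by blast
  show "PP R \<subseteq> MM 0 0 (0 - 2 * \<bar>R\<bar>)" using PP_MM MM_0_D by blast
  fix g assume g: "\<And>d. \<exists>h\<in>PP R. h - g \<in> MM 0 0 d"
  have gG: "g \<in> GG" using g PP_GG by (intro GG_closed) blast
  obtain h where h: "h \<in> PP R" "h - g \<in> MM 0 0 (0 + 2 * \<bar>R\<bar>)" using g by blast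
  have "- (h - g) \<in> MM R R 0" by (rule MM_minus[OF MM_0_I[OF h(2)]])
  then show "g \<in> PP R" using PP_near[OF h(1) gG] by simp
qed

lemma finite_coset_cover:
  assumes C: "compactin (Utop v bar) C" and H: "openin (Utop v bar) H" "mat 1 \<in> H"
  obtains Q where "finite Q" "Q \<subseteq> C" "C \<subseteq> (\<Union>q\<in>Q. (\<lambda>h. h ** q) ` H)"
proof -
  have CG: "C \<subseteq> GG" using compactin_subset_topspace[OF C] by (simp add: topspace_Utop)
  have o: "\<forall>U\<in>(\<lambda>q. (\<lambda>h. h ** q) ` H) ` C. openin (Utop v bar) U"
    using openin_right_translate[OF H(1)] CG by blast
  have "C \<subseteq> \<Union> ((\<lambda>q. (\<lambda>h. h ** q) ` H) ` C)"
  proof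
    fix q assume "q \<in> C"
    moreover have "q \<in> (\<lambda>h. h ** q) ` H" using H(2) by (intro image_eqI[of _ _ "mat 1"]) auto
    ultimately show "q \<in> \<Union> ((\<lambda>q. (\<lambda>h. h ** q) ` H) ` C)" by blast
  qed
  then obtain \<F> where F: "finite \<F>" "\<F> \<subseteq> (\<lambda>q. (\<lambda>h. h ** q) ` H) ` C" "C \<subseteq> \<Union> \<F>"
    using C o unfolding compactin_def by blast
  then obtain Q where Q: "Q \<subseteq> C" "finite Q" "\<F> = (\<lambda>q. (\<lambda>h. h ** q) ` H) ` Q"
    using finite_subset_image[OF F(1,2)] by blast
  then show ?thesis using that F(3) by blast
qed

end

section \<open>Pro-p subgroups and the identification of the groups in the statement\<close>

context local_unitary begin

lemma mat_of_nat_MM: "mat (of_nat n) \<in> MM R R 0" "mat (of_nat p) \<in> MM R R 4"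
  using vge_of_nat[of n] vge_p by (auto simp: MM_def mat_def)

lemma matrix_add_rdist: "(A + B) ** (C::'e^3^3) = A ** C + B ** C"
  by (simp add: vec_eq_iff matrix_matrix_mult_def algebra_simps sum.distrib)

text \<open>The binomial expansion to first order: products of two factors g - 1 lie at depth 2 c,
  which is at least c + 1. For the exponent p the linear term gains depth too, because p is in the
  maximal ideal; this is \<open>KP_pow_p\<close>.\<close>

lemma KP_nat_pow:
  assumes g: "g \<in> KP R c" and c: "1 \<le> c"
  shows "g [^]\<^bsub>Ugrp bar\<^esub> n - mat 1 - mat (of_nat n) ** (g - mat 1) \<in> MM R R (c + 1)"
proof (induction n)
  case 0
  have "(mat 0 :: 'e^3^3) = 0" by (simp add: vec_eq_iff mat_def)
  then show ?case by simp
next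
  case (Suc n)
  define h where "h = g [^]\<^bsub>Ugrp bar\<^esub> n"
  define x where "x = g - mat 1"
  define y where "y = h - mat 1 - mat (of_nat n) ** x"
  have x: "x \<in> MM R R c" using g by (simp add: x_def KP_def)
  have y: "y \<in> MM R R (c + 1)" using Suc by (simp add: y_def h_def x_def)
  have e: "g [^]\<^bsub>Ugrp bar\<^esub> Suc n = h ** g" by (simp add: h_def)
  have m: "(mat (of_nat (Suc n)) :: 'e^3^3) = mat (of_nat n) + mat 1" by (simp add: vec_eq_iff mat_def)
  have h: "h = mat 1 + mat (of_nat n) ** x + y" and gx: "g = mat 1 + x" by (simp_all add: y_def x_def)
  have "h ** g - mat 1 - mat (of_nat (Suc n)) ** x = mat (of_nat n) ** (x ** x) + (y + y ** x)"
    unfolding h gx m by (simp add: matrix_add_ldistrib matrix_add_rdist matrix_mul_assoc algebra_simps)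
  moreover have "mat (of_nat n) ** (x ** x) \<in> MM R R (0 + (c + c))"
    by (rule MM_mult[OF mat_of_nat_MM(1) MM_mult[OF x x]])
  then have "mat (of_nat n) ** (x ** x) \<in> MM R R (c + 1)" by (rule MM_mono) (use c in simp)
  moreover have "y ** x \<in> MM R R (c + 1)" by (rule MM_mono[OF MM_mult[OF y x]]) (use c in simp)
  ultimately have "h ** g - mat 1 - mat (of_nat (Suc n)) ** x \<in> MM R R (c + 1)"
    using y by (simp add: MM_add)
  then show ?case unfolding e x_def .
qed

lemma KP_pow_p: assumes g: "g \<in> KP R c" and c: "1 \<le> c"
  shows "g [^]\<^bsub>Ugrp bar\<^esub> p \<in> KP R (c + 1)"
proof -
  have "g - mat 1 \<in> MM R R c" using g by (simp add: KP_def)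
  then have "mat (of_nat p) ** (g - mat 1) \<in> MM R R (4 + c)" by (rule MM_mult[OF mat_of_nat_MM(2)])
  then have "mat (of_nat p) ** (g - mat 1) \<in> MM R R (c + 1)" by (rule MM_mono) simp
  from MM_add[OF KP_nat_pow[OF g c, of p] this] have "g [^]\<^bsub>Ugrp bar\<^esub> p - mat 1 \<in> MM R R (c + 1)" by simp
  moreover have "g [^]\<^bsub>Ugrp bar\<^esub> p \<in> GG" using KP_GG[OF g] by (rule G.nat_pow_closed)
  ultimately show ?thesis by (simp add: KP_def)
qed

lemma KP_pow_p_power: "g \<in> KP R c \<Longrightarrow> 1 \<le> c \<Longrightarrow> g [^]\<^bsub>Ugrp bar\<^esub> (p ^ j) \<in> KP R (c + int j)"
proof (induction j)
  case (Suc j)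
  have "(g [^]\<^bsub>Ugrp bar\<^esub> (p ^ j)) [^]\<^bsub>Ugrp bar\<^esub> p \<in> KP R (c + int j + 1)"
    by (rule KP_pow_p) (use Suc in auto)
  then show ?case using KP_GG[OF Suc.prems(1)] by (simp add: G.nat_pow_pow mult.commute add.commute add.left_commute)
next
  case 0
  then show ?case using KP_GG[of g] by simp
qed

lemma inv_restrict: "subgroup H (Ugrp bar) \<Longrightarrow> x \<in> H \<Longrightarrow> inv\<^bsub>(Ugrp bar)\<lparr>carrier := H\<rparr>\<^esub> x = star x"
  using G.m_inv_consistent[of H x] subgroup.subset[of H "Ugrp bar"] inv_GG[of x] by auto

lemma group_restrict: "subgroup H (Ugrp bar) \<Longrightarrow> group ((Ugrp bar)\<lparr>carrier := H\<rparr>)"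
  by (rule subgroup.subgroup_is_group[OF _ group_Ugrp])

lemma normal_restrict_iff:
  assumes K: "subgroup K (Ugrp bar)" and N: "subgroup N (Ugrp bar)" "N \<subseteq> K"
  shows "N \<lhd> (Ugrp bar)\<lparr>carrier := K\<rparr> \<longleftrightarrow> (\<forall>k\<in>K. \<forall>n\<in>N. k ** n ** star k \<in> N)"
proof -
  have "subgroup N ((Ugrp bar)\<lparr>carrier := K\<rparr>)" by (rule G.subgroup_incl[OF N(1) K N(2)])
  then show ?thesis
    using group.normal_inv_iff[OF group_restrict[OF K], of N] inv_restrict[OF K] by auto
qed

lemma KP_normal: "0 \<le> c \<Longrightarrow> KP R c \<lhd> (Ugrp bar)\<lparr>carrier := PP R\<rparr>"
  using normal_restrict_iff[OF PP_subgroup KP_subgroup KP_subset_PP] KP_conj by auto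

lemma rcoset_restrict [simp]: "r_coset ((Ugrp bar)\<lparr>carrier := K\<rparr>) H g = (\<lambda>h. h ** g) ` H"
  by (auto simp: r_coset_def)

lemma rcoset_Ugrp: "r_coset (Ugrp bar) H g = (\<lambda>h. h ** g) ` H"
  by (auto simp: r_coset_def)

lemma coset_absorb:
  assumes H: "subgroup H (Ugrp bar)" and h: "h \<in> H" and q: "q \<in> GG"
  shows "(\<lambda>x. x ** (h ** q)) ` H = (\<lambda>x. x ** q) ` H"
proof
  show "(\<lambda>x. x ** (h ** q)) ` H \<subseteq> (\<lambda>x. x ** q) ` H"
  proof (rule image_subsetI)
    fix x assume "x \<in> H"
    then have "x ** h \<in> H" using subgroup.m_closed[OF H _ h] by simp
    then show "x ** (h ** q) \<in> (\<lambda>x. x ** q) ` H" by (intro image_eqI[of _ _ "x ** h"]) (auto simp: matrix_mul_assoc)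
  qed
  have hG: "h \<in> GG" and sh: "star h \<in> H"
    using subgroup.subset[OF H] subgroup.m_inv_closed[OF H h] h inv_GG by auto
  show "(\<lambda>x. x ** q) ` H \<subseteq> (\<lambda>x. x ** (h ** q)) ` H"
  proof (rule image_subsetI)
    fix x assume "x \<in> H"
    then have "x ** star h \<in> H" using subgroup.m_closed[OF H _ sh] by simp
    moreover have "x ** q = x ** star h ** (h ** q)" using hG by (simp add: matrix_mul_assoc star_cancel')
    ultimately show "x ** q \<in> (\<lambda>x. x ** (h ** q)) ` H" by (rule image_eqI[rotated])
  qed
qed

lemma finite_cosets:
  assumes C: "compactin (Utop v bar) C" and H: "openin (Utop v bar) H" "subgroup H (Ugrp bar)"
  shows "finite ((\<lambda>q. (\<lambda>x. x ** q) ` H) ` C)"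
proof -
  have CG: "C \<subseteq> GG" using compactin_subset_topspace[OF C] by (simp add: topspace_Utop)
  have "mat 1 \<in> H" using subgroup.one_closed[OF H(2)] by simp
  then obtain Q where Q: "finite Q" "Q \<subseteq> C" "C \<subseteq> (\<Union>q\<in>Q. (\<lambda>h. h ** q) ` H)"
    by (rule finite_coset_cover[OF C H(1)])
  have "(\<lambda>q. (\<lambda>x. x ** q) ` H) ` C \<subseteq> (\<lambda>q. (\<lambda>x. x ** q) ` H) ` Q"
  proof (rule image_subsetI)
    fix k assume "k \<in> C"
    then obtain q h where qh: "q \<in> Q" "h \<in> H" "k = h ** q" using Q(3) by auto
    then have "(\<lambda>x. x ** k) ` H = (\<lambda>x. x ** q) ` H"
      using coset_absorb[OF H(2) qh(2), of q] Q(2) CG by auto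
    then show "(\<lambda>x. x ** k) ` H \<in> (\<lambda>q. (\<lambda>x. x ** q) ` H) ` Q" using qh(1) by (rule image_eqI)
  qed
  then show ?thesis using Q(1) by (meson finite_imageI finite_subset)
qed

text \<open>An open normal subgroup contains some deeper filtration group, and repeated p-th powers
  descend into it. So every element of the finite quotient has p-power order.\<close>

lemma KP_pro_p: assumes c: "1 \<le> c" shows "pro_p_subgroup v bar p (KP R c)"
  unfolding pro_p_subgroup_def
proof (intro conjI allI impI)
  show sub: "subgroup (KP R c) (Ugrp bar)" using c by (intro KP_subgroup) simp
  show "compactin (Utop v bar) (KP R c)" using c by (intro compactin_KP) simp
  fix U assume U: "U \<lhd> (Ugrp bar)\<lparr>carrier := KP R c\<rparr> \<and> openin (subtopology (Utop v bar) (KP R c)) U"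
  let ?P = "(Ugrp bar)\<lparr>carrier := KP R c\<rparr>"
  interpret P: group ?P by (rule group_restrict[OF sub])
  interpret U: normal U ?P using U by blast
  obtain O' where "openin (Utop v bar) O'" "U = O' \<inter> KP R c" using U by (auto simp: openin_subtopology)
  then have oU: "openin (Utop v bar) U" using openin_KP by blast
  have U1: "mat 1 \<in> U" using U.one_closed by simp
  have UG: "subgroup U (Ugrp bar)"
    using P.subgroup_self U.subgroup_axioms sub G.incl_subgroup by blast
  have rc: "carrier (?P Mod U) = (\<lambda>q. (\<lambda>x. x ** q) ` U) ` KP R c"
    by (auto simp: FactGroup_def RCOSETS_def rcoset_Ugrp)
  obtain b where b: "b \<ge> 1" "KP R b \<subseteq> U" using nbhd_KP[OF oU U1] by blast
  have "\<exists>n. order (?P Mod U) = p ^ n"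
  proof (rule group_p_power_order[OF U.factorgroup_is_group _ prime_p])
    show "finite (carrier (?P Mod U))"
      unfolding rc using c by (intro finite_cosets compactin_KP oU UG) simp
    fix x assume "x \<in> carrier (?P Mod U)"
    then obtain q where q: "q \<in> KP R c" "x = r_coset ?P U q" unfolding rc by (auto simp: rcoset_Ugrp)
    have "x [^]\<^bsub>?P Mod U\<^esub> (p ^ j) = r_coset ?P U (q [^]\<^bsub>?P\<^esub> (p ^ j))" for j
      using group_hom.hom_nat_pow[of ?P "?P Mod U" "\<lambda>a. r_coset ?P U a" q "p ^ j"] q U.r_coset_hom_Mod
      by (simp add: group_hom_def group_hom_axioms_def U.factorgroup_is_group)
    moreover have "q [^]\<^bsub>?P\<^esub> (p ^ nat b) \<in> U"
    proof -
      have "q [^]\<^bsub>Ugrp bar\<^esub> (p ^ nat b) \<in> KP R (c + int (nat b))" by (rule KP_pow_p_power[OF q(1) c])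
      then have "q [^]\<^bsub>Ugrp bar\<^esub> (p ^ nat b) \<in> KP R b" by (rule KP_mono) (use c in simp)
      then show ?thesis using b(2) by (auto simp: G.nat_pow_consistent[of _ _ "KP R c"])
    qed
    moreover have "r_coset ?P U u = U" if "u \<in> U" for u
      using P.coset_join2[OF _ U.subgroup_axioms that] U.subset that by auto
    ultimately have "x [^]\<^bsub>?P Mod U\<^esub> (p ^ nat b) = \<one>\<^bsub>?P Mod U\<^esub>" by (simp add: FactGroup_def del: rcoset_restrict)
    then show "\<exists>j. x [^]\<^bsub>?P Mod U\<^esub> (p ^ j) = \<one>\<^bsub>?P Mod U\<^esub>" by blast
  qed
  then show "\<exists>n. card (rcosets\<^bsub>?P\<^esub> U) = p ^ n" by (simp add: order_def FactGroup_def)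
qed

text \<open>In the residue field the binomial theorem gives x^p - 1 = (x - 1)^p, so Frobenius is
  injective there.\<close>

lemma p_power_unit_1: assumes x: "vge 0 x" "vge 1 (x ^ p - 1)" shows "vge 1 (x - 1)"
proof -
  define y where "y = x - 1"
  have y0: "vge 0 y" unfolding y_def by (intro vge_diff x) (simp add: vge_1)
  have yk: "vge 0 (y ^ k)" for k by (induction k) (use vge_mult[OF y0, of 0] in \<open>auto simp: vge_1\<close>)
  have p1: "p \<ge> 1" using prime_gt_1_nat[OF prime_p] by simp
  have "x ^ p = (y + 1) ^ p" by (simp add: y_def)
  also have "\<dots> = (\<Sum>k\<le>p. of_nat (p choose k) * y ^ k)" using binomial_ring[of y 1 p] by simp
  also have "\<dots> = (\<Sum>k\<in>{0,p}. of_nat (p choose k) * y ^ k) + (\<Sum>k\<in>{..p} - {0,p}. of_nat (p choose k) * y ^ k)"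
    using sum.subset_diff[of "{0,p}" "{..p}" "\<lambda>k. of_nat (p choose k) * y ^ k"] by (simp add: add.commute)
  also have "(\<Sum>k\<in>{0,p}. of_nat (p choose k) * y ^ k) = 1 + y ^ p" using p1 by simp
  finally have e: "y ^ p = (x ^ p - 1) - (\<Sum>k\<in>{..p} - {0,p}. of_nat (p choose k) * y ^ k)" by simp
  have "vge 1 (\<Sum>k\<in>{..p} - {0,p}. of_nat (p choose k) * y ^ k)"
  proof (rule vge_sum)
    fix k assume "k \<in> {..p} - {0,p}"
    then have "p dvd p choose k" by (intro dvd_choose_prime prime_p) auto
    then obtain m where "p choose k = p * m" by blast
    then have "of_nat (p choose k) * y ^ k = of_nat p * (of_nat m * y ^ k)" by simp
    moreover have "vge (4 + (0 + 0)) (of_nat p * (of_nat m * y ^ k))"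
      by (intro vge_mult vge_p vge_of_nat yk)
    then have "vge 1 (of_nat p * (of_nat m * y ^ k))" by (rule vge_mono) simp
    ultimately show "vge 1 (of_nat (p choose k) * y ^ k)" by (simp only:)
  qed
  then have "vge 1 (y ^ p)" unfolding e by (intro vge_diff x)
  then have "vge 1 y"
  proof (cases "y = 0")
    case False
    then have "1 \<le> 4 * (int p * v y)" using \<open>vge 1 (y ^ p)\<close> by (simp add: vge_def v_power)
    then have "0 < int p * v y" by simp
    then have "0 < v y" using p1 by (simp add: zero_less_mult_iff)
    then show ?thesis by (simp add: vge_def)
  qed simp
  then show ?thesis by (simp add: y_def)
qed

lemma p_power_unit: "vge 0 x \<Longrightarrow> vge 1 (x ^ (p ^ j) - 1) \<Longrightarrow> vge 1 (x - 1)"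
proof (induction j)
  case (Suc j)
  have "vge 0 (x ^ n)" for n by (induction n) (use vge_mult[OF Suc.prems(1), of 0] in \<open>auto simp: vge_1\<close>)
  moreover have "vge 1 ((x ^ (p ^ j)) ^ p - 1)" using Suc.prems(2) by (simp add: mult.commute flip: power_mult)
  ultimately show ?case using Suc.IH[OF Suc.prems(1)] p_power_unit_1 by blast
qed simp

text \<open>A central element of N scaled to the vertex 2 a. It is unitary because \<delta> has
  trace zero, and it is nontrivial in the reductive quotient because \<delta> is a unit.\<close>

definition u0 :: "int \<Rightarrow> 'e^3^3" where "u0 a = nu 0 (\<delta> * \<pi> powi (- a))"

lemma u0: "u0 a \<in> NU (2 * a)" "u0 a \<notin> KP (2 * a) 1" "sw a ** u0 a ** sw a \<notin> PP (2 * a + 1)"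
proof -
  have v: "v (\<delta> * \<pi> powi (- a)) = - a" by (simp add: v_mult delta_nonzero v_delta)
  have nz: "\<delta> * \<pi> powi (- a) \<noteq> 0" using delta_nonzero by simp
  show "u0 a \<in> NU (2 * a)" unfolding u0_def
    by (rule NU_I) (use nz v in \<open>auto simp: vge_def bar_mult bar_delta bar_power_int\<close>)
  show "u0 a \<notin> KP (2 * a) 1"
  proof
    assume "u0 a \<in> KP (2 * a) 1"
    then have "vge (1 - 2 * (2 * a)) (\<delta> * \<pi> powi (- a))" unfolding u0_def using nu_KP_D by blast
    then show False using nz v by (simp add: vge_def)
  qed
  show "sw a ** u0 a ** sw a \<notin> PP (2 * a + 1)"
  proof
    assume P: "sw a ** u0 a ** sw a \<in> PP (2 * a + 1)"
    have "sw a ** u0 a ** sw a = nl (- bar 0 * \<pi> powi a) (\<delta> * \<pi> powi (- a) * \<pi> powi (2 * a))"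
      unfolding u0_def by (rule sw_nu)
    then have "vge (2 * (2 * a + 1)) (\<delta> * \<pi> powi (- a) * \<pi> powi (2 * a))" using nl_PP_D P by metis
    moreover have "v (\<delta> * \<pi> powi (- a) * \<pi> powi (2 * a)) = - a + 2 * a" using nz v v_mult[of "\<delta> * \<pi> powi (- a)" "\<pi> powi (2 * a)"] by simp
    ultimately show False using delta_nonzero by (simp add: vge_def)
  qed
qed

text \<open>The points 2 a + 1 and 2 a - 1 lie on both sides of the vertex. An element fixing both
  is diagonal in the reductive quotient of K, and by \<open>diag_mult\<close> its diagonal entries
  multiply modulo the maximal ideal.\<close>

lemma off_diag:
  assumes "g \<in> PP (2 * a + 1)" "g \<in> PP (2 * a - 1)"
  shows "vge (2 * a * (ht i - ht j) + (if i = j then 0 else 1)) (g$i$j)"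
proof -
  have "vge ((2 * a + 1) * (ht i - ht j)) (g$i$j)" "vge ((2 * a - 1) * (ht i - ht j)) (g$i$j)"
    using MM_nth[OF PP_MM[OF assms(1)], of i j] MM_nth[OF PP_MM[OF assms(2)], of i j] by (simp_all add: algebra_simps)
  then show ?thesis
    using exhaust_3[of i] exhaust_3[of j] by (elim disjE) (auto elim: vge_mono simp: algebra_simps)
qed

lemma diag_mult:
  assumes "g \<in> PP (2 * a + 1)" "g \<in> PP (2 * a - 1)" "h \<in> PP (2 * a + 1)" "h \<in> PP (2 * a - 1)"
  shows "vge 1 ((g ** h)$i$i - g$i$i * h$i$i)"
proof -
  have t: "vge 1 (g$i$k * h$k$i)" if "k \<noteq> i" for k
  proof -
    have "vge ((2 * a * (ht i - ht k) + 1) + (2 * a * (ht k - ht i) + 1)) (g$i$k * h$k$i)"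
      using vge_mult[OF off_diag[OF assms(1,2), of i k] off_diag[OF assms(3,4), of k i]] that by simp
    then show ?thesis by (rule vge_mono) (simp add: algebra_simps)
  qed
  have "(g ** h)$i$i = (\<Sum>k\<in>UNIV. g$i$k * h$k$i)" by (simp add: matrix_matrix_mult_def)
  also have "\<dots> = g$i$i * h$i$i + (\<Sum>k\<in>UNIV - {i}. g$i$k * h$k$i)" by (rule sum.remove) auto
  finally have "(g ** h)$i$i - g$i$i * h$i$i = (\<Sum>k\<in>UNIV - {i}. g$i$k * h$k$i)" by simp
  then show ?thesis using t by (auto intro!: vge_sum)
qed

text \<open>The flag variety of the reductive quotient. K acts on these cosets from the right
  through inverses, by \<open>coset_act\<close>.\<close>

definition Icosets :: "int \<Rightarrow> ('e^3^3) set set" where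
  "Icosets a = (\<lambda>k. (\<lambda>x. x ** k) ` PP (2 * a + 1)) ` PP (2 * a)"

definition coset_act :: "'e^3^3 \<Rightarrow> ('e^3^3) set \<Rightarrow> ('e^3^3) set" where
  "coset_act g C = (\<lambda>x. x ** star g) ` C"

lemma coset_act_coset: "coset_act g ((\<lambda>x. x ** k) ` H) = (\<lambda>x. x ** (k ** star g)) ` H"
  by (simp add: coset_act_def image_image matrix_mul_assoc)

lemma coset_act_fixed_iff:
  assumes k: "k \<in> PP (2 * a)" and g: "g \<in> GG"
  shows "coset_act g ((\<lambda>x. x ** k) ` PP (2 * a + 1)) = (\<lambda>x. x ** k) ` PP (2 * a + 1) \<longleftrightarrow> k ** g ** star k \<in> PP (2 * a + 1)"
proof
  have kG: "k \<in> GG" by (rule PP_GG[OF k])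
  assume "coset_act g ((\<lambda>x. x ** k) ` PP (2 * a + 1)) = (\<lambda>x. x ** k) ` PP (2 * a + 1)"
  moreover have "mat 1 ** (k ** star g) \<in> (\<lambda>x. x ** (k ** star g)) ` PP (2 * a + 1)" by (rule imageI) simp
  ultimately have "k ** star g \<in> (\<lambda>x. x ** k) ` PP (2 * a + 1)" unfolding coset_act_coset by simp
  then obtain i where i: "i \<in> PP (2 * a + 1)" "k ** star g = i ** k" by blast
  then have "k ** star g ** star k = i" using kG by (simp add: star_cancel')
  then have "star i = k ** g ** star k" by (auto simp: star_mult matrix_mul_assoc)
  then show "k ** g ** star k \<in> PP (2 * a + 1)" using PP_star[OF i(1)] by simp
next
  have kG: "k \<in> GG" by (rule PP_GG[OF k])
  assume i: "k ** g ** star k \<in> PP (2 * a + 1)"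
  have "star (k ** g ** star k) ** k = k ** star g"
    using kG by (simp add: star_mult matrix_mul_assoc star_cancel')
  then show "coset_act g ((\<lambda>x. x ** k) ` PP (2 * a + 1)) = (\<lambda>x. x ** k) ` PP (2 * a + 1)"
    using coset_absorb[OF PP_subgroup PP_star[OF i] kG] unfolding coset_act_coset by simp
qed

lemma finite_Icosets: "finite (Icosets a)"
  unfolding Icosets_def by (intro finite_cosets compactin_PP openin_PP PP_subgroup)

lemma Icosets_count:
  assumes P: "subgroup P (Ugrp bar)" "P \<subseteq> PP (2 * a)"
    and tors: "\<And>g. g \<in> P \<Longrightarrow> \<exists>j. g [^]\<^bsub>Ugrp bar\<^esub> (p ^ j) \<in> KP (2 * a) 1"
  shows "[card (Icosets a) = card {C\<in>Icosets a. \<forall>g\<in>P. coset_act g C = C}] (mod p)"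
proof -
  let ?P = "(Ugrp bar)\<lparr>carrier := P\<rparr>"
  have "[card (Icosets a) = card {C\<in>Icosets a. \<forall>g\<in>carrier ?P. coset_act g C = C}] (mod p)"
  proof (rule p_group_action_card[OF group_restrict[OF P(1)] prime_p finite_Icosets])
    fix g C assume g: "g \<in> carrier ?P" and C: "C \<in> Icosets a"
    then obtain k where k: "k \<in> PP (2 * a)" "C = (\<lambda>x. x ** k) ` PP (2 * a + 1)" unfolding Icosets_def by blast
    have "k ** star g \<in> PP (2 * a)" using g P(2) by (intro PP_mult PP_star k) auto
    then show "coset_act g C \<in> Icosets a" unfolding k(2) coset_act_coset Icosets_def by blast
  next
    fix C show "coset_act \<one>\<^bsub>?P\<^esub> C = C" by (simp add: coset_act_def)
  next
    fix g h C show "coset_act (g \<otimes>\<^bsub>?P\<^esub> h) C = coset_act g (coset_act h C)"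
      by (simp add: coset_act_def image_image star_mult matrix_mul_assoc)
  next
    fix g assume g: "g \<in> carrier ?P"
    then obtain j where j: "g [^]\<^bsub>Ugrp bar\<^esub> (p ^ j) \<in> KP (2 * a) 1" using tors by auto
    have "coset_act (g [^]\<^bsub>?P\<^esub> (p ^ j)) C = C" if C: "C \<in> Icosets a" for C
    proof -
      from C obtain k where k: "k \<in> PP (2 * a)" "C = (\<lambda>x. x ** k) ` PP (2 * a + 1)" unfolding Icosets_def by blast
      have "k ** (g [^]\<^bsub>Ugrp bar\<^esub> (p ^ j)) ** star k \<in> KP (2 * a) 1" by (rule KP_conj[OF k(1) j])
      then have "k ** (g [^]\<^bsub>Ugrp bar\<^esub> (p ^ j)) ** star k \<in> PP (2 * a + 1)"
        using KP_even_subset KP_subset_PP[of 1] by auto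
      then show ?thesis
        unfolding k(2) G.nat_pow_consistent[symmetric] using coset_act_fixed_iff[OF k(1) KP_GG[OF j]] by simp
    qed
    then show "\<exists>j. \<forall>C\<in>Icosets a. coset_act (g [^]\<^bsub>?P\<^esub> (p ^ j)) C = C" by blast
  qed
  then show ?thesis by simp
qed

lemma KP_odd_3: "KP (2 * a + 1) 3 \<subseteq> KP (2 * a) 1"
  by (auto simp: KP_def MM_iff elim!: vge_mono)

text \<open>The pro-p Iwahori subgroup fixes only the base coset. If it fixed a coset in the big
  cell, conjugating the unipotent element \<open>u0\<close> would put its reflected copy into I,
  which \<open>u0\<close> excludes.\<close>

lemma card_Icosets: "[card (Icosets a) = 1] (mod p)"
proof -
  let ?I1 = "KP (2 * a + 1) 1"
  have I1: "?I1 \<subseteq> PP (2 * a + 1)" using KP_subset_PP[of 1] by simp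
  have "[card (Icosets a) = card {C\<in>Icosets a. \<forall>g\<in>?I1. coset_act g C = C}] (mod p)"
  proof (rule Icosets_count)
    show "subgroup ?I1 (Ugrp bar)" by (rule KP_subgroup) simp
    show "?I1 \<subseteq> PP (2 * a)" using I1 PP_odd_subset by blast
    fix g assume "g \<in> ?I1"
    from KP_pow_p_power[OF this, of 2] show "\<exists>j. g [^]\<^bsub>Ugrp bar\<^esub> (p ^ j) \<in> KP (2 * a) 1"
      using KP_odd_3 by (intro exI[of _ 2]) auto
  qed
  moreover have "{C\<in>Icosets a. \<forall>g\<in>?I1. coset_act g C = C} = {(\<lambda>x. x ** mat 1) ` PP (2 * a + 1)}"
  proof (intro equalityI subsetI)
    fix C assume "C \<in> {C\<in>Icosets a. \<forall>g\<in>?I1. coset_act g C = C}"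
    then obtain k where k: "k \<in> PP (2 * a)" "C = (\<lambda>x. x ** k) ` PP (2 * a + 1)"
      and fx: "\<And>g. g \<in> ?I1 \<Longrightarrow> coset_act g C = C" unfolding Icosets_def by blast
    have fI: "k ** g ** star k \<in> PP (2 * a + 1)" if "g \<in> ?I1" for g
      using fx[OF that] coset_act_fixed_iff[OF k(1) KP_GG[OF that]] unfolding k(2) by blast
    have "star k \<in> PP (2 * a)" by (rule PP_star[OF k(1)])
    from K_big_cell[OF this] have "star k \<in> PP (2 * a + 1)"
    proof
      assume "\<exists>n\<in>NU (2 * a). \<exists>i\<in>PP (2 * a + 1). star k = n ** sw a ** i"
      then obtain n i where n: "n \<in> NU (2 * a)" "i \<in> PP (2 * a + 1)" "star k = n ** sw a ** i" by blast
      have "star (star k) = star (n ** sw a ** i)" using n(3) by (rule arg_cong)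
      then have ke: "k = star i ** sw a ** star n" by (simp add: star_mult matrix_mul_assoc)
      have nG: "n \<in> GG" and iG: "i \<in> GG" using NU_PP[OF n(1)] n(2) PP_GG by auto
      define g where "g = n ** u0 a ** star n"
      have "g \<in> ?I1" unfolding g_def by (intro KP_mult KP_star NU_KP n u0) auto
      then have "k ** g ** star k \<in> PP (2 * a + 1)" by (rule fI)
      moreover have "k ** g ** star k = star i ** (sw a ** u0 a ** sw a) ** i"
      proof -
        have "k ** g = star i ** sw a ** u0 a ** star n"
          unfolding ke g_def using nG by (simp add: matrix_mul_assoc star_cancel')
        then show ?thesis unfolding n(3) using nG by (simp add: matrix_mul_assoc star_cancel')
      qed
      ultimately have "star i ** (sw a ** u0 a ** sw a) ** i \<in> PP (2 * a + 1)" by simp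
      from PP_mult[OF PP_mult[OF n(2) this] PP_star[OF n(2)]]
      have "i ** (star i ** (sw a ** u0 a ** sw a) ** i) ** star i \<in> PP (2 * a + 1)" .
      moreover have "i ** (star i ** (sw a ** u0 a ** sw a) ** i) ** star i = sw a ** u0 a ** sw a"
        using iG GG_star_right[OF iG] by (simp add: matrix_mul_assoc star_cancel')
      ultimately show ?thesis using u0(3) by simp
    qed
    then have "k \<in> PP (2 * a + 1)" using PP_star by fastforce
    then have "C = (\<lambda>x. x ** mat 1) ` PP (2 * a + 1)"
      using coset_absorb[OF PP_subgroup, of k "2 * a + 1" "mat 1"] unfolding k(2) by simp
    then show "C \<in> {(\<lambda>x. x ** mat 1) ` PP (2 * a + 1)}" by simp
  next
    fix C assume "C \<in> {(\<lambda>x. x ** mat 1) ` PP (2 * a + 1)}"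
    then have C: "C = (\<lambda>x. x ** mat 1) ` PP (2 * a + 1)" by simp
    have "coset_act g C = C" if "g \<in> ?I1" for g
      unfolding C using coset_act_fixed_iff[of "mat 1" a g] that I1 KP_GG[OF that] by auto
    moreover have "C \<in> Icosets a" unfolding C Icosets_def by (rule imageI) simp
    ultimately show "C \<in> {C\<in>Icosets a. \<forall>g\<in>?I1. coset_act g C = C}" by blast
  qed
  ultimately show ?thesis by simp
qed

text \<open>
  A normal pro-\<open>p\<close> subgroup has a fixed point on the finite set \<open>K/I\<close>, whose cardinality is \<open>1\<close>
  modulo \<open>p\<close>; by normality it lies in \<open>I\<close> and in its opposite.
\<close>

lemma normal_pro_p_subset:
  assumes N: "P \<lhd> (Ugrp bar)\<lparr>carrier := PP (2 * a)\<rparr>" and P: "pro_p_subgroup v bar p P"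
  shows "P \<subseteq> KP (2 * a) 1"
proof -
  let ?P = "(Ugrp bar)\<lparr>carrier := P\<rparr>"
  have sub: "subgroup P (Ugrp bar)" using P by (simp add: pro_p_subgroup_def)
  interpret N: normal P "(Ugrp bar)\<lparr>carrier := PP (2 * a)\<rparr>" by (rule N)
  have PK: "P \<subseteq> PP (2 * a)" using N.subset by simp
  have conj: "k ** g ** star k \<in> P" if "k \<in> PP (2 * a)" "g \<in> P" for k g
    using normal_restrict_iff[OF PP_subgroup sub PK] N that by blast
  have subKP: "subgroup (KP (2 * a) 1) (Ugrp bar)" by (rule KP_subgroup) simp
  define U where "U = P \<inter> KP (2 * a) 1"
  have subU: "subgroup U (Ugrp bar)" unfolding U_def by (rule G.subgroups_Inter_pair[OF sub subKP])
  have nU: "U \<lhd> ?P"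
    using normal_restrict_iff[OF sub subU] conj KP_conj PK subgroup.m_closed[OF sub] by (auto simp: U_def)
  have "openin (subtopology (Utop v bar) P) U"
    unfolding openin_subtopology U_def using openin_KP by blast
  then obtain n where n: "card (rcosets\<^bsub>?P\<^esub> U) = p ^ n" using P nU unfolding pro_p_subgroup_def by blast
  interpret Pg: group ?P by (rule group_restrict[OF sub])
  interpret U: normal U ?P by (rule nU)
  have tors: "g [^]\<^bsub>Ugrp bar\<^esub> (p ^ n) \<in> KP (2 * a) 1" if g: "g \<in> P" for g
  proof -
    interpret Q: group "?P Mod U" by (rule U.factorgroup_is_group)
    have c: "r_coset ?P U g \<in> carrier (?P Mod U)" using g by (auto simp: FactGroup_def RCOSETS_def)
    have "r_coset ?P U g [^]\<^bsub>?P Mod U\<^esub> order (?P Mod U) = \<one>\<^bsub>?P Mod U\<^esub>" by (rule Q.pow_order_eq_1[OF c])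
    moreover have "order (?P Mod U) = p ^ n" using n by (simp add: order_def FactGroup_def)
    moreover have "r_coset ?P U g [^]\<^bsub>?P Mod U\<^esub> (p ^ n) = r_coset ?P U (g [^]\<^bsub>?P\<^esub> (p ^ n))"
      using group_hom.hom_nat_pow[of ?P "?P Mod U" "\<lambda>a. r_coset ?P U a" g "p ^ n"] g U.r_coset_hom_Mod
      by (simp add: group_hom_def group_hom_axioms_def U.factorgroup_is_group)
    ultimately have "r_coset ?P U (g [^]\<^bsub>?P\<^esub> (p ^ n)) = U" by (simp add: FactGroup_def)
    moreover have "g [^]\<^bsub>?P\<^esub> (p ^ n) \<in> r_coset ?P U (g [^]\<^bsub>?P\<^esub> (p ^ n))"
      using Pg.nat_pow_closed[of g "p ^ n"] g by (intro Pg.rcos_self U.subgroup_axioms) auto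
    ultimately have "g [^]\<^bsub>?P\<^esub> (p ^ n) \<in> U" by simp
    then show ?thesis unfolding U_def G.nat_pow_consistent[symmetric] by blast
  qed
  have "[card (Icosets a) = card {C\<in>Icosets a. \<forall>g\<in>P. coset_act g C = C}] (mod p)"
    using tors by (intro Icosets_count sub PK) blast
  then have "[card {C\<in>Icosets a. \<forall>g\<in>P. coset_act g C = C} = 1] (mod p)"
    using card_Icosets cong_sym cong_trans by blast
  then have "card {C\<in>Icosets a. \<forall>g\<in>P. coset_act g C = C} \<noteq> 0"
    using prime_gt_1_nat[OF prime_p] by (intro notI) (simp add: cong_def)
  then have "{C\<in>Icosets a. \<forall>g\<in>P. coset_act g C = C} \<noteq> {}" by (metis card.empty)
  then obtain C where C: "C \<in> Icosets a" "\<forall>g\<in>P. coset_act g C = C" by blast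
  then obtain k where k: "k \<in> PP (2 * a)" "C = (\<lambda>x. x ** k) ` PP (2 * a + 1)" unfolding Icosets_def by blast
  have kG: "k \<in> GG" by (rule PP_GG[OF k(1)])
  have PI: "g \<in> PP (2 * a + 1)" if g: "g \<in> P" for g
  proof -
    have h: "star k ** g ** k \<in> P" using conj[OF PP_star[OF k(1)] g] by simp
    then have "k ** (star k ** g ** k) ** star k \<in> PP (2 * a + 1)"
      using C(2) coset_act_fixed_iff[OF k(1), of "star k ** g ** k"] subgroup.subset[OF sub] unfolding k(2) by blast
    moreover have "k ** (star k ** g ** k) ** star k = g"
      using kG GG_star_right[OF kG] by (simp add: matrix_mul_assoc star_cancel')
    ultimately show ?thesis by simp
  qed
  have PI': "g \<in> PP (2 * a - 1)" if g: "g \<in> P" for g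
  proof -
    have "sw a ** g ** sw a \<in> PP (2 * a + 1)" using PI conj[OF sw_PP g] by simp
    then show ?thesis using sw_PP_conj[of "sw a ** g ** sw a" a 1] by simp
  qed
  show ?thesis
  proof
    fix g assume g: "g \<in> P"
    have powP: "g [^]\<^bsub>Ugrp bar\<^esub> m \<in> P" for m :: nat
      using Pg.nat_pow_closed[of g m] g unfolding G.nat_pow_consistent[symmetric] by simp
    have d0: "vge 0 (g$i$i)" for i using MM_nth[OF PP_MM[OF PI[OF g]], of i i] by simp
    have dk: "vge 0 (g$i$i ^ m)" for i m by (induction m) (use vge_mult[OF d0, of 0] in \<open>auto simp: vge_1\<close>)
    \<comment> \<open>Diagonal entries are multiplicative modulo the maximal ideal on P, and the
      p^n-th power of g lies in K^1. So each diagonal entry reduces to a root of unity of p-power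
      order, hence to 1.\<close>
    have dm: "vge 1 ((g [^]\<^bsub>Ugrp bar\<^esub> m)$i$i - g$i$i ^ m)" for i and m :: nat
    proof (induction m)
      case (Suc m)
      have "vge 1 ((g [^]\<^bsub>Ugrp bar\<^esub> m ** g)$i$i - (g [^]\<^bsub>Ugrp bar\<^esub> m)$i$i * g$i$i)"
        by (intro diag_mult[of _ a] PI PI' powP g)
      moreover have "vge (1 + 0) (((g [^]\<^bsub>Ugrp bar\<^esub> m)$i$i - g$i$i ^ m) * g$i$i)" by (intro vge_mult Suc d0)
      ultimately have "vge 1 (((g [^]\<^bsub>Ugrp bar\<^esub> m ** g)$i$i - (g [^]\<^bsub>Ugrp bar\<^esub> m)$i$i * g$i$i) + ((g [^]\<^bsub>Ugrp bar\<^esub> m)$i$i - g$i$i ^ m) * g$i$i)"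
        by (intro vge_add) simp_all
      then show ?case by (simp add: algebra_simps)
    qed simp
    have "vge 1 (g$i$i - 1)" for i
    proof (rule p_power_unit[OF d0, of _ n])
      have "vge 1 ((g [^]\<^bsub>Ugrp bar\<^esub> (p ^ n) - mat 1)$i$i)"
        using tors[OF g] MM_nth[of "g [^]\<^bsub>Ugrp bar\<^esub> (p ^ n) - mat 1" "2 * a" "2 * a" 1 i i] by (simp add: KP_def)
      from vge_diff[OF this dm[of "p ^ n" i]] show "vge 1 (g$i$i ^ p ^ n - 1)" by simp
    qed
    then have "vge (2 * a * (ht i - ht j) + 1) ((g - mat 1)$i$j)" for i j
      using off_diag[OF PI[OF g] PI'[OF g], of i j] by (cases "i = j") simp_all
    then show "g \<in> KP (2 * a) 1"
      using subgroup.subset[OF sub] g by (auto simp: KP_def MM_def algebra_simps)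
  qed
qed

definition av :: "vertex \<Rightarrow> int" where "av t = (case t of V0 \<Rightarrow> 0 | V1 \<Rightarrow> 1)"

lemma Kset_eq: "Kset v bar t = PP (2 * av t)"
proof (cases t)
  case V0
  have "(\<forall>i j. g $ i $ j \<in> frac_ideal v 0) \<longleftrightarrow> g \<in> MM 0 0 0" for g :: "'e^3^3"
    by (simp add: MM_def vge_frac_ideal)
  then have *: "(\<forall>i j. g $ i $ j \<in> frac_ideal v 0 \<and> matrix_inv g $ i $ j \<in> frac_ideal v 0) \<longleftrightarrow> g \<in> MM 0 0 0" if "g \<in> GG" for g
    using matrix_inv_GG[OF that] MM_star[of g 0 0 0] by (auto simp: MM_def vge_frac_ideal)
  then show ?thesis by (auto simp: Kset_def V0 av_def PP_def)
next
  case V1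
  have "vge (-2) x \<longleftrightarrow> vge 0 x" "vge 2 x \<longleftrightarrow> vge 4 x" for x using vge_parity(2)[of 0 x] vge_parity(2)[of 1 x] by (auto elim: vge_mono)
  then show ?thesis by (auto simp: Kset_def V1 av_def PP_def MM_iff vge_frac_ideal)
qed

lemma Kgrp_eq: "Kgrp v bar t = (Ugrp bar)\<lparr>carrier := PP (2 * av t)\<rparr>"
  by (simp add: Kgrp_def Kset_eq)

lemma K_pro_p_radical_eq: "K_pro_p_radical v bar p t = KP (2 * av t) 1"
  unfolding K_pro_p_radical_def Kgrp_eq
  by (rule Greatest_equality) (use KP_normal[of 1] KP_pro_p[of 1] normal_pro_p_subset in auto)

text \<open>Unfolds cosets modulo K^1: a class satisfies the matrix condition when some
  representative k g does, which is how the reductions in the statement are phrased.\<close>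

lemma K_preimage_eq:
  "K_preimage v bar p t (Gamma_part v bar \<pi> p t Q) = {g\<in>PP (2 * av t). \<exists>k\<in>KP (2 * av t) 1. Q (gamma_lift \<pi> t (k ** g))}"
proof -
  have "r_coset (Ugrp bar) (KP (2 * av t) 1) g = r_coset (Ugrp bar) (KP (2 * av t) 1) x \<Longrightarrow>
      h \<in> r_coset (Ugrp bar) (KP (2 * av t) 1) x \<Longrightarrow> \<exists>k\<in>KP (2 * av t) 1. h = k ** g" for g x h
    unfolding rcoset_Ugrp by blast
  moreover have "k \<in> KP (2 * av t) 1 \<Longrightarrow> k ** g \<in> r_coset (Ugrp bar) (KP (2 * av t) 1) g" for k g
    unfolding rcoset_Ugrp by blast
  ultimately show ?thesis
    unfolding K_preimage_def Gamma_part_def Gamma_def K_pro_p_radical_eq Kgrp_eq Kset_eq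
    by (auto simp: FactGroup_def RCOSETS_def) blast+
qed

text \<open>Conditions modulo the maximal ideal and bounds at the quarter-integral point 2 a + 1
  round to the same integers. For the second vertex \<open>gamma_lift\<close> rescales the corner
  entries accordingly.\<close>

lemma red_upper_iff: "g \<in> PP (2 * av t) \<Longrightarrow> red_upper v (gamma_lift \<pi> t g) \<longleftrightarrow> g \<in> PP (2 * av t + 1)"
proof (cases t)
  case V0
  have "vge 1 x \<longleftrightarrow> vge 4 x" "vge 2 x \<longleftrightarrow> vge 4 x" "vge (-1) x \<longleftrightarrow> vge 0 x" "vge (-2) x \<longleftrightarrow> vge 0 x" for x
    by (auto simp: vge_def)
  then show "g \<in> PP (2 * av t) \<Longrightarrow> ?thesis"
    by (auto simp: V0 av_def PP_def MM_iff red_upper_def gamma_lift_def vge_frac_ideal)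
next
  case V1
  have 1: "vge 6 x \<longleftrightarrow> vge 8 x" "vge 2 x \<longleftrightarrow> vge 4 x" "vge 3 x \<longleftrightarrow> vge 4 x" "vge (-3) x \<longleftrightarrow> vge 0 x" "vge (-2) x \<longleftrightarrow> vge 0 x" "vge (-6) x \<longleftrightarrow> vge (-4) x" for x
    by (auto simp: vge_def)
  have 2: "vge 4 (inverse \<pi> * x) \<longleftrightarrow> vge 8 x" for x
    by (cases "x = 0") (auto simp: vge_def v_mult v_inverse)
  show "g \<in> PP (2 * av t) \<Longrightarrow> ?thesis"
    by (auto simp: V1 av_def PP_def MM_iff red_upper_def gamma_lift_def vge_frac_ideal 1 2)
qed

lemma red_lower_iff: "g \<in> PP (2 * av t) \<Longrightarrow> red_lower v (gamma_lift \<pi> t g) \<longleftrightarrow> g \<in> PP (2 * av t - 1)"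
proof (cases t)
  case V0
  have "vge 1 x \<longleftrightarrow> vge 4 x" "vge 2 x \<longleftrightarrow> vge 4 x" "vge (-1) x \<longleftrightarrow> vge 0 x" "vge (-2) x \<longleftrightarrow> vge 0 x" for x
    by (auto simp: vge_def)
  then show "g \<in> PP (2 * av t) \<Longrightarrow> ?thesis"
    by (auto simp: V0 av_def PP_def MM_iff red_lower_def gamma_lift_def vge_frac_ideal)
next
  case V1
  have 1: "vge 1 x \<longleftrightarrow> vge 4 x" "vge 2 x \<longleftrightarrow> vge 4 x" "vge (-1) x \<longleftrightarrow> vge 0 x" "vge (-2) x \<longleftrightarrow> vge 0 x" for x
    by (auto simp: vge_def)
  have 2: "vge 4 (\<pi> * x) \<longleftrightarrow> vge 0 x" for x
    by (cases "x = 0") (auto simp: vge_def v_mult)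
  show "g \<in> PP (2 * av t) \<Longrightarrow> ?thesis"
    by (auto simp: V1 av_def PP_def MM_iff red_lower_def gamma_lift_def vge_frac_ideal 1 2)
qed

lemma red_unit_diag_iff: "red_unit_diag v (gamma_lift \<pi> t g) \<longleftrightarrow> (\<forall>i. vge 1 (g$i$i - 1))"
proof -
  have "vge 1 x \<longleftrightarrow> vge 4 x" for x by (auto simp: vge_def)
  then show ?thesis by (cases t) (auto simp: red_unit_diag_def gamma_lift_def vge_frac_ideal forall_3)
qed

text \<open>At an odd point no off-diagonal bound is divisible by 4, so each of them is
  automatically strict and only the diagonal distinguishes the stabilizer from its pro-p
  radical.\<close>

lemma KP_odd_iff: assumes "S = 2 * a + 1 \<or> S = 2 * a - 1"
  shows "g \<in> KP S 1 \<longleftrightarrow> g \<in> PP S \<and> (\<forall>i. vge 1 (g$i$i - 1))"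
proof
  assume g: "g \<in> KP S 1"
  then have "vge 1 ((g - mat 1)$i$i)" for i using MM_nth[of "g - mat 1" S S 1 i i] by (simp add: KP_def)
  then show "g \<in> PP S \<and> (\<forall>i. vge 1 (g$i$i - 1))" using KP_subset_PP[of 1 S] g by auto
next
  assume g: "g \<in> PP S \<and> (\<forall>i. vge 1 (g$i$i - 1))"
  have odd: "vge (S * (ht i - ht j) + 1) x" if "vge (S * (ht i - ht j)) x" "i \<noteq> j" for x i j
  proof -
    have "(S * (ht i - ht j)) mod 4 \<noteq> 0"
      using assms that(2) exhaust_3[of i] exhaust_3[of j] by (elim disjE) (auto, presburger+)
    then have "S * (ht i - ht j) \<noteq> 4 * v x" by auto
    then show ?thesis using that(1) by (auto simp: vge_def)
  qed
  have "vge (S * (ht i - ht j) + 1) ((g - mat 1)$i$j)" for i j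
    using odd[of i j "g$i$j"] MM_nth[OF PP_MM, of g S i j] g by (cases "i = j") (auto simp: algebra_simps)
  then show "g \<in> KP S 1" using g PP_GG by (auto simp: KP_def MM_def algebra_simps)
qed

lemma Iwahori_eq: "Iwahori v bar \<pi> p t = PP (2 * av t + 1)"
proof -
  have KK: "k ** g \<in> PP (2 * av t)" if "g \<in> PP (2 * av t)" "k \<in> KP (2 * av t) 1" for g k
    using that KP_subset_PP[of 1] by (intro PP_mult) auto
  show ?thesis unfolding Iwahori_def K_preimage_eq
  proof (intro equalityI subsetI)
    fix g assume "g \<in> {g\<in>PP (2 * av t). \<exists>k\<in>KP (2 * av t) 1. red_upper v (gamma_lift \<pi> t (k ** g))}"
    then obtain k where k: "g \<in> PP (2 * av t)" "k \<in> KP (2 * av t) 1" "k ** g \<in> PP (2 * av t + 1)"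
      using red_upper_iff KK by blast
    have "star k \<in> PP (2 * av t + 1)" using KP_star[OF k(2)] KP_even_subset KP_subset_PP[of 1] by auto
    from PP_mult[OF this k(3)] show "g \<in> PP (2 * av t + 1)" using KP_GG[OF k(2)] by (simp add: star_cancel)
  next
    fix g assume g: "g \<in> PP (2 * av t + 1)"
    then have gK: "g \<in> PP (2 * av t)" using PP_odd_subset by blast
    then have "red_upper v (gamma_lift \<pi> t (mat 1 ** g))" using g red_upper_iff by simp
    then show "g \<in> {g\<in>PP (2 * av t). \<exists>k\<in>KP (2 * av t) 1. red_upper v (gamma_lift \<pi> t (k ** g))}" using gK KP_1 by blast
  qed
qed

lemma KP_even_subset_opp: "KP (2 * a) 1 \<subseteq> KP (2 * a - 1) 1"
proof
  fix g assume "g \<in> KP (2 * a) 1"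
  then have "sw a ** g ** sw a \<in> KP (2 * a + 1) 1" using KP_sw KP_even_subset by blast
  from sw_KP_conj[OF this] show "g \<in> KP (2 * a - 1) 1" by simp
qed

lemma PP_odd_subset_opp: "PP (2 * a - 1) \<subseteq> PP (2 * a)"
proof
  fix g assume "g \<in> PP (2 * a - 1)"
  then have "sw a ** g ** sw a \<in> PP (2 * a + 1)" using sw_PP_conj[of g a "-1"] by simp
  then have "sw a ** g ** sw a \<in> PP (2 * a)" using PP_odd_subset by blast
  from PP_mult[OF PP_mult[OF sw_PP this] sw_PP] have "sw a ** (sw a ** g ** sw a) ** sw a \<in> PP (2 * a)" .
  then show "g \<in> PP (2 * a)" by simp
qed

lemma unipotent_preimage:
  assumes S: "S = 2 * av t + 1 \<or> S = 2 * av t - 1"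
    and Q: "\<And>g. g \<in> PP (2 * av t) \<Longrightarrow> Q (gamma_lift \<pi> t g) \<longleftrightarrow> g \<in> KP S 1"
  shows "{g\<in>PP (2 * av t). \<exists>k\<in>KP (2 * av t) 1. Q (gamma_lift \<pi> t (k ** g))} = KP S 1"
proof (intro equalityI subsetI)
  have KS: "KP (2 * av t) 1 \<subseteq> KP S 1" using S KP_even_subset KP_even_subset_opp by blast
  fix g assume "g \<in> {g\<in>PP (2 * av t). \<exists>k\<in>KP (2 * av t) 1. Q (gamma_lift \<pi> t (k ** g))}"
  then obtain k where k: "g \<in> PP (2 * av t)" "k \<in> KP (2 * av t) 1" "Q (gamma_lift \<pi> t (k ** g))" by blast
  have "k ** g \<in> PP (2 * av t)" using k KP_subset_PP[of 1] by (intro PP_mult) auto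
  then have "k ** g \<in> KP S 1" using Q k(3) by blast
  moreover have "star k \<in> KP S 1" using KP_star[OF k(2)] KS by blast
  ultimately have "star k ** (k ** g) \<in> KP S 1" using KP_mult[of 1 "star k" S "k ** g"] by simp
  then show "g \<in> KP S 1" using KP_GG[OF k(2)] by (simp add: star_cancel)
next
  fix g assume g: "g \<in> KP S 1"
  then have "g \<in> PP S" using KP_subset_PP[of 1] by auto
  then have gK: "g \<in> PP (2 * av t)" using S PP_odd_subset PP_odd_subset_opp by blast
  then have "Q (gamma_lift \<pi> t (mat 1 ** g))" using Q g by simp
  then show "g \<in> {g\<in>PP (2 * av t). \<exists>k\<in>KP (2 * av t) 1. Q (gamma_lift \<pi> t (k ** g))}" using gK KP_1 by blast
qed

lemma pro_p_Iwahori_eq: "pro_p_Iwahori v bar \<pi> p t = KP (2 * av t + 1) 1"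
  unfolding pro_p_Iwahori_def K_preimage_eq
  by (rule unipotent_preimage) (auto simp: red_upper_iff red_unit_diag_iff KP_odd_iff[of _ "av t"])

lemma pro_p_Iwahori_opp_eq: "pro_p_Iwahori_opp v bar \<pi> p t = KP (2 * av t - 1) 1"
  unfolding pro_p_Iwahori_opp_def K_preimage_eq
  by (rule unipotent_preimage) (auto simp: red_lower_iff red_unit_diag_iff KP_odd_iff[of _ "av t"])

end

section \<open>Weights as representations of a rank one group\<close>

context valued_involution begin

lemma nu_mult: "nu x y ** nu x' y' = nu (x + x') (y + y' - x * bar x')"
  by (rule mat3_eqI) (auto simp: mult_nth bar_add algebra_simps)

lemma NU_mult: assumes "n \<in> NU R" "n' \<in> NU R" shows "n ** n' \<in> NU R"
proof -
  from assms(1) obtain x y where n: "n = nu x y" "x * bar x + y + bar y = 0" "vge (- R) x" "vge (- 2 * R) y" unfolding NU_def by blast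
  from assms(2) obtain x' y' where n': "n' = nu x' y'" "x' * bar x' + y' + bar y' = 0" "vge (- R) x'" "vge (- 2 * R) y'" unfolding NU_def by blast
  have "(x + x') * bar (x + x') + (y + y' - x * bar x') + bar (y + y' - x * bar x')
      = (x * bar x + y + bar y) + (x' * bar x' + y' + bar y')"
    by (simp add: bar_add bar_diff bar_mult algebra_simps)
  then have rel: "(x + x') * bar (x + x') + (y + y' - x * bar x') + bar (y + y' - x * bar x') = 0"
    using n(2) n'(2) by simp
  have "vge (- R + - R) (x * bar x')" using n(3) n'(3) by (intro vge_mult) auto
  then have "vge (- 2 * R) (x * bar x')" by simp
  then have "vge (- 2 * R) (y + y' - x * bar x')" by (intro vge_diff vge_add n n')
  then show ?thesis unfolding n(1) n'(1) nu_mult by (intro NU_I rel vge_add n n')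
qed

lemma NU_1: "mat 1 \<in> NU R"
proof -
  have "nu 0 0 = mat 1" by (rule mat3_eqI) auto
  moreover have "nu 0 0 \<in> NU R" by (rule NU_I) auto
  ultimately show ?thesis by simp
qed

lemma DG_mult: assumes "h \<in> DG" "k \<in> DG" shows "h ** k \<in> DG" "h ** k = k ** h"
proof -
  from assms(1) obtain c b where h: "h = dg c b" "c \<noteq> 0" "v c = 0" "b * bar b = 1" unfolding DG_def by blast
  from assms(2) obtain c' b' where k: "k = dg c' b'" "c' \<noteq> 0" "v c' = 0" "b' * bar b' = 1" unfolding DG_def by blast
  have e: "dg c b ** dg c' b' = dg (c * c') (b * b')" for c b c' b' by (rule mat3_eqI) (auto simp: mult_nth bar_mult)
  have "b * b' * bar (b * b') = (b * bar b) * (b' * bar b')" by (simp add: bar_mult algebra_simps)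
  then show "h ** k \<in> DG" unfolding h(1) k(1) e by (intro DG_I) (use h k in \<open>auto simp: v_mult\<close>)
  show "h ** k = k ** h" unfolding h(1) k(1) e by (simp add: mult.commute)
qed

lemma DG_star: assumes "h \<in> DG" shows "star h \<in> DG"
proof -
  from assms obtain c b where h: "h = dg c b" "c \<noteq> 0" "v c = 0" "b * bar b = 1" unfolding DG_def by blast
  then show ?thesis using DG_I[of "inverse c" "bar b"] by (simp add: star_dg v_inverse mult.commute)
qed

lemma DG_GG: "h \<in> DG \<Longrightarrow> h \<in> GG" using DG_PP PP_GG by blast

lemma DG_1: "mat 1 \<in> DG"
proof -
  have "dg 1 1 = mat 1" by (rule mat3_eqI) auto
  moreover have "dg 1 1 \<in> DG" by (rule DG_I) auto
  ultimately show ?thesis by simp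
qed

lemma DG_NU_conj: assumes "h \<in> DG" "n \<in> NU R" shows "h ** n ** star h \<in> NU R"
proof -
  from assms(1) obtain c b where h: "h = dg c b" "c \<noteq> 0" "v c = 0" "b * bar b = 1" unfolding DG_def by blast
  from assms(2) obtain x y where n: "n = nu x y" "x * bar x + y + bar y = 0" "vge (- R) x" "vge (- 2 * R) y" unfolding NU_def by blast
  have "dg c b ** nu x y ** star (dg c b) = nu (c * x * bar b) (c * bar c * y)"
    using h by (intro mat3_eqI) (auto simp: mult_nth star_dg bar_inverse bar_mult algebra_simps)
  moreover have "nu (c * x * bar b) (c * bar c * y) \<in> NU R"
  proof (rule NU_I)
    have "c * x * bar b * bar (c * x * bar b) + c * bar c * y + bar (c * bar c * y) = c * bar c * (x * bar x * (b * bar b) + y + bar y)"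
      by (simp add: bar_mult algebra_simps)
    then show "c * x * bar b * bar (c * x * bar b) + c * bar c * y + bar (c * bar c * y) = 0" using h n by simp
    have u: "vge 0 c" "vge 0 (bar c)" "vge 0 (bar b)" using h norm_1_v[OF h(4)] by (simp_all only: vge_bar) (simp_all add: vge_def)
    have "vge (0 + - R + 0) (c * x * bar b)" "vge (0 + 0 + - 2 * R) (c * bar c * y)" by (intro vge_mult u n)+
    then show "vge (- R) (c * x * bar b)" "vge (- 2 * R) (c * bar c * y)" by simp_all
  qed
  ultimately show ?thesis using h(1) n(1) by simp
qed

end

locale weight_rep = local_unitary v bar \<pi> \<delta> p + vector_space scale
  for v :: "'e::field \<Rightarrow> int" and bar :: "'e \<Rightarrow> 'e" and \<pi> \<delta> :: 'e and p :: nat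
    and scale :: "'c::alg_closed_field \<Rightarrow> 'v::ab_group_add \<Rightarrow> 'v" +
  fixes t :: vertex and \<sigma> :: "'e^3^3 \<Rightarrow> 'v \<Rightarrow> 'v" and v0 :: 'v
  assumes weight: "weight v bar t scale \<sigma>" and char: "of_nat p = (0::'c)"
    and v0_inv: "v0 \<in> invariants v bar \<pi> p t \<sigma>" and v0_nonzero: "v0 \<noteq> 0"
begin

abbreviation "aa \<equiv> av t"
abbreviation "K \<equiv> PP (2 * aa)"
abbreviation "s \<equiv> \<sigma> (sw aa)"

lemmas weightD = weight[unfolded weight_def Kset_eq]

lemma \<sigma>_linear: "k \<in> K \<Longrightarrow> Vector_Spaces.linear scale scale (\<sigma> k)"
  by (rule bspec[OF weightD[THEN conjunct2, THEN conjunct1]])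

lemma \<sigma>_add: "k \<in> K \<Longrightarrow> \<sigma> k (x + y) = \<sigma> k x + \<sigma> k y"
  and \<sigma>_scale: "k \<in> K \<Longrightarrow> \<sigma> k (scale c x) = scale c (\<sigma> k x)"
  using \<sigma>_linear[of k] by (simp_all add: Vector_Spaces.linear_iff)

lemma \<sigma>_1: "\<sigma> (mat 1) x = x"
  by (simp add: weightD[THEN conjunct2, THEN conjunct2, THEN conjunct1])

lemma \<sigma>_mult: assumes "k \<in> K" "l \<in> K" shows "\<sigma> (k ** l) x = \<sigma> k (\<sigma> l x)"
  by (simp add: bspec[OF bspec[OF weightD[THEN conjunct2, THEN conjunct2, THEN conjunct2, THEN conjunct1] assms(1)] assms(2)])

lemma \<sigma>_0: "k \<in> K \<Longrightarrow> \<sigma> k 0 = 0" using \<sigma>_add[of k 0 0] by simp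

lemma \<sigma>_diff: "k \<in> K \<Longrightarrow> \<sigma> k (x - y) = \<sigma> k x - \<sigma> k y"
  using \<sigma>_add[of k "x - y" y] by (simp add: algebra_simps)

lemma \<sigma>_star: "k \<in> K \<Longrightarrow> \<sigma> (star k) (\<sigma> k x) = x" "k \<in> K \<Longrightarrow> \<sigma> k (\<sigma> (star k) x) = x"
  using \<sigma>_mult[of "star k" k x] \<sigma>_mult[of k "star k" x] GG_star_right[OF PP_GG, of k "2 * aa"] PP_GG[of k "2 * aa"]
  by (simp_all add: PP_star \<sigma>_1 mem_GG_iff)

lemma stabilizer_open: "openin (Utop v bar) {k\<in>K. \<sigma> k x = x}"
  by (rule spec[OF weightD[THEN conjunct2, THEN conjunct2, THEN conjunct2, THEN conjunct2, THEN conjunct1]])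

lemma \<sigma>_irred:
  assumes "subspace W" "\<And>k x. k \<in> K \<Longrightarrow> x \<in> W \<Longrightarrow> \<sigma> k x \<in> W"
  shows "W = {0} \<or> W = UNIV"
  by (rule mp[OF spec[OF weightD[THEN conjunct2, THEN conjunct2, THEN conjunct2, THEN conjunct2, THEN conjunct2, THEN conjunct2]]])
    (intro conjI ballI assms)

lemma KP_K: "1 \<le> c \<Longrightarrow> g \<in> KP (2 * aa) c \<Longrightarrow> g \<in> K"
  using KP_subset_PP[of c "2 * aa"] by auto

text \<open>The congruence group is normal in K, so its fixed vectors form a subrepresentation of an
  irreducible representation.\<close>

lemma KP_fixed_all:
  assumes c: "1 \<le> c" and x: "x \<noteq> 0" "\<And>g. g \<in> KP (2 * aa) c \<Longrightarrow> \<sigma> g x = x" and g: "g \<in> KP (2 * aa) c"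
  shows "\<sigma> g y = y"
proof -
  define W where "W = {y. \<forall>g\<in>KP (2 * aa) c. \<sigma> g y = y}"
  have W: "subspace W" unfolding W_def
    by (rule subspaceI) (auto simp: KP_K[OF c] \<sigma>_0 \<sigma>_add \<sigma>_scale)
  have "\<sigma> k y \<in> W" if k: "k \<in> K" and y: "y \<in> W" for k y
    unfolding W_def
  proof (rule CollectI, rule ballI)
    fix g assume g: "g \<in> KP (2 * aa) c"
    have g': "star k ** g ** k \<in> KP (2 * aa) c" using KP_conj[OF PP_star[OF k] g] by simp
    have "g ** k = k ** (star k ** g ** k)" using PP_GG[OF k] by (simp add: matrix_mul_assoc GG_star_right)
    then have "\<sigma> g (\<sigma> k y) = \<sigma> k (\<sigma> (star k ** g ** k) y)"
      using \<sigma>_mult[OF KP_K[OF c g] k, of y] \<sigma>_mult[OF k KP_K[OF c g'], of y] by simp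
    also have "\<sigma> (star k ** g ** k) y = y" using g' y by (simp add: W_def)
    finally show "\<sigma> g (\<sigma> k y) = \<sigma> k y" .
  qed
  then have "W = {0} \<or> W = UNIV" by (intro \<sigma>_irred W)
  moreover have "x \<in> W" using x(2) by (simp add: W_def)
  ultimately have "y \<in> W" using x(1) by auto
  then show ?thesis using g by (simp add: W_def)
qed

lemma KP_trivial_ex: "\<exists>c\<ge>1. \<forall>g\<in>KP (2 * aa) c. \<forall>y. \<sigma> g y = y"
proof -
  obtain c where c: "c \<ge> 1" "KP (2 * aa) c \<subseteq> {k\<in>K. \<sigma> k v0 = v0}"
    using nbhd_KP[OF stabilizer_open[of v0], of "2 * aa"] by (auto simp: \<sigma>_1)
  then have "\<forall>g\<in>KP (2 * aa) c. \<forall>y. \<sigma> g y = y" using KP_fixed_all[OF c(1) v0_nonzero] by blast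
  then show ?thesis using c(1) by blast
qed

lemma finite_\<sigma>: "finite (\<sigma> ` K)"
proof -
  obtain c where c: "c \<ge> 1" "\<forall>g\<in>KP (2 * aa) c. \<forall>y. \<sigma> g y = y" using KP_trivial_ex by blast
  obtain Q where Q: "finite Q" "Q \<subseteq> K" "K \<subseteq> (\<Union>q\<in>Q. (\<lambda>h. h ** q) ` KP (2 * aa) c)"
    by (rule finite_coset_cover[OF compactin_PP openin_KP KP_1])
  have "\<sigma> ` K \<subseteq> \<sigma> ` Q"
  proof (rule image_subsetI)
    fix k assume "k \<in> K"
    then obtain q h where qh: "q \<in> Q" "h \<in> KP (2 * aa) c" "k = h ** q" using Q(3) by auto
    have "\<sigma> k = \<sigma> q"
    proof
      fix y show "\<sigma> k y = \<sigma> q y"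
        using \<sigma>_mult[OF KP_K[OF c(1) qh(2)], of q y] qh c(2) Q(2) by auto
    qed
    then show "\<sigma> k \<in> \<sigma> ` Q" using qh(1) by (rule image_eqI)
  qed
  then show ?thesis using Q(1) by (meson finite_imageI finite_subset)
qed

lemma finite_orbit: "P \<subseteq> K \<Longrightarrow> finite ((\<lambda>g. \<sigma> g x) ` P)"
proof -
  assume P: "P \<subseteq> K"
  have "(\<lambda>g. \<sigma> g x) ` P \<subseteq> (\<lambda>f. f x) ` (\<sigma> ` K)" using P by auto
  then show ?thesis using finite_\<sigma> by (meson finite_imageI finite_subset)
qed

lemma pro_p_fixed_vector:
  assumes P: "subgroup P (Ugrp bar)" "P \<subseteq> K"
    and tors: "\<And>g. g \<in> P \<Longrightarrow> \<exists>j. \<forall>x. \<sigma> (g [^]\<^bsub>Ugrp bar\<^esub> (p ^ j)) x = x"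
    and Z: "subspace Z" "\<And>g x. g \<in> P \<Longrightarrow> x \<in> Z \<Longrightarrow> \<sigma> g x \<in> Z" and z: "z \<in> Z" "z \<noteq> 0"
  shows "\<exists>x\<in>Z. x \<noteq> 0 \<and> (\<forall>g\<in>P. \<sigma> g x = x)"
proof -
  let ?P = "(Ugrp bar)\<lparr>carrier := P\<rparr>"
  have "\<exists>x\<in>Z. x \<noteq> 0 \<and> (\<forall>g\<in>carrier ?P. \<sigma> g x = x)"
  proof (rule p_group_fixed_vector[OF group_restrict[OF P(1)] prime_p vector_space_axioms char _ _ _ _ _ Z(1) _ z])
    show "\<sigma> g (x + y) = \<sigma> g x + \<sigma> g y" if "g \<in> carrier ?P" for g x y using that P(2) \<sigma>_add by auto
    show "\<sigma> g (scale c x) = scale c (\<sigma> g x)" if "g \<in> carrier ?P" for g c x using that P(2) \<sigma>_scale by auto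
    show "\<sigma> \<one>\<^bsub>?P\<^esub> x = x" for x by (simp add: \<sigma>_1)
    show "\<sigma> (g \<otimes>\<^bsub>?P\<^esub> h) x = \<sigma> g (\<sigma> h x)" if "g \<in> carrier ?P" "h \<in> carrier ?P" for g h x
      using \<sigma>_mult[of g h x] subsetD[OF P(2)] that by simp
    show "\<exists>j. \<forall>x. \<sigma> (g [^]\<^bsub>?P\<^esub> (p ^ j)) x = x" if "g \<in> carrier ?P" for g
      using tors that unfolding G.nat_pow_consistent[symmetric] by simp
    show "\<sigma> g x \<in> Z" if "g \<in> carrier ?P" "x \<in> Z" for g x using that Z(2) by simp
    show "finite ((\<lambda>g. \<sigma> g z) ` carrier ?P)" using finite_orbit[OF P(2)] by simp
  qed
  then show ?thesis by simp
qed

text \<open>By smoothness K^1 acts through a finite p-group, so it fixes a nonzero vector in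
  characteristic p, and by normality it then acts trivially. This is the factorization of weights
  through the reductive quotient.\<close>

lemma K1_trivial: assumes "g \<in> KP (2 * aa) 1" shows "\<sigma> g y = y"
proof -
  obtain c where c: "c \<ge> 1" "\<forall>g\<in>KP (2 * aa) c. \<forall>y. \<sigma> g y = y" using KP_trivial_ex by blast
  have "\<exists>x\<in>UNIV. x \<noteq> 0 \<and> (\<forall>g\<in>KP (2 * aa) 1. \<sigma> g x = x)"
  proof (rule pro_p_fixed_vector[where z = v0])
    show "subgroup (KP (2 * aa) 1) (Ugrp bar)" by (rule KP_subgroup) simp
    show "KP (2 * aa) 1 \<subseteq> K" by (rule KP_subset_PP) simp
    fix g assume "g \<in> KP (2 * aa) 1"
    then have "g [^]\<^bsub>Ugrp bar\<^esub> (p ^ nat c) \<in> KP (2 * aa) (1 + int (nat c))" by (rule KP_pow_p_power) simp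
    then have "g [^]\<^bsub>Ugrp bar\<^esub> (p ^ nat c) \<in> KP (2 * aa) c" by (rule KP_mono) (use c(1) in simp)
    then show "\<exists>j. \<forall>x. \<sigma> (g [^]\<^bsub>Ugrp bar\<^esub> (p ^ j)) x = x" using c(2) by blast
  qed (auto simp: v0_nonzero)
  then obtain x where "x \<noteq> 0" "\<forall>g\<in>KP (2 * aa) 1. \<sigma> g x = x" by blast
  then show ?thesis using KP_fixed_all[of 1 x g y] assms by simp
qed

definition UU where "UU = \<sigma> ` NU (2 * aa)"
definition HH where "HH = \<sigma> ` DG"

lemma sw_K: "sw aa \<in> K" by (rule sw_PP)
lemma NU_K: "n \<in> NU (2 * aa) \<Longrightarrow> n \<in> K" by (rule NU_PP)
lemma DG_K: "h \<in> DG \<Longrightarrow> h \<in> K" by (rule DG_PP)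
lemma I1_K: "KP (2 * aa + 1) 1 \<subseteq> K" using KP_subset_PP[of 1 "2 * aa + 1"] PP_odd_subset by auto

lemma s_s: "s (s x) = x" using \<sigma>_star(1)[OF sw_K] by simp

lemma I1_NU: assumes "g \<in> KP (2 * aa + 1) 1" shows "\<exists>n\<in>NU (2 * aa). \<forall>x. \<sigma> g x = \<sigma> n x"
proof -
  from assms obtain k n where k: "k \<in> KP (2 * aa) 1" "n \<in> NU (2 * aa)" "g = k ** n" by (rule KP_odd_decomp)
  then have "\<sigma> g x = \<sigma> n x" for x using \<sigma>_mult[OF KP_K[of 1, OF _ k(1)] NU_K[OF k(2)]] K1_trivial by simp
  then show ?thesis using k(2) by blast
qed

lemma I1_tors: assumes "g \<in> KP (2 * aa + 1) 1" shows "\<exists>j. \<forall>x. \<sigma> (g [^]\<^bsub>Ugrp bar\<^esub> (p ^ j)) x = x"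
proof -
  from KP_pow_p_power[OF assms, of 2] have "g [^]\<^bsub>Ugrp bar\<^esub> (p ^ 2) \<in> KP (2 * aa) 1" using KP_odd_3 by auto
  then show ?thesis using K1_trivial by blast
qed

lemma linear_functional_ex: "\<exists>l :: 'v \<Rightarrow> 'c. (\<forall>x y. l (x + y) = l x + l y) \<and> (\<forall>c x. l (scale c x) = c * l x) \<and> l v0 \<noteq> 0"
proof -
  have ind: "independent {v0}" using v0_nonzero by (simp add: dependent_single)
  define B where "B = extend_basis {v0}"
  have B: "independent B" "span B = UNIV" "v0 \<in> B"
    unfolding B_def using independent_extend_basis[OF ind] span_extend_basis[OF ind] extend_basis_superset[OF ind] by auto
  show ?thesis
    by (intro exI[of _ "\<lambda>x. representation B x v0"])
      (auto simp: B representation_add representation_scale representation_basis)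
qed

text \<open>The fixed point principle on the dual space: starting from a functional that does not
  vanish at v0, the pro-p Iwahori subgroup fixes some nonzero functional, and this one kills all
  differences \<open>A x - x\<close>. Orbits of functionals are finite because K acts through
  finitely many operators.\<close>

lemma UU_coinvariants_proper: "span {A x - x | A x. A \<in> UU} \<noteq> UNIV"
proof -
  define sc where "sc = (\<lambda>(c::'c) (f::'v \<Rightarrow> 'c) x. c * f x)"
  let ?P = "(Ugrp bar)\<lparr>carrier := KP (2 * aa + 1) 1\<rparr>"
  define act where "act = (\<lambda>g (f::'v \<Rightarrow> 'c) x. f (\<sigma> (star g) x))"
  have vs: "vector_space sc"
    by unfold_locales (auto simp: sc_def algebra_simps fun_eq_iff)
  interpret F: vector_space sc by (rule vs)
  have subI: "subgroup (KP (2 * aa + 1) 1) (Ugrp bar)" by (rule KP_subgroup) simp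
  define Z where "Z = {l :: 'v \<Rightarrow> 'c. (\<forall>x y. l (x + y) = l x + l y) \<and> (\<forall>c x. l (scale c x) = c * l x)}"
  obtain l where l: "l \<in> Z" "l v0 \<noteq> 0" using linear_functional_ex unfolding Z_def by blast
  have gK: "g \<in> K" "star g \<in> K" if "g \<in> carrier ?P" for g using that I1_K KP_star by auto
  have "\<exists>x\<in>Z. x \<noteq> 0 \<and> (\<forall>g\<in>carrier ?P. act g x = x)"
  proof (rule p_group_fixed_vector[OF group_restrict[OF subI] prime_p vs char])
    show "act g (x + y) = act g x + act g y" for g x y by (simp add: act_def fun_eq_iff)
    show "act g (sc c x) = sc c (act g x)" for g c x by (simp add: act_def sc_def)
    show "act \<one>\<^bsub>?P\<^esub> x = x" for x by (simp add: act_def \<sigma>_1)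
    show "act (g \<otimes>\<^bsub>?P\<^esub> h) x = act g (act h x)" if "g \<in> carrier ?P" "h \<in> carrier ?P" for g h x
      using gK[OF that(1)] gK[OF that(2)] by (simp add: act_def star_mult \<sigma>_mult)
    show "\<exists>j. \<forall>x. act (g [^]\<^bsub>?P\<^esub> (p ^ j)) x = x" if g: "g \<in> carrier ?P" for g
    proof -
      obtain j where j: "\<forall>x. \<sigma> (g [^]\<^bsub>Ugrp bar\<^esub> (p ^ j)) x = x" using I1_tors g by auto
      have "g [^]\<^bsub>Ugrp bar\<^esub> (p ^ j) \<in> K"
        using group.is_monoid[OF group_restrict[OF subI]] monoid.nat_pow_closed[of ?P g "p ^ j"] g I1_K
        unfolding G.nat_pow_consistent[symmetric] by auto
      then have "\<sigma> (star (g [^]\<^bsub>Ugrp bar\<^esub> (p ^ j))) x = x" for x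
        using \<sigma>_star(1)[of "g [^]\<^bsub>Ugrp bar\<^esub> (p ^ j)" x] j by simp
      then show ?thesis unfolding G.nat_pow_consistent[symmetric] by (intro exI[of _ j]) (simp add: act_def)
    qed
    show "F.subspace Z" by (rule F.subspaceI) (auto simp: Z_def sc_def algebra_simps)
    show "act g x \<in> Z" if "g \<in> carrier ?P" "x \<in> Z" for g x
      using gK[OF that(1)] that(2) by (auto simp: Z_def act_def \<sigma>_add \<sigma>_scale)
    show "l \<in> Z" by fact
    show "l \<noteq> 0" using l(2) by auto
    have "(\<lambda>g. act g l) ` carrier ?P \<subseteq> (\<lambda>f x. l (f x)) ` (\<sigma> ` K)"
    proof (rule image_subsetI)
      fix g assume "g \<in> carrier ?P"
      then show "act g l \<in> (\<lambda>f x. l (f x)) ` (\<sigma> ` K)" using gK by (auto simp: act_def)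
    qed
    then show "finite ((\<lambda>g. act g l) ` carrier ?P)" using finite_\<sigma> by (meson finite_imageI finite_subset)
  qed
  then obtain f where f: "f \<in> Z" "f \<noteq> 0" "\<And>g. g \<in> KP (2 * aa + 1) 1 \<Longrightarrow> act g f = f" by auto
  have fn: "f (A x - x) = 0" if A: "A \<in> UU" for A x
  proof -
    from A obtain n where n: "n \<in> NU (2 * aa)" "A = \<sigma> n" unfolding UU_def by blast
    have "act (star n) f x = f x" using f(3)[OF KP_star[OF NU_KP[OF n(1)]]] by simp
    then have "f (A x) = f x" by (simp add: act_def n(2))
    moreover have "f (A x - x) + f x = f (A x - x + x)" using f(1) unfolding Z_def by (metis (mono_tags, lifting) mem_Collect_eq)
    ultimately show ?thesis by simp
  qed
  have f0: "f 0 = 0" using f(1) unfolding Z_def by (metis (mono_tags, lifting) mem_Collect_eq mult_zero_left scale_zero_left)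
  have f1: "f x = 0" if "x \<in> span {A x - x | A x. A \<in> UU}" for x
    using that
  proof (induction rule: span_induct_alt)
    case (step c x y)
    then have "f x = 0" using fn by blast
    have "f (scale c x + y) = f (scale c x) + f y" using f(1) by (simp add: Z_def)
    moreover have "f (scale c x) = c * f x" using f(1) by (simp add: Z_def)
    ultimately show ?case using step \<open>f x = 0\<close> by simp
  qed (rule f0)
  show ?thesis
  proof
    assume "span {A x - x | A x. A \<in> UU} = UNIV"
    then have "f = 0" using f1 by auto
    then show False using f(2) by simp
  qed
qed

lemma card_UU_0: assumes "UU \<noteq> {id}" shows "of_nat (card UU) = (0::'c)"
proof -
  define M where "M = \<lparr>carrier = UU, mult = (\<circ>), one = (id :: 'v \<Rightarrow> 'v)\<rparr>"
  have id: "id \<in> UU" unfolding UU_def using \<sigma>_1 NU_1[of "2 * aa"] by (intro image_eqI[of _ _ "mat 1"]) auto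
  have pw: "(\<sigma> n) [^]\<^bsub>M\<^esub> j = \<sigma> (n [^]\<^bsub>Ugrp bar\<^esub> j) \<and> n [^]\<^bsub>Ugrp bar\<^esub> j \<in> NU (2 * aa)" if n: "n \<in> NU (2 * aa)" for n and j :: nat
    by (induction j) (auto simp: M_def nat_pow_def NU_1 NU_mult n fun_eq_iff \<sigma>_1 \<sigma>_mult NU_K)
  have fin: "finite UU" unfolding UU_def using finite_\<sigma> NU_K by (meson finite_subset image_mono subsetI)
  have "group M"
  proof (rule groupI)
    fix A B assume "A \<in> carrier M" "B \<in> carrier M"
    then obtain m n where "m \<in> NU (2 * aa)" "n \<in> NU (2 * aa)" "A = \<sigma> m" "B = \<sigma> n" by (auto simp: M_def UU_def)
    moreover from this have "\<sigma> m \<circ> \<sigma> n = \<sigma> (m ** n)" by (auto simp: \<sigma>_mult NU_K)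
    ultimately show "A \<otimes>\<^bsub>M\<^esub> B \<in> carrier M" by (auto simp: M_def UU_def NU_mult)
  next
    fix A assume "A \<in> carrier M"
    then obtain n where n: "n \<in> NU (2 * aa)" "A = \<sigma> n" by (auto simp: M_def UU_def)
    have "\<sigma> (star n) \<circ> \<sigma> n = id" using \<sigma>_star(1)[OF NU_K[OF n(1)]] by auto
    then show "\<exists>B\<in>carrier M. B \<otimes>\<^bsub>M\<^esub> A = \<one>\<^bsub>M\<^esub>"
      using n star_NU by (intro bexI[of _ "\<sigma> (star n)"]) (auto simp: M_def UU_def)
  qed (use id in \<open>auto simp: M_def comp_assoc\<close>)
  then have "\<exists>n. order M = p ^ n"
  proof (rule group_p_power_order[OF _ _ prime_p])
    show "finite (carrier M)" using fin by (simp add: M_def)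
    fix A assume "A \<in> carrier M"
    then obtain n where n: "n \<in> NU (2 * aa)" "A = \<sigma> n" by (auto simp: M_def UU_def)
    obtain j where "\<forall>x. \<sigma> (n [^]\<^bsub>Ugrp bar\<^esub> (p ^ j)) x = x" using I1_tors[OF NU_KP[OF n(1)]] by blast
    then have "\<sigma> (n [^]\<^bsub>Ugrp bar\<^esub> (p ^ j)) = id" by auto
    then show "\<exists>j. A [^]\<^bsub>M\<^esub> (p ^ j) = \<one>\<^bsub>M\<^esub>" using pw[OF n(1)] n(2) by (intro exI[of _ j]) (simp add: M_def)
  qed
  then obtain n where n: "card UU = p ^ n" by (auto simp: order_def M_def)
  have "n \<noteq> 0"
  proof
    assume "n = 0"
    then have "card UU = 1" using n by simp
    then show False using assms id by (metis card_1_singletonE singletonD)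
  qed
  then show ?thesis using n char by simp
qed

text \<open>Each axiom of the rank one setting is the image of a matrix identity in K, valid modulo
  K^1, which acts trivially.\<close>

sublocale R: rank_one_rep scale UU HH s
proof
  have ops: "\<exists>k\<in>K. A = \<sigma> k" if "A \<in> UU \<union> HH \<union> {s}" for A
    using that NU_K DG_K sw_K unfolding UU_def HH_def by blast
  show "A (x + y) = A x + A y" if "A \<in> UU \<union> HH \<union> {s}" for A x y using ops[OF that] \<sigma>_add by blast
  show "A (scale c x) = scale c (A x)" if "A \<in> UU \<union> HH \<union> {s}" for A c x using ops[OF that] \<sigma>_scale by blast
  show "finite UU" unfolding UU_def using finite_\<sigma> NU_K by (meson finite_subset image_mono subsetI)
  show "finite HH" unfolding HH_def using finite_\<sigma> DG_K by (meson finite_subset image_mono subsetI)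
  show "id \<in> UU" unfolding UU_def using \<sigma>_1 NU_1[of "2 * aa"] by (intro image_eqI[of _ _ "mat 1"]) auto
  show "A \<circ> B \<in> UU" if "A \<in> UU" "B \<in> UU" for A B
  proof -
    from that obtain m n where mn: "m \<in> NU (2 * aa)" "n \<in> NU (2 * aa)" "A = \<sigma> m" "B = \<sigma> n" by (auto simp: UU_def)
    then have "A \<circ> B = \<sigma> (m ** n)" by (auto simp: \<sigma>_mult NU_K)
    then show ?thesis using NU_mult[OF mn(1,2)] by (auto simp: UU_def)
  qed
  show "\<exists>B\<in>UU. A \<circ> B = id \<and> B \<circ> A = id" if "A \<in> UU" for A
  proof -
    from that obtain n where n: "n \<in> NU (2 * aa)" "A = \<sigma> n" by (auto simp: UU_def)
    then show ?thesis using star_NU[OF n(1)] \<sigma>_star[OF NU_K[OF n(1)]]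
      by (intro bexI[of _ "\<sigma> (star n)"]) (auto simp: UU_def)
  qed
  show "h \<circ> k \<in> HH" if "h \<in> HH" "k \<in> HH" for h k
  proof -
    from that obtain m n where mn: "m \<in> DG" "n \<in> DG" "h = \<sigma> m" "k = \<sigma> n" by (auto simp: HH_def)
    then have "h \<circ> k = \<sigma> (m ** n)" by (auto simp: \<sigma>_mult DG_K)
    then show ?thesis using DG_mult(1)[OF mn(1,2)] by (auto simp: HH_def)
  qed
  show "\<exists>k\<in>HH. h \<circ> k = id \<and> k \<circ> h = id" if "h \<in> HH" for h
  proof -
    from that obtain n where n: "n \<in> DG" "h = \<sigma> n" by (auto simp: HH_def)
    then show ?thesis using DG_star[OF n(1)] \<sigma>_star[OF DG_K[OF n(1)]]
      by (intro bexI[of _ "\<sigma> (star n)"]) (auto simp: HH_def)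
  qed
  show "h \<circ> k = k \<circ> h" if "h \<in> HH" "k \<in> HH" for h k
  proof -
    from that obtain m n where mn: "m \<in> DG" "n \<in> DG" "h = \<sigma> m" "k = \<sigma> n" by (auto simp: HH_def)
    have "\<sigma> (m ** n) x = \<sigma> (n ** m) x" for x using DG_mult(2)[OF mn(1,2)] by simp
    then show ?thesis using mn by (auto simp: \<sigma>_mult DG_K)
  qed
  show "s (s x) = x" for x by (rule s_s)
  show "\<exists>k\<in>HH. \<forall>x. h (s x) = s (k x)" if "h \<in> HH" for h
  proof -
    from that obtain m where m: "m \<in> DG" "h = \<sigma> m" by (auto simp: HH_def)
    have d: "sw aa ** m ** sw aa \<in> DG" by (rule sw_DG[OF m(1)])
    have "m ** sw aa = sw aa ** (sw aa ** m ** sw aa)" by (simp add: matrix_mul_assoc sw_sw)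
    then have "h (s x) = s (\<sigma> (sw aa ** m ** sw aa) x)" for x
      using \<sigma>_mult[OF DG_K[OF m(1)] sw_K, of x] \<sigma>_mult[OF sw_K DG_K[OF d], of x] m(2) by simp
    then show ?thesis using d by (auto simp: HH_def)
  qed
  show "\<exists>B\<in>UU. h \<circ> A = B \<circ> h" if "h \<in> HH" "A \<in> UU" for h A
  proof -
    from that obtain m n where mn: "m \<in> DG" "n \<in> NU (2 * aa)" "h = \<sigma> m" "A = \<sigma> n" by (auto simp: HH_def UU_def)
    have d: "m ** n ** star m \<in> NU (2 * aa)" by (rule DG_NU_conj[OF mn(1,2)])
    have "m ** n = (m ** n ** star m) ** m" using DG_GG[OF mn(1)] by (simp add: star_cancel')
    then have "h \<circ> A = \<sigma> (m ** n ** star m) \<circ> h"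
      using \<sigma>_mult[OF DG_K[OF mn(1)] NU_K[OF mn(2)]] \<sigma>_mult[OF NU_K[OF d] DG_K[OF mn(1)]] mn(3,4) by (auto simp: fun_eq_iff)
    then show ?thesis using d by (auto simp: UU_def)
  qed
  show "\<exists>B\<in>UU. A \<circ> h = h \<circ> B" if "h \<in> HH" "A \<in> UU" for h A
  proof -
    from that obtain m n where mn: "m \<in> DG" "n \<in> NU (2 * aa)" "h = \<sigma> m" "A = \<sigma> n" by (auto simp: HH_def UU_def)
    have d: "star m ** n ** m \<in> NU (2 * aa)" using DG_NU_conj[OF DG_star[OF mn(1)] mn(2)] by simp
    have "n ** m = m ** (star m ** n ** m)" using DG_GG[OF mn(1)] by (simp add: matrix_mul_assoc GG_star_right)
    then have "A \<circ> h = h \<circ> \<sigma> (star m ** n ** m)"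
      using \<sigma>_mult[OF NU_K[OF mn(2)] DG_K[OF mn(1)]] \<sigma>_mult[OF DG_K[OF mn(1)] NU_K[OF d]] mn(3,4) by (auto simp: fun_eq_iff)
    then show ?thesis using d by (auto simp: UU_def)
  qed
  have cell: "\<exists>B\<in>NU (2 * aa). \<exists>h\<in>DG. \<exists>C\<in>NU (2 * aa). \<forall>x. s (\<sigma> n (s x)) = \<sigma> B (\<sigma> h (s (\<sigma> C x)))"
    if n: "n \<in> NU (2 * aa)" "n \<notin> KP (2 * aa) 1" for n
  proof -
    from n obtain n1 h n2 k where d: "n1 \<in> NU (2 * aa)" "h \<in> DG" "n2 \<in> NU (2 * aa)" "k \<in> KP (2 * aa) 1"
      "sw aa ** n ** sw aa = n1 ** h ** sw aa ** k ** n2" by (rule NL_sw_NU_decomp)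
    have kK: "k \<in> K" using d(4) KP_K[of 1] by simp
    have "s (\<sigma> n (s x)) = \<sigma> (sw aa ** n ** sw aa) x" for x
      using n(1) by (simp add: \<sigma>_mult sw_K NU_K PP_mult)
    also have "\<sigma> (sw aa ** n ** sw aa) x = \<sigma> n1 (\<sigma> h (s (\<sigma> k (\<sigma> n2 x))))" for x
      unfolding d(5) using d(1-3) kK by (simp add: \<sigma>_mult sw_K NU_K DG_K PP_mult)
    finally have "s (\<sigma> n (s x)) = \<sigma> n1 (\<sigma> h (s (\<sigma> n2 x)))" for x
      by (simp only: K1_trivial[OF d(4)])
    then show ?thesis by (intro bexI[OF _ d(1)] bexI[OF _ d(2)] bexI[OF _ d(3)] allI)
  qed
  show "\<exists>B\<in>UU. \<exists>h\<in>HH. \<exists>C\<in>UU. \<forall>x. s (A (s x)) = B (h (s (C x)))" if A: "A \<in> UU" "A \<noteq> id" for A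
  proof -
    from A(1) obtain n where n: "n \<in> NU (2 * aa)" "A = \<sigma> n" by (auto simp: UU_def)
    have "n \<notin> KP (2 * aa) 1" using A(2) K1_trivial n(2) by auto
    from cell[OF n(1) this] show ?thesis unfolding UU_def HH_def n(2) by blast
  qed
  \<comment> \<open>If N acts trivially, the rank one relation for the nontrivial element
    \<open>u0\<close> collapses to h s = 1 for some h in the torus.\<close>
  show "s \<in> HH" if U: "UU = {id}"
  proof -
    have tr: "\<sigma> n x = x" if "n \<in> NU (2 * aa)" for n x
    proof -
      have "\<sigma> n \<in> UU" using that by (simp add: UU_def)
      then show ?thesis using U by simp
    qed
    obtain B h C where "B \<in> NU (2 * aa)" "h \<in> DG" "C \<in> NU (2 * aa)" "\<forall>x. s (\<sigma> (u0 aa) (s x)) = \<sigma> B (\<sigma> h (s (\<sigma> C x)))"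
      using cell[OF u0(1,2)] by blast
    then have h: "h \<in> DG" "\<And>x. \<sigma> h (s x) = x" using tr u0(1) s_s by auto
    have "s x = \<sigma> (star h) x" for x using \<sigma>_star(1)[OF DG_K[OF h(1)], of "s x"] h(2) by simp
    then have "s = \<sigma> (star h)" by auto
    then show ?thesis using DG_star[OF h(1)] by (simp add: HH_def)
  qed
  show "W = {0} \<or> W = UNIV" if W: "subspace W" "\<And>A x. A \<in> UU \<union> HH \<union> {s} \<Longrightarrow> x \<in> W \<Longrightarrow> A x \<in> W" for W
  proof (rule \<sigma>_irred[OF W(1)])
    have wn: "\<sigma> n x \<in> W" if "n \<in> NU (2 * aa)" "x \<in> W" for n x using W(2)[of "\<sigma> n" x] that by (simp add: UU_def)
    have wh: "\<sigma> n x \<in> W" if "n \<in> DG" "x \<in> W" for n x using W(2)[of "\<sigma> n" x] that by (simp add: HH_def)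
    have ws: "s x \<in> W" if "x \<in> W" for x using W(2)[of s x] that by simp
    \<comment> \<open>The lower Borel part acts through the given operators as well, since lower
      unipotents are reflected upper ones. With \<open>K_cells\<close> a subspace stable under the
      operators is stable under K.\<close>
    have wl: "\<sigma> l x \<in> W" if l: "l \<in> LO (2 * aa)" and x: "x \<in> W" for l x
    proof -
      from l obtain h m where h: "h \<in> DG" "m \<in> NL (2 * aa)" "l = h ** m" unfolding LO_iff by blast
      from h(2) obtain x' y' where n: "sw aa ** m ** sw aa = nu x' y'" "nu x' y' \<in> NU (2 * aa)" by (rule sw_NL)
      have m: "m = sw aa ** nu x' y' ** sw aa" by (rule sw_conj_eq[OF n(1)])
      have "\<sigma> l x = \<sigma> h (s (\<sigma> (nu x' y') (s x)))"
        unfolding h(3) m using h(1) n(2) by (simp add: \<sigma>_mult sw_K NU_K DG_K PP_mult)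
      then show ?thesis using wn wh ws h(1) n(2) x by simp
    qed
    fix k x assume k: "k \<in> K" and x: "x \<in> W"
    from K_cells[OF k] show "\<sigma> k x \<in> W"
    proof
      assume "\<exists>l\<in>LO (2 * aa). \<exists>n\<in>NU (2 * aa). k = l ** n"
      then obtain l n where l: "l \<in> LO (2 * aa)" "n \<in> NU (2 * aa)" "k = l ** n" by blast
      then show ?thesis using wl[OF l(1) wn[OF l(2) x]] by (simp add: \<sigma>_mult LO_PP NU_K)
    next
      assume "\<exists>l\<in>LO (2 * aa). \<exists>n\<in>NL (2 * aa) \<inter> KP (2 * aa) 1. k = l ** sw aa ** n"
      then obtain l n where l: "l \<in> LO (2 * aa)" "n \<in> KP (2 * aa) 1" "k = l ** sw aa ** n" by blast
      have "\<sigma> k x = \<sigma> l (s x)"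
        unfolding l(3) using l KP_K[of 1 n] by (simp add: \<sigma>_mult sw_K LO_PP PP_mult K1_trivial)
      then show ?thesis using wl[OF l(1) ws[OF x]] by simp
    qed
  qed
  show "\<exists>x\<in>Z. x \<noteq> 0 \<and> (\<forall>A\<in>UU. A x = x)"
    if Z: "subspace Z" "\<And>A z. A \<in> UU \<Longrightarrow> z \<in> Z \<Longrightarrow> A z \<in> Z" "z \<in> Z" "z \<noteq> 0" for Z z
  proof -
    have "\<exists>x\<in>Z. x \<noteq> 0 \<and> (\<forall>g\<in>KP (2 * aa + 1) 1. \<sigma> g x = x)"
    proof (rule pro_p_fixed_vector[OF _ I1_K I1_tors Z(1) _ Z(3,4)])
      show "subgroup (KP (2 * aa + 1) 1) (Ugrp bar)" by (rule KP_subgroup) simp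
      fix g x assume g: "g \<in> KP (2 * aa + 1) 1" and x: "x \<in> Z"
      obtain n where n: "n \<in> NU (2 * aa)" "\<forall>x. \<sigma> g x = \<sigma> n x" using I1_NU[OF g] by blast
      have "\<sigma> n x \<in> Z" using Z(2)[of "\<sigma> n" x] n(1) x by (simp add: UU_def)
      then show "\<sigma> g x \<in> Z" using n(2) by simp
    qed
    then show ?thesis using NU_KP by (auto simp: UU_def)
  qed
  show "span {A x - x | A x. A \<in> UU} \<noteq> UNIV" by (rule UU_coinvariants_proper)
  show "of_nat (card UU) = (0::'c)" if "UU \<noteq> {id}" using that by (rule card_UU_0)
qed

lemma fixed_iff: "R.fixed x \<longleftrightarrow> (\<forall>n\<in>NU (2 * aa). \<sigma> n x = x)"
  unfolding R.fixed_def unfolding UU_def by simp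

lemma invariants_iff: "x \<in> invariants v bar \<pi> p t \<sigma> \<longleftrightarrow> R.fixed x"
proof
  assume "x \<in> invariants v bar \<pi> p t \<sigma>"
  then show "R.fixed x" using NU_KP by (auto simp: Defs.invariants_def pro_p_Iwahori_eq fixed_iff)
next
  assume x: "R.fixed x"
  have "\<sigma> g x = x" if g: "g \<in> KP (2 * aa + 1) 1" for g
  proof -
    obtain n where n: "n \<in> NU (2 * aa)" "\<forall>x. \<sigma> g x = \<sigma> n x" using I1_NU[OF g] by blast
    then have "\<sigma> n x = x" using x by (simp add: fixed_iff)
    then show ?thesis using n(2) by simp
  qed
  then show "x \<in> invariants v bar \<pi> p t \<sigma>" by (simp add: Defs.invariants_def pro_p_Iwahori_eq)
qed

lemma v0_fixed: "R.fixed v0" using v0_inv invariants_iff by blast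

lemma I1_v0: "g \<in> KP (2 * aa + 1) 1 \<Longrightarrow> \<sigma> g v0 = v0"
  using v0_inv by (simp add: Defs.invariants_def pro_p_Iwahori_eq)

lemma opp_act: assumes "k \<in> KP (2 * aa - 1) 1" shows "\<exists>A\<in>UU. \<forall>x. \<sigma> k x = s (A (s x))"
proof -
  from assms obtain k1 n where k: "k1 \<in> KP (2 * aa) 1" "n \<in> NU (2 * aa)" "k = k1 ** (sw aa ** n ** sw aa)" by (rule KP_opp_decomp)
  have "\<sigma> k x = s (\<sigma> n (s x))" for x
    unfolding k(3) using KP_K[OF _ k(1)] NU_K[OF k(2)] by (simp add: \<sigma>_mult sw_K PP_mult K1_trivial[OF k(1)])
  then show ?thesis using k(2) by (auto simp: UU_def)
qed

lemma IU_eq: "span {\<sigma> k z - z | k z. k \<in> pro_p_Iwahori_opp v bar \<pi> p t} = R.IU"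
proof -
  have "{\<sigma> k z - z | k z. k \<in> KP (2 * aa - 1) 1} = {s (A (s x)) - x | A x. A \<in> UU}"
  proof (intro equalityI subsetI)
    fix y assume "y \<in> {\<sigma> k z - z | k z. k \<in> KP (2 * aa - 1) 1}"
    then obtain k z where k: "k \<in> KP (2 * aa - 1) 1" "y = \<sigma> k z - z" by blast
    obtain A where "A \<in> UU" "\<forall>x. \<sigma> k x = s (A (s x))" using opp_act[OF k(1)] by blast
    then have "A \<in> UU" "y = s (A (s z)) - z" using k(2) by simp_all
    then show "y \<in> {s (A (s x)) - x | A x. A \<in> UU}" by blast
  next
    fix y assume "y \<in> {s (A (s x)) - x | A x. A \<in> UU}"
    then obtain n x where n: "n \<in> NU (2 * aa)" "y = s (\<sigma> n (s x)) - x" unfolding UU_def by blast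
    have "sw aa ** n ** sw aa \<in> KP (2 * aa - 1) 1" by (rule sw_KP_conj[OF NU_KP[OF n(1)]])
    moreover have "s (\<sigma> n (s x)) = \<sigma> (sw aa ** n ** sw aa) x" using n(1) by (simp add: \<sigma>_mult sw_K NU_K PP_mult)
    then have "y = \<sigma> (sw aa ** n ** sw aa) x - x" using n(2) by simp
    ultimately show "y \<in> {\<sigma> k z - z | k z. k \<in> KP (2 * aa - 1) 1}" by blast
  qed
  then show ?thesis unfolding pro_p_Iwahori_opp_eq R.IU_def by simp
qed

text \<open>The coordinate of x in the one-dimensional coinvariants, normalized by v0. In these
  terms j_sigma sends x to \<open>lc x\<close> times v0 (\<open>jmap_eq\<close>).\<close>

definition lc :: "'v \<Rightarrow> 'c" where "lc x = (THE c. x - scale c v0 \<in> R.IU)"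

lemmas sIU = R.subspace_IU

lemma lc_unique: assumes "x - scale c v0 \<in> R.IU" shows "lc x = c"
  unfolding lc_def
proof (rule the_equality)
  show "x - scale c v0 \<in> R.IU" by (rule assms)
  fix d assume d: "x - scale d v0 \<in> R.IU"
  have "(x - scale c v0) - (x - scale d v0) \<in> R.IU" by (rule subspace_diff[OF sIU assms d])
  then have 1: "scale (d - c) v0 \<in> R.IU" by (simp add: scale_left_diff_distrib)
  show "d = c"
  proof (rule ccontr)
    assume "d \<noteq> c"
    then have "scale (inverse (d - c)) (scale (d - c) v0) = v0" by simp
    then have "v0 \<in> R.IU" using subspace_scale[OF sIU 1, of "inverse (d - c)"] by simp
    then show False using R.coinvariants(1)[OF v0_fixed v0_nonzero] by blast
  qed
qed

lemma lc: "x - scale (lc x) v0 \<in> R.IU"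
  using R.coinvariants(2)[OF v0_fixed v0_nonzero, of x] lc_unique by blast

lemma lc_add: "lc (x + y) = lc x + lc y"
  by (rule lc_unique) (use subspace_add[OF sIU lc[of x] lc[of y]] in \<open>simp add: scale_left_distrib algebra_simps\<close>)

lemma lc_scale: "lc (scale c x) = c * lc x"
  by (rule lc_unique) (use subspace_scale[OF sIU lc[of x], of c] in \<open>simp add: scale_right_diff_distrib\<close>)

lemma lc_v0: "lc v0 = 1"
  by (rule lc_unique) (use subspace_0[OF sIU] in simp)

lemma lc_IU: "x - y \<in> R.IU \<Longrightarrow> lc x = lc y"
  by (rule lc_unique) (use subspace_add[OF sIU _ lc[of y], of "x - y"] in simp)

lemma lc_opp: assumes "k \<in> KP (2 * aa - 1) 1" shows "lc (\<sigma> k x) = lc x"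
proof (rule lc_IU)
  have "\<sigma> k x - x \<in> {\<sigma> k z - z | k z. k \<in> pro_p_Iwahori_opp v bar \<pi> p t}"
    using assms unfolding pro_p_Iwahori_opp_eq by blast
  then show "\<sigma> k x - x \<in> R.IU" unfolding IU_eq[symmetric] by (rule span_base)
qed

text \<open>The nondegeneracy from \<open>coinvariants\<close>. It is what lets the outermost values
  of a function be recovered from its image under T.\<close>

lemma lc_eq_0: assumes "\<And>n. n \<in> NU (2 * aa) \<Longrightarrow> lc (\<sigma> n x) = 0" shows "x = 0"
proof (rule R.coinvariants(3)[OF v0_fixed v0_nonzero])
  fix A assume "A \<in> UU"
  then obtain n where "n \<in> NU (2 * aa)" "A = \<sigma> n" by (auto simp: UU_def)
  then show "A x \<in> R.IU" using lc[of "A x"] assms by simp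
qed

text \<open>The torus acts on the line of v0 by a character and preserves \<open>IU\<close>; as v0
  represents a basis of the coinvariants, the character there is the same.\<close>

lemma DG_char: assumes h: "h \<in> DG" obtains c where "\<sigma> h v0 = scale c v0" "\<And>x. lc (\<sigma> h x) = c * lc x"
proof -
  have hH: "\<sigma> h \<in> HH" using h by (simp add: HH_def)
  then obtain c where c: "\<sigma> h v0 = scale c v0"
    using R.fixed_unique(1)[OF v0_fixed v0_nonzero] by (auto simp: R.eigen_def)
  have "lc (\<sigma> h x) = c * lc x" for x
  proof (rule lc_unique)
    have "\<sigma> h (x - scale (lc x) v0) \<in> R.IU" by (rule R.HH_IU[OF hH lc])
    then show "\<sigma> h x - scale (c * lc x) v0 \<in> R.IU"
      using DG_K[OF h] c by (simp add: \<sigma>_diff \<sigma>_scale mult.commute)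
  qed
  then show ?thesis using that c by blast
qed

lemma jmap_eq: "jmap v bar \<pi> p t scale \<sigma> x = scale (lc x) v0"
proof -
  let ?I = "invariants v bar \<pi> p t \<sigma>" and ?c = "coinv_proj v bar \<pi> p t scale \<sigma>"
  have c: "?c x = {y. y - x \<in> R.IU}" for x unfolding coinv_proj_def IU_eq ..
  have eq: "?c x = ?c y \<longleftrightarrow> lc x = lc y" for x y
  proof
    assume "?c x = ?c y"
    moreover have "x \<in> ?c x" unfolding c using subspace_0[OF sIU] by simp
    ultimately show "lc x = lc y" unfolding c using lc_IU by blast
  next
    assume e: "lc x = lc y"
    have "(x - scale (lc x) v0) - (y - scale (lc y) v0) \<in> R.IU" by (intro subspace_diff sIU lc)
    then have xy: "x - y \<in> R.IU" by (simp add: e)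
    have yx: "y - x \<in> R.IU" using subspace_neg[OF sIU xy] by simp
    have "z - x \<in> R.IU \<longleftrightarrow> z - y \<in> R.IU" for z
      using subspace_add[OF sIU _ xy, of "z - x"] subspace_add[OF sIU _ yx, of "z - y"] by auto
    then show "?c x = ?c y" unfolding c by blast
  qed
  have inj: "inj_on ?c ?I"
  proof (rule inj_onI)
    fix x y assume "x \<in> ?I" "y \<in> ?I" "?c x = ?c y"
    moreover from this obtain a b where "x = scale a v0" "y = scale b v0"
      using R.fixed_unique(3)[OF v0_fixed v0_nonzero] invariants_iff by blast
    ultimately show "x = y" unfolding eq by (simp add: lc_scale lc_v0)
  qed
  have "scale (lc x) v0 \<in> ?I" using R.subspace_fixed v0_fixed unfolding invariants_iff
    by (metis mem_Collect_eq subspace_scale)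
  moreover have "?c (scale (lc x) v0) = ?c x" unfolding eq by (simp add: lc_scale lc_v0)
  ultimately show ?thesis unfolding jmap_def by (rule inv_into_f_eq[OF inj])
qed

end

section \<open>Compact induction and the Hecke operator\<close>

context local_unitary begin

lemma compactin_right_translate: 
  assumes S: "compactin (Utop v bar) S" and x: "x \<in> GG" shows "compactin (Utop v bar) ((\<lambda>u. u ** x) ` S)"
proof (rule image_compactin[OF S])
  show "continuous_map (Utop v bar) (Utop v bar) (\<lambda>u. u ** x)"
    unfolding continuous_map_def topspace_Utop
  proof (intro conjI allI impI)
    show "(\<lambda>u. u ** x) \<in> GG \<rightarrow> GG" using x by (simp add: mult_GG)
    fix U assume U: "openin (Utop v bar) U"
    have "{u \<in> GG. u ** x \<in> U} = (\<lambda>u. u ** star x) ` U"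
    proof (intro equalityI subsetI)
      fix u assume "u \<in> {u \<in> GG. u ** x \<in> U}"
      then show "u \<in> (\<lambda>u. u ** star x) ` U" using x by (intro image_eqI[of _ _ "u ** x"]) (auto simp: star_cancel')
    next
      fix u assume "u \<in> (\<lambda>u. u ** star x) ` U"
      then obtain w where w: "w \<in> U" "u = w ** star x" by blast
      then have "w \<in> GG" using U by (auto simp: openin_Utop)
      then show "u \<in> {u \<in> GG. u ** x \<in> U}" using w x by (simp add: mult_GG star_GG star_cancel')
    qed
    then show "openin (Utop v bar) {u \<in> GG. u ** x \<in> U}"
      using openin_right_translate[OF U star_GG[OF x]] by simp
  qed
qed

lemma alpha_eq: "alpha \<pi> = alph 1"
  by (rule mat3_eqI) (simp_all add: alpha_def)

lemma alpha_pow: "alpha \<pi> [^]\<^bsub>Ugrp bar\<^esub> (n::int) = alph n"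
proof -
  have nat: "alpha \<pi> [^]\<^bsub>Ugrp bar\<^esub> (m::nat) = alph (int m)" for m
    by (induction m) (simp_all add: alpha_eq alph_add add.commute)
  show ?thesis
    by (simp add: int_pow_def2 nat inv_GG)
qed

text \<open>The two matrices beta_K are the reflections of the apartment at the two
  vertices.\<close>

lemma beta_eq: "beta bar \<pi> t = sw (av t)"
proof -
  have 0: "antidiag = sw 0" by (rule mat3_eqI) simp_all
  have "sw 0 ** alph (- 1) = sw 1" using sw_shift[of 1] by (simp add: alph_add flip: matrix_mul_assoc)
  then show ?thesis by (cases t) (simp_all add: beta_def av_def 0 alpha_eq inv_GG)
qed

lemma dcoset_eq: "dcoset v bar t g H = {k ** g ** h | k h. k \<in> PP (2 * av t) \<and> h \<in> H}"
  unfolding dcoset_def Kset_eq set_mult_def r_coset_def by auto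

lemma dcoset_cell: "dcoset v bar t (alph m) (PP (2 * av t + 1)) = cell (av t) m"
  unfolding dcoset_eq cell_def ..

end

context weight_rep begin

definition coset :: "'e^3^3 \<Rightarrow> ('e^3^3) set" where "coset y = (\<lambda>x. x ** y) ` K"

lemma K_GG: "k \<in> K \<Longrightarrow> k \<in> GG" by (rule PP_GG)

lemma coset_self: "y \<in> coset y" unfolding coset_def by (rule image_eqI[of _ _ "mat 1"]) auto

lemma coset_mult: "k \<in> K \<Longrightarrow> y \<in> GG \<Longrightarrow> coset (k ** y) = coset y"
  unfolding coset_def by (rule coset_absorb[OF PP_subgroup])

lemma coset_eq_iff: assumes "y \<in> GG" shows "coset x = coset y \<longleftrightarrow> (\<exists>k\<in>K. x = k ** y)"
proof
  assume "coset x = coset y"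
  then have "x \<in> coset y" using coset_self by blast
  then show "\<exists>k\<in>K. x = k ** y" by (auto simp: coset_def)
qed (use coset_mult assms in auto)

lemma rcosets_eq: "rcosets\<^bsub>Ugrp bar\<^esub> K = coset ` GG"
  by (auto simp: RCOSETS_def rcoset_Ugrp coset_def)

lemma finite_reps:
  assumes "finite Q" "Q \<subseteq> GG" obtains Y where "finite Y" "Y \<subseteq> GG" "inj_on coset Y" "\<And>q. q \<in> Q \<Longrightarrow> \<exists>y\<in>Y. coset q = coset y"
proof -
  obtain Y where "Y \<subseteq> Q" "inj_on coset Y" "coset ` Q = coset ` Y" using subset_image_inj[of "coset ` Q" coset Q] by auto
  moreover from this have "\<exists>y\<in>Y. coset q = coset y" if "q \<in> Q" for q using that by (metis imageE imageI)
  ultimately show ?thesis using that[of Y] assms finite_subset[of Y Q] by (meson subset_trans)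
qed

definition equivariant :: "('e^3^3 \<Rightarrow> 'v) \<Rightarrow> bool" where
  "equivariant f \<longleftrightarrow> (\<forall>g. g \<notin> GG \<longrightarrow> f g = 0) \<and> (\<forall>k\<in>K. \<forall>g\<in>GG. f (k ** g) = \<sigma> k (f g))"

definition fin_supp :: "('e^3^3 \<Rightarrow> 'v) \<Rightarrow> bool" where
  "fin_supp f \<longleftrightarrow> (\<exists>Q. finite Q \<and> Q \<subseteq> GG \<and> (\<forall>g\<in>GG. f g \<noteq> 0 \<longrightarrow> (\<exists>q\<in>Q. \<exists>k\<in>K. g = k ** q)))"

lemma equivariant_0: "equivariant f \<Longrightarrow> k \<in> K \<Longrightarrow> g \<in> GG \<Longrightarrow> f (k ** g) = 0 \<longleftrightarrow> f g = 0"
  unfolding equivariant_def using \<sigma>_star(1)[of k "f g"] \<sigma>_0[of k] \<sigma>_0[of "star k"] PP_star[of k "2 * aa"] by auto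

text \<open>Replaces topology by finite combinatorics. As K is open and compact, an equivariant
  function has compact support exactly when its support is a finite union of cosets K g; local
  constancy follows from smoothness of the weight.\<close>

lemma ind_iff: "f \<in> ind v bar t \<sigma> \<longleftrightarrow> equivariant f \<and> fin_supp f"
proof
  assume f: "f \<in> ind v bar t \<sigma>"
  then have eq: "equivariant f" by (auto simp: ind_def equivariant_def Kset_eq)
  have "compactin (Utop v bar) {g. f g \<noteq> 0}" using f by (simp add: ind_def)
  then obtain Q where Q: "finite Q" "Q \<subseteq> {g. f g \<noteq> 0}" "{g. f g \<noteq> 0} \<subseteq> (\<Union>q\<in>Q. (\<lambda>h. h ** q) ` K)"
    by (rule finite_coset_cover[OF _ openin_PP PP_1])
  have "fin_supp f" unfolding fin_supp_def
  proof (intro exI conjI ballI impI)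
    show "finite Q" by fact
    show "Q \<subseteq> GG" using Q(2) eq by (auto simp: equivariant_def)
    fix g assume "f g \<noteq> 0"
    then have "g \<in> (\<Union>q\<in>Q. (\<lambda>h. h ** q) ` K)" using Q(3) by (intro subsetD[OF Q(3)]) simp
    then obtain q k where "q \<in> Q" "k \<in> K" "g = k ** q" by (elim UN_E imageE)
    then show "\<exists>q\<in>Q. \<exists>k\<in>K. g = k ** q" by (intro bexI)
  qed
  then show "equivariant f \<and> fin_supp f" using eq by blast
next
  assume f: "equivariant f \<and> fin_supp f"
  then have eq: "equivariant f" and z: "\<And>g. g \<notin> GG \<Longrightarrow> f g = 0" by (auto simp: equivariant_def)
  obtain Q where Q: "finite Q" "Q \<subseteq> GG" "\<And>g. g \<in> GG \<Longrightarrow> f g \<noteq> 0 \<Longrightarrow> \<exists>q\<in>Q. \<exists>k\<in>K. g = k ** q"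
    using f unfolding fin_supp_def by blast
  have loc: "\<exists>U. openin (Utop v bar) U \<and> g \<in> U \<and> (\<forall>h\<in>U. f h = f g)" if g: "g \<in> GG" for g
  proof (intro exI conjI)
    show "openin (Utop v bar) ((\<lambda>u. u ** g) ` {k\<in>K. \<sigma> k (f g) = f g})"
      by (rule openin_right_translate[OF stabilizer_open g])
    show "g \<in> (\<lambda>u. u ** g) ` {k\<in>K. \<sigma> k (f g) = f g}"
      by (rule image_eqI[of _ _ "mat 1"]) (auto simp: \<sigma>_1)
    show "\<forall>h\<in>(\<lambda>u. u ** g) ` {k\<in>K. \<sigma> k (f g) = f g}. f h = f g"
      using eq g by (auto simp: equivariant_def)
  qed
  have "{g. f g \<noteq> 0} = \<Union> (coset ` {q\<in>Q. f q \<noteq> 0})"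
  proof (intro equalityI subsetI)
    fix g assume "g \<in> {g. f g \<noteq> 0}"
    then have g: "f g \<noteq> 0" "g \<in> GG" using z by auto
    then obtain q k where qk: "q \<in> Q" "k \<in> K" "g = k ** q" using Q(3) by blast
    then have "f q \<noteq> 0" using g equivariant_0[OF eq qk(2), of q] Q(2) by auto
    then show "g \<in> \<Union> (coset ` {q\<in>Q. f q \<noteq> 0})" using qk by (auto simp: coset_def)
  next
    fix g assume "g \<in> \<Union> (coset ` {q\<in>Q. f q \<noteq> 0})"
    then obtain q k where qk: "q \<in> Q" "f q \<noteq> 0" "k \<in> K" "g = k ** q" by (auto simp: coset_def)
    then show "g \<in> {g. f g \<noteq> 0}" using equivariant_0[OF eq qk(3), of q] Q(2) by auto
  qed
  moreover have "compactin (Utop v bar) (\<Union> (coset ` {q\<in>Q. f q \<noteq> 0}))"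
    using Q(1,2) by (intro compactin_Union) (auto simp: coset_def intro!: compactin_right_translate compactin_PP)
  ultimately show "f \<in> ind v bar t \<sigma>" using eq loc by (auto simp: ind_def equivariant_def Kset_eq)
qed

lemma ind_eq: "f \<in> ind v bar t \<sigma> \<Longrightarrow> k \<in> K \<Longrightarrow> g \<in> GG \<Longrightarrow> f (k ** g) = \<sigma> k (f g)"
  and ind_0: "f \<in> ind v bar t \<sigma> \<Longrightarrow> g \<notin> GG \<Longrightarrow> f g = 0"
  by (auto simp: ind_iff equivariant_def)

lemma fin_supp_2:
  assumes "fin_supp f1" "fin_supp f2" "\<And>g. f1 g = 0 \<Longrightarrow> f2 g = 0 \<Longrightarrow> f g = 0" shows "fin_supp f"
proof -
  obtain Q1 where Q1: "finite Q1" "Q1 \<subseteq> GG" "\<forall>g\<in>GG. f1 g \<noteq> 0 \<longrightarrow> (\<exists>q\<in>Q1. \<exists>k\<in>K. g = k ** q)" using assms(1) unfolding fin_supp_def by blast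
  obtain Q2 where Q2: "finite Q2" "Q2 \<subseteq> GG" "\<forall>g\<in>GG. f2 g \<noteq> 0 \<longrightarrow> (\<exists>q\<in>Q2. \<exists>k\<in>K. g = k ** q)" using assms(2) unfolding fin_supp_def by blast
  show ?thesis unfolding fin_supp_def
  proof (intro exI conjI ballI impI)
    show "finite (Q1 \<union> Q2)" "Q1 \<union> Q2 \<subseteq> GG" using Q1 Q2 by auto
    fix g assume "g \<in> GG" "f g \<noteq> 0"
    moreover from this have "f1 g \<noteq> 0 \<or> f2 g \<noteq> 0" using assms(3) by blast
    ultimately show "\<exists>q\<in>Q1 \<union> Q2. \<exists>k\<in>K. g = k ** q" using Q1(3) Q2(3) by blast
  qed
qed

lemma ind_add: assumes "f1 \<in> ind v bar t \<sigma>" "f2 \<in> ind v bar t \<sigma>" shows "(\<lambda>g. f1 g + f2 g) \<in> ind v bar t \<sigma>"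
proof -
  have "fin_supp (\<lambda>g. f1 g + f2 g)" by (rule fin_supp_2[of f1 f2]) (use assms in \<open>auto simp: ind_iff\<close>)
  moreover have "equivariant (\<lambda>g. f1 g + f2 g)" using assms by (auto simp: ind_iff equivariant_def \<sigma>_add)
  ultimately show ?thesis by (simp add: ind_iff)
qed

lemma ind_scale: assumes "f \<in> ind v bar t \<sigma>" shows "(\<lambda>g. scale c (f g)) \<in> ind v bar t \<sigma>"
proof -
  have "fin_supp (\<lambda>g. scale c (f g))" by (rule fin_supp_2[of f f]) (use assms in \<open>auto simp: ind_iff\<close>)
  moreover have "equivariant (\<lambda>g. scale c (f g))" using assms by (auto simp: ind_iff equivariant_def \<sigma>_scale)
  ultimately show ?thesis by (simp add: ind_iff)
qed

lemma ind_zero: "(\<lambda>g. 0) \<in> ind v bar t \<sigma>"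
  unfolding ind_iff equivariant_def fin_supp_def by (auto simp: \<sigma>_0 intro!: exI[of _ "{}"])

lemma ind_restrict:
  assumes "f \<in> ind v bar t \<sigma>" "\<And>k g. k \<in> K \<Longrightarrow> g \<in> GG \<Longrightarrow> P (k ** g) \<longleftrightarrow> P g"
  shows "(\<lambda>g. if P g then f g else 0) \<in> ind v bar t \<sigma>"
proof -
  have "fin_supp (\<lambda>g. if P g then f g else 0)" by (rule fin_supp_2[of f f]) (use assms in \<open>auto simp: ind_iff\<close>)
  moreover have "equivariant (\<lambda>g. if P g then f g else 0)" using assms by (auto simp: ind_iff equivariant_def \<sigma>_0)
  ultimately show ?thesis by (simp add: ind_iff)
qed

lemma ind_translate: assumes f: "f \<in> ind v bar t \<sigma>" and h: "h \<in> GG" shows "right_translate h f \<in> ind v bar t \<sigma>"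
proof -
  have GGh: "g ** h \<in> GG \<longleftrightarrow> g \<in> GG" for g
    using h mult_GG[OF _ h, of g] mult_GG[OF _ star_GG[OF h], of "g ** h"] by (auto simp: star_cancel')
  have "equivariant (right_translate h f)"
    using f GGh by (auto simp: ind_iff equivariant_def right_translate_def simp flip: matrix_mul_assoc)
  moreover have "fin_supp (right_translate h f)"
  proof -
    obtain Q where Q: "finite Q" "Q \<subseteq> GG" "\<forall>g\<in>GG. f g \<noteq> 0 \<longrightarrow> (\<exists>q\<in>Q. \<exists>k\<in>K. g = k ** q)"
      using f unfolding ind_iff fin_supp_def by blast
    show ?thesis unfolding fin_supp_def
    proof (intro exI conjI ballI impI)
      show "finite ((\<lambda>q. q ** star h) ` Q)" using Q(1) by simp
      show "(\<lambda>q. q ** star h) ` Q \<subseteq> GG" using Q(2) h by (auto simp: mult_GG star_GG)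
      fix g assume "g \<in> GG" "right_translate h f g \<noteq> 0"
      then obtain q k where q: "q \<in> Q" "k \<in> K" "g ** h = k ** q" using Q(3) GGh by (auto simp: right_translate_def)
      have "g = k ** (q ** star h)" using q(3) h by (metis matrix_mul_assoc star_cancel'(2))
      then show "\<exists>q\<in>(\<lambda>q. q ** star h) ` Q. \<exists>k\<in>K. g = k ** q" using q by blast
    qed
  qed
  ultimately show ?thesis by (simp add: ind_iff)
qed

text \<open>The explicit Hecke function: at k alpha l it is sigma(k) j_sigma sigma(l). The chosen
  factorization is immaterial by \<open>phi_well_defined\<close>.\<close>

definition phi :: "'e^3^3 \<Rightarrow> 'v \<Rightarrow> 'v" where
  "phi g x = (if \<exists>kl\<in>K \<times> K. g = fst kl ** alph 1 ** snd kl
     then let kl = (SOME kl. kl \<in> K \<times> K \<and> g = fst kl ** alph 1 ** snd kl) in \<sigma> (fst kl) (scale (lc (\<sigma> (snd kl) x)) v0)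
     else 0)"

text \<open>Two factorizations differ by an element b of K whose conjugate by alpha is also in K. By
  \<open>hecke_stabilizer\<close> its torus part acts on the coinvariants and on v0 by the same
  character; the remaining factors of b are invisible to \<open>lc\<close>, and those of its
  conjugate fix v0.\<close>

lemma phi_well_defined:
  assumes k: "k \<in> K" "l \<in> K" "k' \<in> K" "l' \<in> K" and e: "k ** alph 1 ** l = k' ** alph 1 ** l'"
  shows "\<sigma> k (scale (lc (\<sigma> l x)) v0) = \<sigma> k' (scale (lc (\<sigma> l' x)) v0)"
proof -
  define b where "b = l' ** star l"
  define q where "q = star k' ** k"
  have bK: "b \<in> K" unfolding b_def by (intro PP_mult PP_star k)
  have qK: "q \<in> K" unfolding q_def by (intro PP_mult PP_star k)
  have "star k' ** (k ** alph 1 ** l) ** star l ** alph (- 1) = star k' ** (k' ** alph 1 ** l') ** star l ** alph (- 1)"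
    by (simp add: e)
  moreover have "star k' ** (k ** alph 1 ** l) ** star l ** alph (- 1) = q"
  proof -
    have "star k' ** (k ** alph 1 ** l) ** star l ** alph (- 1) = star k' ** k ** (alph 1 ** alph (- 1))"
      using K_GG[OF k(2)] by (simp only: matrix_mul_assoc star_cancel'(2))
    then show ?thesis by (simp add: alph_add q_def)
  qed
  moreover have "star k' ** (k' ** alph 1 ** l') ** star l ** alph (- 1) = alph 1 ** b ** alph (- 1)"
    using K_GG[OF k(3)] by (simp add: b_def star_cancel flip: matrix_mul_assoc)
  ultimately have qb: "q = alph 1 ** b ** alph (- 1)" by simp
  then have "alph 1 ** b ** alph (- 1) \<in> K" using qK by simp
  with bK obtain h m n where h: "h \<in> DG" "m \<in> NL (2 * aa)" "n \<in> NU (2 * aa)" "n \<in> KP (2 * aa) 1" "b = h ** m ** n"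
    "alph 1 ** m ** alph (- 1) \<in> KP (2 * aa) 1" "alph 1 ** n ** alph (- 1) \<in> NU (2 * aa)"
    by (rule hecke_stabilizer)
  obtain c where c: "\<sigma> h v0 = scale c v0" "\<And>x. lc (\<sigma> h x) = c * lc x" by (rule DG_char[OF h(1)]) blast
  have hK: "h \<in> K" and mK: "m \<in> K" and nK: "n \<in> K" using h DG_K NL_PP NU_K by auto
  have "b ** l = l'" unfolding b_def using K_GG[OF k(2)] by (simp add: star_cancel')
  then have "\<sigma> l' x = \<sigma> h (\<sigma> m (\<sigma> n (\<sigma> l x)))"
    using \<sigma>_mult[OF bK k(2), of x] hK mK nK unfolding h(5) by (simp add: \<sigma>_mult PP_mult)
  then have "\<sigma> l' x = \<sigma> h (\<sigma> m (\<sigma> l x))" by (simp add: K1_trivial[OF h(4)])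
  moreover have "m \<in> KP (2 * aa - 1) 1"
  proof -
    from h(2) obtain x' y' where n: "sw aa ** m ** sw aa = nu x' y'" "nu x' y' \<in> NU (2 * aa)" by (rule sw_NL)
    have "m = sw aa ** nu x' y' ** sw aa" by (rule sw_conj_eq[OF n(1)])
    then show ?thesis using sw_KP_conj[OF NU_KP[OF n(2)]] by simp
  qed
  ultimately have l': "lc (\<sigma> l' x) = c * lc (\<sigma> l x)" by (simp add: c lc_opp)
  have "alph 1 ** b ** alph (- 1) = h ** (alph 1 ** m ** alph (- 1)) ** (alph 1 ** n ** alph (- 1))"
  proof -
    from h(1) obtain c b where "h = dg c b" unfolding DG_def by blast
    then have "alph 1 ** h = h ** alph 1" using alph_dg by simp
    moreover have "alph 1 ** (h ** m ** n) ** alph (- 1) = (alph 1 ** h) ** m ** n ** alph (- 1)"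
      by (simp only: matrix_mul_assoc)
    moreover have "h ** (alph 1 ** m ** alph (- 1)) ** (alph 1 ** n ** alph (- 1)) = h ** alph 1 ** m ** (alph (- 1) ** alph 1) ** n ** alph (- 1)"
      by (simp only: matrix_mul_assoc)
    moreover have "alph (- 1) ** alph 1 = mat 1" by (simp add: alph_add)
    ultimately show ?thesis unfolding h(5) by simp
  qed
  then have "\<sigma> q v0 = \<sigma> h (\<sigma> (alph 1 ** m ** alph (- 1)) (\<sigma> (alph 1 ** n ** alph (- 1)) v0))"
    unfolding qb using hK KP_K[OF _ h(6)] NU_K[OF h(7)] by (simp add: \<sigma>_mult PP_mult)
  then have q0: "\<sigma> q v0 = scale c v0" using I1_v0[OF NU_KP[OF h(7)]] K1_trivial[OF h(6)] c by simp
  have "k = k' ** q" unfolding q_def using K_GG[OF k(3)] by (simp add: star_cancel)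
  then have "\<sigma> k v0 = \<sigma> k' (scale c v0)" using \<sigma>_mult[OF k(3) qK, of v0] q0 by simp
  then show ?thesis using k by (simp add: \<sigma>_scale l' mult.commute)
qed

lemma phi_cell: assumes "k \<in> K" "l \<in> K" shows "phi (k ** alph 1 ** l) x = \<sigma> k (scale (lc (\<sigma> l x)) v0)"
proof -
  let ?P = "\<lambda>kl. kl \<in> K \<times> K \<and> k ** alph 1 ** l = fst kl ** alph 1 ** snd kl"
  define kl where "kl = (SOME kl. ?P kl)"
  have ex: "?P (k, l)" using assms by simp
  then have P: "?P kl" unfolding kl_def by (rule someI)
  have "\<exists>kl\<in>K \<times> K. k ** alph 1 ** l = fst kl ** alph 1 ** snd kl" using ex by blast
  then have "phi (k ** alph 1 ** l) x = \<sigma> (fst kl) (scale (lc (\<sigma> (snd kl) x)) v0)"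
    unfolding phi_def kl_def Let_def by (rule if_P)
  also have "\<dots> = \<sigma> k (scale (lc (\<sigma> l x)) v0)"
    by (rule phi_well_defined) (use P assms in auto)
  finally show ?thesis .
qed

lemma phi_outside: assumes "\<And>k l. k \<in> K \<Longrightarrow> l \<in> K \<Longrightarrow> g \<noteq> k ** alph 1 ** l" shows "phi g x = 0"
proof -
  have "\<not> (\<exists>kl\<in>K \<times> K. g = fst kl ** alph 1 ** snd kl)" using assms by auto
  then show ?thesis unfolding phi_def by (rule if_not_P)
qed

lemma phi_bi: assumes k: "k \<in> K" "l \<in> K" shows "phi (k ** g ** l) x = \<sigma> k (phi g (\<sigma> l x))"
proof (cases "\<exists>k'\<in>K. \<exists>l'\<in>K. g = k' ** alph 1 ** l'")
  case True
  then obtain k' l' where kl: "k' \<in> K" "l' \<in> K" "g = k' ** alph 1 ** l'" by blast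
  have "k ** g ** l = (k ** k') ** alph 1 ** (l' ** l)" by (simp add: kl(3) matrix_mul_assoc)
  then show ?thesis using kl k by (simp add: phi_cell PP_mult \<sigma>_mult)
next
  case False
  then have "phi g (\<sigma> l x) = 0" by (intro phi_outside) blast
  moreover have "phi (k ** g ** l) x = 0"
  proof (rule phi_outside)
    fix k' l' assume kl: "k' \<in> K" "l' \<in> K"
    show "k ** g ** l \<noteq> k' ** alph 1 ** l'"
    proof
      assume e: "k ** g ** l = k' ** alph 1 ** l'"
      have "g = star k ** (k ** g ** l) ** star l"
        using K_GG[OF k(1)] K_GG[OF k(2)] by (simp add: star_cancel star_cancel' flip: matrix_mul_assoc) (simp add: GG_star_right)
      also have "\<dots> = (star k ** k') ** alph 1 ** (l' ** star l)" unfolding e by (simp only: matrix_mul_assoc)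
      finally show False using False kl k PP_mult PP_star by metis
    qed
  qed
  ultimately show ?thesis using k by (simp add: \<sigma>_0)
qed

lemma phi_add: "phi g (x + y) = phi g x + phi g y" and phi_scale: "phi g (scale c x) = scale c (phi g x)"
proof -
  have "phi g (x + y) = phi g x + phi g y \<and> phi g (scale c x) = scale c (phi g x)"
  proof (cases "\<exists>k\<in>K. \<exists>l\<in>K. g = k ** alph 1 ** l")
    case True
    then obtain k l where "k \<in> K" "l \<in> K" "g = k ** alph 1 ** l" by blast
    then show ?thesis by (simp add: phi_cell \<sigma>_add \<sigma>_scale lc_add lc_scale scale_left_distrib)
  next
    case False
    then have "phi g x = 0" for x by (intro phi_outside) blast
    then show ?thesis by simp
  qed
  then show "phi g (x + y) = phi g x + phi g y" "phi g (scale c x) = scale c (phi g x)" by blast+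
qed

lemma phi_0: "phi g 0 = 0" using phi_scale[of g 0 0] by simp

text \<open>Equivariance on both sides determines the function from its value at alpha, so the
  description in the statement has \<open>phi\<close> as its only solution.\<close>

lemma hecke_fun_eq: "hecke_fun v bar \<pi> p t scale \<sigma> = phi"
  unfolding hecke_fun_def
proof (rule the_equality)
  have "(\<lambda>x. 0) = phi g" if "g \<notin> dcoset v bar t (alpha \<pi>) (Kset v bar t)" for g
  proof
    fix x show "0 = phi g x" using that by (intro phi_outside[symmetric]) (auto simp: dcoset_eq Kset_eq alpha_eq)
  qed
  moreover have "phi (alpha \<pi>) = jmap v bar \<pi> p t scale \<sigma>"
  proof
    fix x show "phi (alpha \<pi>) x = jmap v bar \<pi> p t scale \<sigma> x"
      using phi_cell[of "mat 1" "mat 1" x] by (simp add: jmap_eq alpha_eq \<sigma>_1)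
  qed
  ultimately show "(\<forall>g. g \<notin> dcoset v bar t (alpha \<pi>) (Kset v bar t) \<longrightarrow> phi g = (\<lambda>x. 0)) \<and>
     (\<forall>k\<in>Kset v bar t. \<forall>l\<in>Kset v bar t. \<forall>g\<in>GG. phi (k ** g ** l) = \<sigma> k \<circ> phi g \<circ> \<sigma> l) \<and>
     phi (alpha \<pi>) = jmap v bar \<pi> p t scale \<sigma>"
    by (auto simp: Kset_eq phi_bi fun_eq_iff)
next
  fix \<phi> assume *: "(\<forall>g. g \<notin> dcoset v bar t (alpha \<pi>) (Kset v bar t) \<longrightarrow> \<phi> g = (\<lambda>x. 0)) \<and>
     (\<forall>k\<in>Kset v bar t. \<forall>l\<in>Kset v bar t. \<forall>g\<in>GG. \<phi> (k ** g ** l) = \<sigma> k \<circ> \<phi> g \<circ> \<sigma> l) \<and>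
     \<phi> (alpha \<pi>) = jmap v bar \<pi> p t scale \<sigma>"
  show "\<phi> = phi"
  proof (intro ext)
    fix g x
    show "\<phi> g x = phi g x"
    proof (cases "g \<in> dcoset v bar t (alpha \<pi>) (Kset v bar t)")
      case True
      then obtain k l where kl: "k \<in> K" "l \<in> K" "g = k ** alph 1 ** l" by (auto simp: dcoset_eq Kset_eq alpha_eq)
      have "\<phi> (k ** alpha \<pi> ** l) = \<sigma> k \<circ> \<phi> (alpha \<pi>) \<circ> \<sigma> l"
        using * kl(1,2) alph_GG[of 1] unfolding Kset_eq alpha_eq by blast
      then have "\<phi> g x = \<sigma> k (jmap v bar \<pi> p t scale \<sigma> (\<sigma> l x))"
        using * by (simp add: kl(3) alpha_eq)
      then show ?thesis using phi_cell[OF kl(1,2)] by (simp add: kl(3) jmap_eq)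
    next
      case False
      then have "phi g x = 0" by (intro phi_outside) (auto simp: dcoset_eq Kset_eq alpha_eq)
      then show ?thesis using * False by simp
    qed
  qed
qed

text \<open>The contribution of the coset K y to (T F)(g), which by \<open>tm_coset\<close> does not
  depend on the representative y.\<close>

definition tm :: "('e^3^3 \<Rightarrow> 'v) \<Rightarrow> 'e^3^3 \<Rightarrow> 'e^3^3 \<Rightarrow> 'v" where "tm F g y = phi (g ** star y) (F y)"

abbreviation "T \<equiv> hecke_T v bar \<pi> p t scale \<sigma>"

lemma tm_coset: assumes "equivariant F" "k \<in> K" "y \<in> GG" shows "tm F g (k ** y) = tm F g y"
proof -
  have "g ** star (k ** y) = mat 1 ** (g ** star y) ** star k" by (simp add: star_mult matrix_mul_assoc)
  moreover have "F (k ** y) = \<sigma> k (F y)" using assms by (simp add: equivariant_def)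
  ultimately show ?thesis
    unfolding tm_def using phi_bi[of "mat 1" "star k" "g ** star y" "\<sigma> k (F y)"] assms(2)
    by (simp add: PP_star \<sigma>_1 \<sigma>_star)
qed

lemma T_sum:
  assumes F: "equivariant F" and Y: "finite Y" "Y \<subseteq> GG" "inj_on coset Y"
    and supp: "\<And>y. y \<in> GG \<Longrightarrow> tm F g y \<noteq> 0 \<Longrightarrow> \<exists>y'\<in>Y. coset y = coset y'"
  shows "T F g = (\<Sum>y\<in>Y. tm F g y)"
proof -
  define ct where "ct = (\<lambda>C. if C \<in> rcosets\<^bsub>Ugrp bar\<^esub> Kset v bar t
     then (let y = (SOME y. y \<in> C) in hecke_fun v bar \<pi> p t scale \<sigma> (g ** inv\<^bsub>Ugrp bar\<^esub> y) (F y)) else 0)"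
  have ct: "ct (coset y) = tm F g y" if y: "y \<in> GG" for y
  proof -
    define z where "z = (SOME z. z \<in> coset y)"
    have "z \<in> coset y" unfolding z_def by (rule someI[of _ y]) (rule coset_self)
    then obtain k where k: "k \<in> K" "z = k ** y" unfolding coset_def by blast
    have zG: "z \<in> GG" unfolding k(2) by (intro mult_GG K_GG k y)
    have "ct (coset y) = phi (g ** star z) (F z)"
      unfolding ct_def Kset_eq rcosets_eq hecke_fun_eq Let_def z_def[symmetric] using y inv_GG[OF zG] by simp
    also have "\<dots> = tm F g y" using tm_coset[OF F k(1) y, of g] by (simp add: tm_def k(2))
    finally show ?thesis .
  qed
  have "{C. ct C \<noteq> 0} \<subseteq> coset ` Y"
  proof
    fix C assume C: "C \<in> {C. ct C \<noteq> 0}"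
    then have "C \<in> coset ` GG" unfolding ct_def Kset_eq rcosets_eq by (auto split: if_splits)
    then obtain y where y: "y \<in> GG" "C = coset y" by blast
    then have "tm F g y \<noteq> 0" using C ct by simp
    then show "C \<in> coset ` Y" using supp[OF y(1)] y(2) by blast
  qed
  then have "Sum_any ct = sum ct (coset ` Y)" using Y(1) by (intro Sum_any.expand_superset) auto
  also have "\<dots> = (\<Sum>y\<in>Y. ct (coset y))" using Y(3) by (simp add: sum.reindex)
  also have "\<dots> = (\<Sum>y\<in>Y. tm F g y)" using Y(2) ct by (intro sum.cong) auto
  finally show ?thesis unfolding hecke_T_def ct_def .
qed

lemma tm_0: "F y = 0 \<Longrightarrow> tm F g y = 0" by (simp add: tm_def phi_0)

lemma tm_neighbours: assumes "tm F g y \<noteq> 0" "y \<in> GG" shows "neighbours aa g y \<and> F y \<noteq> 0"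
proof
  show "F y \<noteq> 0" using assms tm_0 by blast
  obtain k l where "k \<in> K" "l \<in> K" "g ** star y = k ** alph 1 ** l"
    using assms(1) phi_outside unfolding tm_def by blast
  moreover from this have "g = k ** alph 1 ** l ** y" using assms(2) by (metis star_cancel'(1))
  ultimately show "neighbours aa g y" unfolding neighbours_def by blast
qed

lemma ind_reps:
  assumes "fin_supp F" obtains Y where "finite Y" "Y \<subseteq> GG" "inj_on coset Y"
    "\<And>y. y \<in> GG \<Longrightarrow> F y \<noteq> 0 \<Longrightarrow> \<exists>y'\<in>Y. coset y = coset y'"
proof -
  obtain Q where Q: "finite Q" "Q \<subseteq> GG" "\<forall>g\<in>GG. F g \<noteq> 0 \<longrightarrow> (\<exists>q\<in>Q. \<exists>k\<in>K. g = k ** q)"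
    using assms unfolding fin_supp_def by blast
  obtain Y where Y: "finite Y" "Y \<subseteq> GG" "inj_on coset Y" "\<And>q. q \<in> Q \<Longrightarrow> \<exists>y\<in>Y. coset q = coset y"
    using finite_reps[OF Q(1,2)] by blast
  have "\<exists>y'\<in>Y. coset y = coset y'" if y: "y \<in> GG" "F y \<noteq> 0" for y
  proof -
    obtain q k where q: "q \<in> Q" "k \<in> K" "y = k ** q" using Q(3) y by blast
    then have "coset y = coset q" using coset_mult Q(2) by auto
    then show ?thesis using Y(4)[OF q(1)] by simp
  qed
  then show ?thesis using that Y by blast
qed

lemma T_linear:
  assumes F: "F1 \<in> ind v bar t \<sigma>" "F2 \<in> ind v bar t \<sigma>"
  shows "T (\<lambda>g. F1 g + scale c (F2 g)) g = T F1 g + scale c (T F2 g)"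
proof -
  have e: "equivariant F1" "equivariant F2" "equivariant (\<lambda>g. F1 g + scale c (F2 g))"
    using F ind_add[OF F(1) ind_scale[OF F(2)]] by (auto simp: ind_iff)
  \<comment> \<open>Only the support of N matters: it is the union of the supports of F1 and F2, so
    that one set of representatives serves all three sums.\<close>
  define N where "N = (\<lambda>g. if F1 g = 0 \<and> F2 g = 0 then 0 else v0)"
  have "fin_supp N" by (rule fin_supp_2[of F1 F2]) (use F in \<open>auto simp: ind_iff N_def\<close>)
  then obtain Y where Y: "finite Y" "Y \<subseteq> GG" "inj_on coset Y" "\<And>y. y \<in> GG \<Longrightarrow> N y \<noteq> 0 \<Longrightarrow> \<exists>y'\<in>Y. coset y = coset y'"
    by (rule ind_reps) blast
  have Y4: "\<exists>y'\<in>Y. coset y = coset y'" if "y \<in> GG" "F1 y \<noteq> 0 \<or> F2 y \<noteq> 0" for y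
    using Y(4)[OF that(1)] that(2) v0_nonzero by (auto simp: N_def)
  have "T (\<lambda>g. F1 g + scale c (F2 g)) g = (\<Sum>y\<in>Y. tm (\<lambda>g. F1 g + scale c (F2 g)) g y)"
    by (rule T_sum[OF e(3) Y(1-3)], rule Y4) (use tm_0[of "\<lambda>g. F1 g + scale c (F2 g)"] in auto)
  also have "\<dots> = (\<Sum>y\<in>Y. tm F1 g y) + scale c (\<Sum>y\<in>Y. tm F2 g y)"
    by (simp add: tm_def phi_add phi_scale sum.distrib scale_sum_right)
  also have "(\<Sum>y\<in>Y. tm F1 g y) = T F1 g"
    by (rule T_sum[OF e(1) Y(1-3), symmetric], rule Y4) (use tm_0[of F1] in auto)
  also have "(\<Sum>y\<in>Y. tm F2 g y) = T F2 g"
    by (rule T_sum[OF e(2) Y(1-3), symmetric], rule Y4) (use tm_0[of F2] in auto)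
  finally show ?thesis .
qed

lemma T_subspace:
  assumes F: "F \<in> ind v bar t \<sigma>" and S: "subspace S"
    and m: "\<And>y. y \<in> GG \<Longrightarrow> neighbours aa g y \<Longrightarrow> F y \<noteq> 0 \<Longrightarrow> tm F g y \<in> S"
  shows "T F g \<in> S"
proof -
  have e: "equivariant F" "fin_supp F" using F by (auto simp: ind_iff)
  obtain Y where Y: "finite Y" "Y \<subseteq> GG" "inj_on coset Y" "\<And>y. y \<in> GG \<Longrightarrow> F y \<noteq> 0 \<Longrightarrow> \<exists>y'\<in>Y. coset y = coset y'"
    using ind_reps[OF e(2)] by blast
  have "T F g = (\<Sum>y\<in>Y. tm F g y)"
    by (rule T_sum[OF e(1) Y(1-3)], rule Y(4)) (use tm_0[of F] in auto)
  moreover have "tm F g y \<in> S" if "y \<in> Y" for y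
    using m[of y] tm_neighbours[of F g y] subspace_0[OF S] that Y(2) by (cases "tm F g y = 0") auto
  ultimately show ?thesis using subspace_sum[OF S] by metis
qed

lemma T_single:
  assumes F: "F \<in> ind v bar t \<sigma>" and y0: "y0 \<in> GG"
    and m: "\<And>y. y \<in> GG \<Longrightarrow> neighbours aa g y \<Longrightarrow> F y \<noteq> 0 \<Longrightarrow> \<exists>k\<in>K. y = k ** y0"
  shows "T F g = tm F g y0"
proof -
  have e: "equivariant F" using F by (simp add: ind_iff)
  have "T F g = (\<Sum>y\<in>{y0}. tm F g y)"
  proof (rule T_sum[OF e])
    fix y assume y: "y \<in> GG" "tm F g y \<noteq> 0"
    then have "\<exists>k\<in>K. y = k ** y0" using tm_neighbours[OF y(2,1)] m by blast
    then show "\<exists>y'\<in>{y0}. coset y = coset y'" using coset_eq_iff[OF y0] by simp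
  qed (use y0 in auto)
  then show ?thesis by simp
qed

text \<open>Right translation by h carries a set of coset representatives to another one and leaves
  g y^-1 unchanged.\<close>

lemma T_translate:
  assumes F: "F \<in> ind v bar t \<sigma>" and h: "h \<in> GG"
  shows "T (right_translate h F) = right_translate h (T F)"
proof
  fix g
  have e: "equivariant F" "fin_supp F" using F by (auto simp: ind_iff)
  have e': "equivariant (right_translate h F)" using ind_translate[OF F h] by (simp add: ind_iff)
  obtain Y where Y: "finite Y" "Y \<subseteq> GG" "inj_on coset Y" "\<And>y. y \<in> GG \<Longrightarrow> F y \<noteq> 0 \<Longrightarrow> \<exists>y'\<in>Y. coset y = coset y'"
    using ind_reps[OF e(2)] by blast
  have inj: "inj_on (\<lambda>y. y ** star h) Y"
    by (rule inj_onI) (metis h star_cancel'(1))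
  have ch: "coset (y ** x) = (\<lambda>u. u ** x) ` coset y" for x y by (simp add: coset_def image_image matrix_mul_assoc)
  have ci: "coset y = coset y'" if "coset (y ** star h) = coset (y' ** star h)" for y y'
  proof -
    have "(\<lambda>u. u ** h) ` coset (y ** star h) = (\<lambda>u. u ** h) ` coset (y' ** star h)" using that by simp
    then show ?thesis using h by (simp add: ch[symmetric] star_cancel')
  qed
  have tmh: "tm (right_translate h F) g (y ** star h) = tm F (g ** h) y" for y
    using h by (simp add: tm_def right_translate_def star_mult star_cancel' matrix_mul_assoc)
  have "T (right_translate h F) g = (\<Sum>y\<in>(\<lambda>y. y ** star h) ` Y. tm (right_translate h F) g y)"
  proof (rule T_sum[OF e'])
    show "finite ((\<lambda>y. y ** star h) ` Y)" using Y(1) by simp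
    show "(\<lambda>y. y ** star h) ` Y \<subseteq> GG" using Y(2) h by (auto simp: mult_GG star_GG)
    show "inj_on coset ((\<lambda>y. y ** star h) ` Y)"
    proof (rule inj_onI)
      fix x y assume "x \<in> (\<lambda>y. y ** star h) ` Y" "y \<in> (\<lambda>y. y ** star h) ` Y" "coset x = coset y"
      then obtain x' y' where xy: "x' \<in> Y" "y' \<in> Y" "x = x' ** star h" "y = y' ** star h" "coset (x' ** star h) = coset (y' ** star h)" by blast
      then show "x = y" using inj_onD[OF Y(3) ci[OF xy(5)]] by simp
    qed
    fix y assume y: "y \<in> GG" "tm (right_translate h F) g y \<noteq> 0"
    then have "F (y ** h) \<noteq> 0" using tm_0[of "right_translate h F"] by (auto simp: right_translate_def)
    then obtain y' where y': "y' \<in> Y" "coset (y ** h) = coset y'" using Y(4)[of "y ** h"] y(1) h mult_GG by blast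
    have "coset y = coset (y' ** star h)" using ch[of "y ** h" "star h"] y'(2) ch[of y' "star h"] h by (simp add: star_cancel')
    then show "\<exists>y'\<in>(\<lambda>y. y ** star h) ` Y. coset y = coset y'" using y'(1) by blast
  qed
  also have "\<dots> = (\<Sum>y\<in>Y. tm F (g ** h) y)" by (simp add: sum.reindex[OF inj] tmh)
  also have "\<dots> = T F (g ** h)"
    by (rule T_sum[OF e(1) Y(1-3), symmetric], rule Y(4)) (use tm_0[of F] in auto)
  finally show "T (right_translate h F) g = right_translate h (T F) g" by (simp add: right_translate_def)
qed

lemma T_ind: assumes F: "F \<in> ind v bar t \<sigma>" shows "T F \<in> ind v bar t \<sigma>"
proof -
  have e: "equivariant F" "fin_supp F" using F by (auto simp: ind_iff)
  obtain Y where Y: "finite Y" "Y \<subseteq> GG" "inj_on coset Y" "\<And>y. y \<in> GG \<Longrightarrow> F y \<noteq> 0 \<Longrightarrow> \<exists>y'\<in>Y. coset y = coset y'"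
    using ind_reps[OF e(2)] by blast
  have TF: "T F g = (\<Sum>y\<in>Y. tm F g y)" for g
    by (rule T_sum[OF e(1) Y(1-3)], rule Y(4)) (use tm_0[of F] in auto)
  have out: "tm F g y = 0" if "g \<notin> GG" "y \<in> GG" for g y
  proof (rule ccontr)
    assume "tm F g y \<noteq> 0"
    then have "neighbours aa g y" using tm_neighbours that(2) by blast
    then show False using that unfolding neighbours_def by (auto simp: mult_GG K_GG)
  qed
  have "equivariant (T F)" unfolding equivariant_def
  proof (intro conjI allI impI ballI)
    show "T F g = 0" if "g \<notin> GG" for g unfolding TF using out[OF that] Y(2) by (intro sum.neutral) auto
    fix k g assume k: "k \<in> K"
    have "\<sigma> k (sum f A) = (\<Sum>y\<in>A. \<sigma> k (f y))" for f and A :: "('e^3^3) set"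
      using k by (induction A rule: infinite_finite_induct) (auto simp: \<sigma>_0 \<sigma>_add)
    moreover have "tm F (k ** g) y = \<sigma> k (tm F g y)" for y
      using phi_bi[OF k PP_1, of "g ** star y"] by (simp add: tm_def \<sigma>_1 matrix_mul_assoc)
    ultimately show "T F (k ** g) = \<sigma> k (T F g)" unfolding TF by simp
  qed
  moreover have "fin_supp (T F)"
  proof -
    \<comment> \<open>K alpha K consists of finitely many cosets K alpha q. Depth 8 is enough
      because conjugation by alpha costs 4 on each side.\<close>
    obtain Q where Q: "finite Q" "Q \<subseteq> K" "K \<subseteq> (\<Union>q\<in>Q. (\<lambda>h. h ** q) ` KP (2 * aa) 8)"
      by (rule finite_coset_cover[OF compactin_PP openin_KP KP_1])
    show ?thesis unfolding fin_supp_def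
    proof (intro exI conjI ballI impI)
      show "finite ((\<lambda>(q, y). alph 1 ** q ** y) ` (Q \<times> Y))" using Q(1) Y(1) by simp
      show "(\<lambda>(q, y). alph 1 ** q ** y) ` (Q \<times> Y) \<subseteq> GG" using Q(2) Y(2) by (auto simp: mult_GG K_GG subset_iff)
      fix g assume "g \<in> GG" "T F g \<noteq> 0"
      then obtain y where y: "y \<in> Y" "tm F g y \<noteq> 0" unfolding TF by (metis sum.neutral)
      then have "neighbours aa g y" using tm_neighbours[of F g y] Y(2) by blast
      then obtain k k' where k: "k \<in> K" "k' \<in> K" "g = k ** alph 1 ** k' ** y" unfolding neighbours_def by blast
      obtain q h where qh: "q \<in> Q" "h \<in> KP (2 * aa) 8" "k' = h ** q" using Q(3) k(2) by auto
      have "alph 1 ** (h - mat 1) ** alph (- 1) \<in> MM (2 * aa) (2 * aa) (- 4 + 8 + - 4)"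
        using qh(2) by (intro MM_mult[of _ _ "2 * aa"] alph_MM) (auto simp: KP_def)
      moreover have "alph 1 ** (h - mat 1) ** alph (- 1) = alph 1 ** h ** alph (- 1) - mat 1"
        by (simp add: matrix_sub_ldistrib matrix_sub_rdistrib alph_add)
      ultimately have "alph 1 ** h ** alph (- 1) \<in> KP (2 * aa) 0" using qh(2) by (simp add: KP_def mult_GG)
      then have r: "alph 1 ** h ** alph (- 1) \<in> K" using KP_subset_PP[of 0 "2 * aa"] by auto
      have "g = k ** (alph 1 ** h ** alph (- 1)) ** (alph 1 ** q ** y)"
        unfolding k(3) qh(3) by (simp flip: matrix_mul_assoc)
      then show "\<exists>q\<in>(\<lambda>(q, y). alph 1 ** q ** y) ` (Q \<times> Y). \<exists>k\<in>K. g = k ** q"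
        using PP_mult[OF k(1) r] qh(1) y(1) by force
    qed
  qed
  ultimately show ?thesis by (simp add: ind_iff)
qed

end

section \<open>Subspaces with two generators and quotient modules\<close>

lemma (in vectorspace) two_generated_subspace:
  assumes u: "u \<in> carrier V" and w: "w \<in> carrier V"
    and indep: "\<And>a b. a \<in> carrier K \<Longrightarrow> b \<in> carrier K \<Longrightarrow> a \<odot>\<^bsub>V\<^esub> u \<oplus>\<^bsub>V\<^esub> b \<odot>\<^bsub>V\<^esub> w = \<zero>\<^bsub>V\<^esub> \<Longrightarrow> a = \<zero>\<^bsub>K\<^esub> \<and> b = \<zero>\<^bsub>K\<^esub>"
    and J: "J = {a \<odot>\<^bsub>V\<^esub> u \<oplus>\<^bsub>V\<^esub> b \<odot>\<^bsub>V\<^esub> w | a b. a \<in> carrier K \<and> b \<in> carrier K}"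
  shows "VectorSpace.subspace K J V" "vectorspace.basis K (V\<lparr>carrier := J\<rparr>) {u, w}"
    "vectorspace.dim K (V\<lparr>carrier := J\<rparr>) = 2"
proof -
  have sub: "submodule K J V"
  proof (unfold_locales)
    show "J \<subseteq> carrier V" unfolding J using u w by auto
    show "x \<oplus>\<^bsub>V\<^esub> y \<in> J" if xy: "x \<in> J" "y \<in> J" for x y
    proof -
      obtain a b where ab: "x = a \<odot>\<^bsub>V\<^esub> u \<oplus>\<^bsub>V\<^esub> b \<odot>\<^bsub>V\<^esub> w" "a \<in> carrier K" "b \<in> carrier K" using xy(1) unfolding J by blast
      obtain c d where cd: "y = c \<odot>\<^bsub>V\<^esub> u \<oplus>\<^bsub>V\<^esub> d \<odot>\<^bsub>V\<^esub> w" "c \<in> carrier K" "d \<in> carrier K" using xy(2) unfolding J by blast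
      have "x \<oplus>\<^bsub>V\<^esub> y = (a \<oplus>\<^bsub>K\<^esub> c) \<odot>\<^bsub>V\<^esub> u \<oplus>\<^bsub>V\<^esub> (b \<oplus>\<^bsub>K\<^esub> d) \<odot>\<^bsub>V\<^esub> w"
        using ab cd u w by (simp add: smult_l_distr M.a_ac)
      then show ?thesis unfolding J using ab cd by blast
    qed
    have "\<zero>\<^bsub>V\<^esub> = \<zero>\<^bsub>K\<^esub> \<odot>\<^bsub>V\<^esub> u \<oplus>\<^bsub>V\<^esub> \<zero>\<^bsub>K\<^esub> \<odot>\<^bsub>V\<^esub> w" using u w by simp
    then show "\<zero>\<^bsub>V\<^esub> \<in> J" unfolding J by blast
    show "c \<odot>\<^bsub>V\<^esub> x \<in> J" if c: "c \<in> carrier K" and x: "x \<in> J" for c x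
    proof -
      obtain a b where ab: "x = a \<odot>\<^bsub>V\<^esub> u \<oplus>\<^bsub>V\<^esub> b \<odot>\<^bsub>V\<^esub> w" "a \<in> carrier K" "b \<in> carrier K" using x unfolding J by blast
      have "c \<odot>\<^bsub>V\<^esub> x = (c \<otimes>\<^bsub>K\<^esub> a) \<odot>\<^bsub>V\<^esub> u \<oplus>\<^bsub>V\<^esub> (c \<otimes>\<^bsub>K\<^esub> b) \<odot>\<^bsub>V\<^esub> w"
        using ab c u w by (simp add: smult_r_distr smult_assoc1)
      then show ?thesis unfolding J using ab c by blast
    qed
  qed
  then show sp: "VectorSpace.subspace K J V" by (simp add: VectorSpace.subspace_def vectorspace_axioms)
  interpret J: vectorspace K "V\<lparr>carrier := J\<rparr>" by (rule subspace_is_vs[OF sp])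
  have "u = \<one>\<^bsub>K\<^esub> \<odot>\<^bsub>V\<^esub> u \<oplus>\<^bsub>V\<^esub> \<zero>\<^bsub>K\<^esub> \<odot>\<^bsub>V\<^esub> w" "w = \<zero>\<^bsub>K\<^esub> \<odot>\<^bsub>V\<^esub> u \<oplus>\<^bsub>V\<^esub> \<one>\<^bsub>K\<^esub> \<odot>\<^bsub>V\<^esub> w" using u w by simp_all
  then have uw: "u \<in> J" "w \<in> J" unfolding J by blast+
  have ne: "u \<noteq> w"
  proof
    assume "u = w"
    then have "\<one>\<^bsub>K\<^esub> \<odot>\<^bsub>V\<^esub> u \<oplus>\<^bsub>V\<^esub> (\<ominus>\<^bsub>K\<^esub> \<one>\<^bsub>K\<^esub>) \<odot>\<^bsub>V\<^esub> w = (\<one>\<^bsub>K\<^esub> \<oplus>\<^bsub>K\<^esub> \<ominus>\<^bsub>K\<^esub> \<one>\<^bsub>K\<^esub>) \<odot>\<^bsub>V\<^esub> u" using u by (subst smult_l_distr) auto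
    also have "\<dots> = \<zero>\<^bsub>V\<^esub>" using u by (simp add: R.r_neg)
    finally show False using indep[of "\<one>\<^bsub>K\<^esub>" "\<ominus>\<^bsub>K\<^esub> \<one>\<^bsub>K\<^esub>"] by simp
  qed
  have lin: "J.lincomb a {u, w} = a u \<odot>\<^bsub>V\<^esub> u \<oplus>\<^bsub>V\<^esub> a w \<odot>\<^bsub>V\<^esub> w" if a: "a \<in> {u, w} \<rightarrow> carrier K" for a
  proof -
    have "J.lincomb a {w} = a w \<odot>\<^bsub>V\<^esub> w"
      using J.lincomb_del2[of "{w}" a w] a uw w by (simp add: J.lincomb_def)
    then show ?thesis using J.lincomb_del2[of "{u, w}" a u] a uw ne by (simp add: insert_Diff_if)
  qed
  have "J.lin_indpt {u, w}"
  proof (rule J.finite_lin_indpt2)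
    fix a assume a: "a \<in> {u, w} \<rightarrow> carrier K" "J.lincomb a {u, w} = \<zero>\<^bsub>V\<lparr>carrier := J\<rparr>\<^esub>"
    then show "\<forall>v\<in>{u, w}. a v = \<zero>\<^bsub>K\<^esub>" using indep[of "a u" "a w"] lin[OF a(1)] by auto
  qed (use uw in auto)
  moreover have "J.span {u, w} = J"
  proof -
    have "J.span {u, w} = {J.lincomb a {u, w} | a. a \<in> {u, w} \<rightarrow> carrier K}"
      by (rule J.finite_span) (use uw in auto)
    also have "\<dots> = J"
    proof (intro equalityI subsetI)
      fix x assume "x \<in> {J.lincomb a {u, w} | a. a \<in> {u, w} \<rightarrow> carrier K}"
      then obtain a where a: "x = J.lincomb a {u, w}" "a \<in> {u, w} \<rightarrow> carrier K" by blast
      then show "x \<in> J" using lin[OF a(2)] unfolding J by auto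
    next
      fix x assume "x \<in> J"
      then obtain a b where ab: "x = a \<odot>\<^bsub>V\<^esub> u \<oplus>\<^bsub>V\<^esub> b \<odot>\<^bsub>V\<^esub> w" "a \<in> carrier K" "b \<in> carrier K" unfolding J by blast
      define f where "f = (\<lambda>z. if z = u then a else b)"
      have f: "f \<in> {u, w} \<rightarrow> carrier K" using ab by (auto simp: f_def)
      have "x = J.lincomb f {u, w}" using lin[OF f] ab ne by (simp add: f_def)
      then show "x \<in> {J.lincomb a {u, w} | a. a \<in> {u, w} \<rightarrow> carrier K}" using f by blast
    qed
    finally show ?thesis .
  qed
  ultimately show b: "J.basis {u, w}" unfolding J.basis_def using uw by simp
  show "J.dim = 2" using J.dim_basis[OF _ b] ne by simp
qed

lemma quot_module:
  fixes V :: "('a, 'm) module"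
  assumes V: "vectorspace K V" and W: "submodule K W V"
  shows "carrier (quot_module V W) = (\<lambda>x. W +>\<^bsub>V\<^esub> x) ` carrier V"
    and "\<And>x y. x \<in> carrier V \<Longrightarrow> y \<in> carrier V \<Longrightarrow> (W +>\<^bsub>V\<^esub> x) \<oplus>\<^bsub>quot_module V W\<^esub> (W +>\<^bsub>V\<^esub> y) = W +>\<^bsub>V\<^esub> (x \<oplus>\<^bsub>V\<^esub> y)"
    and "\<And>c x. c \<in> carrier K \<Longrightarrow> x \<in> carrier V \<Longrightarrow> c \<odot>\<^bsub>quot_module V W\<^esub> (W +>\<^bsub>V\<^esub> x) = W +>\<^bsub>V\<^esub> (c \<odot>\<^bsub>V\<^esub> x)"
    and "\<And>x y. x \<in> carrier V \<Longrightarrow> y \<in> carrier V \<Longrightarrow> W +>\<^bsub>V\<^esub> x = W +>\<^bsub>V\<^esub> y \<longleftrightarrow> x \<oplus>\<^bsub>V\<^esub> \<ominus>\<^bsub>V\<^esub> y \<in> W"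
    and "W +>\<^bsub>V\<^esub> \<zero>\<^bsub>V\<^esub> = \<zero>\<^bsub>quot_module V W\<^esub>"
    and "vectorspace K (quot_module V W)"
proof -
  interpret vectorspace K V by fact
  interpret W: submodule K W V by fact
  let ?Q = "quot_module V W" and ?q = "\<lambda>x. W +>\<^bsub>V\<^esub> x"
  have "subgroup W (add_monoid V)"
  proof (rule subgroup.intro)
    fix x assume x: "x \<in> W"
    then have "x \<in> carrier V" using W.subset by blast
    then have "\<ominus>\<^bsub>V\<^esub> x = (\<ominus>\<^bsub>K\<^esub> \<one>\<^bsub>K\<^esub>) \<odot>\<^bsub>V\<^esub> x" by (simp add: smult_minus_1)
    then show "inv\<^bsub>add_monoid V\<^esub> x \<in> W" using x by (simp add: a_inv_def[symmetric])
  qed (use W.subset in auto)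
  then interpret A: abelian_subgroup W V
    by (intro abelian_subgroupI3 additive_subgroup.intro abelian_group_axioms)
  show car: "carrier ?Q = ?q ` carrier V"
    by (auto simp: quot_module_def A_RCOSETS_def RCOSETS_def a_r_coset_def)
  show add: "?q x \<oplus>\<^bsub>?Q\<^esub> ?q y = ?q (x \<oplus>\<^bsub>V\<^esub> y)" if "x \<in> carrier V" "y \<in> carrier V" for x y
    using A.a_rcos_sum[OF that] by (simp add: quot_module_def)
  show eq: "?q x = ?q y \<longleftrightarrow> x \<oplus>\<^bsub>V\<^esub> \<ominus>\<^bsub>V\<^esub> y \<in> W" if xy: "x \<in> carrier V" "y \<in> carrier V" for x y
  proof -
    have "?q x = ?q y \<longleftrightarrow> x \<in> ?q y"
      using A.a_rcos_self[OF xy(1)] A.a_repr_independence'[OF _ xy(2), of x] by auto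
    then show ?thesis using A.a_rcos_module[OF xy(2,1)] by simp
  qed
  show smult: "c \<odot>\<^bsub>?Q\<^esub> ?q x = ?q (c \<odot>\<^bsub>V\<^esub> x)" if cx: "c \<in> carrier K" "x \<in> carrier V" for c x
  proof -
    have "?q (c \<odot>\<^bsub>V\<^esub> y) = ?q (c \<odot>\<^bsub>V\<^esub> x)" if y: "y \<in> ?q x" for y
    proof -
      have yV: "y \<in> carrier V" using A.a_elemrcos_carrier[OF cx(2) y] .
      have "y \<oplus>\<^bsub>V\<^esub> \<ominus>\<^bsub>V\<^esub> x \<in> W" using A.a_rcos_module[OF cx(2) yV] y by simp
      then have "c \<odot>\<^bsub>V\<^esub> (y \<oplus>\<^bsub>V\<^esub> \<ominus>\<^bsub>V\<^esub> x) \<in> W" using cx by simp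
      moreover have "c \<odot>\<^bsub>V\<^esub> (y \<oplus>\<^bsub>V\<^esub> \<ominus>\<^bsub>V\<^esub> x) = c \<odot>\<^bsub>V\<^esub> y \<oplus>\<^bsub>V\<^esub> \<ominus>\<^bsub>V\<^esub> (c \<odot>\<^bsub>V\<^esub> x)"
        using smult_r_distr[OF cx(1) yV M.a_inv_closed[OF cx(2)]] smult_r_minus[OF cx] by simp
      ultimately show ?thesis using eq[OF smult_closed[OF cx(1) yV] smult_closed[OF cx]] by simp
    qed
    \<comment> \<open>Scalar multiplication on the quotient is a union over all members of a coset;
      since W is stable, all the sets in the union coincide.\<close>
    then have "(\<Union>y\<in>?q x. ?q (c \<odot>\<^bsub>V\<^esub> y)) = (\<Union>y\<in>?q x. ?q (c \<odot>\<^bsub>V\<^esub> x))" by (rule SUP_cong[OF refl])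
    also have "\<dots> = ?q (c \<odot>\<^bsub>V\<^esub> x)" using A.a_rcos_self[OF cx(2)] by blast
    finally show ?thesis by (simp add: quot_module_def)
  qed
  show zero: "?q \<zero>\<^bsub>V\<^esub> = \<zero>\<^bsub>?Q\<^esub>" using A.a_rcos_const[OF W.zero_closed] by (simp add: quot_module_def)
  have "abelian_group ?Q"
  proof (rule abelian_groupI)
    fix x y z assume "x \<in> carrier ?Q" "y \<in> carrier ?Q" "z \<in> carrier ?Q"
    then show "x \<oplus>\<^bsub>?Q\<^esub> y \<oplus>\<^bsub>?Q\<^esub> z = x \<oplus>\<^bsub>?Q\<^esub> (y \<oplus>\<^bsub>?Q\<^esub> z)" unfolding car by (auto simp: add M.a_assoc)
  next
    fix x assume "x \<in> carrier ?Q"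
    then obtain x' where x': "x' \<in> carrier V" "x = ?q x'" unfolding car by blast
    then have "?q (\<ominus>\<^bsub>V\<^esub> x') \<oplus>\<^bsub>?Q\<^esub> x = \<zero>\<^bsub>?Q\<^esub>" by (simp add: add M.l_neg zero)
    then show "\<exists>y\<in>carrier ?Q. y \<oplus>\<^bsub>?Q\<^esub> x = \<zero>\<^bsub>?Q\<^esub>" unfolding car using x' by blast
  qed (unfold car zero[symmetric], auto simp: add M.a_comm intro!: imageI)
  then show "vectorspace K ?Q"
    by (intro vectorspace.intro moduleI R.is_cring vectorspace.axioms(2)[OF V])
      (auto simp: car add smult smult_l_distr smult_r_distr smult_assoc1)
qed

section \<open>Levels, the two halves of the induced representation and the action of T\<close>

context weight_rep begin

text \<open>The signed position of the vertex K g relative to the base edge. By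
  \<open>cell_disjoint\<close> the choice is forced for g in G.\<close>

definition lev :: "'e^3^3 \<Rightarrow> int" where "lev g = (SOME m. g \<in> cell aa m)"

lemma lev: assumes "g \<in> GG" shows "g \<in> cell aa m \<longleftrightarrow> lev g = m"
proof -
  have "g \<in> cell aa (lev g)" unfolding lev_def by (rule someI_ex[OF GG_cell[OF assms]])
  then show ?thesis using cell_disjoint by metis
qed

lemma lev_K: assumes "k \<in> K" "g \<in> GG" shows "lev (k ** g) = lev g"
  using lev[OF mult_GG[OF K_GG[OF assms(1)] assms(2)]] lev[OF assms(2)] cell_K[OF assms(1)] by blast

lemma lev_I: assumes "i \<in> PP (2 * aa + 1)" "g \<in> GG" shows "lev (g ** i) = lev g"
  using lev[OF mult_GG[OF assms(2) PP_GG[OF assms(1)]]] lev[OF assms(2)] cell_I[OF assms(1)] by blast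

lemma lev_alph: "lev (alph m) = m" using lev[of "alph m" m] alph_cell by simp

lemma lev_cell: "k \<in> K \<Longrightarrow> i \<in> PP (2 * aa + 1) \<Longrightarrow> lev (k ** alph m ** i) = m"
  by (simp add: lev_I lev_K lev_alph mult_GG K_GG)

lemma lev_decomp: assumes "g \<in> GG"
  obtains k i where "k \<in> K" "i \<in> KP (2 * aa + 1) 1" "g = k ** alph (lev g) ** i"
proof -
  have "g \<in> cell aa (lev g)" using lev[OF assms] by simp
  then obtain k j where k: "k \<in> K" "j \<in> PP (2 * aa + 1)" "g = k ** alph (lev g) ** j" unfolding cell_def by blast
  obtain h i where h: "h \<in> DG" "i \<in> KP (2 * aa + 1) 1" "j = h ** i" by (rule Iwahori_decomp[OF k(2)])
  have "alph (lev g) ** h = h ** alph (lev g)" using h(1) alph_dg unfolding DG_def by auto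
  then have "k ** alph (lev g) ** j = (k ** h) ** alph (lev g) ** i" unfolding h(3) by (metis matrix_mul_assoc)
  then show ?thesis using that[of "k ** h" i] k(3) h PP_mult[OF k(1) DG_K[OF h(1)]] by simp
qed

lemma lev_0: assumes "g \<in> GG" shows "lev g = 0 \<longleftrightarrow> g \<in> K"
proof
  assume "lev g = 0"
  then obtain k i where k: "k \<in> K" "i \<in> KP (2 * aa + 1) 1" "g = k ** alph 0 ** i" using lev_decomp[OF assms] by metis
  then show "g \<in> K" using PP_mult[OF k(1), of i] I1_K by auto
next
  assume "g \<in> K"
  then show "lev g = 0" using lev_cell[of g "mat 1" 0] by simp
qed

text \<open>Write X = 4 lev x + 1 and Y = -(4 lev y + 1) for the distances. The estimates for
  neighbours in both directions give Y <= max X 3 and X <= Y; X is 1 and Y is 3 modulo 4, so they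
  differ, which leaves only X = 1 and Y = 3.\<close>

lemma crossing:
  assumes n: "neighbours aa x y" and G: "y \<in> GG" "x \<in> GG" and l: "0 \<le> lev x" "lev y < 0"
  shows "lev x = 0 \<and> lev y = - 1"
proof -
  have "x \<in> cell aa (lev x)" "y \<in> cell aa (lev y)" using lev G by simp_all
  then have "\<bar>4 * lev y + 1\<bar> \<le> max (4 * lev x + 1) 3" "\<bar>4 * lev x + 1\<bar> \<le> - (4 * lev y + 1)"
    using neighbours_plus[OF l(1) _ neighbours_sym[OF n G(1)], of "lev y"] neighbours_minus[of "lev y" y aa x "lev x"] n l by auto
  then show ?thesis using l by presburger
qed

text \<open>The function supported on K with value w at the identity. \<open>E v0\<close> is
  f_0.\<close>

definition E :: "'v \<Rightarrow> 'e^3^3 \<Rightarrow> 'v" where "E w g = (if g \<in> K then \<sigma> g w else 0)"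

lemma K_mult_iff: assumes "k \<in> K" "g \<in> GG" shows "k ** g \<in> K \<longleftrightarrow> g \<in> K"
  using lev_K[OF assms] lev_0[OF assms(2)] lev_0[OF mult_GG[OF K_GG[OF assms(1)] assms(2)]] by simp

lemma E_1: "E w (mat 1) = w" by (simp add: E_def \<sigma>_1)

lemma E_ind: "E w \<in> ind v bar t \<sigma>"
proof -
  have "equivariant (E w)" unfolding equivariant_def E_def by (auto simp: K_mult_iff \<sigma>_mult \<sigma>_0 dest: K_GG)
  moreover have "fin_supp (E w)" unfolding fin_supp_def E_def by (intro exI[of _ "{mat 1}"]) auto
  ultimately show ?thesis by (simp add: ind_iff)
qed

lemma T_E: "T (E w) g = phi g w"
proof -
  have "T (E w) g = tm (E w) g (mat 1)"
    by (rule T_single[OF E_ind]) (auto simp: E_def split: if_splits)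
  then show ?thesis by (simp add: tm_def E_1)
qed

text \<open>The inverse of alpha is its conjugate by the reflection, and the reflected i lies in the
  opposite pro-p Iwahori subgroup, which \<open>lc\<close> does not see.\<close>

lemma phi_minus_1:
  assumes k: "k \<in> K" and i: "i \<in> KP (2 * aa + 1) 1"
  shows "phi (k ** alph (- 1) ** i) w = scale (lc (s w)) (\<sigma> k (s v0))"
proof -
  have iK: "i \<in> K" using i I1_K by blast
  have "sw aa ** alph 1 = alph (- 1) ** sw aa" using sw_alph by simp
  then have "k ** alph (- 1) ** i = (k ** sw aa) ** alph 1 ** (sw aa ** i)"
    by (metis matrix_mul_assoc sw_conj_conj(3))
  moreover have "\<sigma> (sw aa ** i) w = \<sigma> (sw aa ** i ** sw aa) (s w)"
    using iK sw_K by (simp add: \<sigma>_mult PP_mult s_s)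
  moreover have "sw aa ** i ** sw aa \<in> KP (2 * aa - 1) 1" by (rule sw_KP_conj[OF i])
  ultimately have "phi (k ** alph (- 1) ** i) w = \<sigma> (k ** sw aa) (scale (lc (s w)) v0)"
    using phi_cell[OF PP_mult[OF k sw_K] PP_mult[OF sw_K iK], of w] lc_opp[of "sw aa ** i ** sw aa" "s w"] by simp
  then show ?thesis using k sw_K by (simp add: \<sigma>_mult \<sigma>_scale)
qed

text \<open>f_1, cut out of T applied to a function on K, so that it inherits equivariance and
  compact support.\<close>

definition f1 :: "'e^3^3 \<Rightarrow> 'v" where "f1 g = (if lev g = - 1 then T (E (s v0)) g else 0)"

lemma f1_ind: "f1 \<in> ind v bar t \<sigma>"
  unfolding f1_def by (rule ind_restrict[OF T_ind[OF E_ind]]) (simp add: lev_K)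

lemma f1_eq: assumes "k \<in> K" "i \<in> KP (2 * aa + 1) 1" shows "f1 (k ** alph (- 1) ** i) = \<sigma> k (s v0)"
  using lev_cell[OF assms(1), of i "-1"] phi_minus_1[OF assms, of "s v0"] assms(2) KP_subset_PP[of 1 "2 * aa + 1"]
  by (auto simp: f1_def T_E s_s lc_v0)

lemma f_fun_value:
  assumes "f \<in> ind v bar t \<sigma>" "\<And>g i. g \<in> GG \<Longrightarrow> i \<in> KP (2 * aa + 1) 1 \<Longrightarrow> f (g ** i) = f g"
    and "k \<in> K" "h \<in> KP (2 * aa + 1) 1"
  shows "f (k ** alph m ** h) = \<sigma> k (f (alph m))"
proof -
  have "f (k ** alph m ** h) = f (k ** alph m)" by (rule assms(2)[OF mult_GG[OF K_GG[OF assms(3)] alph_GG] assms(4)])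
  also have "\<dots> = \<sigma> k (f (alph m))" by (rule ind_eq[OF assms(1,3) alph_GG])
  finally show ?thesis .
qed

text \<open>Equivariance under K and invariance under the pro-p Iwahori subgroup determine a
  function on the double coset from its value at one power of alpha, so the description in
  \<open>f_fun\<close> has only one solution.\<close>

lemma f_fun_eqI:
  assumes "f \<in> ind v bar t \<sigma>" "\<And>g i. g \<in> GG \<Longrightarrow> i \<in> KP (2 * aa + 1) 1 \<Longrightarrow> f (g ** i) = f g"
    and "\<And>g. f g \<noteq> 0 \<Longrightarrow> lev g = - n" "f (alph (- n)) = (if n > 0 then s v0 else v0)"
  shows "f_fun v bar \<pi> p t \<sigma> v0 n = f"
proof -
  have 3: "{g. f g \<noteq> 0} \<subseteq> {k ** alph (- n) ** h | k h. k \<in> K \<and> h \<in> KP (2 * aa + 1) 1}"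
  proof
    fix g assume "g \<in> {g. f g \<noteq> 0}"
    then have g: "f g \<noteq> 0" by simp
    then have "g \<in> GG" using ind_0[OF assms(1)] by blast
    then obtain k i where "k \<in> K" "i \<in> KP (2 * aa + 1) 1" "g = k ** alph (lev g) ** i" by (rule lev_decomp)
    then show "g \<in> {k ** alph (- n) ** h | k h. k \<in> K \<and> h \<in> KP (2 * aa + 1) 1}"
      unfolding assms(3)[OF g] by (intro CollectI exI conjI)
  qed
  show ?thesis
    unfolding f_fun_def alpha_pow dcoset_eq pro_p_Iwahori_eq beta_eq
  proof (rule the_equality)
    show "f \<in> ind v bar t \<sigma> \<and> (\<forall>g\<in>GG. \<forall>i\<in>KP (2 * aa + 1) 1. f (g ** i) = f g) \<and>
      {g. f g \<noteq> 0} \<subseteq> {k ** alph (- n) ** h | k h. k \<in> K \<and> h \<in> KP (2 * aa + 1) 1} \<and>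
      f (alph (- n)) = (if 0 < n then s v0 else v0)" using assms 3 by blast
  next
    fix f' assume f': "f' \<in> ind v bar t \<sigma> \<and> (\<forall>g\<in>GG. \<forall>i\<in>KP (2 * aa + 1) 1. f' (g ** i) = f' g) \<and>
      {g. f' g \<noteq> 0} \<subseteq> {k ** alph (- n) ** h | k h. k \<in> K \<and> h \<in> KP (2 * aa + 1) 1} \<and>
      f' (alph (- n)) = (if 0 < n then s v0 else v0)"
    show "f' = f"
    proof
      fix g
      show "f' g = f g"
      proof (cases "g \<in> {k ** alph (- n) ** h | k h. k \<in> K \<and> h \<in> KP (2 * aa + 1) 1}")
        case True
        then obtain k h where g: "g = k ** alph (- n) ** h" and k: "k \<in> K" "h \<in> KP (2 * aa + 1) 1" by blast
        have "f' g = \<sigma> k (f' (alph (- n)))" unfolding g by (rule f_fun_value[OF _ _ k]) (use f' in blast)+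
        moreover have "f g = \<sigma> k (f (alph (- n)))" unfolding g by (rule f_fun_value[OF assms(1,2) k])
        ultimately show ?thesis using f' assms(4) by simp
      next
        case False
        then have "f g = 0" "f' g = 0" using 3 f' by blast+
        then show ?thesis by simp
      qed
    qed
  qed
qed

lemma f_fun_0: "f_fun v bar \<pi> p t \<sigma> v0 0 = E v0"
proof (rule f_fun_eqI)
  show "E v0 (g ** i) = E v0 g" if g: "g \<in> GG" and i: "i \<in> KP (2 * aa + 1) 1" for g i
  proof -
    have iK: "i \<in> K" using i I1_K by blast
    have iP: "i \<in> PP (2 * aa + 1)" using i KP_subset_PP[of 1 "2 * aa + 1"] by auto
    have "g ** i \<in> K \<longleftrightarrow> g \<in> K"
      using lev_I[OF iP g] lev_0[OF g] lev_0[OF mult_GG[OF g PP_GG[OF iP]]] by simp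
    then show ?thesis using iK i by (simp add: E_def \<sigma>_mult I1_v0)
  qed
  show "lev g = - 0" if "E v0 g \<noteq> 0" for g using that lev_0[of g] K_GG by (auto simp: E_def split: if_splits)
qed (simp_all add: E_ind E_1)

lemma f_fun_1: "f_fun v bar \<pi> p t \<sigma> v0 1 = f1"
proof (rule f_fun_eqI)
  show "f1 (g ** i) = f1 g" if g: "g \<in> GG" and i: "i \<in> KP (2 * aa + 1) 1" for g i
  proof -
    have iP: "i \<in> PP (2 * aa + 1)" using i KP_subset_PP[of 1 "2 * aa + 1"] by auto
    show ?thesis
    proof (cases "lev g = - 1")
      case True
      obtain k j where k: "k \<in> K" "j \<in> KP (2 * aa + 1) 1" "g = k ** alph (lev g) ** j" by (rule lev_decomp[OF g])
      have "g ** i = k ** alph (- 1) ** (j ** i)" using k(3) True by (simp add: matrix_mul_assoc)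
      then show ?thesis using f1_eq[OF k(1,2)] f1_eq[OF k(1) KP_mult[OF _ k(2) i]] k(3) True by simp
    next
      case False
      then show ?thesis using lev_I[OF iP g] by (simp add: f1_def)
    qed
  qed
  show "lev g = - 1" if "f1 g \<noteq> 0" for g using that by (simp add: f1_def split: if_splits)
  show "f1 (alph (- 1)) = (if 1 > (0::int) then s v0 else v0)" using f1_eq[of "mat 1" "mat 1"] by (simp add: \<sigma>_1)
qed (rule f1_ind)

lemma lev_bound: assumes "F \<in> ind v bar t \<sigma>" shows "\<exists>N::nat. \<forall>g. F g \<noteq> 0 \<longrightarrow> \<bar>lev g\<bar> \<le> int N"
proof -
  obtain Q where Q: "finite Q" "Q \<subseteq> GG" "\<forall>g\<in>GG. F g \<noteq> 0 \<longrightarrow> (\<exists>q\<in>Q. \<exists>k\<in>K. g = k ** q)"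
    using assms unfolding ind_iff fin_supp_def by blast
  obtain N where N: "\<forall>n\<in>(\<lambda>q. nat \<bar>lev q\<bar>) ` Q. n \<le> N"
    using finite_nat_set_iff_bounded_le[of "(\<lambda>q. nat \<bar>lev q\<bar>) ` Q"] Q(1) by auto
  have "\<bar>lev g\<bar> \<le> int N" if g: "F g \<noteq> 0" for g
  proof -
    have "g \<in> GG" using g ind_0[OF assms] by blast
    then obtain q k where q: "q \<in> Q" "k \<in> K" "g = k ** q" using Q(3) g by blast
    then have "lev g = lev q" using lev_K Q(2) by auto
    then show ?thesis using N q(1) by force
  qed
  then show ?thesis by blast
qed

text \<open>With sign conditions as P these are I^+ and I^-; with a single level, the summands R_n^+
  and R_n^-.\<close>

definition half :: "(int \<Rightarrow> bool) \<Rightarrow> ('e^3^3 \<Rightarrow> 'v) set" where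
  "half P = {F \<in> ind v bar t \<sigma>. \<forall>g. F g \<noteq> 0 \<longrightarrow> P (lev g)}"

lemma support_cell: 
  "{f \<in> ind v bar t \<sigma>. {g. f g \<noteq> 0} \<subseteq> dcoset v bar t (alph m) (PP (2 * aa + 1))} = half (\<lambda>l. l = m)"
  unfolding half_def dcoset_cell using lev ind_0 cell_GG by blast

text \<open>Here \<open>h\<close> enumerates the levels allowed by P. A function of compact support
  has bounded levels, and |h n| >= n then limits the summands to finitely many.\<close>

lemma half_sums:
  assumes "inj h" "\<And>l. P l \<longleftrightarrow> (\<exists>n::nat. l = h n)" "\<And>n. int n \<le> \<bar>h n\<bar>"
  shows "{\<lambda>g. \<Sum>n\<le>N. H n g | (N::nat) H. \<forall>n\<le>N. H n \<in> half (\<lambda>l. l = h n)} = half P"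
proof (intro equalityI subsetI)
  fix F assume "F \<in> {\<lambda>g. \<Sum>n\<le>N. H n g | (N::nat) H. \<forall>n\<le>N. H n \<in> half (\<lambda>l. l = h n)}"
  then obtain N :: nat and H where F: "F = (\<lambda>g. \<Sum>n\<le>N. H n g)" and H: "\<forall>n\<le>N. H n \<in> half (\<lambda>l. l = h n)" by blast
  have "(\<lambda>g. \<Sum>n\<le>N'. H n g) \<in> ind v bar t \<sigma>" if "N' \<le> N" for N'
    using that
  proof (induction N')
    case 0
    then show ?case using H by (auto simp: half_def)
  next
    case (Suc N')
    then have "H (Suc N') \<in> ind v bar t \<sigma>" using H by (auto simp: half_def)
    then show ?case using ind_add Suc by simp
  qed
  moreover have "P (lev g)" if "F g \<noteq> 0" for g
  proof -
    obtain n where "n \<le> N" "H n g \<noteq> 0" using \<open>F g \<noteq> 0\<close> unfolding F by (metis atMost_iff sum.neutral)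
    then show ?thesis using H assms(2) by (auto simp: half_def)
  qed
  ultimately show "F \<in> half P" unfolding half_def F by blast
next
  fix F assume "F \<in> half P"
  then have F: "F \<in> ind v bar t \<sigma>" "\<And>g. F g \<noteq> 0 \<Longrightarrow> P (lev g)" by (auto simp: half_def)
  obtain N :: nat where N: "\<forall>g. F g \<noteq> 0 \<longrightarrow> \<bar>lev g\<bar> \<le> int N" using lev_bound[OF F(1)] by blast
  define H where "H = (\<lambda>n g. if lev g = h n then F g else 0)"
  have "H n \<in> half (\<lambda>l. l = h n)" for n
    unfolding half_def H_def using ind_restrict[OF F(1), of "\<lambda>g. lev g = h n"] by (auto simp: lev_K)
  moreover have "F g = (\<Sum>n\<le>N. H n g)" for g
  proof (cases "F g = 0")
    case False
    then obtain m where m: "lev g = h m" using F(2) assms(2) by blast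
    then have "m \<le> N" using N False assms(3)[of m] by force
    moreover have "H n g = (if n = m then F g else 0)" for n using m injD[OF assms(1), of n m] by (auto simp: H_def)
    ultimately show ?thesis by simp
  next
    case True
    then have "H n g = 0" for n by (simp add: H_def)
    then show ?thesis using True by simp
  qed
  ultimately show "F \<in> {\<lambda>g. \<Sum>n\<le>N. H n g | (N::nat) H. \<forall>n\<le>N. H n \<in> half (\<lambda>l. l = h n)}" by blast
qed

lemma I_plus_eq: "I_plus v bar \<pi> p t \<sigma> = half (\<lambda>l. 0 \<le> l)"
  unfolding I_plus_def R_plus_def alpha_pow Iwahori_eq support_cell
  by (rule half_sums) (auto simp: inj_def intro: exI[of _ "nat _"])

lemma I_minus_eq: "I_minus v bar \<pi> p t \<sigma> = half (\<lambda>l. l < 0)"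
  unfolding I_minus_def R_minus_def alpha_pow Iwahori_eq support_cell
proof (rule half_sums)
  show "l < 0 \<longleftrightarrow> (\<exists>n. l = - int (n + 1))" for l
  proof
    assume "l < 0"
    then have "l = - int (nat (- l - 1) + 1)" by simp
    then show "\<exists>n. l = - int (n + 1)" ..
  qed auto
qed (auto simp: inj_def)

text \<open>By \<open>crossing\<close> only vertices g of level -1 receive anything, and only from
  the coset K. So the value depends on F at the identity alone, through
  \<open>phi_minus_1\<close>.\<close>

lemma T_plus:
  assumes F: "F \<in> half (\<lambda>l. 0 \<le> l)" and g: "g \<in> GG" "lev g < 0"
  shows "T F g = scale (lc (s (F (mat 1)))) (f1 g)"
proof -
  have Fi: "F \<in> ind v bar t \<sigma>" and Fs: "\<And>y. F y \<noteq> 0 \<Longrightarrow> 0 \<le> lev y" using F unfolding half_def by blast+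
  have cr: "lev y = 0 \<and> lev g = - 1" if "y \<in> GG" "neighbours aa g y" "F y \<noteq> 0" for y
    using crossing[OF neighbours_sym[OF that(2,1)] g(1) that(1) Fs[OF that(3)] g(2)] .
  show ?thesis
  proof (cases "lev g = - 1")
    case True
    have "T F g = tm F g (mat 1)"
    proof (rule T_single[OF Fi one_GG])
      fix y assume y: "y \<in> GG" "neighbours aa g y" "F y \<noteq> 0"
      then have "y \<in> K" using cr lev_0 by blast
      then show "\<exists>k\<in>K. y = k ** mat 1" by (intro bexI[of _ y]) simp_all
    qed
    moreover obtain k i where "k \<in> K" "i \<in> KP (2 * aa + 1) 1" "g = k ** alph (- 1) ** i" using lev_decomp[OF g(1)] unfolding True by blast
    ultimately show ?thesis by (simp add: tm_def f1_eq phi_minus_1)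
  next
    case False
    have "T F g \<in> {0}" by (rule T_subspace[OF Fi subspace_single_0]) (use cr False in blast)
    then show ?thesis using False by (simp add: f1_def)
  qed
qed

text \<open>By \<open>crossing\<close> only the vertex K receives anything, from vertices of level
  -1. Each contribution to the value at the identity is the image of a multiple of v0 under an
  element of the pro-p Iwahori subgroup, hence again a multiple of v0.\<close>

lemma T_minus:
  assumes F: "F \<in> half (\<lambda>l. l < 0)"
  shows "\<exists>c. \<forall>g\<in>GG. 0 \<le> lev g \<longrightarrow> T F g = scale c (E v0 g)"
proof -
  have Fi: "F \<in> ind v bar t \<sigma>" and Fs: "\<And>y. F y \<noteq> 0 \<Longrightarrow> lev y < 0" using F unfolding half_def by blast+
  have cr: "lev g = 0 \<and> lev y = - 1" if "g \<in> GG" "0 \<le> lev g" "y \<in> GG" "neighbours aa g y" "F y \<noteq> 0" for y g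
    by (rule crossing[OF that(4) that(3) that(1) that(2)]) (rule Fs[OF that(5)])
  have l1: "lev (mat 1) = 0" using lev_0 by simp
  have "T F (mat 1) \<in> span {v0}"
  proof (rule T_subspace[OF Fi subspace_span])
    fix y assume y: "y \<in> GG" "neighbours aa (mat 1) y" "F y \<noteq> 0"
    then have "lev y = - 1" using cr[OF one_GG] l1 by simp
    then obtain k i where k: "k \<in> K" "i \<in> KP (2 * aa + 1) 1" "y = k ** alph (- 1) ** i" using lev_decomp[OF y(1)] by metis
    have "star y = star i ** alph 1 ** star k" unfolding k(3) by (simp add: star_mult matrix_mul_assoc)
    then have "tm F (mat 1) y = \<sigma> (star i) (scale (lc (\<sigma> (star k) (F y))) v0)"
      using k I1_K by (auto simp: tm_def phi_cell PP_star)
    also have "\<dots> = scale (lc (\<sigma> (star k) (F y))) v0"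
      using KP_star[OF k(2)] I1_K by (auto simp: \<sigma>_scale I1_v0)
    finally show "tm F (mat 1) y \<in> span {v0}" by (simp add: span_scale span_base)
  qed
  then obtain c where c: "T F (mat 1) = scale c v0" by (auto simp: span_singleton)
  have "T F g = scale c (E v0 g)" if g: "g \<in> GG" "0 \<le> lev g" for g
  proof (cases "g \<in> K")
    case True
    then have "T F g = \<sigma> g (T F (mat 1))" using ind_eq[OF T_ind[OF Fi] True one_GG] by simp
    then show ?thesis using True c by (simp add: E_def \<sigma>_scale)
  next
    case False
    have "T F g \<in> {0}" by (rule T_subspace[OF Fi subspace_single_0]) (use cr[OF g] False lev_0[OF g(1)] in blast)
    then show ?thesis using False by (simp add: E_def)
  qed
  then show ?thesis by blast
qed

lemma lc_orbit_0: assumes "\<And>u. u \<in> NU (2 * aa) \<Longrightarrow> scale (lc (\<sigma> u x)) v0 = 0" shows "x = 0"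
  using assms v0_nonzero by (intro lc_eq_0) (auto simp: scale_eq_0_iff)

text \<open>A vertex x just beyond the support has y as its only neighbour in the support. As x runs
  over the outer neighbours of y, the values T F x run, up to a reflection, over the vectors
  \<open>lc\<close> (sigma(u) F(y)) v0 with u in N; if all vanish, \<open>lc_orbit_0\<close> gives
  F(y) = 0.\<close>

lemma outer_vanish:
  assumes F: "F \<in> ind v bar t \<sigma>" and N: "0 \<le> N"
    and out: "\<And>g. F g \<noteq> 0 \<Longrightarrow> - N - 1 \<le> lev g \<and> lev g \<le> N"
    and TF: "\<And>g. g \<in> GG \<Longrightarrow> lev g = N + 1 \<or> lev g = - N - 2 \<Longrightarrow> T F g = 0"
    and g: "F g \<noteq> 0"
  shows "- N \<le> lev g \<and> lev g \<le> N - 1"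
proof (rule ccontr)
  assume "\<not> ?thesis"
  then have l: "lev g = N \<or> lev g = - N - 1" using out[OF g] by linarith
  have gG: "g \<in> GG" using g ind_0[OF F] by blast
  obtain k i where k: "k \<in> K" "i \<in> KP (2 * aa + 1) 1" "g = k ** alph (lev g) ** i" by (rule lev_decomp[OF gG])
  have iP: "i \<in> PP (2 * aa + 1)" using k(2) KP_subset_PP[of 1 "2 * aa + 1"] by auto
  define y where "y = alph (lev g) ** i"
  have yG: "y \<in> GG" unfolding y_def using iP by (simp add: mult_GG PP_GG)
  have gy: "g = k ** y" using k(3) by (simp add: y_def matrix_mul_assoc)
  have yc: "y \<in> cell aa (lev g)" using lev[OF yG] lev_K[OF k(1) yG] gy by simp
  have Fy: "F y \<noteq> 0" using g F equivariant_0[OF _ k(1) yG] unfolding gy ind_iff by blast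
  from l show False
  proof
    assume lg: "lev g = N"
    have "scale (lc (\<sigma> u (F y))) v0 = 0" if u: "u \<in> NU (2 * aa)" for u
    proof -
      \<comment> \<open>The outer neighbour of y in direction u. Rewriting with i' exhibits x at
        level N + 1 and y at level N with the same Iwahori element.\<close>
      define x where "x = alph 1 ** u ** y"
      define i' where "i' = alph (- N) ** u ** alph N ** i"
      have i': "i' \<in> PP (2 * aa + 1)" unfolding i'_def by (intro PP_mult alph_NU_PP u N iP)
      have uG: "u \<in> GG" using u NU_PP PP_GG by blast
      have "alph 1 ** alph N = alph (N + 1)" by (simp add: alph_add add.commute)
      then have x1: "x = mat 1 ** alph (N + 1) ** i'" unfolding x_def y_def i'_def lg
        by (metis alph_mult_cancel(2) matrix_mul_assoc matrix_mul_lid)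
      have y1: "y = star u ** alph N ** i'" unfolding y_def i'_def lg
        using uG by (simp add: star_cancel flip: matrix_mul_assoc)
      have xG: "x \<in> GG" unfolding x_def by (intro mult_GG uG yG alph_GG)
      have lx: "lev x = N + 1" unfolding x1 by (rule lev_cell[OF PP_1 i'])
      have o: "outward aa (N + 1) N x y" unfolding outward_def
        using i' x1 y1 PP_1 PP_star[OF NU_PP[OF u]] by blast
      \<comment> \<open>The distance of x is 4 N + 5, while the support reaches at most 4 N + 3. So
        a neighbour of x in the support can only be reached by an outward step from level N, and
        that neighbour is unique.\<close>
      have "T F x = tm F x y"
      proof (rule T_single[OF F yG])
        fix y' assume y': "y' \<in> GG" "neighbours aa x y'" "F y' \<noteq> 0"
        have c: "y' \<in> cell aa (lev y')" "x \<in> cell aa (N + 1)" using lev[OF y'(1)] lev[OF xG] lx by simp_all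
        have b: "- N - 1 \<le> lev y'" "lev y' \<le> N" using out[OF y'(3)] by auto
        show "\<exists>k\<in>K. y' = k ** y"
        proof (cases "0 \<le> lev y'")
          case True
          have e: "N + 1 = lev y' + 1 \<and> outward aa (N + 1) (lev y') x y'"
            using neighbours_plus[OF True c(1) y'(2) c(2)] b N by (auto simp: le_max_iff_disj)
          then have "lev y' = N" by linarith
          then have "outward aa (N + 1) N x y'" using e by metis
          then show ?thesis by (rule outward_unique[OF o]) (use N in auto)
        next
          case False
          then show ?thesis using neighbours_minus[of "lev y'", OF _ c(1) y'(2) c(2)] b N by (auto simp: le_max_iff_disj)
        qed
      qed
      moreover have "x ** star y = alph 1 ** u ** mat 1" unfolding x_def using yG by (simp add: star_cancel')
      then have "x ** star y = mat 1 ** alph 1 ** u" by simp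
      ultimately have "T F x = scale (lc (\<sigma> u (F y))) v0"
        using phi_cell[OF PP_1 NU_K[OF u], of "F y"] by (simp add: tm_def \<sigma>_1)
      then show ?thesis using TF[OF xG] lx by simp
    qed
    then show False using lc_orbit_0 Fy by blast
  next
    assume lg: "lev g = - N - 1"
    \<comment> \<open>On the negative side the same argument runs with the reflected unipotent n;
      the outer neighbours have level -M - 1.\<close>
    define M where "M = N + 1"
    have lg: "lev g = - M" using lg by (simp add: M_def)
    have "scale (lc (\<sigma> u (s (F y)))) v0 = 0" if u: "u \<in> NU (2 * aa)" for u
    proof -
      define n where "n = sw aa ** u ** sw aa"
      have nL: "n \<in> NL (2 * aa)" unfolding n_def by (rule sw_NU[OF u])
      define x where "x = alph (- 1) ** n ** y"
      define i' where "i' = alph M ** n ** alph (- M) ** i"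
      from nL obtain a b where ab: "n = nl a b" "a * bar a + b + bar b = 0" "vge (2 * aa) a" "vge (2 * (2 * aa)) b"
        unfolding NL_def by blast
      have M: "1 \<le> M" using N by (simp add: M_def)
      have "alph M ** n ** alph (- M) \<in> PP (2 * aa + 1)" unfolding ab(1) alph_nl
      proof (rule nl_PP)
        have pp: "\<pi> powi (2 * M) = \<pi> powi M * \<pi> powi M" by (simp add: pi_nonzero flip: power_int_add)
        have "bar (\<pi> powi M) = \<pi> powi M" by (simp add: bar_power_int bar_pi)
        then have "a * \<pi> powi M * bar (a * \<pi> powi M) + b * \<pi> powi (2 * M) + bar (b * \<pi> powi (2 * M))
            = (a * bar a + b + bar b) * (\<pi> powi M * \<pi> powi M)"
          unfolding pp by (simp add: bar_mult algebra_simps)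
        then show "a * \<pi> powi M * bar (a * \<pi> powi M) + b * \<pi> powi (2 * M) + bar (b * \<pi> powi (2 * M)) = 0"
          using ab(2) by simp
        show "vge (2 * aa + 1) (a * \<pi> powi M)"
          by (rule vge_mono[OF vge_mult[OF ab(3)]]) (use M in \<open>auto simp: vge_pi_power_int\<close>)
        show "vge (2 * (2 * aa + 1)) (b * \<pi> powi (2 * M))"
          by (rule vge_mono[OF vge_mult[OF ab(4), of "8 * M"]]) (use M in \<open>auto simp: vge_pi_power_int\<close>)
      qed
      then have i': "i' \<in> PP (2 * aa + 1)" unfolding i'_def by (rule PP_mult[OF _ iP])
      have nK: "n \<in> K" by (rule NL_PP[OF nL])
      have nG: "n \<in> GG" by (rule K_GG[OF nK])
      have mm: "alph (- M) ** (alph M ** z) = z" for z by (rule alph_mult_cancel(1))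
      have "- 1 + - M = - M - 1" by simp
      then have "alph (- 1) ** alph (- M) = alph (- M - 1)" by (simp only: alph_add)
      then have x1: "x = mat 1 ** alph (- M - 1) ** i'" unfolding x_def y_def i'_def lg
        by (metis mm matrix_mul_assoc matrix_mul_lid)
      have y1: "y = star n ** alph (- M) ** i'" unfolding y_def i'_def lg
        using nG by (simp add: star_cancel flip: matrix_mul_assoc)
      have xG: "x \<in> GG" unfolding x_def by (intro mult_GG nG yG alph_GG)
      have lx: "lev x = - M - 1" unfolding x1 by (rule lev_cell[OF PP_1 i'])
      have o: "outward aa (- M - 1) (- M) x y" unfolding outward_def
        using i' x1 y1 PP_1 PP_star[OF nK] by blast
      have "T F x = tm F x y"
      proof (rule T_single[OF F yG])
        fix y' assume y': "y' \<in> GG" "neighbours aa x y'" "F y' \<noteq> 0"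
        have c: "y' \<in> cell aa (lev y')" "x \<in> cell aa (- M - 1)" using lev[OF y'(1)] lev[OF xG] lx by simp_all
        have b: "- M \<le> lev y'" "lev y' \<le> M - 1" using out[OF y'(3)] by (auto simp: M_def)
        show "\<exists>k\<in>K. y' = k ** y"
        proof (cases "0 \<le> lev y'")
          case True
          then show ?thesis using neighbours_plus[OF True c(1) y'(2) c(2)] b M by (auto simp: le_max_iff_disj)
        next
          case False
          then have e: "- M - 1 = lev y' - 1 \<and> outward aa (- M - 1) (lev y') x y'"
            using neighbours_minus[of "lev y'", OF _ c(1) y'(2) c(2)] b M by (auto simp: le_max_iff_disj)
          then have "lev y' = - M" by linarith
          then have "outward aa (- M - 1) (- M) x y'" using e by metis
          then show ?thesis by (rule outward_unique[OF o]) (use M in auto)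
        qed
      qed
      moreover have "x ** star y = sw aa ** alph 1 ** (u ** sw aa)"
      proof -
        have "x ** star y = alph (- 1) ** n" unfolding x_def using yG by (simp add: star_cancel')
        also have "\<dots> = alph (- 1) ** sw aa ** (u ** sw aa)" by (simp add: n_def matrix_mul_assoc)
        also have "alph (- 1) ** sw aa = sw aa ** alph 1" using sw_alph[of aa 1] by simp
        finally show ?thesis .
      qed
      ultimately have "T F x = s (scale (lc (\<sigma> u (s (F y)))) v0)"
        using phi_cell[OF sw_K PP_mult[OF NU_K[OF u] sw_K], of "F y"] \<sigma>_mult[OF NU_K[OF u] sw_K] by (simp add: tm_def)
      moreover have "T F x = 0" using TF[OF xG] lx by (simp add: M_def)
      ultimately have "s (s (scale (lc (\<sigma> u (s (F y)))) v0)) = 0" using \<sigma>_0[OF sw_K] by metis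
      then show ?thesis by (simp only: s_s)
    qed
    then have "s (F y) = 0" by (rule lc_orbit_0)
    then have "s (s (F y)) = 0" using \<sigma>_0[OF sw_K] by simp
    then show False using Fy by (simp only: s_s)
  qed
qed

text \<open>Induction on shells: the levels -N, ..., N - 1 are the N innermost pairs of levels. Just
  outside the support F vanishes and, the levels 0 and -1 being excluded there, so does T F = lam F;
  hence the outermost pair of levels can be removed, until nothing remains.\<close>

lemma eigen_vanish:
  assumes F: "F \<in> ind v bar t \<sigma>"
    and TF: "\<And>g. g \<in> GG \<Longrightarrow> lev g \<noteq> 0 \<Longrightarrow> lev g \<noteq> - 1 \<Longrightarrow> T F g = scale lam (F g)"
  shows "F g = 0"
proof -
  have "(\<forall>g. F g \<noteq> 0 \<longrightarrow> - int N \<le> lev g \<and> lev g \<le> int N - 1) \<Longrightarrow> \<forall>g. F g = 0" for N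
  proof (induction N)
    case 0
    then show ?case by fastforce
  next
    case (Suc N)
    have out: "- int N - 1 \<le> lev g \<and> lev g \<le> int N" if "F g \<noteq> 0" for g using Suc.prems that by fastforce
    have "T F g = 0" if "g \<in> GG" "lev g = int N + 1 \<or> lev g = - int N - 2" for g
    proof -
      have "F g = 0" using out[of g] that(2) by linarith
      then show ?thesis using TF[OF that(1)] that(2) by auto
    qed
    then have "- int N \<le> lev g \<and> lev g \<le> int N - 1" if "F g \<noteq> 0" for g
      using outer_vanish[OF F _ out _ that] by auto
    then show ?case using Suc.IH by blast
  qed
  moreover obtain N where N: "\<forall>g. F g \<noteq> 0 \<longrightarrow> \<bar>lev g\<bar> \<le> int N" using lev_bound[OF F] by blast
  moreover have "- int (Suc N) \<le> lev g \<and> lev g \<le> int (Suc N) - 1" if "F g \<noteq> 0" for g using N that by fastforce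
  ultimately show ?thesis by blast
qed

end

section \<open>The image of T - lambda and the intersection of the two halves\<close>

context weight_rep begin

abbreviation "C \<equiv> (ring_of_type_algebra :: 'c ring)"
abbreviation "M \<equiv> ind_module v bar t scale \<sigma>"
abbreviation "W \<equiv> T_minus_image v bar \<pi> p t scale \<sigma>"

definition D :: "'c \<Rightarrow> ('e^3^3 \<Rightarrow> 'v) \<Rightarrow> 'e^3^3 \<Rightarrow> 'v" where
  "D lam F = (\<lambda>g. T F g - scale lam (F g))"

lemma W_eq: "W lam = D lam ` ind v bar t \<sigma>"
  unfolding T_minus_image_def D_def ..

lemma D_lin:
  assumes "F1 \<in> ind v bar t \<sigma>" "F2 \<in> ind v bar t \<sigma>"
  shows "D lam (\<lambda>g. F1 g + scale c (F2 g)) = (\<lambda>g. D lam F1 g + scale c (D lam F2 g))"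
  by (rule ext) (simp add: D_def T_linear[OF assms] algebra_simps)

lemma T_zero: "T (\<lambda>g. 0) g = 0"
  using T_subspace[OF ind_zero subspace_single_0, of g] by simp

lemma D_zero: "D lam (\<lambda>g. 0) = (\<lambda>g. 0)"
  by (simp add: D_def T_zero)

lemma D_scale: assumes "F \<in> ind v bar t \<sigma>" shows "D lam (\<lambda>g. scale c (F g)) = (\<lambda>g. scale c (D lam F g))"
  using D_lin[OF ind_zero assms, of lam c] by (simp add: D_zero)

lemma ind_lin:
  assumes "F1 \<in> ind v bar t \<sigma>" "F2 \<in> ind v bar t \<sigma>" shows "(\<lambda>g. F1 g + scale c (F2 g)) \<in> ind v bar t \<sigma>"
  by (rule ind_add[OF assms(1) ind_scale[OF assms(2)]])

lemma ind_diff: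
  assumes "F1 \<in> ind v bar t \<sigma>" "F2 \<in> ind v bar t \<sigma>" shows "(\<lambda>g. F1 g - F2 g) \<in> ind v bar t \<sigma>"
  using ind_lin[OF assms, of "- 1"] by simp

lemma D_ind: assumes "F \<in> ind v bar t \<sigma>" shows "D lam F \<in> ind v bar t \<sigma>"
  unfolding D_def by (rule ind_diff[OF T_ind[OF assms] ind_scale[OF assms]])

lemma C_simps [simp]: "carrier C = UNIV" "add C = (+)" "mult C = (*)" "one C = 1" "zero C = 0"
  by (simp_all add: ring_of_type_algebra_def)

lemma M_simps [simp]: "carrier M = ind v bar t \<sigma>" "add M = (\<lambda>f f' g. f g + f' g)" "zero M = (\<lambda>g. 0)"
    "smult M = (\<lambda>c f g. scale c (f g))"
  by (simp_all add: ind_module_def)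

lemma vectorspace_M: "vectorspace C M"
proof -
  have "abelian_group M"
  proof (rule abelian_groupI)
    fix F assume "F \<in> carrier M"
    then have "(\<lambda>g. 0 - F g) \<in> ind v bar t \<sigma>" using ind_diff[OF ind_zero] by simp
    then show "\<exists>G\<in>carrier M. G \<oplus>\<^bsub>M\<^esub> F = \<zero>\<^bsub>M\<^esub>" by (intro bexI[of _ "\<lambda>g. 0 - F g"]) simp_all
  qed (auto simp: ind_add ind_zero algebra_simps)
  then have "module C M"
    by (intro moduleI cring_from_type_algebra) (auto simp: ind_scale algebra_simps)
  then show ?thesis by (intro vectorspace.intro field_from_type_algebra)
qed

lemma submodule_W: "submodule C (W lam) M"
proof (rule submodule.intro)
  show "module C M" by (rule vectorspace.axioms(1)[OF vectorspace_M])
  show "W lam \<subseteq> carrier M" by (auto simp: W_eq D_ind)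
  show "F \<oplus>\<^bsub>M\<^esub> G \<in> W lam" if FG: "F \<in> W lam" "G \<in> W lam" for F G
  proof -
    obtain F' G' where F': "F = D lam F'" "F' \<in> ind v bar t \<sigma>" "G = D lam G'" "G' \<in> ind v bar t \<sigma>" using FG unfolding W_eq by blast
    then have "F \<oplus>\<^bsub>M\<^esub> G = D lam (\<lambda>g. F' g + scale 1 (G' g))" using D_lin[OF F'(2,4), of lam 1] by simp
    then show ?thesis unfolding W_eq using ind_lin[OF F'(2,4)] by blast
  qed
  have "\<zero>\<^bsub>M\<^esub> = D lam (\<lambda>g. 0)" by (simp add: D_zero)
  then show "\<zero>\<^bsub>M\<^esub> \<in> W lam" unfolding W_eq using ind_zero by blast
  show "c \<odot>\<^bsub>M\<^esub> F \<in> W lam" if F: "F \<in> W lam" for c F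
  proof -
    obtain F' where F': "F = D lam F'" "F' \<in> ind v bar t \<sigma>" using F unfolding W_eq by blast
    then have "c \<odot>\<^bsub>M\<^esub> F = D lam (\<lambda>g. scale c (F' g))" by (simp add: D_scale)
    then show ?thesis unfolding W_eq using ind_scale[OF F'(2)] by blast
  qed
qed

lemma minus_M: assumes F: "F \<in> ind v bar t \<sigma>" shows "\<ominus>\<^bsub>M\<^esub> F = (\<lambda>g. - F g)"
proof -
  have "abelian_group M" using vectorspace_M by (simp add: vectorspace_def module_def)
  moreover have "(\<lambda>g. - F g) \<in> ind v bar t \<sigma>" using ind_diff[OF ind_zero F] by simp
  ultimately show ?thesis using F by (intro abelian_group.minus_equality) simp_all
qed

lemma coset_W_eq_iff:
  assumes "F \<in> ind v bar t \<sigma>" "G \<in> ind v bar t \<sigma>"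
  shows "W lam +>\<^bsub>M\<^esub> F = W lam +>\<^bsub>M\<^esub> G \<longleftrightarrow> (\<lambda>g. F g - G g) \<in> W lam"
  using quot_module(4)[OF vectorspace_M submodule_W, of F G lam] assms by (simp add: minus_M)

lemma half_ind: "F \<in> half P \<Longrightarrow> F \<in> ind v bar t \<sigma>" by (simp add: half_def)

lemma half_0: "F \<in> half P \<Longrightarrow> \<not> P (lev g) \<Longrightarrow> F g = 0" unfolding half_def by blast

lemma half_lin: assumes F: "F \<in> half P" and G: "G \<in> half P" shows "(\<lambda>g. F g + scale c (G g)) \<in> half P"
proof -
  have "F g = 0 \<and> G g = 0" if "\<not> P (lev g)" for g using half_0[OF F that] half_0[OF G that] by blast
  then show ?thesis using ind_lin[OF half_ind[OF F] half_ind[OF G], of c] unfolding half_def by force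
qed

lemma half_scale: assumes "F \<in> half P" shows "(\<lambda>g. scale c (F g)) \<in> half P"
  using assms ind_scale unfolding half_def by force

lemma E_0: assumes "lev g \<noteq> 0" shows "E w g = 0"
  using assms lev_0[of g] K_GG[of g] by (auto simp: E_def)

lemma E_half: assumes "P 0" shows "E w \<in> half P"
  unfolding half_def
proof (intro CollectI conjI allI impI)
  fix g assume "E w g \<noteq> 0"
  then have "lev g = 0" using E_0 by blast
  then show "P (lev g)" using assms by simp
qed (rule E_ind)

lemma f1_half: "P (- 1) \<Longrightarrow> f1 \<in> half P"
  unfolding half_def using f1_ind by (auto simp: f1_def)

lemma half_translate:
  assumes h: "h \<in> PP (2 * aa + 1)" and F: "F \<in> half P" shows "right_translate h F \<in> half P"
proof -
  have i: "right_translate h F \<in> ind v bar t \<sigma>" by (rule ind_translate[OF half_ind[OF F] PP_GG[OF h]])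
  have "P (lev g)" if g: "right_translate h F g \<noteq> 0" for g
  proof -
    have "g \<in> GG" using g ind_0[OF i] by blast
    then have "lev (g ** h) = lev g" by (rule lev_I[OF h])
    then show ?thesis using half_0[OF F, of "g ** h"] g by (auto simp: right_translate_def)
  qed
  then show ?thesis using i unfolding half_def by blast
qed

text \<open>T commutes with right translation, so the image of T - lambda is stable under G and
  translation acts on its cosets.\<close>

lemma coset_translate:
  assumes h: "h \<in> GG" and F: "F \<in> ind v bar t \<sigma>"
  shows "right_translate h ` (W lam +>\<^bsub>M\<^esub> F) = W lam +>\<^bsub>M\<^esub> right_translate h F"
proof -
  have rt: "right_translate h w \<in> W lam" if w: "w \<in> W lam" and h: "h \<in> GG" for w h
  proof -
    obtain F where F: "F \<in> ind v bar t \<sigma>" "w = D lam F" using w unfolding W_eq by blast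
    have "right_translate h w = D lam (right_translate h F)"
      unfolding F(2) D_def T_translate[OF F(1) h] by (simp add: right_translate_def)
    then show ?thesis unfolding W_eq using ind_translate[OF F(1) h] by blast
  qed
  have coset: "W lam +>\<^bsub>M\<^esub> G = (\<lambda>w g. w g + G g) ` W lam" for G by (auto simp: a_r_coset_def')
  show ?thesis unfolding coset
  proof (intro equalityI subsetI)
    fix A assume "A \<in> right_translate h ` (\<lambda>w g. w g + F g) ` W lam"
    then obtain w where w: "w \<in> W lam" "A = right_translate h (\<lambda>g. w g + F g)" by blast
    then show "A \<in> (\<lambda>w g. w g + right_translate h F g) ` W lam"
      using rt[OF w(1) h] by (intro image_eqI[of _ _ "right_translate h w"]) (simp_all add: right_translate_def)
  next
    fix A assume "A \<in> (\<lambda>w g. w g + right_translate h F g) ` W lam"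
    then obtain w where w: "w \<in> W lam" "A = (\<lambda>g. w g + right_translate h F g)" by blast
    have "A = right_translate h (\<lambda>g. right_translate (star h) w g + F g)"
      using h by (simp add: w(2) right_translate_def star_cancel')
    then show "A \<in> right_translate h ` (\<lambda>w g. w g + F g) ` W lam"
      using rt[OF w(1) star_GG[OF h]] by blast
  qed
qed

text \<open>T - lambda applied to the function on K with value s v0 has f_1 as its part on negative
  levels: the coefficient from \<open>T_plus\<close> is \<open>lc v0\<close>, which is 1.
  Subtracting leaves levels >= 0.\<close>

lemma f1_plus: "\<exists>P\<in>half (\<lambda>l. 0 \<le> l). (\<lambda>g. f1 g - P g) \<in> W lam"
proof (intro bexI)
  let ?F = "E (s v0)"
  show "(\<lambda>g. f1 g - (f1 g - D lam ?F g)) \<in> W lam" using E_ind by (simp add: W_eq)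
  have "f1 g - D lam ?F g = 0" if "\<not> 0 \<le> lev g" for g
  proof (cases "g \<in> GG")
    case True
    have "T ?F g = scale (lc (s (?F (mat 1)))) (f1 g)"
      by (rule T_plus[OF E_half True]) (use that in auto)
    then show ?thesis using E_0[of g] that by (simp add: D_def E_1 s_s lc_v0)
  next
    case False
    then show ?thesis using ind_0[OF D_ind[OF E_ind]] ind_0[OF f1_ind] by simp
  qed
  then show "(\<lambda>g. f1 g - D lam ?F g) \<in> half (\<lambda>l. 0 \<le> l)"
    using ind_diff[OF f1_ind D_ind[OF E_ind]] unfolding half_def by blast
qed

text \<open>The translate of f_0 by alpha lives at level -1. By \<open>T_minus\<close> the
  nonnegative part of its image under T is a multiple of f_0, and evaluation at the identity shows
  that the multiple is 1.\<close>

lemma f0_minus: "\<exists>P\<in>half (\<lambda>l. l < 0). (\<lambda>g. E v0 g - P g) \<in> W lam"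
proof (intro bexI)
  let ?F = "right_translate (alph 1) (E v0)"
  have Fi: "?F \<in> ind v bar t \<sigma>" by (rule ind_translate[OF E_ind alph_GG])
  show "(\<lambda>g. E v0 g - (E v0 g - D lam ?F g)) \<in> W lam" using Fi by (simp add: W_eq)
  have F0: "lev g = - 1" if "?F g \<noteq> 0" for g
  proof -
    have "g ** alph 1 \<in> K" using that by (auto simp: right_translate_def E_def split: if_splits)
    moreover have "g = (g ** alph 1) ** alph (- 1)" by (simp add: alph_add flip: matrix_mul_assoc)
    ultimately show ?thesis using lev_K[of "g ** alph 1" "alph (- 1)"] lev_alph by simp
  qed
  have "?F \<in> half (\<lambda>l. l < 0)" unfolding half_def using Fi F0 by force
  then obtain c where c: "\<And>g. g \<in> GG \<Longrightarrow> 0 \<le> lev g \<Longrightarrow> T ?F g = scale c (E v0 g)" using T_minus by blast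
  have "T ?F (mat 1) = v0"
    unfolding T_translate[OF E_ind alph_GG] using phi_cell[of "mat 1" "mat 1" v0]
    by (simp add: right_translate_def T_E \<sigma>_1 lc_v0)
  then have "scale c v0 = scale 1 v0" using c[of "mat 1"] lev_0[of "mat 1"] by (simp add: E_1)
  then have c1: "c = 1" using v0_nonzero by (metis scale_cancel_right)
  have "E v0 g - D lam ?F g = 0" if "\<not> lev g < 0" for g
  proof (cases "g \<in> GG")
    case True
    have "?F g = 0" using F0[of g] that by auto
    then show ?thesis using c[OF True] that by (simp add: D_def c1)
  next
    case False
    then show ?thesis using ind_0[OF D_ind[OF Fi]] ind_0[OF E_ind] by simp
  qed
  then show "(\<lambda>g. E v0 g - D lam ?F g) \<in> half (\<lambda>l. l < 0)"
    using ind_diff[OF E_ind D_ind[OF Fi]] unfolding half_def by blast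
qed

lemma W_scale: "F \<in> W lam \<Longrightarrow> (\<lambda>g. scale c (F g)) \<in> W lam"
  using submodule.smult_closed[OF submodule_W, of c F lam] by simp

definition comb :: "'c \<Rightarrow> 'c \<Rightarrow> 'e^3^3 \<Rightarrow> 'v" where "comb a b = (\<lambda>g. scale a (E v0 g) + scale b (f1 g))"

lemma comb_ind: "comb a b \<in> ind v bar t \<sigma>"
  unfolding comb_def by (intro ind_lin ind_scale E_ind f1_ind)

text \<open>If F1 - F2 = (T - lam) F, split F into P on levels >= 0 and Q on levels < 0. On levels
  >= 0, F1 differs from (T - lam) P by T Q, a multiple of f_0; on levels < 0, F1 vanishes and (T -
  lam) P is a multiple of f_1. Hence F1 is a combination of f_0 and f_1 modulo the image of T - lam.
  The other inclusion is \<open>f1_plus\<close> and \<open>f0_minus\<close>.\<close>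

lemma intersection_eq:
  "(\<lambda>F. W lam +>\<^bsub>M\<^esub> F) ` half (\<lambda>l. 0 \<le> l) \<inter> (\<lambda>F. W lam +>\<^bsub>M\<^esub> F) ` half (\<lambda>l. l < 0)
    = {W lam +>\<^bsub>M\<^esub> comb a b | a b. True}"
proof (intro equalityI subsetI)
  fix A assume A: "A \<in> (\<lambda>F. W lam +>\<^bsub>M\<^esub> F) ` half (\<lambda>l. 0 \<le> l) \<inter> (\<lambda>F. W lam +>\<^bsub>M\<^esub> F) ` half (\<lambda>l. l < 0)"
  then obtain F1 F2 where F1: "F1 \<in> half (\<lambda>l. 0 \<le> l)" "A = W lam +>\<^bsub>M\<^esub> F1"
    and F2: "F2 \<in> half (\<lambda>l. l < 0)" "A = W lam +>\<^bsub>M\<^esub> F2" by blast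
  then have "(\<lambda>g. F1 g - F2 g) \<in> W lam" using coset_W_eq_iff[OF half_ind half_ind] by blast
  then obtain F where F: "F \<in> ind v bar t \<sigma>" "(\<lambda>g. F1 g - F2 g) = D lam F" unfolding W_eq by blast
  define P where "P = (\<lambda>g. if 0 \<le> lev g then F g else 0)"
  define Q where "Q = (\<lambda>g. if lev g < 0 then F g else 0)"
  have P: "P \<in> half (\<lambda>l. 0 \<le> l)"
    unfolding half_def P_def using ind_restrict[OF F(1), of "\<lambda>g. 0 \<le> lev g"] by (auto simp: lev_K)
  have Q: "Q \<in> half (\<lambda>l. l < 0)"
    unfolding half_def Q_def using ind_restrict[OF F(1), of "\<lambda>g. lev g < 0"] by (auto simp: lev_K)
  have "F = (\<lambda>g. P g + scale 1 (Q g))" by (auto simp: P_def Q_def)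
  then have DF: "D lam F = (\<lambda>g. D lam P g + D lam Q g)" using D_lin[OF half_ind[OF P] half_ind[OF Q], of lam 1] by simp
  obtain c where c: "\<And>g. g \<in> GG \<Longrightarrow> 0 \<le> lev g \<Longrightarrow> T Q g = scale c (E v0 g)" using T_minus[OF Q] by blast
  \<comment> \<open>On negative levels F1, P and f_0 vanish, so - c' f_1 has to equal T P there;
    this fixes the sign.\<close>
  define c' where "c' = - lc (s (P (mat 1)))"
  have "F1 g - comb c c' g = D lam P g" for g
  proof (cases "g \<in> GG")
    case True
    have F12: "F1 g - F2 g = D lam P g + D lam Q g" using fun_cong[OF F(2), of g] by (simp add: DF)
    show ?thesis
    proof (cases "0 \<le> lev g")
      case g: True
      then have "F2 g = 0" "Q g = 0" "f1 g = 0" using half_0[OF F2(1)] by (auto simp: Q_def f1_def)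
      then show ?thesis using F12 c[OF True g] by (simp add: comb_def D_def algebra_simps)
    next
      case g: False
      then have "F1 g = 0" "P g = 0" "E v0 g = 0" using half_0[OF F1(1)] E_0[of g] by (auto simp: P_def)
      then show ?thesis using T_plus[OF P True] g by (simp add: comb_def D_def c'_def)
    qed
  next
    case False
    then show ?thesis using ind_0[OF half_ind[OF F1(1)]] ind_0[OF comb_ind] ind_0[OF D_ind[OF half_ind[OF P]]] by simp
  qed
  then have "(\<lambda>g. F1 g - comb c c' g) = D lam P" by blast
  then have "(\<lambda>g. F1 g - comb c c' g) \<in> W lam" unfolding W_eq using half_ind[OF P] by blast
  then have "A = W lam +>\<^bsub>M\<^esub> comb c c'" using coset_W_eq_iff[OF half_ind[OF F1(1)] comb_ind] F1(2) by simp
  then show "A \<in> {W lam +>\<^bsub>M\<^esub> comb a b | a b. True}" by blast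
next
  fix A assume "A \<in> {W lam +>\<^bsub>M\<^esub> comb a b | a b. True}"
  then obtain a b where A: "A = W lam +>\<^bsub>M\<^esub> comb a b" by blast
  obtain P1 where P1: "P1 \<in> half (\<lambda>l. 0 \<le> l)" "(\<lambda>g. f1 g - P1 g) \<in> W lam" using f1_plus by blast
  obtain P0 where P0: "P0 \<in> half (\<lambda>l. l < 0)" "(\<lambda>g. E v0 g - P0 g) \<in> W lam" using f0_minus by blast
  have h1: "(\<lambda>g. scale a (E v0 g) + scale b (P1 g)) \<in> half (\<lambda>l. 0 \<le> l)" by (intro half_lin half_scale E_half P1 order_refl)
  have h0: "(\<lambda>g. scale a (P0 g) + scale b (f1 g)) \<in> half (\<lambda>l. l < 0)" by (intro half_lin half_scale P0 f1_half) simp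
  have "(\<lambda>g. comb a b g - (scale a (E v0 g) + scale b (P1 g))) \<in> W lam"
    using W_scale[OF P1(2), of b] by (simp add: comb_def scale_right_diff_distrib)
  then have "A = W lam +>\<^bsub>M\<^esub> (\<lambda>g. scale a (E v0 g) + scale b (P1 g))" using coset_W_eq_iff[OF comb_ind half_ind[OF h1]] A by blast
  moreover have "(\<lambda>g. comb a b g - (scale a (P0 g) + scale b (f1 g))) \<in> W lam"
    using W_scale[OF P0(2), of a] by (simp add: comb_def scale_right_diff_distrib)
  then have "A = W lam +>\<^bsub>M\<^esub> (\<lambda>g. scale a (P0 g) + scale b (f1 g))" using coset_W_eq_iff[OF comb_ind half_ind[OF h0]] A by blast
  ultimately show "A \<in> (\<lambda>F. W lam +>\<^bsub>M\<^esub> F) ` half (\<lambda>l. 0 \<le> l) \<inter> (\<lambda>F. W lam +>\<^bsub>M\<^esub> F) ` half (\<lambda>l. l < 0)"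
    using h0 h1 by blast
qed

text \<open>A relation is (T - lam) F for some F that satisfies the eigenvalue equation off the
  levels 0 and -1, where f_0 and f_1 vanish. By \<open>eigen_vanish\<close> F is zero, and the two
  coefficients are read off at the identity and at the inverse of alpha.\<close>

lemma comb_W: assumes "comb a b \<in> W lam" shows "a = 0 \<and> b = 0"
proof -
  obtain F where F: "F \<in> ind v bar t \<sigma>" "comb a b = D lam F" using assms unfolding W_eq by blast
  have "F g = 0" for g
  proof (rule eigen_vanish[OF F(1)])
    fix g assume "lev g \<noteq> 0" "lev g \<noteq> - 1"
    then have "comb a b g = 0" by (simp add: comb_def E_0 f1_def)
    then show "T F g = scale lam (F g)" unfolding F(2) D_def by simp
  qed
  then have "F = (\<lambda>g. 0)" by blast
  then have z: "comb a b g = 0" for g using F(2) D_zero by simp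
  have "scale a v0 = 0" using z[of "mat 1"] lev_0[of "mat 1"] by (simp add: comb_def E_1 f1_def)
  moreover have "f1 (alph (- 1)) = s v0" using f1_eq[of "mat 1" "mat 1"] by (simp add: \<sigma>_1)
  then have "scale b (s v0) = 0" using z[of "alph (- 1)"] E_0[of "alph (- 1)"] by (simp add: comb_def lev_alph)
  moreover have "s v0 \<noteq> 0" using v0_nonzero s_s[of v0] \<sigma>_0[OF sw_K] by metis
  ultimately show ?thesis using v0_nonzero by (simp add: scale_eq_0_iff)
qed

theorem intersection:
  fixes lam :: 'c
  defines "PI \<equiv> quot_module M (W lam)" and "q \<equiv> (\<lambda>F. W lam +>\<^bsub>M\<^esub> F)"
  defines "J \<equiv> q ` I_plus v bar \<pi> p t \<sigma> \<inter> q ` I_minus v bar \<pi> p t \<sigma>"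
  defines "f \<equiv> f_fun v bar \<pi> p t \<sigma> v0"
  shows "VectorSpace.subspace C J PI \<and> (\<forall>h\<in>Iwahori v bar \<pi> p t. \<forall>A\<in>J. right_translate h ` A \<in> J)
    \<and> vectorspace.basis C (PI\<lparr>carrier := J\<rparr>) {q (f 0), q (f 1)} \<and> vectorspace.dim C (PI\<lparr>carrier := J\<rparr>) = 2"
proof -
  note Q = quot_module[OF vectorspace_M submodule_W[of lam], folded PI_def]
  interpret Q: vectorspace C PI by (rule Q(6))
  have J: "J = {q (comb a b) | a b. True}"
    unfolding J_def I_plus_eq I_minus_eq q_def by (rule intersection_eq)
  have f: "f 0 = E v0" "f 1 = f1" unfolding f_def by (rule f_fun_0 f_fun_1)+
  have comb: "a \<odot>\<^bsub>PI\<^esub> q (E v0) \<oplus>\<^bsub>PI\<^esub> b \<odot>\<^bsub>PI\<^esub> q f1 = q (comb a b)" for a b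
    unfolding q_def comb_def using E_ind f1_ind ind_scale by (simp add: Q(2,3))
  have car: "q (E v0) \<in> carrier PI" "q f1 \<in> carrier PI" unfolding q_def Q(1) using E_ind f1_ind by auto
  have indep: "a = \<zero>\<^bsub>C\<^esub> \<and> b = \<zero>\<^bsub>C\<^esub>" if "a \<odot>\<^bsub>PI\<^esub> q (E v0) \<oplus>\<^bsub>PI\<^esub> b \<odot>\<^bsub>PI\<^esub> q f1 = \<zero>\<^bsub>PI\<^esub>" for a b
  proof -
    have "q (comb a b) = q (\<lambda>g. 0)" using that[unfolded comb] Q(5) by (simp add: q_def)
    then have "comb a b \<in> W lam" using coset_W_eq_iff[OF comb_ind ind_zero] by (simp add: q_def)
    then show ?thesis using comb_W by simp
  qed
  have J': "J = {a \<odot>\<^bsub>PI\<^esub> q (E v0) \<oplus>\<^bsub>PI\<^esub> b \<odot>\<^bsub>PI\<^esub> q f1 | a b. a \<in> carrier C \<and> b \<in> carrier C}"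
    unfolding J comb by simp
  have "right_translate h ` A \<in> J" if h: "h \<in> Iwahori v bar \<pi> p t" and A: "A \<in> J" for h A
  proof -
    have hP: "h \<in> PP (2 * aa + 1)" using h by (simp add: Iwahori_eq)
    have "right_translate h ` A \<in> q ` half P" if P: "A \<in> q ` half P" for P
    proof -
      obtain F where F: "F \<in> half P" "A = q F" using P by blast
      have "right_translate h ` A = q (right_translate h F)"
        unfolding F(2) q_def by (rule coset_translate[OF PP_GG[OF hP] half_ind[OF F(1)]])
      then show ?thesis using half_translate[OF hP F(1)] by blast
    qed
    then show ?thesis using A unfolding J_def I_plus_eq I_minus_eq by blast
  qed
  then show ?thesis using Q.two_generated_subspace[OF car indep J'] unfolding f by blast
qed

end

section \<open>Valuation and conjugation of an unramified quadratic extension\<close>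

lemma normalized_valuation_minus:
  assumes "normalized_valuation v" shows "v 1 = 0" "x \<noteq> 0 \<Longrightarrow> v (- x) = v x"
proof -
  have m: "\<And>x y. x \<noteq> 0 \<Longrightarrow> y \<noteq> 0 \<Longrightarrow> v (x * y) = v x + v y" using assms unfolding normalized_valuation_def by blast
  show "v 1 = 0" using m[of 1 1] by simp
  then have "v (- 1) = 0" using m[of "- 1" "- 1"] by simp
  then show "x \<noteq> 0 \<Longrightarrow> v (- x) = v x" using m[of "- 1" x] by simp
qed

lemma frac_ideal_closed:
  assumes nv: "normalized_valuation v"
  shows frac_ideal_add: "x \<in> frac_ideal v k \<Longrightarrow> y \<in> frac_ideal v k \<Longrightarrow> x + y \<in> frac_ideal v k"
    and frac_ideal_minus: "x \<in> frac_ideal v k \<Longrightarrow> - x \<in> frac_ideal v k"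
    and frac_ideal_diff: "x \<in> frac_ideal v k \<Longrightarrow> y \<in> frac_ideal v k \<Longrightarrow> x - y \<in> frac_ideal v k"
    and frac_ideal_mult: "x \<in> frac_ideal v k \<Longrightarrow> y \<in> frac_ideal v l \<Longrightarrow> x * y \<in> frac_ideal v (k + l)"
    and frac_ideal_mono: "x \<in> frac_ideal v k \<Longrightarrow> l \<le> k \<Longrightarrow> x \<in> frac_ideal v l"
proof -
  have vm: "x \<noteq> 0 \<Longrightarrow> y \<noteq> 0 \<Longrightarrow> v (x * y) = v x + v y" for x y
    using nv unfolding normalized_valuation_def by blast
  have add: "x + y \<in> frac_ideal v k" if "x \<in> frac_ideal v k" "y \<in> frac_ideal v k" for x y
  proof (cases "x = 0 \<or> y = 0 \<or> x + y = 0")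
    case False
    then have "min (v x) (v y) \<le> v (x + y)" using nv unfolding normalized_valuation_def by blast
    then show ?thesis using that False by (auto simp: frac_ideal_def)
  qed (use that in \<open>auto simp: frac_ideal_def\<close>)
  have minus: "- x \<in> frac_ideal v k" if "x \<in> frac_ideal v k" for x
    using that normalized_valuation_minus(2)[OF nv, of x] unfolding frac_ideal_def by (cases "x = 0") simp_all
  show "x \<in> frac_ideal v k \<Longrightarrow> y \<in> frac_ideal v k \<Longrightarrow> x + y \<in> frac_ideal v k" by (rule add)
  show "x \<in> frac_ideal v k \<Longrightarrow> - x \<in> frac_ideal v k" by (rule minus)
  show "x \<in> frac_ideal v k \<Longrightarrow> y \<in> frac_ideal v k \<Longrightarrow> x - y \<in> frac_ideal v k"
    using add[of x "- y"] minus[of y] by simp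
  show "x \<in> frac_ideal v k \<Longrightarrow> y \<in> frac_ideal v l \<Longrightarrow> x * y \<in> frac_ideal v (k + l)"
    using vm[of x y] unfolding frac_ideal_def by (cases "x = 0"; cases "y = 0") simp_all
  show "x \<in> frac_ideal v k \<Longrightarrow> l \<le> k \<Longrightarrow> x \<in> frac_ideal v l" by (auto simp: frac_ideal_def)
qed

lemma frac_ideal_all: assumes "\<And>k. x \<in> frac_ideal v k" shows "x = 0"
  using assms[of "v x + 1"] by (auto simp: frac_ideal_def)

text \<open>Since 2 is a unit, y -> (x - y * y) / 2 is a contraction of the maximal ideal; its fixed
  point solves (1 + y)^2 = 1 + x.\<close>

lemma principal_unit_sqrt:
  assumes nv: "normalized_valuation v" and complete: "valuation_complete v"
    and two: "(2::'e::field) \<noteq> 0" "v (2::'e) = 0" and x: "x \<in> frac_ideal v 1"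
  shows "\<exists>y\<in>frac_ideal v 1. (1 + y)\<^sup>2 = 1 + x"
proof -
  have half: "z / 2 \<in> frac_ideal v k" if "z \<in> frac_ideal v k" for z k
  proof (cases "z = 0")
    case False
    then have "v (z / 2 * 2) = v (z / 2) + v 2" using nv two unfolding normalized_valuation_def by (metis divide_eq_0_iff)
    then show ?thesis using that two by (auto simp: frac_ideal_def)
  qed (auto simp: frac_ideal_def)
  define s where "s = rec_nat 0 (\<lambda>_ y. (x - y * y) / 2)"
  have s0: "s 0 = 0" and sS: "s (Suc n) = (x - s n * s n) / 2" for n by (simp_all add: s_def)
  have diff: "(x - a * a) / 2 - (x - b * b) / 2 = - ((a - b) * (a + b) / 2)" for a b
  proof -
    have "(x - a * a) - (x - b * b) = - ((a - b) * (a + b))" by (simp add: algebra_simps)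
    then show ?thesis by (metis diff_divide_distrib minus_divide_left)
  qed
  have sI: "s n \<in> frac_ideal v 1" for n
  proof (induction n)
    case (Suc n)
    have "s n * s n \<in> frac_ideal v 1" using frac_ideal_mono[OF nv frac_ideal_mult[OF nv Suc Suc]] by simp
    then show ?case unfolding sS using x by (intro half frac_ideal_diff[OF nv])
  qed (simp add: s0 frac_ideal_def)
  have step: "s (Suc n) - s n \<in> frac_ideal v (int n + 1)" for n
  proof (induction n)
    case 0
    then show ?case using sI[of "Suc 0"] s0 by simp
  next
    case (Suc n)
    have e: "s (Suc (Suc n)) - s (Suc n) = - ((s (Suc n) - s n) * (s (Suc n) + s n) / 2)"
      using diff[of "s (Suc n)" "s n"] sS[of "Suc n"] sS[of n] by metis
    have "(s (Suc n) - s n) * (s (Suc n) + s n) \<in> frac_ideal v (int n + 1 + 1)"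
      by (rule frac_ideal_mult[OF nv Suc frac_ideal_add[OF nv sI sI]])
    then show ?case unfolding e by (intro frac_ideal_minus[OF nv] half) (simp add: add.commute)
  qed
  have tail: "s m - s n \<in> frac_ideal v (int n + 1)" if "n \<le> m" for m n
    using that
  proof (induction rule: dec_induct)
    case base
    then show ?case by (simp add: frac_ideal_def)
  next
    case (step m)
    have "s (Suc m) - s m \<in> frac_ideal v (int n + 1)"
      by (rule frac_ideal_mono[OF nv \<open>s (Suc m) - s m \<in> frac_ideal v (int m + 1)\<close>[OF]]) (use step in simp)
    from frac_ideal_add[OF nv this step.IH] show ?case by simp
  qed
  have "\<exists>M. \<forall>m\<ge>M. \<forall>n\<ge>M. s m - s n \<in> frac_ideal v k" for k
  proof (intro exI allI impI)
    fix m n assume mn: "nat k \<le> m" "nat k \<le> n"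
    have "(s m - s (nat k)) - (s n - s (nat k)) \<in> frac_ideal v (int (nat k) + 1)"
      by (rule frac_ideal_diff[OF nv tail[OF mn(1)] tail[OF mn(2)]])
    then have "s m - s n \<in> frac_ideal v (int (nat k) + 1)" by simp
    then show "s m - s n \<in> frac_ideal v k" by (rule frac_ideal_mono[OF nv]) simp
  qed
  then obtain l where l: "\<And>k. \<exists>M. \<forall>n\<ge>M. s n - l \<in> frac_ideal v k"
    using complete unfolding valuation_complete_def by blast
  obtain n0 where "s n0 - l \<in> frac_ideal v 1" using l[of 1] by blast
  from frac_ideal_diff[OF nv sI[of n0] this] have lI: "l \<in> frac_ideal v 1" by simp
  have "l - (x - l * l) / 2 \<in> frac_ideal v k" for k
  proof -
    obtain n where n: "\<And>m. n \<le> m \<Longrightarrow> s m - l \<in> frac_ideal v k" using l[of k] by blast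
    have "(s n - l) * (s n + l) \<in> frac_ideal v (k + 1)"
      by (rule frac_ideal_mult[OF nv n[OF order_refl] frac_ideal_add[OF nv sI lI]])
    then have "(s n - l) * (s n + l) \<in> frac_ideal v k" by (rule frac_ideal_mono[OF nv]) simp
    then have "(s n - l) * (s n + l) / 2 \<in> frac_ideal v k" by (rule half)
    moreover have "s (Suc n) - l \<in> frac_ideal v k" by (rule n) simp
    moreover have "l - (x - l * l) / 2 = - ((s (Suc n) - l) + (s n - l) * (s n + l) / 2)"
    proof -
      have "z = c - b \<Longrightarrow> l - c = - ((b - l) + z)" for z c b by simp
      moreover have "(s n - l) * (s n + l) / 2 = (x - l * l) / 2 - s (Suc n)"
        unfolding sS using diff[of "s n" l] by (metis minus_diff_eq minus_minus)
      ultimately show ?thesis by blast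
    qed
    ultimately show ?thesis using frac_ideal_minus[OF nv frac_ideal_add[OF nv]] by metis
  qed
  then have "l - (x - l * l) / 2 = 0" by (rule frac_ideal_all)
  then have "2 * l + l * l = x" using two by (simp add: field_simps)
  then have "(1 + l)\<^sup>2 = 1 + x" by (simp add: power2_eq_square algebra_simps)
  then show ?thesis using lI by blast
qed

text \<open>A principal unit has \<open>2^k\<close>-th roots for all \<open>k\<close>, so every other valuation vanishes on it.\<close>

lemma normalized_valuation_unique:
  assumes nv: "normalized_valuation v" and complete: "valuation_complete v"
    and two: "(2::'e::field) \<noteq> 0" "v (2::'e) = 0"
    and nw: "normalized_valuation w" and \<pi>: "\<pi> \<noteq> 0" "v \<pi> = 1" "w \<pi> = 1" and x: "x \<noteq> 0"
  shows "w x = v x"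
proof -
  have wm: "\<And>x y. x \<noteq> 0 \<Longrightarrow> y \<noteq> 0 \<Longrightarrow> w (x * y) = w x + w y" using nw unfolding normalized_valuation_def by blast
  have vm: "\<And>x y. x \<noteq> 0 \<Longrightarrow> y \<noteq> 0 \<Longrightarrow> v (x * y) = v x + v y" using nv unfolding normalized_valuation_def by blast
  have nz: "1 + y \<noteq> 0" if "y \<in> frac_ideal v 1" for y
  proof
    assume "1 + y = 0"
    then have "y = - 1" by (simp add: eq_neg_iff_add_eq_0 add.commute)
    then show False using that normalized_valuation_minus[OF nv] by (auto simp: frac_ideal_def)
  qed
  have root: "\<exists>y\<in>frac_ideal v 1. w (1 + z) = 2 ^ k * w (1 + y)" if "z \<in> frac_ideal v 1" for z and k :: nat
  proof (induction k)
    case (Suc k)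
    then obtain y where y: "y \<in> frac_ideal v 1" "w (1 + z) = 2 ^ k * w (1 + y)" by blast
    obtain u where u: "u \<in> frac_ideal v 1" "(1 + u)\<^sup>2 = 1 + y" using principal_unit_sqrt[OF nv complete two y(1)] by blast
    have "w (1 + y) = 2 * w (1 + u)" using wm[OF nz[OF u(1)] nz[OF u(1)]] u(2) by (simp add: power2_eq_square)
    then show ?case using y u by auto
  qed (use that in auto)
  have w1: "w (1 + z) = 0" if z: "z \<in> frac_ideal v 1" for z
  proof (rule ccontr)
    assume n: "w (1 + z) \<noteq> 0"
    \<comment> \<open>Chosen so that 2^k exceeds the absolute value, which a nonzero multiple of 2^k
      cannot allow.\<close>
    define k where "k = nat \<bar>w (1 + z)\<bar>"
    obtain y where "w (1 + z) = 2 ^ k * w (1 + y)" using root[OF z] by blast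
    then have "(2::int) ^ k dvd w (1 + z)" by simp
    then have "(2::int) ^ k \<le> \<bar>w (1 + z)\<bar>" using dvd_imp_le_int[OF n, of "2 ^ k"] by simp
    moreover have "int k < 2 ^ k" by simp
    ultimately show False using n by (simp add: k_def)
  qed
  \<comment> \<open>z is the difference of 1 + z and 1, on both of which w vanishes.\<close>
  have w0: "0 \<le> w z" if z: "z \<noteq> 0" "1 \<le> v z" for z
  proof -
    have zI: "z \<in> frac_ideal v 1" using z by (simp add: frac_ideal_def)
    have "min (w (1 + z)) (w (- 1)) \<le> w ((1 + z) + (- 1))"
      using nw nz[OF zI] z unfolding normalized_valuation_def by (metis add.commute add_cancel_left_right minus_add_cancel neg_equal_0_iff_equal zero_neq_one)
    then show ?thesis using w1[OF zI] normalized_valuation_minus[OF nw] by simp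
  qed
  have pw: "y \<noteq> 0 \<Longrightarrow> w (y ^ n) = int n * w y" and pv: "y \<noteq> 0 \<Longrightarrow> v (y ^ n) = int n * v y" for y n
    by (induction n) (simp_all add: wm vm normalized_valuation_minus nv nw algebra_simps)
  \<comment> \<open>Squaring and multiplying by the uniformizer brings a unit into the maximal
    ideal; 2 w(z) + 1 >= 0 then forces w(z) >= 0 by integrality.\<close>
  have unit: "0 \<le> w z" if z: "z \<noteq> 0" "v z = 0" for z
  proof (rule ccontr)
    assume "\<not> 0 \<le> w z"
    moreover have "0 \<le> w (z ^ 2 * \<pi>)" by (rule w0) (use z \<pi> in \<open>simp_all add: vm pv\<close>)
    then have "0 \<le> 2 * w z + 1" using z \<pi> by (simp add: wm pw)
    ultimately show False by linarith
  qed
  have unit0: "w z = 0" if z: "z \<noteq> 0" "v z = 0" for z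
  proof -
    have "v (inverse z) = 0" using vm[of z "inverse z"] z normalized_valuation_minus(1)[OF nv] by simp
    then have "0 \<le> w (inverse z)" using unit[of "inverse z"] z by simp
    moreover have "w z + w (inverse z) = 0" using wm[of z "inverse z"] z normalized_valuation_minus(1)[OF nw] by simp
    ultimately show ?thesis using unit[OF z] by linarith
  qed
  define n where "n = nat \<bar>v x\<bar>"
  show ?thesis
  proof (cases "0 \<le> v x")
    case True
    have "v x = v (x / \<pi> ^ n * \<pi> ^ n)" "w x = w (x / \<pi> ^ n * \<pi> ^ n)" using \<pi> by simp_all
    then have "v x = v (x / \<pi> ^ n) + int n" "w x = w (x / \<pi> ^ n) + int n"
      using x \<pi> vm[of "x / \<pi> ^ n" "\<pi> ^ n"] wm[of "x / \<pi> ^ n" "\<pi> ^ n"] pv[of \<pi> n] pw[of \<pi> n] by simp_all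
    then show ?thesis using unit0[of "x / \<pi> ^ n"] x \<pi> True by (simp add: n_def)
  next
    case False
    have "v (x * \<pi> ^ n) = v x + int n" "w (x * \<pi> ^ n) = w x + int n" using x \<pi> by (simp_all add: vm wm pv pw)
    then show ?thesis using unit0[of "x * \<pi> ^ n"] x \<pi> False by (simp add: n_def)
  qed
qed

text \<open>An element x outside F is a root of a quadratic polynomial over F with root sum a. Its
  conjugate is a root of the same polynomial, hence x or a - x, and both cases give back x after
  conjugating twice.\<close>

lemma quadratic_conjugation_involutive:
  assumes \<iota>: "field_hom (\<iota> :: 'f::field \<Rightarrow> 'e::field)" and dim: "vector_space.dim (\<lambda>a x. \<iota> a * x) (UNIV :: 'e set) = 2"
    and bar: "field_hom bar" and fix\<iota>: "\<And>a. bar (\<iota> a) = \<iota> a"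
  shows "bar (bar x) = x"
proof -
  interpret \<iota>: field_hom \<iota> by fact
  interpret bar: field_hom bar by fact
  interpret V: vector_space "\<lambda>a x. \<iota> a * x" by unfold_locales (simp_all add: algebra_simps \<iota>.hom_add \<iota>.hom_mult)
  show ?thesis
  proof (cases "x \<in> range \<iota>")
    case False
    obtain B where B: "V.independent B" "UNIV \<subseteq> V.span B" "card B = 2" using V.basis_exists[of UNIV] dim by metis
    then have fB: "finite B" by (metis card.infinite zero_neq_numeral)
    have s1: "V.span {1} = range \<iota>" unfolding V.span_singleton by simp
    have i1: "V.independent {1}" using V.independent_insertI[of 1 "{}"] by simp
    have ix: "V.independent {x, 1}" using V.independent_insertI[OF _ i1, of x] False s1 by simp
    have "x * x \<in> V.span {x, 1}"
    proof (rule ccontr)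
      assume n: "x * x \<notin> V.span {x, 1}"
      then have "V.independent {x * x, x, 1}" by (rule V.independent_insertI[OF _ ix])
      then have "card {x * x, x, 1} \<le> 2" using V.independent_span_bound[OF fB, of "{x * x, x, 1}"] B by auto
      moreover have "x * x \<noteq> x" "x * x \<noteq> 1" using n V.span_base[of _ "{x, 1}"] by auto
      moreover have "x \<noteq> 1" using False \<iota>.hom_one by (metis rangeI)
      ultimately show False by simp
    qed
    then obtain a where "x * x - \<iota> a * x \<in> range \<iota>" using V.span_breakdown_eq[of "x * x" x "{1}"] s1 by auto
    then obtain b where "x * x - \<iota> a * x = \<iota> b" by blast
    then have b: "x * x = \<iota> a * x + \<iota> b" by (simp add: algebra_simps)
    then have "bar (x * x) = bar (\<iota> a * x + \<iota> b)" by simp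
    then have b': "bar x * bar x = \<iota> a * bar x + \<iota> b" by (simp add: bar.hom_mult bar.hom_add fix\<iota>)
    have "(bar x - x) * (bar x + x - \<iota> a) = 0" using b b' by (simp add: algebra_simps)
    then have "bar x - x = 0 \<or> bar x + x - \<iota> a = 0" by (simp only: mult_eq_0_iff)
    then have "bar x = x \<or> bar x = \<iota> a - x" by (auto simp: eq_diff_eq)
    then show ?thesis by (auto simp: bar.hom_minus fix\<iota>)
  qed (auto simp: fix\<iota>)
qed

lemma finite_residue_digits:
  assumes nv: "normalized_valuation v" and fin: "finite (carrier (residue_field v))"
  shows "\<exists>D. finite D \<and> (\<forall>x\<in>frac_ideal v 0. \<exists>d\<in>D. x - d \<in> frac_ideal v 1)"
proof -
  define D where "D = (\<lambda>A. SOME y. y \<in> A) ` carrier (residue_field v)"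
  have "\<exists>d\<in>D. x - d \<in> frac_ideal v 1" if x: "x \<in> frac_ideal v 0" for x
  proof -
    define A where "A = (\<lambda>h. h + x) ` frac_ideal v 1"
    have A: "A \<in> carrier (residue_field v)"
      unfolding residue_field_def FactRing_def A_RCOSETS_def RCOSETS_def r_coset_def A_def
      using x by (auto simp: ring_of_type_algebra_def)
    have "0 \<in> frac_ideal v 1" by (simp add: frac_ideal_def)
    then have "x \<in> A" unfolding A_def by (intro image_eqI[of _ _ 0]) simp_all
    then have "(SOME y. y \<in> A) \<in> A" by (rule someI)
    then obtain h where h: "h \<in> frac_ideal v 1" "(SOME y. y \<in> A) = h + x" unfolding A_def by blast
    have "x - (SOME y. y \<in> A) \<in> frac_ideal v 1" using frac_ideal_minus[OF nv h(1)] by (simp add: h(2))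
    moreover have "(SOME y. y \<in> A) \<in> D" unfolding D_def using A by blast
    ultimately show ?thesis by blast
  qed
  moreover have "finite D" using fin by (simp add: D_def)
  ultimately show ?thesis by blast
qed

text \<open>Conjugation preserves the valuation because composing with it gives another normalized
  valuation with the same value at the uniformizer, to which
  \<open>normalized_valuation_unique\<close> applies. This needs 2 to be a unit, and that is where
  the odd residue characteristic enters.\<close>

lemma unramified_local_unitary:
  fixes \<iota> :: "'f::field \<Rightarrow> 'e::field"
  assumes E: "unramified_quadratic vF v \<iota> bar" and p: "prime p" "odd p" "of_nat p \<in> frac_ideal vF 1"
    and \<pi>F: "\<pi>F \<noteq> 0" "vF \<pi>F = 1"
  shows "\<exists>\<delta>. local_unitary v bar (\<iota> \<pi>F) \<delta> p"
proof -
  have E': "normalized_valuation v" "valuation_complete v" "finite (carrier (residue_field v))" "field_hom \<iota>"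
    "vector_space.dim (\<lambda>a x. \<iota> a * x) (UNIV :: 'e set) = 2" "\<And>a. a \<noteq> 0 \<Longrightarrow> v (\<iota> a) = vF a"
    "field_hom bar" "\<And>a. bar (\<iota> a) = \<iota> a" "bar \<noteq> id"
    using E unfolding unramified_quadratic_def nonarch_local_field_def by auto
  interpret \<iota>: field_hom \<iota> by (rule E')
  interpret bar: field_hom bar by (rule E')
  note nv = E'(1)
  have vm: "\<And>x y. x \<noteq> 0 \<Longrightarrow> y \<noteq> 0 \<Longrightarrow> v (x * y) = v x + v y" using nv unfolding normalized_valuation_def by blast
  have \<pi>: "\<iota> \<pi>F \<noteq> 0" "v (\<iota> \<pi>F) = 1" using \<pi>F E'(6) by auto
  have pI: "of_nat p \<in> frac_ideal v 1"
  proof (cases "of_nat p = (0::'f)")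
    case True
    then have "of_nat p = (0::'e)" by (metis \<iota>.hom_of_nat \<iota>.hom_zero)
    then show ?thesis by (simp add: frac_ideal_def)
  next
    case False
    then have "v (of_nat p) = vF (of_nat p)" using E'(6)[OF False] \<iota>.hom_of_nat[of p] by metis
    then show ?thesis using p(3) False by (simp add: frac_ideal_def)
  qed
  have nat0: "(of_nat n :: 'e) \<in> frac_ideal v 0" for n
  proof (induction n)
    case (Suc n)
    have "1 \<in> frac_ideal v 0" using normalized_valuation_minus(1)[OF nv] by (simp add: frac_ideal_def)
    then show ?case using frac_ideal_add[OF nv Suc] by (simp add: add.commute)
  qed (simp add: frac_ideal_def)
  \<comment> \<open>If 2 were in the maximal ideal, so would be p - 2 (p div 2) = 1.\<close>
  have "(2::'e) \<notin> frac_ideal v 1"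
  proof
    assume "(2::'e) \<in> frac_ideal v 1"
    then have "2 * of_nat (p div 2) \<in> frac_ideal v (1 + 0)" by (rule frac_ideal_mult[OF nv _ nat0])
    then have "of_nat p - 2 * of_nat (p div 2) \<in> frac_ideal v 1" using frac_ideal_diff[OF nv pI] by simp
    moreover have "p = 2 * (p div 2) + 1" using p(2) by simp
    then have "(of_nat p :: 'e) = 2 * of_nat (p div 2) + 1" by (metis of_nat_1 of_nat_add of_nat_mult of_nat_numeral)
    ultimately have "(1::'e) \<in> frac_ideal v 1" by simp
    then show False using normalized_valuation_minus(1)[OF nv] by (simp add: frac_ideal_def)
  qed
  then have two: "(2::'e) \<noteq> 0" "v (2::'e) = 0" using nat0[of 2] by (auto simp: frac_ideal_def)
  have nw: "normalized_valuation (\<lambda>x. v (bar x))"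
    unfolding normalized_valuation_def
  proof (intro conjI allI impI)
    show "v (bar (x * y)) = v (bar x) + v (bar y)" if "x \<noteq> 0" "y \<noteq> 0" for x y using that by (simp add: bar.hom_mult vm)
    show "min (v (bar x)) (v (bar y)) \<le> v (bar (x + y))" if "x \<noteq> 0" "y \<noteq> 0" "x + y \<noteq> 0" for x y
    proof -
      have "bar x \<noteq> 0" "bar y \<noteq> 0" "bar x + bar y \<noteq> 0" using that by (simp_all flip: bar.hom_add)
      then show ?thesis using nv unfolding normalized_valuation_def by (simp add: bar.hom_add)
    qed
    show "\<exists>x. x \<noteq> 0 \<and> v (bar x) = 1" using \<pi> E'(8) by (intro exI[of _ "\<iota> \<pi>F"]) simp
  qed
  have vbar: "x \<noteq> 0 \<Longrightarrow> v (bar x) = v x" for x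
    by (rule normalized_valuation_unique[OF nv E'(2) two nw, of "\<iota> \<pi>F"]) (use \<pi> E'(8) in simp_all)
  have bb: "bar (bar x) = x" for x by (rule quadratic_conjugation_involutive[OF E'(4,5,7,8)])
  interpret valued_involution v bar "\<iota> \<pi>F"
    by unfold_locales (use nv \<pi> vbar bb E'(8) in \<open>simp_all add: normalized_valuation_def bar.hom_add bar.hom_mult\<close>)
  obtain x0 where x0: "bar x0 \<noteq> x0" using E'(9) by (auto simp: fun_eq_iff)
  \<comment> \<open>A nonzero element of trace zero; multiplying by a power of the uniformizer,
    which conjugation fixes, makes it a unit.\<close>
  define d where "d = x0 - bar x0"
  have d: "d \<noteq> 0" "bar d = - d" using x0 by (auto simp: d_def bar_diff)
  define \<delta> where "\<delta> = d * \<iota> \<pi>F powi (- v d)"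
  have \<delta>: "\<delta> \<noteq> 0" "bar \<delta> = - \<delta>" "v \<delta> = 0"
    using d \<pi> by (simp_all add: \<delta>_def bar_mult bar_power_int v_mult)
  obtain D where D: "finite D" "\<And>x. x \<in> frac_ideal v 0 \<Longrightarrow> \<exists>d\<in>D. x - d \<in> frac_ideal v 1"
    using finite_residue_digits[OF nv E'(3)] by blast
  have "local_unitary v bar (\<iota> \<pi>F) \<delta> p"
  proof unfold_locales
    show "vge 4 (of_nat p)" using pI by (simp add: vge_frac_ideal)
    show "\<exists>D. finite D \<and> (\<forall>x. vge 0 x \<longrightarrow> (\<exists>d\<in>D. vge 4 (x - d)))"
      using D by (auto simp: vge_frac_ideal intro!: exI[of _ D])
  qed (use p E'(2) \<delta> in simp_all)
  then show ?thesis ..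
qed

theorem theorem1p1:
  fixes vF :: "'f::field \<Rightarrow> int" and vE :: "'e::field \<Rightarrow> int"
    and \<iota> :: "'f \<Rightarrow> 'e" and bar :: "'e \<Rightarrow> 'e" and \<pi>F :: 'f
    and t :: vertex
    and scale :: "'p::prime_card mod_ring alg_closure \<Rightarrow> 'v::ab_group_add \<Rightarrow> 'v"
    and \<sigma> :: "'e^3^3 \<Rightarrow> 'v \<Rightarrow> 'v"
    and v0 :: 'v
    and lam :: "'p mod_ring alg_closure"
  defines "p \<equiv> CARD('p)"
  defines "\<pi>E \<equiv> \<iota> \<pi>F"
  defines "M \<equiv> ind_module vE bar t scale \<sigma>"
  defines "W \<equiv> T_minus_image vE bar \<pi>E p t scale \<sigma> lam"
  defines "PI \<equiv> quot_module M W"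
  defines "quot \<equiv> (\<lambda>f. W +>\<^bsub>M\<^esub> f)"
  defines "J \<equiv> quot ` I_plus vE bar \<pi>E p t \<sigma> \<inter> quot ` I_minus vE bar \<pi>E p t \<sigma>"
  defines "f \<equiv> f_fun vE bar \<pi>E p t \<sigma> v0"
  assumes "unramified_quadratic vF vE \<iota> bar"
    and "odd p" and "of_nat p \<in> frac_ideal vF 1"
    and "\<pi>F \<noteq> 0" and "vF \<pi>F = 1"
    and "weight vE bar t scale \<sigma>"
    and "v0 \<in> invariants vE bar \<pi>E p t \<sigma>" and "v0 \<noteq> 0"
  shows "VectorSpace.subspace ring_of_type_algebra J PI
       \<and> (\<forall>h\<in>Iwahori vE bar \<pi>E p t. \<forall>A\<in>J. right_translate h ` A \<in> J)
       \<and> vectorspace.basis ring_of_type_algebra (PI\<lparr>carrier := J\<rparr>) {quot (f 0), quot (f 1)}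
       \<and> vectorspace.dim ring_of_type_algebra (PI\<lparr>carrier := J\<rparr>) = 2"
proof -
  have "prime p" unfolding p_def by (rule prime_card)
  then obtain \<delta> where "local_unitary vE bar \<pi>E \<delta> p"
    using unramified_local_unitary[of vF vE \<iota> bar p \<pi>F] \<open>unramified_quadratic vF vE \<iota> bar\<close> \<open>odd p\<close>
      \<open>of_nat p \<in> frac_ideal vF 1\<close> \<open>\<pi>F \<noteq> 0\<close> \<open>vF \<pi>F = 1\<close> unfolding \<pi>E_def by blast
  moreover have "vector_space scale" using \<open>weight vE bar t scale \<sigma>\<close> by (simp add: weight_def)
  moreover have "of_nat p = (0 :: 'p mod_ring alg_closure)"
    using of_nat_CHAR[where 'a = "'p mod_ring alg_closure"] by (simp add: p_def)
  ultimately have "weight_rep vE bar \<pi>E \<delta> p scale t \<sigma> v0"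
    using \<open>weight vE bar t scale \<sigma>\<close> \<open>v0 \<in> invariants vE bar \<pi>E p t \<sigma>\<close> \<open>v0 \<noteq> 0\<close>
    by (intro weight_rep.intro weight_rep_axioms.intro)
  then show ?thesis
    unfolding f_def J_def quot_def PI_def W_def M_def by (rule weight_rep.intersection)
qed

end
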